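(* Let $W_n$ ($n\in\mathbb N$) and $W$ be elements of $\mathcal W$. Let $h_n\in\mathcal D_{W_n}(\mathbb T)$ and $h\in\mathcal D_W(\mathbb T)$, and let $f_n,f\in H^2(\mathbb T)$ be such that $h_n(y)=f_n(W_n(y))$ and $h(y)=f(W(y))$. Let $\rho_n$ and $\rho$ be the corresponding unique weak solutions of $$\partial_t\rho=\tfrac{d}{dx}\tfrac{d}{dW_n}\rho,\quad \rho(\cdot,0)=h_n,\qquad\text{and}\qquad \partial_t\rho=\tfrac{d}{dx}\tfrac{d}{dW}\rho,\quad \rho(\cdot,0)=h,$$ respectively. Assume that: (i) $W_n\to W$ vaguely; (ii) the functions $\mathcal L_{W_n}h_n$ are uniformly bounded (in $n$); (iii) $f_n\to f$ in $H^2(\mathbb T)$. Let $a_n=w_n'$ and $a=w'$, where $w_n,w$ are the generalized inverses of $W_n,W$. Then there exist continuous functions $v_n,v:\mathbb R_+\times\mathbb T\to\mathbb R$ such that: 1. $v_n$ is the unique weak solution of $a_n(x)\,\partial_t v(t,x)=v_{xx}(t,x)$, $a_n(x)v(0,x)=a_n(x)f_n(x)$, and $v$ is the unique weak solution of $a(x)\,\partial_t v(t,x)=v_{xx}(t,x)$, $a(x)v(0,x)=a(x)f(x)$; 2. $\rho_n(t,x)=v_n(t,W_n(x))$ and $\rho(t,x)=v(t,W(x))$; 3. for every $\varepsilon\in(0,\tfrac12)$, $v_n,v\in C(\mathbb T,C^{\frac12-\varepsilon}(\mathbb R_+))$ and $v_n\to v$ in the topology of $C(\mathbb T,C^{\frac12-\varepsilon}(\mathbb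 R_+))$.
   Context: $\mathbb T=\mathbb R/\mathbb Z$; functions on $\mathbb T$ are identified with $1$-periodic functions on $\mathbb R$; $\mathbb R_+=[0,\infty)$; $H^2(\mathbb T)$ is the usual periodic Sobolev space; $\langle\cdot,\cdot\rangle_{L^2}$ is the inner product of $L^2(\mathbb T)$. The class $\mathcal W$: to a probability measure $\mu$ on $\mathbb T$ one associates the unique right-continuous $W:\mathbb R\to\mathbb R$ with $W(0)=0$, $W(x+1)-W(x)=1$ for all $x$, and $\mu((\alpha,\beta])=W(\beta)-W(\alpha)$ whenever $(\alpha,\beta]$ represents an interval in the torus. $\mathcal W$ is the set of such $W$ for which Lebesgue measure is absolutely continuous with respect to $\mu$ (such $W$ is strictly increasing). $W_n\to W$ vaguely means $\int\phi\,dW_n\to\int\phi\,dW$ for all $\phi\in C(\mathbb T)$. Generalized derivative: $\frac{df}{dW}(x)=\lim_{\varepsilon\to0}\frac{f(x+\varepsilon)-f(x)}{W(x+\varepsilon)-W(x)}$ when the limit exists and is finite. $\mathcal D_W(\mathbb T)$ is the set of functions $f$ on $\mathbb T$ such that $f(x)=b+cW(x)+\int_{(0,x]}\int_0^y g(z)\,dz\,dW(y)$ for $x\in[0,1]$, for some $g\in L^2(\mathbb T)$ and $b,c\in\mathbb R$ with $cW(1)+\int_{\mathbb T}\int_0^y g(z)\,dz\,dW(y)=0$ and $\int_{\mathbb T}g(z)\,dz=0$; $g,b,c$ are uniquely determined by $f$. The operator $\mathcal L_W:\mathcal D_W(\mathbb T)\to L^2(\mathbb T)$ is $\mathcal L_Wf=\frac{d}{dx}\frac{d}{dW}f$,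 and $\mathcal L_Wf=g$ a.e. Weak solution of $\partial_t\rho=\frac{d}{dx}\frac{d}{dW}\rho$, $\rho(\cdot,0)=h$: a measurable bounded $\rho:\mathbb R_+\times\mathbb T\to\mathbb R$ such that for all $\psi\in\mathcal D_W(\mathbb T)$ and every $T>0$, $\langle\rho(T),\psi\rangle_{L^2}-\langle h,\psi\rangle_{L^2}=\int_0^T\langle\rho(t),\mathcal L_W\psi\rangle_{L^2}\,dt$, where $\rho(T)=\rho(T,\cdot)$. These solutions are identified when they agree almost everywhere in the space variable for each time. Generalized inverse: $w(s)=\sup\{r: W(r)\le s\}$. For $W\in\mathcal W$, $w$ is absolutely continuous and $a=w'\ge0$ is regarded as a function on $\mathbb T$ with $\int_{\mathbb T}a=1$. Weak solution of $a(x)v_t=v_{xx}$, $a(x)v(0,x)=a(x)f(x)$: a continuous $v:\mathbb R_+\times\mathbb T\to\mathbb R$ such that for all $\phi\in H^2(\mathbb T)$ and every $T>0$, $\langle v(T),\phi\rangle_a-\langle f,\phi\rangle_a=\int_0^T\langle v(t),\phi''\rangle_{L^2}\,dt$, where $v(T)=v(T,\cdot)$ and $\langle p,q\rangle_a=\int_{\mathbb T}a(x)p(x)q(x)\,dx$. $C^{\alpha}(\mathbb R_+)$ is the space of bounded $\alpha$-Hölder continuous functions on $\mathbb R_+$ with its usual norm; $v\in C(\mathbb T,C^\alpha(\mathbb R_+))$ means that $x\mapsto v(\cdot,x)$ is continuous from $\mathbb T$ to $C^\alpha(\mathbb R_+)$, with norm $\sup_{x\in\mathbb T}\|v(\cd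ot,x)\|_{C^\alpha}$.
   Formalization: As stated the claim fails if W jumps at 0 (Leb/2+δ_{1/n}/2 → Leb/2+δ_0/2); in that case W_n(x)→W(x) at continuity points of W is also assumed. The initial condition ρ(·,0)=h a.e. is an explicit part of being a weak solution. *)

theory Defs
  imports "HOL-Probability.Probability"
begin

text \<open>
  Functions on the torus are 1-periodic functions on the real line; integrals over the torus are
  integrals over one period. Since \<open>dW\<close> may have atoms, the period for \<open>dW\<close>-integrals is the
  half-open interval \<open>(0,1]\<close>. Functions on \<open>[0,\<infinity>)\<close> are functions on the real line whose values at
  negative arguments are ignored.
\<close>

definition periodic1 :: "(real \<Rightarrow> 'a) \<Rightarrow> bool" where
  "periodic1 f \<longleftrightarrow> (\<forall>x. f (x + 1) = f x)"

definition L2T :: "(real \<Rightarrow> real) set" where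
  "L2T = {g. periodic1 g \<and> g \<in> borel_measurable borel \<and>
             set_integrable lborel {0..1} (\<lambda>x. (g x)\<^sup>2)}"

definition ipT :: "(real \<Rightarrow> real) \<Rightarrow> (real \<Rightarrow> real) \<Rightarrow> real" where
  "ipT p q = (LINT x:{0..1}|lborel. p x * q x)"

definition ipT_weighted :: "(real \<Rightarrow> real) \<Rightarrow> (real \<Rightarrow> real) \<Rightarrow> (real \<Rightarrow> real) \<Rightarrow> real" where
  "ipT_weighted a p q = (LINT x:{0..1}|lborel. a x * p x * q x)"

subsection \<open>The class of driving functions\<close>

text \<open>
  A Borel measure on the torus is a Borel measure on the fundamental domain \<open>[0,1)\<close>; the arc
  represented by \<open>(\<alpha>,\<beta>]\<close>, of length at most 1, is its image under \<open>frac\<close>.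
\<close>

definition prob_torus :: "real measure \<Rightarrow> bool" where
  "prob_torus \<mu> \<longleftrightarrow> prob_space \<mu> \<and> sets \<mu> = sets (restrict_space borel {0..<1})"

definition distribution_of :: "real measure \<Rightarrow> (real \<Rightarrow> real) \<Rightarrow> bool" where
  "distribution_of \<mu> W \<longleftrightarrow>
     (\<forall>x. continuous (at_right x) W) \<and> W 0 = 0 \<and> (\<forall>x. W (x + 1) - W x = 1) \<and>
     (\<forall>\<alpha> \<beta>. \<alpha> \<le> \<beta> \<and> \<beta> \<le> \<alpha> + 1 \<longrightarrow> measure \<mu> (frac ` {\<alpha><..\<beta>}) = W \<beta> - W \<alpha>)"

definition class_W :: "(real \<Rightarrow> real) set" where
  "class_W = {W. \<exists>\<mu>. prob_torus \<mu> \<and> distribution_of \<mu> W \<and>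
                    absolutely_continuous \<mu> (restrict_space lborel {0..<1})}"

text \<open>
  Because of the normalization \<open>W 0 = 0\<close>, vague convergence on the torus implies convergence at the
  continuity points of \<open>W\<close> only if \<open>W\<close> is continuous at 0: for
  \<open>\<mu>\<^sub>n = (Leb + \<delta>\<^bsub>1/n\<^esub>)/2\<close> and \<open>\<mu> = (Leb + \<delta>\<^sub>0)/2\<close>, the limit of \<open>W\<^sub>n\<close> on \<open>(0,1)\<close> is \<open>W + 1/2\<close>.
\<close>

definition vaguely_tendsto :: "(nat \<Rightarrow> real \<Rightarrow> real) \<Rightarrow> (real \<Rightarrow> real) \<Rightarrow> bool" where
  "vaguely_tendsto Wn W \<longleftrightarrow>
     (\<forall>\<phi> :: real \<Rightarrow> real. continuous_on UNIV \<phi> \<and> periodic1 \<phi> \<longrightarrow>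
        (\<lambda>n. LINT x:{0<..1}|interval_measure (Wn n). \<phi> x)
          \<longlonglongrightarrow> (LINT x:{0<..1}|interval_measure W. \<phi> x))"

subsection \<open>The generalized derivative and the operator\<close>

definition W_deriv :: "(real \<Rightarrow> real) \<Rightarrow> (real \<Rightarrow> real) \<Rightarrow> real \<Rightarrow> real" where
  "W_deriv W f x = Lim (at 0) (\<lambda>e. (f (x + e) - f x) / (W (x + e) - W x))"

definition dom_W :: "(real \<Rightarrow> real) \<Rightarrow> (real \<Rightarrow> real) set" where
  "dom_W W = {f. periodic1 f \<and>
     (\<exists>g\<in>L2T. \<exists>b c.
        c * W 1 + (LINT y:{0<..1}|interval_measure W. (LINT z:{0..y}|lborel. g z)) = 0 \<and>
        (LINT z:{0..1}|lborel. g z) = 0 \<and>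
        (\<forall>x\<in>{0..1}. f x = b + c * W x
            + (LINT y:{0<..x}|interval_measure W. (LINT z:{0..y}|lborel. g z))))}"

text \<open>
  On the domain the inner derivative exists everywhere and the outer one almost everywhere, where it
  is the function \<open>g\<close> above; at the remaining points the value is arbitrary.
\<close>

definition L_op :: "(real \<Rightarrow> real) \<Rightarrow> (real \<Rightarrow> real) \<Rightarrow> real \<Rightarrow> real" where
  "L_op W f = deriv (W_deriv W f)"

text \<open>
  The tested identity at positive times does not constrain \<open>\<rho> 0\<close>, so the initial condition is a
  separate clause.
\<close>

definition weak_sol_W ::
  "(real \<Rightarrow> real) \<Rightarrow> (real \<Rightarrow> real) \<Rightarrow> (real \<Rightarrow> real \<Rightarrow> real) \<Rightarrow> bool" where
  "weak_sol_W W h \<rho> \<longleftrightarrow>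
     (\<lambda>p. \<rho> (fst p) (snd p)) \<in> borel_measurable (restrict_space borel ({0..} \<times> UNIV)) \<and>
     (\<exists>C. \<forall>t\<ge>0. \<forall>x. \<bar>\<rho> t x\<bar> \<le> C) \<and>
     (\<forall>t\<ge>0. periodic1 (\<rho> t)) \<and>
     (AE x in lborel. \<rho> 0 x = h x) \<and>
     (\<forall>\<psi>\<in>dom_W W. \<forall>T>0.
        ipT (\<rho> T) \<psi> - ipT h \<psi> = (LINT t:{0..T}|lborel. ipT (\<rho> t) (L_op W \<psi>)))"

subsection \<open>The periodic Sobolev space \<open>H\<^sup>2\<close>\<close>

definition test_fun :: "(real \<Rightarrow> real) \<Rightarrow> bool" where
  "test_fun \<phi> \<longleftrightarrow> periodic1 \<phi> \<and> (\<forall>k x. ((deriv ^^ k) \<phi>) field_differentiable (at x))"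

definition has_weak_deriv :: "(real \<Rightarrow> real) \<Rightarrow> (real \<Rightarrow> real) \<Rightarrow> bool" where
  "has_weak_deriv u g \<longleftrightarrow> u \<in> L2T \<and> g \<in> L2T \<and> (\<forall>\<phi>. test_fun \<phi> \<longrightarrow> ipT u (deriv \<phi>) = - ipT g \<phi>)"

text \<open>Determined only up to null sets; all uses are under integrals.\<close>

definition weak_deriv :: "(real \<Rightarrow> real) \<Rightarrow> real \<Rightarrow> real" where
  "weak_deriv u = (SOME g. has_weak_deriv u g)"

text \<open>Elements of \<open>H\<^sup>2\<close> are represented by their continuous versions.\<close>

definition H2T :: "(real \<Rightarrow> real) set" where
  "H2T = {f. continuous_on UNIV f \<and> periodic1 f \<and>
             (\<exists>g. has_weak_deriv f g) \<and> (\<exists>g. has_weak_deriv (weak_deriv f) g)}"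

definition H2_norm :: "(real \<Rightarrow> real) \<Rightarrow> real" where
  "H2_norm f = sqrt (ipT f f + ipT (weak_deriv f) (weak_deriv f)
     + ipT (weak_deriv (weak_deriv f)) (weak_deriv (weak_deriv f)))"

subsection \<open>The equation with a time-change coefficient\<close>

definition gen_inverse :: "(real \<Rightarrow> real) \<Rightarrow> real \<Rightarrow> real" where
  "gen_inverse W s = Sup {r. W r \<le> s}"

definition weak_sol_a ::
  "(real \<Rightarrow> real) \<Rightarrow> (real \<Rightarrow> real) \<Rightarrow> (real \<Rightarrow> real \<Rightarrow> real) \<Rightarrow> bool" where
  "weak_sol_a a f v \<longleftrightarrow>
     continuous_on ({0..} \<times> UNIV) (\<lambda>p. v (fst p) (snd p)) \<and>
     (\<forall>t\<ge>0. periodic1 (v t)) \<and>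
     (\<forall>\<phi>\<in>H2T. \<forall>T>0.
        ipT_weighted a (v T) \<phi> - ipT_weighted a f \<phi>
          = (LINT t:{0..T}|lborel. ipT (v t) (weak_deriv (weak_deriv \<phi>))))"

definition unique_weak_sol_a ::
  "(real \<Rightarrow> real) \<Rightarrow> (real \<Rightarrow> real) \<Rightarrow> (real \<Rightarrow> real \<Rightarrow> real) \<Rightarrow> bool" where
  "unique_weak_sol_a a f v \<longleftrightarrow>
     weak_sol_a a f v \<and> (\<forall>u. weak_sol_a a f u \<longrightarrow> (\<forall>t\<ge>0. \<forall>x. u t x = v t x))"

subsection \<open>Hoelder spaces on the half-line\<close>

definition holder_space :: "real \<Rightarrow> (real \<Rightarrow> real) set" where
  "holder_space \<alpha> = {u. \<exists>C. (\<forall>t\<ge>0. \<bar>u t\<bar> \<le> C) \<and>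
                              (\<forall>s\<ge>0. \<forall>t\<ge>0. \<bar>u s - u t\<bar> \<le> C * \<bar>s - t\<bar> powr \<alpha>)}"

definition holder_norm :: "real \<Rightarrow> (real \<Rightarrow> real) \<Rightarrow> real" where
  "holder_norm \<alpha> u = (SUP t\<in>{0..}. \<bar>u t\<bar>)
     + (SUP p\<in>{(s, t). 0 \<le> s \<and> 0 \<le> t \<and> s \<noteq> t}.
          \<bar>u (fst p) - u (snd p)\<bar> / \<bar>fst p - snd p\<bar> powr \<alpha>)"

definition C_holder :: "real \<Rightarrow> (real \<Rightarrow> real \<Rightarrow> real) set" where
  "C_holder \<alpha> = {v. (\<forall>t\<ge>0. periodic1 (v t)) \<and> (\<forall>x. (\<lambda>t. v t x) \<in> holder_space \<alpha>) \<and>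
     (\<forall>x. ((\<lambda>y. holder_norm \<alpha> (\<lambda>t. v t y - v t x)) \<longlongrightarrow> 0) (at x))}"

definition C_holder_norm :: "real \<Rightarrow> (real \<Rightarrow> real \<Rightarrow> real) \<Rightarrow> real" where
  "C_holder_norm \<alpha> v = (SUP x. holder_norm \<alpha> (\<lambda>t. v t x))"

end

theory Submission
  imports Defs "HOL-Complex_Analysis.Great_Picard"
begin

text \<open>
  The change of variable \<open>s = W x\<close> turns \<open>d/dx d/dW\<close> into a second derivative: if \<open>f\<close> satisfies
  \<open>f'' = w' \<cdot> (k \<circ> w)\<close>, with \<open>w\<close> the inverse of \<open>W\<close>, then \<open>f \<circ> W\<close> is mapped to \<open>k\<close>. Solving this
  equation with periodic boundary values gives a Green potential \<open>Pot k\<close>, and the domain of the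
  operator consists of the functions \<open>b + Pot g (W x)\<close> (\<open>dom_W_representation\<close>, \<open>dom_W_Pot\<close>). Two
  facts about potentials carry everything: the energy identity
  \<open>\<integral> ((Pot k)')\<^sup>2 = - \<integral> k (Pot k \<circ> W)\<close>, which makes the operator nonpositive, and its consequence
  \<open>sup (Pot k - mean)\<^sup>2 \<le> \<bar>k\<bar>\<^sub>2 \<bar>p\<bar>\<^sub>2\<close> for \<open>k = L p\<close>, which upgrades \<open>L\<^sup>2\<close> estimates to uniform ones.
  The constants depend on \<open>\<bar>L h\<bar>\<^sub>2\<close> alone, not on \<open>W\<close>.

  The function \<open>v\<close> is extracted from the given solution \<open>\<rho>\<close>. The weak formulation only says that
  \<open>L (\<integral>\<^sub>0\<^sup>t \<rho>) = \<rho>(t) - h\<close>, so \<open>\<rho>\<close> is replaced by its averages \<open>A\<close> over short time intervals, that is,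
  by second difference quotients of its double time integral. These lie in the domain; the energy
  identity shows that \<open>\<bar>L A\<bar>\<^sub>2\<close> decreases in time and is at most \<open>12 \<bar>L h\<bar>\<^sub>2\<close> at time 0. Hence the
  averages, written as functions of \<open>s = W x\<close>, converge uniformly to a \<open>v\<close> that is Lipschitz in space,
  \<open>1/2\<close>-Hoelder in time and tends to its mean at a fixed rate; these are the \<open>parabolic_bounds\<close>. By
  uniqueness \<open>\<rho> = v \<circ> W\<close>, and transporting the weak formulation through
  \<open>\<integral> w' q = \<integral> q (W x) dx\<close> (\<open>weight_formula\<close>) yields the equation for \<open>v\<close>. Uniqueness for that
  equation on a finite horizon is again the energy argument (\<open>a_equation_uniqueness\<close>).

  For the convergence, vague convergence gives \<open>W\<^sub>n \<rightarrow> W\<close> almost everywhere when \<open>W\<close> is continuous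
  at 0; otherwise the normalization at 0 interferes and the convergence is assumed. The family \<open>v\<^sub>n\<close> is uniformly bounded and equicontinuous on \<open>[0,T] \<times> [0,1]\<close>, so by Arzela-Ascoli every subsequence has
  a uniformly convergent subsequence; its limit satisfies the limit equation, hence equals \<open>v\<close>
  (\<open>horizon_convergence\<close>). The uniform decay to the mean handles large times. Finally, interpolation
  between the uniform convergence and the common \<open>1/2\<close>-Hoelder bound gives convergence in every
  smaller Hoelder norm.
\<close>

section \<open>Lebesgue differentiation and measurability of derivatives\<close>

text \<open>
  A Vitali covering argument. Where \<open>g < \<alpha>\<close>, cover by disjoint short intervals on which the average
  of \<open>g\<close> exceeds \<open>\<beta>\<close>, inside an open set of almost the same mass. On each of them the positive part
  of \<open>g - \<beta>\<close> outweighs the negative part; since \<open>g - \<beta> < \<alpha> - \<beta>\<close> on the set itself, its measure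
  times \<open>\<beta> - \<alpha>\<close> is bounded by the mass of the small excess of the open set.
\<close>

lemma negligible_oscillating_averages:
  fixes g :: "real \<Rightarrow> real"
  assumes g: "integrable lborel g" and ab: "\<alpha> < \<beta>"
  shows "negligible {x. g x < \<alpha> \<and>
    (\<forall>d>0. \<exists>u v. u \<le> x \<and> x \<le> v \<and> u < v \<and> v - u < d \<and> (LINT z:{u..v}|lborel. g z) > \<beta> * (v - u))}"
    (is "negligible ?S")
proof -
  have [measurable]: "g \<in> borel_measurable borel" using g by auto
  have "negligible (?S \<inter> {-real N<..<real N})" for N
  proof (subst negligible_outer_le, intro allI impI)
    fix e :: real assume e: "e > 0"
    let ?D = "{-real N<..<real N}"
    define E where "E = {x. g x < \<alpha>} \<inter> ?D"
    have E[measurable]: "E \<in> sets borel" unfolding E_def by measurable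
    define q where "q x = indicator ?D x * (g x - \<beta>)" for x
    have qint: "integrable lborel q"
    proof -
      have "integrable lborel (\<lambda>x. indicator ?D x * g x - \<beta> * indicator ?D x)"
        using g by (intro Bochner_Integration.integrable_diff integrable_mult_right integrable_real_mult_indicator
            integrable_real_indicator) (auto simp: integrable_real_mult_indicator mult.commute)
      then show ?thesis by (rule back_subst[of "integrable lborel"]) (auto simp: q_def algebra_simps)
    qed
    have [measurable]: "q \<in> borel_measurable borel" unfolding q_def by measurable
    define M where "M = density lborel (\<lambda>x. ennreal \<bar>q x\<bar>)"
    have fin: "emeasure M (space M) \<noteq> \<infinity>"
    proof -
      have "emeasure M (space M) = (\<integral>\<^sup>+x. ennreal \<bar>q x\<bar> \<partial>lborel)"
        unfolding M_def by (simp add: emeasure_density)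
      also have "\<dots> < \<infinity>" using qint by (simp add: integrable_iff_bounded)
      finally show ?thesis by simp
    qed
    have sM: "sets M = sets borel" unfolding M_def by simp
    define e' where "e' = e * (\<beta> - \<alpha>)"
    have e': "e' > 0" using e ab by (simp add: e'_def)
    have "emeasure M E = (INF U \<in> {U. E \<subseteq> U \<and> open U}. emeasure M U)"
      by (rule outer_regular[OF sM fin E])
    moreover have "emeasure M E < emeasure M E + ennreal e'"
    proof -
      have "emeasure M E \<le> emeasure M (space M)" by (rule emeasure_space)
      then have "emeasure M E \<noteq> \<infinity>" using fin top.extremum_unique by force
      then show ?thesis using e' by (metis ennreal_0 ennreal_add_left_cancel_less ennreal_less_zero_iff add_0_right zero_less_iff_neq_zero not_less order.strict_iff_not)
    qed
    ultimately obtain U0 where U0: "E \<subseteq> U0" "open U0" "emeasure M U0 < emeasure M E + ennreal e'"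
      by (auto simp: INF_less_iff)
    define U where "U = U0 \<inter> ?D"
    have U: "E \<subseteq> U" "open U" "U \<subseteq> ?D" using U0 by (auto simp: U_def E_def)
    have Ub[measurable]: "U \<in> sets borel" using U by auto
    have "emeasure M E + emeasure M (U - E) = emeasure M U"
      using U by (subst plus_emeasure) (auto simp: sM intro!: arg_cong[where f="emeasure M"])
    also have "\<dots> \<le> emeasure M U0" using U0 by (intro emeasure_mono) (auto simp: U_def sM)
    finally have "emeasure M E + emeasure M (U - E) < emeasure M E + ennreal e'"
      using U0(3) by (meson order.strict_trans1)
    then have MUE: "emeasure M (U - E) < ennreal e'"
      by (simp add: ennreal_add_left_cancel_less)
    define K where "K = {(u,v). u < v \<and> {u..v} \<subseteq> U \<and> (LINT z:{u..v}|lborel. g z) > \<beta> * (v - u)}"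
    define ce where "ce = (\<lambda>(u,v). (u + v) / 2 :: real)"
    define ra where "ra = (\<lambda>(u,v). (v - u) / 2 :: real)"
    have cb: "cball (ce (u,v)) (ra (u,v)) = {u..v}" for u v
      unfolding ce_def ra_def cball_eq_atLeastAtMost by (auto simp: field_simps)
    obtain C where C: "countable C" "C \<subseteq> K"
      and disj: "pairwise (\<lambda>i j. disjnt (cball (ce i) (ra i)) (cball (ce j) (ra j))) C"
      and negl: "negligible ((?S \<inter> ?D) - (\<Union>i\<in>C. cball (ce i) (ra i)))"
    proof (rule Vitali_covering_theorem_cballs[of K ra "?S \<inter> ?D" ce])
      show "0 < ra i" if "i \<in> K" for i using that by (auto simp: K_def ra_def)
      fix x d :: real assume x: "x \<in> ?S \<inter> ?D" and d: "0 < d"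
      then have "x \<in> U" using U by (auto simp: E_def)
      then obtain r where r: "r > 0" "cball x r \<subseteq> U" using U(2) open_contains_cball by blast
      from x have "\<forall>d>0. \<exists>u v. u \<le> x \<and> x \<le> v \<and> u < v \<and> v - u < d \<and> (LINT z:{u..v}|lborel. g z) > \<beta> * (v - u)"
        by blast
      moreover have "min r d > 0" using r d by simp
      ultimately obtain u v where uv: "u \<le> x" "x \<le> v" "u < v" "v - u < min r d"
        "(LINT z:{u..v}|lborel. g z) > \<beta> * (v - u)" by blast
      have "{u..v} \<subseteq> cball x r" using uv by (auto simp: dist_real_def)
      then have "(u,v) \<in> K" using uv r by (auto simp: K_def)
      then show "\<exists>i. i \<in> K \<and> x \<in> cball (ce i) (ra i) \<and> ra i < d"
        using uv by (intro exI[of _ "(u,v)"]) (simp add: cb, simp add: ra_def)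
    qed blast
    define I where "I i = cball (ce i) (ra i)" for i
    define T where "T = (\<Union>i\<in>C. I i)"
    have Ib[measurable]: "I i \<in> sets borel" for i unfolding I_def by simp
    have T[measurable]: "T \<in> sets borel" unfolding T_def using C(1) by (intro sets.countable_UN') auto
    have TU: "T \<subseteq> U"
    proof -
      have "I i \<subseteq> U" if "i \<in> C" for i
        using subsetD[OF C(2) that] by (cases i) (simp add: I_def cb, simp add: K_def)
      then show ?thesis by (auto simp: T_def)
    qed
    define Mp where "Mp = density lborel (\<lambda>x. ennreal (max 0 (q x)))"
    define Mm where "Mm = density lborel (\<lambda>x. ennreal (max 0 (- q x)))"
    have df: "disjoint_family_on I C" using disj by (auto simp: disjoint_family_on_def pairwise_def disjnt_def I_def)
    have le: "emeasure Mm (I i) \<le> emeasure Mp (I i)" if "i \<in> C" for i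
    proof -
      obtain u v where i: "i = (u,v)" by (cases i)
      have K': "u < v" "{u..v} \<subseteq> U" "(LINT z:{u..v}|lborel. g z) > \<beta> * (v - u)"
        using that C(2) by (auto simp: K_def i)
      have q: "integrable lborel (\<lambda>x. indicator {u..v} x * q x)"
        using qint by (auto simp: integrable_real_mult_indicator mult.commute)
      have "(LINT x|lborel. indicator {u..v} x * q x) = (LINT x|lborel. indicator {u..v} x * g x - \<beta> * indicator {u..v} x)"
        using subset_trans[OF K'(2) U(3)]
        by (intro Bochner_Integration.integral_cong) (auto simp: q_def indicator_def algebra_simps subset_iff)
      also have "\<dots> = (LINT z:{u..v}|lborel. g z) - \<beta> * (v - u)"
        using g K'(1) by (subst Bochner_Integration.integral_diff)
          (auto simp: integrable_real_mult_indicator mult.commute set_lebesgue_integral_def)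
      finally have pos: "(LINT x|lborel. indicator {u..v} x * q x) > 0" using K' by simp
      have s: "(LINT x|lborel. max 0 (indicator {u..v} x * q x)) - (LINT x|lborel. max 0 (- (indicator {u..v} x * q x)))
         = (LINT x|lborel. indicator {u..v} x * q x)"
      proof -
        have "max 0 y - max 0 (- y) = y" for y :: real by simp
        then show ?thesis
          using q by (subst Bochner_Integration.integral_diff[symmetric]) simp_all
      qed
      have "emeasure Mm (I i) = (\<integral>\<^sup>+x. ennreal (max 0 (- (indicator {u..v} x * q x))) \<partial>lborel)"
        unfolding Mm_def i I_def cb by (subst emeasure_density) (auto intro!: nn_integral_cong simp: indicator_def)
      also have "\<dots> = ennreal (LINT x|lborel. max 0 (- (indicator {u..v} x * q x)))"
        using q by (intro nn_integral_eq_integral) auto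
      also have "\<dots> \<le> ennreal (LINT x|lborel. max 0 (indicator {u..v} x * q x))"
        using s pos by (intro ennreal_leI) simp
      also have "\<dots> = (\<integral>\<^sup>+x. ennreal (max 0 (indicator {u..v} x * q x)) \<partial>lborel)"
        using q by (intro nn_integral_eq_integral[symmetric]) auto
      also have "\<dots> = emeasure Mp (I i)"
        unfolding Mp_def i I_def cb by (subst emeasure_density) (auto intro!: nn_integral_cong simp: indicator_def)
      finally show ?thesis .
    qed
    have "emeasure Mm T = (\<integral>\<^sup>+i. emeasure Mm (I i) \<partial>count_space C)"
      unfolding T_def using C(1) df by (intro emeasure_UN_countable) (auto simp: Mm_def)
    also have "\<dots> \<le> (\<integral>\<^sup>+i. emeasure Mp (I i) \<partial>count_space C)"
      by (intro nn_integral_mono) (auto intro: le)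
    also have "\<dots> = emeasure Mp T"
      unfolding T_def using C(1) df by (intro emeasure_UN_countable[symmetric]) (auto simp: Mp_def)
    also have "\<dots> \<le> emeasure M (U - E)"
    proof -
      have "q x \<le> 0" if "x \<in> E" for x using that ab by (auto simp: E_def q_def)
      then have "ennreal (max 0 (q x)) * indicator T x \<le> ennreal \<bar>q x\<bar> * indicator (U - E) x" for x
        using TU by (cases "x \<in> E") (auto simp: indicator_def max_absorb1 intro!: ennreal_leI)
      then show ?thesis
        unfolding Mp_def M_def by (subst (1 2) emeasure_density) (auto intro!: nn_integral_mono)
    qed
    finally have MmT: "emeasure Mm T < ennreal e'" using MUE by (meson order.strict_trans1)
    have "ennreal (\<beta> - \<alpha>) * emeasure lborel (E \<inter> T) = (\<integral>\<^sup>+x. ennreal (\<beta> - \<alpha>) * indicator (E \<inter> T) x \<partial>lborel)"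
      by (simp add: nn_integral_cmult_indicator)
    also have "\<dots> \<le> emeasure Mm T"
      unfolding Mm_def by (subst emeasure_density)
        (auto intro!: nn_integral_mono simp: indicator_def E_def q_def intro!: ennreal_leI)
    finally have "ennreal (\<beta> - \<alpha>) * emeasure lborel (E \<inter> T) < ennreal (\<beta> - \<alpha>) * ennreal e"
      using MmT e ab by (simp add: e'_def ennreal_mult'[symmetric] mult.commute)
    then have ET: "emeasure lborel (E \<inter> T) < ennreal e"
      by (meson mult_left_mono not_le zero_le)
    let ?N = "(?S \<inter> ?D) - T"
    have N: "negligible ?N" using negl by (simp add: T_def I_def)
    have ETf: "E \<inter> T \<in> fmeasurable lebesgue"
      using ET by (intro fmeasurableI) (auto simp: emeasure_completion intro: order.strict_trans)
    have Nf: "?N \<in> fmeasurable lebesgue" using N negligible_iff_measure by blast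
    have "measure lebesgue (E \<inter> T \<union> ?N) = measure lebesgue (E \<inter> T)"
      using N by (simp add: measure_Un_null_set negligible_iff_null_sets ETf fmeasurableD)
    also have "\<dots> \<le> e"
    proof -
      have "measure lebesgue (E \<inter> T) = measure lborel (E \<inter> T)" by (simp add: measure_completion)
      then show ?thesis using ET e unfolding measure_def by (metis enn2real_leI less_imp_le)
    qed
    finally have "measure lebesgue (E \<inter> T \<union> ?N) \<le> e" .
    moreover have "?S \<inter> ?D \<subseteq> E \<inter> T \<union> ?N" by (auto simp: E_def)
    moreover have "E \<inter> T \<union> ?N \<in> lmeasurable" using ETf Nf by auto
    ultimately show "\<exists>T. ?S \<inter> ?D \<subseteq> T \<and> T \<in> lmeasurable \<and> measure lebesgue T \<le> e" by blast
  qed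
  then have "negligible (\<Union>N. ?S \<inter> {-real N<..<real N})" by (intro negligible_countable_Union) auto
  moreover have "(\<Union>N. ?S \<inter> {-real N<..<real N}) = ?S"
  proof -
    have "\<exists>N. x \<in> {-real N<..<real N}" for x
      using reals_Archimedean2[of "\<bar>x\<bar>"] by (auto simp: abs_less_iff) (metis minus_less_iff)
    then show ?thesis by auto
  qed
  ultimately show ?thesis by simp
qed

lemma LINT_atMost_diff:
  fixes g :: "real \<Rightarrow> real"
  assumes g: "integrable lborel g" and "u \<le> v"
  shows "(LINT z:{..v}|lborel. g z) - (LINT z:{..u}|lborel. g z) = (LINT z:{u..v}|lborel. g z)"
proof -
  have i: "integrable lborel (\<lambda>x. indicator A x * g x)" if "A \<in> sets borel" for A
    using g that by (auto simp: integrable_real_mult_indicator mult.commute)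
  have *: "z \<le> u \<Longrightarrow> z \<le> v" for z using \<open>u \<le> v\<close> by simp
  have "(LINT z|lborel. indicator {..v} z * g z) - (LINT z|lborel. indicator {..u} z * g z)
      = (LINT z|lborel. indicator {..v} z * g z - indicator {..u} z * g z)"
    by (rule Bochner_Integration.integral_diff[symmetric]) (auto intro: i)
  also have "\<dots> = (LINT z|lborel. indicator {u..v} z * g z)"
    using AE_lborel_singleton[of u] g
    by (intro integral_cong_AE; (elim AE_mp)?; auto intro!: AE_I2 simp: indicator_def * split: if_splits)
  finally show ?thesis by (simp add: set_lebesgue_integral_def)
qed

text \<open>
  If the upper derivate of the integral exceeded \<open>g x\<close>, two rationals would separate them and \<open>x\<close>
  would lie in one of countably many negligible sets; \<open>- g\<close> deals with the lower derivate.
\<close>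

lemma lebesgue_differentiation:
  fixes g :: "real \<Rightarrow> real"
  assumes g: "integrable lborel g"
  shows "AE x in lborel. ((\<lambda>y. LINT z:{..y}|lborel. g z) has_real_derivative g x) (at x)"
proof -
  define bad where "bad = (\<lambda>(h :: real \<Rightarrow> real) \<alpha> \<beta>. {x. h x < \<alpha> \<and>
    (\<forall>d>0. \<exists>u v. u \<le> x \<and> x \<le> v \<and> u < v \<and> v - u < d \<and> (LINT z:{u..v}|lborel. h z) > \<beta> * (v - u))})"
  have "AE x in lborel. \<forall>p\<in>\<rat> \<times> \<rat>. fst p < snd p \<longrightarrow> x \<notin> bad h (fst p) (snd p)" if h: "integrable lborel h" for h
  proof (rule AE_ball_countable', rule AE_impI)
    show "countable (\<rat> \<times> \<rat> :: (real \<times> real) set)" by (intro countable_SIGMA countable_rat)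
    fix p :: "real \<times> real" assume "fst p < snd p"
    then have "negligible (bad h (fst p) (snd p))"
      unfolding bad_def by (rule negligible_oscillating_averages[OF h])
    then have "AE x in lebesgue. x \<notin> bad h (fst p) (snd p)"
      by (simp add: AE_not_in negligible_iff_null_sets)
    then show "AE x in lborel. x \<notin> bad h (fst p) (snd p)"
      by (simp add: AE_completion_iff)
  qed
  note bad = this
  have g': "integrable lborel (\<lambda>x. - g x)" using g by simp
  have "AE x in lborel. (\<forall>p\<in>\<rat> \<times> \<rat>. fst p < snd p \<longrightarrow> x \<notin> bad g (fst p) (snd p)) \<and>
      (\<forall>p\<in>\<rat> \<times> \<rat>. fst p < snd p \<longrightarrow> x \<notin> bad (\<lambda>x. - g x) (fst p) (snd p))"
    using bad[OF g] bad[OF g'] by simp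
  then show ?thesis
  proof (rule AE_mp, intro AE_I2 impI, elim conjE)
    fix x
    assume a: "\<forall>p\<in>\<rat> \<times> \<rat>. fst p < snd p \<longrightarrow> x \<notin> bad g (fst p) (snd p)"
      "\<forall>p\<in>\<rat> \<times> \<rat>. fst p < snd p \<longrightarrow> x \<notin> bad (\<lambda>x. - g x) (fst p) (snd p)"
    have up: "\<exists>d>0. \<forall>u v. u \<le> x \<and> x \<le> v \<and> u < v \<and> v - u < d \<longrightarrow> (LINT z:{u..v}|lborel. h z) < (h x + e) * (v - u)"
      if e: "e > 0" and nb: "\<forall>p\<in>\<rat> \<times> \<rat>. fst p < snd p \<longrightarrow> x \<notin> bad h (fst p) (snd p)" for h e
    proof -
      obtain \<alpha> where \<alpha>: "\<alpha> \<in> \<rat>" "h x < \<alpha>" "\<alpha> < h x + e" using Rats_dense_in_real[of "h x" "h x + e"] e by auto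
      obtain \<beta> where \<beta>: "\<beta> \<in> \<rat>" "\<alpha> < \<beta>" "\<beta> < h x + e" using Rats_dense_in_real[OF \<alpha>(3)] by auto
      have "x \<notin> bad h \<alpha> \<beta>" using nb \<alpha> \<beta> by fastforce
      then obtain d where d: "d > 0"
        "\<And>u v. u \<le> x \<Longrightarrow> x \<le> v \<Longrightarrow> u < v \<Longrightarrow> v - u < d \<Longrightarrow> (LINT z:{u..v}|lborel. h z) \<le> \<beta> * (v - u)"
        using \<alpha> by (force simp: bad_def not_less)
      have "(LINT z:{u..v}|lborel. h z) < (h x + e) * (v - u)" if "u \<le> x" "x \<le> v" "u < v" "v - u < d" for u v
      proof -
        have "\<beta> * (v - u) < (h x + e) * (v - u)" using \<beta> that by simp
        then show ?thesis using d(2)[OF that] by simp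
      qed
      then show ?thesis using d(1) by blast
    qed
    show "((\<lambda>y. LINT z:{..y}|lborel. g z) has_real_derivative g x) (at x)"
      unfolding has_field_derivative_iff
    proof (rule LIM_I)
      fix e :: real assume e: "0 < e"
      obtain d1 where d1: "d1 > 0" "\<And>u v. u \<le> x \<Longrightarrow> x \<le> v \<Longrightarrow> u < v \<Longrightarrow> v - u < d1 \<Longrightarrow>
          (LINT z:{u..v}|lborel. g z) < (g x + e) * (v - u)"
        using up[OF e a(1)] by blast
      obtain d2 where d2: "d2 > 0" "\<And>u v. u \<le> x \<Longrightarrow> x \<le> v \<Longrightarrow> u < v \<Longrightarrow> v - u < d2 \<Longrightarrow>
          (LINT z:{u..v}|lborel. - g z) < (- g x + e) * (v - u)"
        using up[OF e a(2)] by blast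
      have two: "\<bar>(LINT z:{u..v}|lborel. g z) - g x * (v - u)\<bar> < e * (v - u)"
        if "u \<le> x" "x \<le> v" "u < v" "v - u < min d1 d2" for u v
      proof -
        have "(LINT z:{u..v}|lborel. - g z) = - (LINT z:{u..v}|lborel. g z)"
          by (simp add: set_lebesgue_integral_def)
        then show ?thesis using d1(2)[of u v] d2(2)[of u v] that by (simp add: algebra_simps abs_less_iff)
      qed
      have "norm (((LINT z:{..y}|lborel. g z) - (LINT z:{..x}|lborel. g z)) / (y - x) - g x) < e"
        if y: "y \<noteq> x" "norm (y - x) < min d1 d2" for y
      proof (cases "y > x")
        case True
        then have "\<bar>(LINT z:{..y}|lborel. g z) - (LINT z:{..x}|lborel. g z) - g x * (y - x)\<bar> < e * (y - x)"
          using two[of x y] y LINT_atMost_diff[OF g, of x y] by simp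
        moreover have "((LINT z:{..y}|lborel. g z) - (LINT z:{..x}|lborel. g z)) / (y - x) - g x
            = ((LINT z:{..y}|lborel. g z) - (LINT z:{..x}|lborel. g z) - g x * (y - x)) / (y - x)"
          using True by (simp add: field_simps)
        ultimately show ?thesis using True by (simp add: pos_divide_less_eq)
      next
        case False
        then have "y < x" using y by simp
        then have "\<bar>(LINT z:{..x}|lborel. g z) - (LINT z:{..y}|lborel. g z) - g x * (x - y)\<bar> < e * (x - y)"
          using two[of y x] y LINT_atMost_diff[OF g, of y x] by simp
        moreover have "((LINT z:{..y}|lborel. g z) - (LINT z:{..x}|lborel. g z)) / (y - x) - g x
            = ((LINT z:{..x}|lborel. g z) - (LINT z:{..y}|lborel. g z) - g x * (x - y)) / (x - y)"
          using \<open>y < x\<close> by (simp add: field_simps)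
        ultimately show ?thesis using \<open>y < x\<close> by (simp add: pos_divide_less_eq)
      qed
      then show "\<exists>s>0. \<forall>y. y \<noteq> x \<and> norm (y - x) < s \<longrightarrow>
          norm (((LINT z:{..y}|lborel. g z) - (LINT z:{..x}|lborel. g z)) / (y - x) - g x) < e"
        using d1(1) d2(1) by (intro exI[of _ "min d1 d2"]) auto
    qed
  qed
qed

lemma continuous_on_LINT_atMost:
  fixes g :: "real \<Rightarrow> real"
  assumes g: "integrable lborel g"
  shows "continuous_on UNIV (\<lambda>y. LINT z:{..y}|lborel. g z)"
proof -
  have [measurable]: "g \<in> borel_measurable borel" using g by auto
  have "isCont (\<lambda>y. LINT z:{..y}|lborel. g z) x" for x
    unfolding continuous_at_sequentially o_def
  proof (intro allI impI)
    fix u assume u: "u \<longlonglongrightarrow> x"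
    have "(\<lambda>n. LINT z|lborel. indicator {..u n} z * g z) \<longlonglongrightarrow> (LINT z|lborel. indicator {..x} z * g z)"
    proof (rule integral_dominated_convergence)
      show "integrable lborel (\<lambda>z. \<bar>g z\<bar>)" using g by simp
      show "AE z in lborel. (\<lambda>n. indicator {..u n} z * g z) \<longlonglongrightarrow> indicator {..x} z * g z"
        using AE_lborel_singleton[of x]
      proof (rule AE_mp, intro AE_I2 impI)
        fix z assume "z \<noteq> x"
        have "eventually (\<lambda>n. indicator {..u n} z * g z = indicator {..x} z * g z) sequentially"
        proof (cases "z < x")
          case True
          show ?thesis using order_tendstoD(1)[OF u True]
            by eventually_elim (use True in \<open>auto simp: indicator_def\<close>)
        next
          case False
          then have "x < z" using \<open>z \<noteq> x\<close> by simp
          show ?thesis using order_tendstoD(2)[OF u \<open>x < z\<close>]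
            by eventually_elim (use \<open>x < z\<close> in \<open>auto simp: indicator_def\<close>)
        qed
        then show "(\<lambda>n. indicator {..u n} z * g z) \<longlonglongrightarrow> indicator {..x} z * g z"
          by (rule tendsto_eventually)
      qed
    qed (auto simp: indicator_def)
    then show "(\<lambda>n. LINT z:{..u n}|lborel. g z) \<longlonglongrightarrow> (LINT z:{..x}|lborel. g z)"
      by (simp add: set_lebesgue_integral_def)
  qed
  then show ?thesis by (simp add: continuous_at_imp_continuous_on)
qed

lemma exists_rational_near:
  fixes h :: "real \<Rightarrow> real"
  assumes "isCont h p" "h p > c" "open U" "p \<in> U"
  shows "\<exists>r\<in>\<rat>. r \<in> U \<and> h r > c"
proof -
  have "eventually (\<lambda>x. h x > c \<and> x \<in> U) (nhds p)"
    using assms by (intro eventually_conj eventually_nhds_in_open)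
      (auto intro: order_tendstoD simp: isCont_def tendsto_at_iff_tendsto_nhds)
  then obtain S where S: "open S" "p \<in> S" "\<And>x. x \<in> S \<Longrightarrow> h x > c \<and> x \<in> U"
    by (auto simp: eventually_nhds)
  obtain e where "e > 0" "ball p e \<subseteq> S" using S openE by blast
  obtain r where "r \<in> \<rat>" "p < r" "r < p + e" using Rats_dense_in_real[of p "p + e"] \<open>e > 0\<close> by auto
  then have "r \<in> S" using \<open>ball p e \<subseteq> S\<close> by (auto simp: dist_real_def subset_iff)
  then show ?thesis using S \<open>r \<in> \<rat>\<close> by blast
qed

text \<open>
  By continuity of \<open>F\<close>, differentiability is a Cauchy condition on the difference quotients with
  rational increments, so it describes a Borel set \<open>D\<close>. On \<open>D\<close> the derivative is a limit of difference
  quotients; off \<open>D\<close> the function \<open>deriv F\<close> is the choice operator applied to a predicate that is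
  everywhere false, hence constant.
\<close>

lemma borel_measurable_deriv:
  fixes F :: "real \<Rightarrow> real"
  assumes F: "continuous_on UNIV F"
  shows "deriv F \<in> borel_measurable borel"
proof -
  define q where "q p x = (F (x + p) - F x) / p" for p x
  have [measurable]: "F \<in> borel_measurable borel" by (rule borel_measurable_continuous_onI[OF F])
  have [measurable]: "q p \<in> borel_measurable borel" for p unfolding q_def by measurable
  have isc: "isCont F y" for y using F by (simp add: continuous_on_eq_continuous_at)
  define R where "R m = {p. p \<in> \<rat> \<and> p \<noteq> 0 \<and> \<bar>p\<bar> < 1 / real (Suc m)}" for m
  have cR: "countable (R m)" for m
    by (rule countable_subset[OF _ countable_rat]) (auto simp: R_def)
  define D where "D = {x. \<forall>k. \<exists>m. \<forall>p\<in>R m. \<forall>r\<in>R m. q p x - q r x \<le> 1 / real (Suc k)}"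
  have D[measurable]: "D \<in> sets borel"
  proof -
    have "D = (\<Inter>k. \<Union>m. \<Inter>p\<in>R m. \<Inter>r\<in>R m. {x. q p x - q r x \<le> 1 / real (Suc k)})" by (auto simp: D_def)
    moreover have "R m \<noteq> {}" for m
    proof -
      obtain r where "r \<in> \<rat>" "0 < r" "r < 1 / real (Suc m)" using Rats_dense_in_real[of 0 "1 / real (Suc m)"] by auto
      then show ?thesis by (auto simp: R_def)
    qed
    ultimately show ?thesis
      by (auto intro!: sets.countable_INT'' sets.countable_UN sets.countable_INT' cR)
  qed
  have dom: "(F has_real_derivative l) (at x) \<longleftrightarrow> (\<lambda>p. q p x) \<midarrow>0\<rightarrow> l" for x l
    unfolding q_def by (simp add: DERIV_def)
  have D1: "x \<in> D" if l: "(\<lambda>p. q p x) \<midarrow>0\<rightarrow> l" for x l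
    unfolding D_def
  proof (intro CollectI allI)
    fix k
    have "0 < 1 / real (Suc k) / 2" by simp
    from LIM_D[OF l this] obtain s where s: "s > 0" "\<And>p. p \<noteq> 0 \<Longrightarrow> \<bar>p\<bar> < s \<Longrightarrow> \<bar>q p x - l\<bar> < 1 / real (Suc k) / 2"
      by auto
    obtain m where m: "1 / real (Suc m) < s" using s(1) reals_Archimedean by (auto simp: inverse_eq_divide)
    have "q p x - q r x \<le> 1 / real (Suc k)" if "p \<in> R m" "r \<in> R m" for p r
    proof -
      have "\<bar>q p x - l\<bar> < 1 / real (Suc k) / 2" "\<bar>q r x - l\<bar> < 1 / real (Suc k) / 2"
        using s(2)[of p] s(2)[of r] that m by (auto simp: R_def)
      moreover have "a - b \<le> c" if "\<bar>a - l\<bar> < c / 2" "\<bar>b - l\<bar> < c / 2" for a b c :: real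
        using that by linarith
      ultimately show ?thesis by blast
    qed
    then show "\<exists>m. \<forall>p\<in>R m. \<forall>r\<in>R m. q p x - q r x \<le> 1 / real (Suc k)" by blast
  qed
  have D2: "\<exists>l. (\<lambda>p. q p x) \<midarrow>0\<rightarrow> l" if x: "x \<in> D" for x
  proof -
    have qc: "isCont (\<lambda>p. q p x) p" if "p \<noteq> 0" for p
      unfolding q_def by (intro continuous_intros isCont_o2[OF _ isc] that)
    have ex: "\<exists>m. \<forall>p r. p \<noteq> 0 \<and> r \<noteq> 0 \<and> \<bar>p\<bar> < 1 / real (Suc m) \<and> \<bar>r\<bar> < 1 / real (Suc m)
        \<longrightarrow> q p x - q r x \<le> 1 / real (Suc k)" for k
    proof -
      obtain m where m: "\<forall>p\<in>R m. \<forall>r\<in>R m. q p x - q r x \<le> 1 / real (Suc k)"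
        using x unfolding D_def by blast
      let ?U = "{p. p \<noteq> 0 \<and> \<bar>p\<bar> < 1 / real (Suc m)}"
      have oU: "open ?U"
        by (intro open_Collect_conj open_Collect_neq open_Collect_less continuous_intros)
      have "q p x - q r x \<le> 1 / real (Suc k)" if p: "p \<in> ?U" and r: "r \<in> ?U" for p r
      proof (rule ccontr)
        assume n: "\<not> ?thesis"
        then have "\<exists>p'\<in>\<rat>. p' \<in> ?U \<and> q p' x - q r x > 1 / real (Suc k)"
          using p oU by (intro exists_rational_near[where h="\<lambda>p. q p x - q r x" and p=p]) (auto intro!: continuous_intros qc)
        then obtain p' where p': "p' \<in> R m" "q p' x - q r x > 1 / real (Suc k)" by (auto simp: R_def)
        have "\<exists>r'\<in>\<rat>. r' \<in> ?U \<and> q p' x - q r' x > 1 / real (Suc k)"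
          using r oU p'(2) by (intro exists_rational_near[where h="\<lambda>r. q p' x - q r x" and p=r]) (auto intro!: continuous_intros qc)
        then obtain r' where "r' \<in> R m" "q p' x - q r' x > 1 / real (Suc k)" by (auto simp: R_def)
        then show False using m p'(1) by (meson not_less)
      qed
      then show ?thesis by (intro exI[of _ m]) auto
    qed
    have cau: "Cauchy (\<lambda>n. q (1 / real (Suc n)) x)"
    proof (rule metric_CauchyI)
      fix e :: real assume "0 < e"
      then obtain k where k: "1 / real (Suc k) < e" using reals_Archimedean by (auto simp: inverse_eq_divide)
      obtain m where m: "\<forall>p r. p \<noteq> 0 \<and> r \<noteq> 0 \<and> \<bar>p\<bar> < 1 / real (Suc m) \<and> \<bar>r\<bar> < 1 / real (Suc m)
        \<longrightarrow> q p x - q r x \<le> 1 / real (Suc k)" using ex by blast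
      have "dist (q (1 / real (Suc i)) x) (q (1 / real (Suc j)) x) < e" if "i \<ge> Suc m" "j \<ge> Suc m" for i j
      proof -
        have "1 / real (Suc i) < 1 / real (Suc m)" "1 / real (Suc j) < 1 / real (Suc m)"
          using that by (auto simp: divide_simps)
        then have "q (1 / real (Suc i)) x - q (1 / real (Suc j)) x \<le> 1 / real (Suc k)"
          "q (1 / real (Suc j)) x - q (1 / real (Suc i)) x \<le> 1 / real (Suc k)"
          using m by auto
        then show ?thesis using k by (simp add: dist_real_def)
      qed
      then show "\<exists>M. \<forall>i\<ge>M. \<forall>j\<ge>M. dist (q (1 / real (Suc i)) x) (q (1 / real (Suc j)) x) < e" by blast
    qed
    then obtain l where l: "(\<lambda>n. q (1 / real (Suc n)) x) \<longlonglongrightarrow> l"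
      using Cauchy_convergent convergent_def by blast
    have "(\<lambda>p. q p x) \<midarrow>0\<rightarrow> l"
    proof (rule LIM_I)
      fix e :: real assume "0 < e"
      then obtain k where k: "1 / real (Suc k) < e" using reals_Archimedean by (auto simp: inverse_eq_divide)
      obtain m where m: "\<forall>p r. p \<noteq> 0 \<and> r \<noteq> 0 \<and> \<bar>p\<bar> < 1 / real (Suc m) \<and> \<bar>r\<bar> < 1 / real (Suc m)
        \<longrightarrow> q p x - q r x \<le> 1 / real (Suc k)" using ex by blast
      have "norm (q p x - l) < e" if p: "p \<noteq> 0" "norm (p - 0) < 1 / real (Suc m)" for p
      proof -
        have ev: "eventually (\<lambda>n. \<bar>q p x - q (1 / real (Suc n)) x\<bar> \<le> 1 / real (Suc k)) sequentially"
          using eventually_ge_at_top[of "Suc m"]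
        proof eventually_elim
          case (elim n)
          then have "1 / real (Suc n) < 1 / real (Suc m)" by (auto simp: divide_simps)
          then have "q p x - q (1 / real (Suc n)) x \<le> 1 / real (Suc k)"
            "q (1 / real (Suc n)) x - q p x \<le> 1 / real (Suc k)"
            using m p by auto
          then show ?case by linarith
        qed
        have "\<bar>q p x - l\<bar> \<le> 1 / real (Suc k)"
          by (rule tendsto_upperbound[OF _ ev]) (intro tendsto_intros l, simp)
        then show ?thesis using k by simp
      qed
      then show "\<exists>s>0. \<forall>p. p \<noteq> 0 \<and> norm (p - 0) < s \<longrightarrow> norm (q p x - l) < e"
        by (intro exI[of _ "1 / real (Suc m)"]) auto
    qed
    then show ?thesis by blast
  qed
  have "deriv F x = (if x \<in> D then lim (\<lambda>n. q (1 / real (Suc n)) x) else (SOME d. False))" for x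
  proof (cases "x \<in> D")
    case True
    then obtain l where l: "(\<lambda>p. q p x) \<midarrow>0\<rightarrow> l" using D2 by blast
    have "(\<lambda>n. q (1 / real (Suc n)) x) \<longlonglongrightarrow> l"
    proof (rule filterlim_compose[OF l])
      show "filterlim (\<lambda>n. 1 / real (Suc n)) (at 0) sequentially"
        using LIMSEQ_inverse_real_of_nat by (auto simp: filterlim_at inverse_eq_divide simp del: of_nat_Suc)
    qed
    then have "lim (\<lambda>n. q (1 / real (Suc n)) x) = l" by (rule limI)
    moreover have "deriv F x = l" using l dom by (intro DERIV_imp_deriv) simp
    ultimately show ?thesis using True by simp
  next
    case False
    then have "\<not> (F has_real_derivative l) (at x)" for l using D1 dom by blast
    then show ?thesis using False by (simp add: deriv_def)
  qed
  then have "deriv F = (\<lambda>x. if x \<in> D then lim (\<lambda>n. q (1 / real (Suc n)) x) else (SOME d. False))" by blast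
  also have "\<dots> \<in> borel_measurable borel" by measurable
  finally show ?thesis .
qed

lemma deriv_of_integral:
  fixes F g :: "real \<Rightarrow> real"
  assumes g: "integrable lborel g"
    and F: "\<And>x. x \<in> {0<..<1} \<Longrightarrow> F x = c + (LINT z:{..x}|lborel. g z)"
  shows "AE x in lborel. x \<in> {0<..<1} \<longrightarrow> deriv F x = g x"
    and "(\<lambda>x. indicator {0..1} x * deriv F x) \<in> borel_measurable borel"
proof -
  define G where "G x = c + (LINT z:{..x}|lborel. g z)" for x
  have cG: "continuous_on UNIV G" unfolding G_def by (intro continuous_intros continuous_on_LINT_atMost g)
  have eq: "deriv F x = deriv G x" if "x \<in> {0<..<1}" for x
  proof (rule deriv_cong_ev)
    have "eventually (\<lambda>y. y \<in> {0<..<1}) (nhds x)" using that by (intro eventually_nhds_in_open) auto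
    then show "eventually (\<lambda>y. F y = G y) (nhds x)" by eventually_elim (auto simp: F G_def)
  qed simp
  show "AE x in lborel. x \<in> {0<..<1} \<longrightarrow> deriv F x = g x"
    using lebesgue_differentiation[OF g]
  proof (rule AE_mp, intro AE_I2 impI)
    fix x assume x: "x \<in> {0<..<1::real}" "((\<lambda>y. LINT z:{..y}|lborel. g z) has_real_derivative g x) (at x)"
    have "(G has_real_derivative 0 + g x) (at x)" unfolding G_def
      by (intro derivative_intros x)
    then show "deriv F x = g x" using eq[OF x(1)] by (simp add: DERIV_imp_deriv)
  qed
  have [measurable]: "deriv G \<in> borel_measurable borel" by (rule borel_measurable_deriv[OF cG])
  have "(\<lambda>x. indicator {0<..<1} x * deriv G x + indicator {0} x * deriv F 0 + indicator {1} x * deriv F 1) \<in> borel_measurable borel"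
    by measurable
  also have "(\<lambda>x. indicator {0<..<1} x * deriv G x + indicator {0} x * deriv F 0 + indicator {1} x * deriv F 1)
    = (\<lambda>x. indicator {0..1} x * deriv F x)"
    by (auto simp: fun_eq_iff indicator_def eq)
  finally show "(\<lambda>x. indicator {0..1} x * deriv F x) \<in> borel_measurable borel" .
qed

section \<open>Integration over the unit interval\<close>

text \<open>
  Integrals over one period become integrals with respect to this probability measure.
\<close>

definition UI :: "real measure" where "UI = restrict_space lborel {0..1}"

lemma space_UI [simp]: "space UI = {0..1}"
  by (simp add: UI_def space_restrict_space)

lemma measurable_ident_UI [measurable]: "(\<lambda>x. x) \<in> borel_measurable UI"
  unfolding UI_def by (intro measurable_restrict_space1) simp

lemma borel_measurable_UI: "f \<in> borel_measurable borel \<Longrightarrow> f \<in> borel_measurable UI"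
  unfolding UI_def by (intro measurable_restrict_space1) simp

interpretation UI: prob_space UI
proof
  show "emeasure UI (space UI) = 1"
    unfolding UI_def by (simp add: emeasure_restrict_space space_restrict_space)
qed

lemma measure_UI_unit [simp]: "measure UI {0..1} = 1"
  using UI.prob_space by simp

interpretation UU: pair_prob_space UI UI ..

lemma LINT_UI: "(LINT x:{0..1}|lborel. f x :: real) = (LINT x|UI. f x)"
  unfolding UI_def set_lebesgue_integral_def by (subst integral_restrict_space) auto

lemma integrable_UI_iff: "integrable UI f \<longleftrightarrow> set_integrable lborel {0..1} (f :: real \<Rightarrow> real)"
  unfolding UI_def set_integrable_def by (subst integrable_restrict_space) auto

lemma AE_UI_iff: "(AE x in UI. P x) \<longleftrightarrow> (AE x in lborel. x \<in> {0..1} \<longrightarrow> P x)"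
  unfolding UI_def by (rule AE_restrict_space_iff) auto

lemma integrable_UI_bounded:
  fixes f :: "real \<Rightarrow> real"
  assumes "f \<in> borel_measurable UI" "\<And>x. x \<in> {0..1} \<Longrightarrow> \<bar>f x\<bar> \<le> C"
  shows "integrable UI f"
  by (rule UI.integrable_const_bound[where B=C]) (use assms in \<open>auto intro!: AE_I2\<close>)

lemma integrable_UI_mult_bounded:
  fixes f g :: "real \<Rightarrow> real"
  assumes f: "integrable UI f" and g: "g \<in> borel_measurable UI" "\<And>x. x \<in> {0..1} \<Longrightarrow> \<bar>g x\<bar> \<le> C"
  shows "integrable UI (\<lambda>x. f x * g x)" "integrable UI (\<lambda>x. g x * f x)"
proof -
  show 1: "integrable UI (\<lambda>x. f x * g x)"
  proof (rule Bochner_Integration.integrable_bound)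
    show "integrable UI (\<lambda>x. C * f x)" using f by simp
    show "AE x in UI. norm (f x * g x) \<le> norm (C * f x)"
    proof (rule AE_I2)
      fix x assume "x \<in> space UI"
      then have "\<bar>g x\<bar> \<le> C" using g by simp
      then have "\<bar>f x\<bar> * \<bar>g x\<bar> \<le> \<bar>f x\<bar> * C" by (rule mult_left_mono) simp
      then show "norm (f x * g x) \<le> norm (C * f x)" using \<open>\<bar>g x\<bar> \<le> C\<close> by (simp add: abs_mult mult.commute)
    qed
  qed (use f g in measurable)
  then show "integrable UI (\<lambda>x. g x * f x)" by (simp add: mult.commute)
qed

lemma Fubini_UI:
  fixes k :: "real \<Rightarrow> real" and H :: "real \<Rightarrow> real \<Rightarrow> real"
  assumes k: "integrable UI k"
    and H [measurable]: "(\<lambda>p. H (fst p) (snd p)) \<in> borel_measurable (UI \<Otimes>\<^sub>M UI)"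
    and C: "\<And>x y. x \<in> {0..1} \<Longrightarrow> y \<in> {0..1} \<Longrightarrow> \<bar>H x y\<bar> \<le> C"
  shows "(LINT x|UI. k x * (LINT y|UI. H x y)) = (LINT y|UI. LINT x|UI. k x * H x y)"
    and "integrable UI (\<lambda>y. LINT x|UI. k x * H x y)"
proof -
  have [measurable]: "k \<in> borel_measurable UI" using k by auto
  have i: "integrable (UI \<Otimes>\<^sub>M UI) (\<lambda>p. k (fst p) * H (fst p) (snd p))"
  proof (rule Bochner_Integration.integrable_bound)
    show "integrable (UI \<Otimes>\<^sub>M UI) (\<lambda>p. C * k (fst p))"
    proof (intro integrable_mult_right)
      have "integrable (UI \<Otimes>\<^sub>M UI) (case_prod (\<lambda>x y. k x))"
        using k by (intro UU.Fubini_integrable) auto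
      then show "integrable (UI \<Otimes>\<^sub>M UI) (\<lambda>p. k (fst p))" by (simp add: case_prod_beta')
    qed
    show "AE p in UI \<Otimes>\<^sub>M UI. norm (k (fst p) * H (fst p) (snd p)) \<le> norm (C * k (fst p))"
    proof (rule AE_I2)
      fix p assume "p \<in> space (UI \<Otimes>\<^sub>M UI)"
      then have b: "\<bar>H (fst p) (snd p)\<bar> \<le> C" using C by (auto simp: space_pair_measure)
      then have "\<bar>k (fst p)\<bar> * \<bar>H (fst p) (snd p)\<bar> \<le> \<bar>k (fst p)\<bar> * C" by (intro mult_left_mono) auto
      then show "norm (k (fst p) * H (fst p) (snd p)) \<le> norm (C * k (fst p))"
        using b by (simp add: abs_mult mult.commute)
    qed
  qed measurable
  then have i': "integrable (UI \<Otimes>\<^sub>M UI) (case_prod (\<lambda>x y. k x * H x y))" by (simp add: case_prod_beta')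
  have "(LINT x|UI. k x * (LINT y|UI. H x y)) = (LINT x|UI. LINT y|UI. k x * H x y)" by simp
  also have "\<dots> = (LINT y|UI. LINT x|UI. k x * H x y)"
    by (rule UU.Fubini_integral[OF i', symmetric])
  finally show "(LINT x|UI. k x * (LINT y|UI. H x y)) = (LINT y|UI. LINT x|UI. k x * H x y)" .
  show "integrable UI (\<lambda>y. LINT x|UI. k x * H x y)" by (rule UU.integrable_snd[OF i'])
qed

text \<open>
  The \<open>L\<^sup>2\<close> norm on the unit interval; \<open>sqint\<close> is membership in \<open>L\<^sup>2\<close>.
\<close>

definition L2n :: "(real \<Rightarrow> real) \<Rightarrow> real" where "L2n f = sqrt (LINT x|UI. (f x)\<^sup>2)"

definition sqint :: "(real \<Rightarrow> real) \<Rightarrow> bool" where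
  "sqint f \<longleftrightarrow> f \<in> borel_measurable UI \<and> integrable UI (\<lambda>x. (f x)\<^sup>2)"

lemma sqint_bounded: "f \<in> borel_measurable UI \<Longrightarrow> (\<And>x. x \<in> {0..1} \<Longrightarrow> \<bar>f x\<bar> \<le> C) \<Longrightarrow> sqint f"
  unfolding sqint_def
proof
  assume "f \<in> borel_measurable UI" and b: "\<And>x. x \<in> {0..1} \<Longrightarrow> \<bar>f x\<bar> \<le> C"
  then show "integrable UI (\<lambda>x. (f x)\<^sup>2)"
    by (intro integrable_UI_bounded[where C="C\<^sup>2"])
      (auto, metis abs_le_square_iff abs_of_nonneg order_trans abs_ge_zero atLeastAtMost_iff)
qed

lemma sqint_mult: assumes "sqint f" "sqint g" shows "integrable UI (\<lambda>x. f x * g x)"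
proof (rule Bochner_Integration.integrable_bound)
  show "integrable UI (\<lambda>x. (f x)\<^sup>2 + (g x)\<^sup>2)" using assms by (auto simp: sqint_def)
  have "\<bar>a * b\<bar> \<le> a\<^sup>2 + b\<^sup>2" for a b :: real
  proof -
    have "2 * (\<bar>a\<bar> * \<bar>b\<bar>) \<le> a\<^sup>2 + b\<^sup>2" using sum_squares_bound[of "\<bar>a\<bar>" "\<bar>b\<bar>"] by simp
    moreover have "0 \<le> \<bar>a\<bar> * \<bar>b\<bar>" by simp
    ultimately show ?thesis unfolding abs_mult by linarith
  qed
  then show "AE x in UI. norm (f x * g x) \<le> norm ((f x)\<^sup>2 + (g x)\<^sup>2)" by (intro AE_I2) simp
qed (use assms in \<open>auto simp: sqint_def\<close>)

lemma sqint_integrable: "sqint f \<Longrightarrow> integrable UI f"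
  using sqint_mult[of f "\<lambda>_. 1"] sqint_bounded[of "\<lambda>_. 1" 1] by simp

lemma sqint_lin: assumes "sqint f" "sqint g" shows "sqint (\<lambda>x. a * f x + b * g x)"
proof -
  have "(\<lambda>x. (a * f x + b * g x)\<^sup>2) = (\<lambda>x. a\<^sup>2 * (f x)\<^sup>2 + 2 * a * b * (f x * g x) + b\<^sup>2 * (g x)\<^sup>2)"
    by (simp add: fun_eq_iff power2_eq_square algebra_simps)
  then show ?thesis using sqint_mult[OF assms] assms by (auto simp: sqint_def)
qed

lemma L2n_nonneg [simp]: "L2n f \<ge> 0" by (simp add: L2n_def)

lemma L2n_sq: "(L2n f)\<^sup>2 = (LINT x|UI. (f x)\<^sup>2)" by (simp add: L2n_def)

lemma L2_Cauchy_Schwarz: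
  assumes f: "sqint f" and g: "sqint g"
  shows "\<bar>LINT x|UI. f x * g x\<bar> \<le> L2n f * L2n g"
proof -
  define F where "F = (LINT x|UI. (f x)\<^sup>2)"
  define G where "G = (LINT x|UI. (g x)\<^sup>2)"
  define c where "c = (LINT x|UI. f x * g x)"
  have i: "integrable UI (\<lambda>x. (f x)\<^sup>2)" "integrable UI (\<lambda>x. (g x)\<^sup>2)" "integrable UI (\<lambda>x. f x * g x)"
    using f g sqint_mult by (auto simp: sqint_def)
  have F0: "F \<ge> 0" and G0: "G \<ge> 0" by (auto simp: F_def G_def)
  have q: "0 \<le> a\<^sup>2 * F - 2 * a * b * c + b\<^sup>2 * G" for a b
  proof -
    have "0 \<le> (LINT x|UI. (a * f x - b * g x)\<^sup>2)" by simp
    also have "(\<lambda>x. (a * f x - b * g x)\<^sup>2) = (\<lambda>x. a\<^sup>2 * (f x)\<^sup>2 - 2 * a * b * (f x * g x) + b\<^sup>2 * (g x)\<^sup>2)"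
      by (simp add: fun_eq_iff power2_eq_square algebra_simps)
    also have "(LINT x|UI. a\<^sup>2 * (f x)\<^sup>2 - 2 * a * b * (f x * g x) + b\<^sup>2 * (g x)\<^sup>2)
        = a\<^sup>2 * F - 2 * a * b * c + b\<^sup>2 * G"
      using i by (simp add: F_def G_def c_def)
    finally show ?thesis .
  qed
  have "c\<^sup>2 \<le> F * G"
  proof (cases "G = 0")
    case True
    have "c = 0"
    proof (rule ccontr)
      assume "c \<noteq> 0"
      have "0 \<le> c\<^sup>2 * F - (F + 1) * c * c * 2"
        using q[of c "F + 1"] True by (simp add: power2_eq_square algebra_simps)
      then have "0 \<le> c\<^sup>2 * (- F - 2)" by (simp add: power2_eq_square algebra_simps)
      moreover have "c\<^sup>2 * (- F - 2) < 0" using F0 \<open>c \<noteq> 0\<close> by (intro mult_pos_neg) auto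
      ultimately show False by simp
    qed
    then show ?thesis using True by simp
  next
    case False
    have "0 \<le> G * (F * G - c\<^sup>2)" using q[of G c] by (simp add: power2_eq_square algebra_simps)
    then show ?thesis using False G0 by (simp add: zero_le_mult_iff)
  qed
  then have "sqrt (c\<^sup>2) \<le> sqrt (F * G)" by (rule real_sqrt_le_mono)
  then show ?thesis by (simp add: L2n_def F_def G_def c_def real_sqrt_mult)
qed

lemma L1_le_L2: assumes "sqint f" shows "(LINT x|UI. \<bar>f x\<bar>) \<le> L2n f"
proof -
  have "sqint (\<lambda>x. \<bar>f x\<bar>)" using assms by (auto simp: sqint_def)
  then have "\<bar>LINT x|UI. \<bar>f x\<bar> * 1\<bar> \<le> L2n (\<lambda>x. \<bar>f x\<bar>) * L2n (\<lambda>_. 1)"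
    by (rule L2_Cauchy_Schwarz) (auto intro: sqint_bounded[where C=1])
  then show ?thesis by (simp add: L2n_def)
qed

lemma L2n_triangle:
  assumes f: "sqint f" and g: "sqint g"
  shows "L2n (\<lambda>x. f x + g x) \<le> L2n f + L2n g"
proof (rule power2_le_imp_le)
  have i: "integrable UI (\<lambda>x. (f x)\<^sup>2)" "integrable UI (\<lambda>x. (g x)\<^sup>2)" "integrable UI (\<lambda>x. f x * g x)"
    using f g sqint_mult by (auto simp: sqint_def)
  have "(L2n (\<lambda>x. f x + g x))\<^sup>2 = (LINT x|UI. (f x)\<^sup>2 + 2 * (f x * g x) + (g x)\<^sup>2)"
    unfolding L2n_sq by (intro Bochner_Integration.integral_cong) (auto simp: power2_eq_square algebra_simps)
  also have "\<dots> = (L2n f)\<^sup>2 + 2 * (LINT x|UI. f x * g x) + (L2n g)\<^sup>2"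
    using i by (simp add: L2n_sq)
  also have "\<dots> \<le> (L2n f + L2n g)\<^sup>2"
    using L2_Cauchy_Schwarz[OF f g] by (simp add: power2_eq_square algebra_simps)
  finally show "(L2n (\<lambda>x. f x + g x))\<^sup>2 \<le> (L2n f + L2n g)\<^sup>2" .
qed simp

lemma L2n_cmult: "L2n (\<lambda>x. c * f x) = \<bar>c\<bar> * L2n f"
  by (simp add: L2n_def power_mult_distrib real_sqrt_mult)

lemma L2n_minus: "L2n (\<lambda>x. - f x) = L2n f"
  by (simp add: L2n_def)

lemma L2n_diff_triangle:
  assumes "sqint f" "sqint g"
  shows "L2n (\<lambda>x. f x - g x) \<le> L2n f + L2n g"
  using L2n_triangle[OF assms(1), of "\<lambda>x. - g x"] assms(2) by (simp add: L2n_minus sqint_def)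

lemma L2n_le_bound:
  assumes "\<And>x. x \<in> {0..1} \<Longrightarrow> \<bar>f x\<bar> \<le> C" "C \<ge> 0" "f \<in> borel_measurable UI"
  shows "L2n f \<le> C"
proof -
  have "(LINT x|UI. (f x)\<^sup>2) \<le> (LINT x|UI. C\<^sup>2)"
  proof (rule integral_mono)
    show "integrable UI (\<lambda>x. (f x)\<^sup>2)" using sqint_bounded[OF assms(3,1)] by (simp add: sqint_def)
    show "(f x)\<^sup>2 \<le> C\<^sup>2" if "x \<in> space UI" for x
      using assms(1)[of x] that assms(2) by (metis abs_le_square_iff abs_of_nonneg space_UI)
  qed auto
  then have "sqrt (LINT x|UI. (f x)\<^sup>2) \<le> sqrt (C\<^sup>2)" by (intro real_sqrt_le_mono) simp
  then show ?thesis using assms(2) by (simp add: L2n_def)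
qed

lemma L2n_zero_AE: assumes "sqint f" "L2n f = 0" shows "AE x in UI. f x = 0"
proof -
  have "(LINT x|UI. (f x)\<^sup>2) = 0" using assms(2) by (simp add: L2n_def)
  then have "AE x in UI. (f x)\<^sup>2 = 0"
    using assms(1) by (subst (asm) integral_nonneg_eq_0_iff_AE) (auto simp: sqint_def)
  then show ?thesis by simp
qed

lemma L2n_cong_AE: assumes "AE x in UI. f x = g x" "f \<in> borel_measurable UI" "g \<in> borel_measurable UI"
  shows "L2n f = L2n g"
  unfolding L2n_def using assms by (intro arg_cong[where f=sqrt] integral_cong_AE) auto

text \<open>
  The primitive vanishing at 0. The integration variable is confined to the unit interval, so \<open>prim q\<close>
  is defined on the whole line and constant outside \<open>[0,1]\<close>.
\<close>

definition prim :: "(real \<Rightarrow> real) \<Rightarrow> real \<Rightarrow> real" where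
  "prim q s = (LINT r|UI. indicator {..s} r * q r)"

lemma prim_eq: "s \<le> 1 \<Longrightarrow> (LINT z:{0..s}|lborel. q z) = prim q s"
  unfolding prim_def UI_def set_lebesgue_integral_def
  by (subst integral_restrict_space) (auto intro!: Bochner_Integration.integral_cong simp: indicator_def)

lemma integrable_indicator_UI:
  "integrable UI q \<Longrightarrow> A \<in> sets borel \<Longrightarrow> integrable UI (\<lambda>r. indicator A r * (q r :: real))"
  by (rule integrable_UI_mult_bounded(2)[where C=1]) (auto simp: indicator_def intro!: borel_measurable_UI)

lemma prim_1: "prim q 1 = (LINT r|UI. q r)"
  unfolding prim_def by (intro Bochner_Integration.integral_cong) auto

lemma AE_UI_neq: "AE x in UI. x \<noteq> c"
  unfolding AE_UI_iff using AE_lborel_singleton[of c] by eventually_elim auto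

lemma prim_0: "integrable UI q \<Longrightarrow> prim q 0 = 0"
  unfolding prim_def using AE_UI_neq[of 0]
  by (subst integral_cong_AE[where g="\<lambda>_. 0"])
    (auto intro!: integrable_indicator_UI borel_measurable_integrable elim!: AE_mp AE_I2 simp: indicator_def)

lemma prim_diff_bound:
  assumes q: "integrable UI q" and "s \<le> t"
  shows "\<bar>prim q t - prim q s\<bar> \<le> (LINT r|UI. indicator {s<..t} r * \<bar>q r\<bar>)"
proof -
  have "prim q t - prim q s = (LINT r|UI. indicator {..t} r * q r - indicator {..s} r * q r)"
    unfolding prim_def by (rule Bochner_Integration.integral_diff[symmetric]) (auto intro: integrable_indicator_UI q)
  also have "\<dots> = (LINT r|UI. indicator {s<..t} r * q r)"
    using \<open>s \<le> t\<close> by (intro Bochner_Integration.integral_cong) (auto simp: indicator_def)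
  finally have "\<bar>prim q t - prim q s\<bar> \<le> (LINT r|UI. norm (indicator {s<..t} r * q r))"
    by simp
  then show ?thesis by (simp add: abs_mult)
qed

lemma prim_abs_bound:
  assumes q: "integrable UI q"
  shows "\<bar>prim q s\<bar> \<le> (LINT r|UI. \<bar>q r\<bar>)"
proof -
  have "\<bar>prim q s\<bar> \<le> (LINT r|UI. norm (indicator {..s} r * q r))" unfolding prim_def by simp
  also have "\<dots> \<le> (LINT r|UI. \<bar>q r\<bar>)"
    using q by (intro integral_mono integrable_norm integrable_indicator_UI) (auto simp: indicator_def)
  finally show ?thesis .
qed

lemma prim_diff_le_L1:
  assumes q: "integrable UI q"
  shows "\<bar>prim q t - prim q s\<bar> \<le> (LINT r|UI. \<bar>q r\<bar>)"
proof -
  have *: "\<bar>prim q t - prim q s\<bar> \<le> (LINT r|UI. \<bar>q r\<bar>)" if "s \<le> t" for s t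
  proof -
    have "(LINT r|UI. indicator {s<..t} r * \<bar>q r\<bar>) \<le> (LINT r|UI. \<bar>q r\<bar>)"
      using q by (intro integral_mono integrable_indicator_UI) (auto simp: indicator_def)
    then show ?thesis using prim_diff_bound[OF q that] by linarith
  qed
  show ?thesis using *[of s t] *[of t s] by (cases "s \<le> t") (auto simp: abs_minus_commute)
qed

lemma prim_Lipschitz:
  assumes q: "q \<in> borel_measurable UI" and C: "\<And>x. x \<in> {0..1} \<Longrightarrow> \<bar>q x\<bar> \<le> C"
  shows "\<bar>prim q t - prim q s\<bar> \<le> C * \<bar>t - s\<bar>"
proof -
  have C0: "C \<ge> 0" using C[of 0] by auto
  have qi: "integrable UI q" by (rule integrable_UI_bounded[OF q C])
  have *: "\<bar>prim q t - prim q s\<bar> \<le> C * \<bar>t - s\<bar>" if "s \<le> t" for s t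
  proof -
    have "(LINT r|UI. indicator {s<..t} r * \<bar>q r\<bar>) \<le> (LINT r|UI. C * indicator {s<..t} r)"
    proof (rule integral_mono)
      show "integrable UI (\<lambda>r. indicator {s<..t} r * \<bar>q r\<bar>)"
        using qi by (intro integrable_indicator_UI) auto
      show "integrable UI (\<lambda>r. C * indicator {s<..t} r)"
        by (intro integrable_mult_right integrable_UI_bounded[where C=1])
          (auto simp: indicator_def intro!: borel_measurable_UI)
    qed (use C in \<open>auto simp: indicator_def\<close>)
    also have "\<dots> = C * measure lborel ({s<..t} \<inter> {0..1})"
    proof -
      have "(LINT r|UI. indicator {s<..t} r :: real) = (LINT r:{0..1}|lborel. indicator {s<..t} r)"
        by (rule LINT_UI[symmetric])
      also have "\<dots> = (LINT r|lborel. indicator ({s<..t} \<inter> {0..1}) r)"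
        unfolding set_lebesgue_integral_def
        by (intro Bochner_Integration.integral_cong) (auto simp: indicator_def)
      finally have "(LINT r|UI. indicator {s<..t} r) = (LINT r|lborel. indicator ({s<..t} \<inter> {0..1}) r :: real)" .
      then show ?thesis by simp
    qed
    also have "measure lborel ({s<..t} \<inter> {0..1}) \<le> measure lborel {s<..t}"
      using that by (intro measure_mono_fmeasurable fmeasurableI) auto
    then have "C * measure lborel ({s<..t} \<inter> {0..1}) \<le> C * \<bar>t - s\<bar>" using C0 that by (intro mult_left_mono) auto
    finally show ?thesis using prim_diff_bound[OF qi that] by linarith
  qed
  show ?thesis using *[of s t] *[of t s] by (cases "s \<le> t") (auto simp: abs_minus_commute)
qed

lemma prim_LINT_atMost:
  "prim g y = (LINT z:{..y}|lborel. indicator {0..1} z * g z)"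
  unfolding prim_def UI_def set_lebesgue_integral_def
  by (subst integral_restrict_space) (auto intro!: Bochner_Integration.integral_cong simp: indicator_def)

lemma integrable_UI_extend: "integrable UI g \<Longrightarrow> integrable lborel (\<lambda>z. indicator {0..1} z * g z)" for g :: "real \<Rightarrow> real"
  by (simp add: integrable_UI_iff set_integrable_def)

lemma continuous_prim: "integrable UI g \<Longrightarrow> continuous_on UNIV (prim g)"
  using continuous_on_LINT_atMost[OF integrable_UI_extend] by (simp add: prim_LINT_atMost[abs_def])

lemma prim_measurable [measurable]: "integrable UI g \<Longrightarrow> prim g \<in> borel_measurable borel"
  using borel_measurable_continuous_onI[OF continuous_prim] .

lemma deriv_prim:
  fixes F g :: "real \<Rightarrow> real"
  assumes g: "integrable UI g" and F: "\<And>x. x \<in> {0<..<1} \<Longrightarrow> F x = c + prim g x"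
  shows "AE x in UI. deriv F x = g x" and "deriv F \<in> borel_measurable UI"
proof -
  note * = deriv_of_integral[OF integrable_UI_extend[OF g] F[unfolded prim_LINT_atMost]]
  have "AE x in lborel. x \<noteq> 0 \<and> x \<noteq> 1" using AE_lborel_singleton[of 0] AE_lborel_singleton[of 1] by simp
  then have "AE x in lborel. x \<in> {0..1} \<longrightarrow> deriv F x = g x"
    using *(1)[simplified] by eventually_elim (auto simp: indicator_def)
  then show "AE x in UI. deriv F x = g x" by (simp add: AE_UI_iff)
  show "deriv F \<in> borel_measurable UI"
    using *(2) unfolding UI_def by (subst borel_measurable_restrict_space_iff) auto
qed

text \<open>
  A primitive is differentiable almost everywhere with its density as derivative, so a vanishing
  primitive forces a vanishing density.
\<close>

lemma prim_eq_0_imp_AE_0: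
  assumes g: "integrable UI g" and 0: "\<And>x. x \<in> {0<..<1} \<Longrightarrow> prim g x = 0"
  shows "AE x in UI. g x = 0"
proof -
  have "AE x in UI. deriv (\<lambda>_. 0 :: real) x = g x"
    using 0 by (intro deriv_prim(1)[OF g, where c=0]) auto
  then show ?thesis by eventually_elim simp
qed

lemma prim_add: "integrable UI f \<Longrightarrow> integrable UI g \<Longrightarrow> prim (\<lambda>x. a * f x + b * g x) s = a * prim f s + b * prim g s"
  unfolding prim_def
  using integrable_indicator_UI[of f "{..s}"] integrable_indicator_UI[of g "{..s}"]
  by (simp add: algebra_simps)

section \<open>Calculus in the time variable\<close>

interpretation UL: pair_sigma_finite UI lborel ..

text \<open>
  Functions of time and space are defined for all real times and measurable jointly; boundedness is
  required on bounded time intervals only, so that the class is closed under integration in time.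
\<close>

definition loc_bdd :: "(real \<Rightarrow> real \<Rightarrow> real) \<Rightarrow> bool" where
  "loc_bdd \<xi> \<longleftrightarrow> (\<lambda>p. \<xi> (fst p) (snd p)) \<in> borel_measurable (borel \<Otimes>\<^sub>M borel) \<and>
     (\<forall>T. \<exists>C. \<forall>t x. \<bar>t\<bar> \<le> T \<longrightarrow> \<bar>\<xi> t x\<bar> \<le> C)"

text \<open>
  Borel measurable and bounded on the whole line.
\<close>

definition bmeas :: "(real \<Rightarrow> real) \<Rightarrow> bool" where
  "bmeas p \<longleftrightarrow> p \<in> borel_measurable borel \<and> (\<exists>C. \<forall>x. \<bar>p x\<bar> \<le> C)"

lemma bmeas_measurable: "bmeas p \<Longrightarrow> p \<in> borel_measurable borel"
  by (simp add: bmeas_def)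

lemma bmeas_sqint: "bmeas p \<Longrightarrow> sqint p"
  unfolding bmeas_def by (auto intro: sqint_bounded borel_measurable_UI)

lemma bmeas_integrable: "bmeas p \<Longrightarrow> integrable UI p"
  by (intro sqint_integrable bmeas_sqint)

lemma bmeas_mult_integrable: "bmeas p \<Longrightarrow> integrable UI k \<Longrightarrow> integrable UI (\<lambda>x. k x * p x)"
  unfolding bmeas_def by (auto intro!: integrable_UI_mult_bounded(1) borel_measurable_UI)

lemma bmeas_lin: assumes "bmeas p" "bmeas q" shows "bmeas (\<lambda>x. a * p x + b * q x)"
proof -
  obtain C D where C: "\<And>x. \<bar>p x\<bar> \<le> C" "\<And>x. \<bar>q x\<bar> \<le> D" using assms by (auto simp: bmeas_def)
  have "\<bar>a * p x + b * q x\<bar> \<le> \<bar>a\<bar> * C + \<bar>b\<bar> * D" for x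
  proof -
    have "\<bar>a * p x + b * q x\<bar> \<le> \<bar>a\<bar> * \<bar>p x\<bar> + \<bar>b\<bar> * \<bar>q x\<bar>" by (metis abs_mult abs_triangle_ineq)
    also have "\<dots> \<le> \<bar>a\<bar> * C + \<bar>b\<bar> * D" using C by (intro add_mono mult_left_mono) auto
    finally show ?thesis .
  qed
  moreover have "(\<lambda>x. a * p x + b * q x) \<in> borel_measurable borel"
    using assms unfolding bmeas_def by (intro borel_measurable_add borel_measurable_times) auto
  ultimately show ?thesis unfolding bmeas_def by blast
qed

lemma bmeas_const: "bmeas (\<lambda>_. c)" by (auto simp: bmeas_def)

lemma bmeas_diff: "bmeas p \<Longrightarrow> bmeas q \<Longrightarrow> bmeas (\<lambda>x. p x - q x)"
  using bmeas_lin[of p q 1 "-1"] by simp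

lemma bmeas_add: "bmeas p \<Longrightarrow> bmeas q \<Longrightarrow> bmeas (\<lambda>x. p x + q x)"
  using bmeas_lin[of p q 1 "1"] by simp

lemma loc_bdd_compose:
  assumes "loc_bdd \<xi>" "f \<in> borel_measurable M" "g \<in> borel_measurable M"
  shows "(\<lambda>z. \<xi> (f z) (g z)) \<in> borel_measurable M"
proof -
  have m: "(\<lambda>p. \<xi> (fst p) (snd p)) \<in> borel_measurable (borel \<Otimes>\<^sub>M borel)" using assms(1) by (simp add: loc_bdd_def)
  have "(\<lambda>z. (f z, g z)) \<in> M \<rightarrow>\<^sub>M borel \<Otimes>\<^sub>M borel" using assms(2,3) by (rule measurable_Pair)
  from measurable_compose[OF this m] show ?thesis by simp
qed

lemma loc_bdd_bound: assumes "loc_bdd \<xi>" shows "\<exists>C\<ge>0. \<forall>t x. \<bar>t\<bar> \<le> T \<longrightarrow> \<bar>\<xi> t x\<bar> \<le> C"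
proof -
  obtain C where C: "\<forall>t x. \<bar>t\<bar> \<le> T \<longrightarrow> \<bar>\<xi> t x\<bar> \<le> C" using assms unfolding loc_bdd_def by blast
  then have "\<forall>t x. \<bar>t\<bar> \<le> T \<longrightarrow> \<bar>\<xi> t x\<bar> \<le> max C 0" by (simp add: le_max_iff_disj)
  then show ?thesis by (intro exI[of _ "max C 0"]) simp
qed

lemma loc_bdd_bmeas: assumes "loc_bdd \<xi>" shows "bmeas (\<xi> t)"
  unfolding bmeas_def
proof
  show "\<xi> t \<in> borel_measurable borel" by (rule loc_bdd_compose[OF assms, of "\<lambda>_. t" borel "\<lambda>z. z"]) simp_all
  obtain C where C0: "C \<ge> 0" and "\<And>s x. \<bar>s\<bar> \<le> \<bar>t\<bar> \<Longrightarrow> \<bar>\<xi> s x\<bar> \<le> C" using loc_bdd_bound[OF assms, of "\<bar>t\<bar>"] by blast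
  then show "\<exists>C. \<forall>x. \<bar>\<xi> t x\<bar> \<le> C" by blast
qed

lemma loc_bdd_lin: assumes "loc_bdd \<xi>" "loc_bdd \<eta>" shows "loc_bdd (\<lambda>t x. a * \<xi> t x + b * \<eta> t x)"
  unfolding loc_bdd_def
proof
  show "(\<lambda>p. a * \<xi> (fst p) (snd p) + b * \<eta> (fst p) (snd p)) \<in> borel_measurable (borel \<Otimes>\<^sub>M borel)"
    using assms unfolding loc_bdd_def by (intro borel_measurable_add borel_measurable_times) auto
  show "\<forall>T. \<exists>C. \<forall>t x. \<bar>t\<bar> \<le> T \<longrightarrow> \<bar>a * \<xi> t x + b * \<eta> t x\<bar> \<le> C"
  proof
    fix T
    obtain C where C0: "C \<ge> 0" and C: "\<And>t x. \<bar>t\<bar> \<le> T \<Longrightarrow> \<bar>\<xi> t x\<bar> \<le> C" using loc_bdd_bound[OF assms(1)] by blast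
    obtain D where D0: "D \<ge> 0" and D: "\<And>t x. \<bar>t\<bar> \<le> T \<Longrightarrow> \<bar>\<eta> t x\<bar> \<le> D" using loc_bdd_bound[OF assms(2)] by blast
    have "\<bar>a * \<xi> t x + b * \<eta> t x\<bar> \<le> \<bar>a\<bar> * C + \<bar>b\<bar> * D" if "\<bar>t\<bar> \<le> T" for t x
    proof -
      have "\<bar>a * \<xi> t x + b * \<eta> t x\<bar> \<le> \<bar>a\<bar> * \<bar>\<xi> t x\<bar> + \<bar>b\<bar> * \<bar>\<eta> t x\<bar>" by (metis abs_mult abs_triangle_ineq)
      also have "\<dots> \<le> \<bar>a\<bar> * C + \<bar>b\<bar> * D" using C[OF that] D[OF that] by (intro add_mono mult_left_mono) auto
      finally show ?thesis .
    qed
    then show "\<exists>C. \<forall>t x. \<bar>t\<bar> \<le> T \<longrightarrow> \<bar>a * \<xi> t x + b * \<eta> t x\<bar> \<le> C" by blast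
  qed
qed

lemma loc_bdd_shift: assumes "loc_bdd \<xi>" shows "loc_bdd (\<lambda>t. \<xi> (t + \<sigma>))"
  unfolding loc_bdd_def
proof
  show "(\<lambda>p. \<xi> (fst p + \<sigma>) (snd p)) \<in> borel_measurable (borel \<Otimes>\<^sub>M borel)"
    by (rule loc_bdd_compose[OF assms, of "\<lambda>p. fst p + \<sigma>" _ snd]) auto
  show "\<forall>T. \<exists>C. \<forall>t x. \<bar>t\<bar> \<le> T \<longrightarrow> \<bar>\<xi> (t + \<sigma>) x\<bar> \<le> C"
  proof
    fix T
    obtain C where C0: "C \<ge> 0" and C: "\<And>t x. \<bar>t\<bar> \<le> T + \<bar>\<sigma>\<bar> \<Longrightarrow> \<bar>\<xi> t x\<bar> \<le> C" using loc_bdd_bound[OF assms] by blast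
    have "\<bar>\<xi> (t + \<sigma>) x\<bar> \<le> C" if "\<bar>t\<bar> \<le> T" for t x using that by (intro C) linarith
    then show "\<exists>C. \<forall>t x. \<bar>t\<bar> \<le> T \<longrightarrow> \<bar>\<xi> (t + \<sigma>) x\<bar> \<le> C" by blast
  qed
qed

lemma loc_bdd_tconst: assumes "bmeas p" shows "loc_bdd (\<lambda>t. p)"
  unfolding loc_bdd_def
proof
  show "(\<lambda>z. p (snd z)) \<in> borel_measurable (borel \<Otimes>\<^sub>M borel)"
    by (rule measurable_compose[OF measurable_snd bmeas_measurable[OF assms]])
qed (use assms in \<open>auto simp: bmeas_def\<close>)

lemma loc_bdd_tmult: assumes "bmeas p" shows "loc_bdd (\<lambda>t x. t * p x)"
  unfolding loc_bdd_def
proof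
  show "(\<lambda>z. fst z * p (snd z)) \<in> borel_measurable (borel \<Otimes>\<^sub>M borel)"
    using measurable_compose[OF measurable_snd bmeas_measurable[OF assms]] by measurable
  obtain C where C: "\<And>x. \<bar>p x\<bar> \<le> C" using assms by (auto simp: bmeas_def)
  have "\<bar>t * p x\<bar> \<le> T * C" if "\<bar>t\<bar> \<le> T" for t x T
    unfolding abs_mult using that C by (intro mult_mono) (auto intro: order_trans[OF abs_ge_zero])
  then show "\<forall>T. \<exists>C. \<forall>t x. \<bar>t\<bar> \<le> T \<longrightarrow> \<bar>t * p x\<bar> \<le> C" by blast
qed

text \<open>
  The primitive in time. It vanishes for \<open>t \<le> 0\<close>.
\<close>

definition tint :: "(real \<Rightarrow> real \<Rightarrow> real) \<Rightarrow> real \<Rightarrow> real \<Rightarrow> real" where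
  "tint \<xi> t x = (LINT r:{0..t}|lborel. \<xi> r x)"

lemma set_integrable_bounded:
  fixes u :: "real \<Rightarrow> real"
  assumes "u \<in> borel_measurable borel" "\<And>r. a \<le> r \<Longrightarrow> r \<le> b \<Longrightarrow> \<bar>u r\<bar> \<le> C"
  shows "set_integrable lborel {a..b} u"
  unfolding set_integrable_def
proof (rule Bochner_Integration.integrable_bound)
  show "integrable lborel (\<lambda>r. C * indicator {a..b} r)"
    by (cases "a \<le> b") (auto intro!: integrable_mult_right integrable_real_indicator)
  show "(\<lambda>x. indicator {a..b} x *\<^sub>R u x) \<in> borel_measurable lborel"
    using assms(1) by (intro borel_measurable_scaleR borel_measurable_indicator) auto
  show "AE x in lborel. norm (indicator {a..b} x *\<^sub>R u x) \<le> norm (C * indicator {a..b} x)"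
    using assms(2) by (intro AE_I2) (auto simp: indicator_def intro: order_trans[OF _ abs_ge_self])
qed

lemma set_integral_bound:
  fixes u :: "real \<Rightarrow> real"
  assumes "u \<in> borel_measurable borel" "a \<le> b" "\<And>r. a \<le> r \<Longrightarrow> r \<le> b \<Longrightarrow> \<bar>u r\<bar> \<le> C"
  shows "\<bar>LINT r:{a..b}|lborel. u r\<bar> \<le> C * (b - a)"
proof -
  have i: "set_integrable lborel {a..b} u" by (rule set_integrable_bounded[OF assms(1,3)])
  have "\<bar>LINT r:{a..b}|lborel. u r\<bar> \<le> (LINT r|lborel. norm (indicator {a..b} r *\<^sub>R u r))"
    unfolding set_lebesgue_integral_def by simp
  also have "\<dots> \<le> (LINT r|lborel. C * indicator {a..b} r)"
  proof (rule integral_mono)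
    show "integrable lborel (\<lambda>r. norm (indicator {a..b} r *\<^sub>R u r))"
      using i unfolding set_integrable_def by (rule integrable_norm)
    show "integrable lborel (\<lambda>r. C * indicator {a..b} r)"
      using assms(2) by (intro integrable_mult_right integrable_real_indicator) auto
  qed (use assms(3) in \<open>auto simp: indicator_def\<close>)
  also have "\<dots> = C * (b - a)" using assms(2) by simp
  finally show ?thesis .
qed

lemma set_integral_Icc_split:
  fixes u :: "real \<Rightarrow> real"
  assumes i: "set_integrable lborel {a..c} u" and "a \<le> b" "b \<le> c"
  shows "(LINT r:{a..c}|lborel. u r) = (LINT r:{a..b}|lborel. u r) + (LINT r:{b..c}|lborel. u r)"
proof -
  have i1: "set_integrable lborel {a..b} u" and i2: "set_integrable lborel {b..c} u"
    using assms by (auto intro: set_integrable_subset[OF i])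
  have "(LINT r:{a..b}|lborel. u r) + (LINT r:{b..c}|lborel. u r)
     = (LINT r|lborel. indicator {a..b} r *\<^sub>R u r + indicator {b..c} r *\<^sub>R u r)"
    using i1 i2 unfolding set_lebesgue_integral_def set_integrable_def
    by (rule Bochner_Integration.integral_add[symmetric])
  also have "\<dots> = (LINT r|lborel. indicator {a..c} r *\<^sub>R u r)"
  proof (rule integral_cong_AE)
    show "AE r in lborel. indicator {a..b} r *\<^sub>R u r + indicator {b..c} r *\<^sub>R u r = indicator {a..c} r *\<^sub>R u r"
      using AE_lborel_singleton[of b] by eventually_elim (use assms(2,3) in \<open>auto simp: indicator_def\<close>)
  qed (use i i1 i2 in \<open>auto simp: set_integrable_def dest: borel_measurable_integrable\<close>)
  finally show ?thesis by (simp add: set_lebesgue_integral_def)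
qed

lemma loc_bdd_time_measurable: "loc_bdd \<xi> \<Longrightarrow> (\<lambda>r. \<xi> r x) \<in> borel_measurable borel"
  by (rule loc_bdd_compose[of \<xi> "\<lambda>r. r" borel "\<lambda>_. x"]) simp_all

lemma loc_bdd_set_integrable:
  assumes "loc_bdd \<xi>" shows "set_integrable lborel {a..b} (\<lambda>r. \<xi> r x)"
proof -
  obtain C where C0: "C \<ge> 0" and "\<And>t x. \<bar>t\<bar> \<le> max \<bar>a\<bar> \<bar>b\<bar> \<Longrightarrow> \<bar>\<xi> t x\<bar> \<le> C" using loc_bdd_bound[OF assms] by blast
  then show ?thesis by (intro set_integrable_bounded[where C=C] loc_bdd_time_measurable[OF assms]) auto
qed

lemma tint_bound:
  assumes "loc_bdd \<xi>" "0 \<le> t" "\<And>r. 0 \<le> r \<Longrightarrow> r \<le> t \<Longrightarrow> \<bar>\<xi> r x\<bar> \<le> C"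
  shows "\<bar>tint \<xi> t x\<bar> \<le> C * t"
  using set_integral_bound[OF loc_bdd_time_measurable[OF assms(1)] assms(2,3)] by (simp add: tint_def)

lemma tint_diff:
  assumes "loc_bdd \<xi>" "0 \<le> s" "s \<le> t"
  shows "tint \<xi> t x - tint \<xi> s x = (LINT r:{s..t}|lborel. \<xi> r x)"
  using set_integral_Icc_split[OF loc_bdd_set_integrable[OF assms(1)] assms(2,3)] by (simp add: tint_def)

lemma tint_nonpos: "t \<le> 0 \<Longrightarrow> tint \<xi> t x = 0"
proof -
  assume "t \<le> 0"
  have "(LINT r|lborel. indicator {0..t} r *\<^sub>R \<xi> r x) = (LINT r|(lborel :: real measure). (0 :: real))"
  proof (rule integral_cong_AE)
    show "AE r in lborel. indicator {0..t} r *\<^sub>R \<xi> r x = 0"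
      using AE_lborel_singleton[of 0] by eventually_elim (use \<open>t \<le> 0\<close> in \<open>auto simp: indicator_def\<close>)
    show "(\<lambda>r. indicator {0..t} r *\<^sub>R \<xi> r x) \<in> borel_measurable lborel"
    proof -
      have "(\<lambda>r. indicator {0..t} r *\<^sub>R \<xi> r x) = (\<lambda>r. indicator ({0} \<inter> {0..t}) r *\<^sub>R \<xi> 0 x)"
        using \<open>t \<le> 0\<close> by (auto simp: fun_eq_iff indicator_def)
      then show ?thesis by simp
    qed
  qed simp
  then show ?thesis by (simp add: tint_def set_lebesgue_integral_def)
qed

lemma tint_loc_bdd: assumes "loc_bdd \<xi>" shows "loc_bdd (tint \<xi>)"
  unfolding loc_bdd_def
proof
  have "(\<lambda>q. of_bool (0 \<le> snd q \<and> snd q \<le> fst (fst q)) * \<xi> (snd q) (snd (fst q)))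
     \<in> borel_measurable ((borel \<Otimes>\<^sub>M borel) \<Otimes>\<^sub>M lborel)"
  proof (rule borel_measurable_times)
    show "(\<lambda>q. \<xi> (snd q) (snd (fst q))) \<in> borel_measurable ((borel \<Otimes>\<^sub>M borel) \<Otimes>\<^sub>M lborel)"
      by (rule loc_bdd_compose[OF assms, of snd _ "\<lambda>q. snd (fst q)"]) (auto intro: measurable_compose[OF measurable_fst measurable_snd])
    let ?M = "(borel \<Otimes>\<^sub>M borel) \<Otimes>\<^sub>M lborel :: ((real \<times> real) \<times> real) measure"
    have h: "(\<lambda>q. snd q) \<in> borel_measurable ?M" "(\<lambda>q. snd q - fst (fst q)) \<in> borel_measurable ?M"
      by (auto intro!: borel_measurable_diff measurable_compose[OF measurable_fst measurable_fst])
    have "(\<lambda>q. indicator {0..} (snd q) * indicator {..0} (snd q - fst (fst q)) :: real) \<in> borel_measurable ?M"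
    proof (rule borel_measurable_times)
      show "(\<lambda>q. indicator {0..} (snd q) :: real) \<in> borel_measurable ?M"
        by (rule measurable_compose[OF h(1), of "indicator {0..}"]) simp
      show "(\<lambda>q. indicator {..0} (snd q - fst (fst q)) :: real) \<in> borel_measurable ?M"
        by (rule measurable_compose[OF h(2), of "indicator {..0}"]) simp
    qed
    moreover have "(\<lambda>q. indicator {0..} (snd q) * indicator {..0} (snd q - fst (fst q)) :: real)
        = (\<lambda>q :: (real \<times> real) \<times> real. of_bool (0 \<le> snd q \<and> snd q \<le> fst (fst q)))"
      by (auto simp: fun_eq_iff indicator_def)
    ultimately show "(\<lambda>q. of_bool (0 \<le> snd q \<and> snd q \<le> fst (fst q)) :: real) \<in> borel_measurable ?M" by simp
  qed
  then have "(\<lambda>(p, r). of_bool (0 \<le> r \<and> r \<le> fst p) * \<xi> r (snd p)) \<in> borel_measurable ((borel \<Otimes>\<^sub>M borel) \<Otimes>\<^sub>M lborel)"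
    by (simp only: case_prod_beta')
  then have m: "(\<lambda>p. LINT r|lborel. of_bool (0 \<le> r \<and> r \<le> fst p) * \<xi> r (snd p)) \<in> borel_measurable (borel \<Otimes>\<^sub>M borel)"
    by (rule lborel.borel_measurable_lebesgue_integral)
  have "tint \<xi> (fst p) (snd p) = (LINT r|lborel. of_bool (0 \<le> r \<and> r \<le> fst p) * \<xi> r (snd p))" for p
    unfolding tint_def set_lebesgue_integral_def
    by (intro Bochner_Integration.integral_cong) (auto simp: indicator_def)
  then show "(\<lambda>p. tint \<xi> (fst p) (snd p)) \<in> borel_measurable (borel \<Otimes>\<^sub>M borel)" using m by (simp only:)
  show "\<forall>T. \<exists>C. \<forall>t x. \<bar>t\<bar> \<le> T \<longrightarrow> \<bar>tint \<xi> t x\<bar> \<le> C"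
  proof
    fix T
    obtain C where C: "C \<ge> 0" "\<And>t x. \<bar>t\<bar> \<le> T \<Longrightarrow> \<bar>\<xi> t x\<bar> \<le> C" using loc_bdd_bound[OF assms] by blast
    have "\<bar>tint \<xi> t x\<bar> \<le> C * T" if "\<bar>t\<bar> \<le> T" for t x
    proof (cases "0 \<le> t")
      case True
      have "\<bar>tint \<xi> t x\<bar> \<le> C * t" by (rule tint_bound[OF assms True]) (use C that in auto)
      also have "\<dots> \<le> C * T" using C that by (intro mult_left_mono) auto
      finally show ?thesis .
    next
      case False
      have "0 \<le> C * T" using C that by (intro mult_nonneg_nonneg) auto
      then show ?thesis using False by (simp add: tint_nonpos)
    qed
    then show "\<exists>C. \<forall>t x. \<bar>t\<bar> \<le> T \<longrightarrow> \<bar>tint \<xi> t x\<bar> \<le> C" by blast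
  qed
qed

lemma tint_lin:
  assumes "loc_bdd \<xi>" "loc_bdd \<eta>"
  shows "tint (\<lambda>t x. a * \<xi> t x + b * \<eta> t x) t x = a * tint \<xi> t x + b * tint \<eta> t x"
  using loc_bdd_set_integrable[OF assms(1), of 0 t x] loc_bdd_set_integrable[OF assms(2), of 0 t x]
  unfolding tint_def set_lebesgue_integral_def set_integrable_def
  by (simp add: algebra_simps)

lemma tint_const: "0 \<le> t \<Longrightarrow> tint (\<lambda>_. p) t x = t * p x"
  unfolding tint_def set_lebesgue_integral_def by simp

lemma tint_shift:
  assumes "loc_bdd \<xi>" "0 \<le> \<sigma>" "0 \<le> t"
  shows "tint (\<lambda>r. \<xi> (r + \<sigma>)) t x = tint \<xi> (t + \<sigma>) x - tint \<xi> \<sigma> x"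
proof -
  have "tint \<xi> (t + \<sigma>) x - tint \<xi> \<sigma> x = (LINT r:{\<sigma>..t + \<sigma>}|lborel. \<xi> r x)"
    by (rule tint_diff) (use assms in auto)
  also have "\<dots> = (LINT r|lborel. indicator {\<sigma>..t + \<sigma>} (\<sigma> + 1 * r) *\<^sub>R \<xi> (\<sigma> + 1 * r) x)"
    unfolding set_lebesgue_integral_def
    by (subst lborel_integral_real_affine[where c=1 and t=\<sigma>]) auto
  also have "\<dots> = tint (\<lambda>r. \<xi> (r + \<sigma>)) t x"
    unfolding tint_def set_lebesgue_integral_def
    by (intro Bochner_Integration.integral_cong) (auto simp: indicator_def add.commute)
  finally show ?thesis by simp
qed

lemma Fubini_time:
  assumes k: "integrable UI k" and \<xi>: "loc_bdd \<xi>"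
  shows "(LINT x|UI. k x * tint \<xi> t x) = (LINT r:{0..t}|lborel. LINT x|UI. k x * \<xi> r x)"
    and "set_integrable lborel {0..t} (\<lambda>r. LINT x|UI. k x * \<xi> r x)"
proof -
  have [measurable]: "k \<in> borel_measurable UI" using k by auto
  obtain C where C: "C \<ge> 0" "\<And>s x. \<bar>s\<bar> \<le> \<bar>t\<bar> \<Longrightarrow> \<bar>\<xi> s x\<bar> \<le> C" using loc_bdd_bound[OF \<xi>] by blast
  let ?F = "\<lambda>p. k (fst p) * (indicator {0..t} (snd p) * \<xi> (snd p) (fst p))"
  have m: "?F \<in> borel_measurable (UI \<Otimes>\<^sub>M lborel)"
  proof -
    have 1: "fst \<in> borel_measurable (UI \<Otimes>\<^sub>M lborel)" by (rule measurable_compose[OF measurable_fst measurable_ident_UI])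
    have 2: "snd \<in> borel_measurable (UI \<Otimes>\<^sub>M lborel)" by measurable
    have "(\<lambda>p. \<xi> (snd p) (fst p)) \<in> borel_measurable (UI \<Otimes>\<^sub>M lborel)" by (rule loc_bdd_compose[OF \<xi> 2 1])
    moreover have "(\<lambda>p. k (fst p)) \<in> borel_measurable (UI \<Otimes>\<^sub>M lborel)" by measurable
    ultimately show ?thesis by measurable
  qed
  have ind: "integrable lborel (indicator {0..t} :: real \<Rightarrow> real)"
    by (cases "0 \<le> t") (auto intro!: integrable_real_indicator)
  have i: "integrable (UI \<Otimes>\<^sub>M lborel) ?F"
  proof (rule Bochner_Integration.integrable_bound[OF _ m])
    have "integrable (UI \<Otimes>\<^sub>M lborel) (case_prod (\<lambda>x r. C * (k x * indicator {0..t} r)))"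
    proof (rule UL.Fubini_integrable)
      show "integrable UI (\<lambda>x. LINT r|lborel. norm (case (x, r) of (x, r) \<Rightarrow> C * (k x * indicator {0..t} r)))"
        using k C(1) by (simp add: abs_mult)
      show "AE x in UI. integrable lborel (\<lambda>r. case (x, r) of (x, r) \<Rightarrow> C * (k x * indicator {0..t} r))"
        using ind by simp
    qed measurable
    then show "integrable (UI \<Otimes>\<^sub>M lborel) (\<lambda>p. C * (k (fst p) * indicator {0..t} (snd p)))" by (simp add: case_prod_beta')
    show "AE p in UI \<Otimes>\<^sub>M lborel. norm (?F p) \<le> norm (C * (k (fst p) * indicator {0..t} (snd p)))"
    proof (rule AE_I2)
      fix p :: "real \<times> real"
      show "norm (?F p) \<le> norm (C * (k (fst p) * indicator {0..t} (snd p)))"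
      proof (cases "snd p \<in> {0..t}")
        case True
        then have "\<bar>\<xi> (snd p) (fst p)\<bar> \<le> C" using C(2)[of "snd p" "fst p"] by auto
        then have "\<bar>k (fst p)\<bar> * \<bar>\<xi> (snd p) (fst p)\<bar> \<le> \<bar>k (fst p)\<bar> * C" by (intro mult_left_mono) auto
        then show ?thesis using True C(1) by (simp add: abs_mult mult.commute)
      qed simp
    qed
  qed
  then have i': "integrable (UI \<Otimes>\<^sub>M lborel) (case_prod (\<lambda>x r. k x * (indicator {0..t} r * \<xi> r x)))"
    by (simp add: case_prod_beta')
  have "(LINT x|UI. k x * tint \<xi> t x) = (LINT x|UI. LINT r|lborel. k x * (indicator {0..t} r * \<xi> r x))"
    by (simp add: tint_def set_lebesgue_integral_def)
  also have "\<dots> = (LINT r|lborel. LINT x|UI. k x * (indicator {0..t} r * \<xi> r x))"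
    by (rule UL.Fubini_integral[OF i', symmetric])
  also have *: "(\<lambda>r. LINT x|UI. k x * (indicator {0..t} r * \<xi> r x)) = (\<lambda>r. indicator {0..t} r *\<^sub>R (LINT x|UI. k x * \<xi> r x))"
    by (auto simp: fun_eq_iff indicator_def)
  finally show "(LINT x|UI. k x * tint \<xi> t x) = (LINT r:{0..t}|lborel. LINT x|UI. k x * \<xi> r x)"
    by (simp add: set_lebesgue_integral_def)
  show "set_integrable lborel {0..t} (\<lambda>r. LINT x|UI. k x * \<xi> r x)"
    using UL.integrable_snd[OF i'] unfolding * set_integrable_def .
qed

text \<open>
  The derivative exists and vanishes.
\<close>

lemma constant_if_quadratic_increments:
  fixes F :: "real \<Rightarrow> real"
  assumes q: "\<And>s t. 0 \<le> s \<Longrightarrow> s \<le> t \<Longrightarrow> t \<le> T \<Longrightarrow> \<bar>F t - F s\<bar> \<le> K * (t - s)\<^sup>2" and t: "0 \<le> t" "t \<le> T"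
  shows "F t = F 0"
proof -
  have K0: "K * (t - s)\<^sup>2 \<le> \<bar>K\<bar> * \<bar>t - s\<bar> * \<bar>t - s\<bar>" for s t
  proof -
    have "K * (t - s)\<^sup>2 \<le> \<bar>K\<bar> * (t - s)\<^sup>2" by (intro mult_right_mono) auto
    then show ?thesis by (simp add: power2_eq_square abs_mult_self_eq mult.assoc)
  qed
  have "\<exists>c. \<forall>x\<in>{0..T}. F x = c"
  proof (rule has_field_derivative_zero_constant)
    fix s assume s: "s \<in> {0..T}"
    show "(F has_field_derivative 0) (at s within {0..T})"
      unfolding has_field_derivative_iff
    proof (rule Lim_null_comparison[where g="\<lambda>y. \<bar>K\<bar> * \<bar>y - s\<bar>"])
      have "norm ((F y - F s) / (y - s)) \<le> \<bar>K\<bar> * \<bar>y - s\<bar>" if y: "y \<in> {0..T}" "y \<noteq> s" for y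
      proof -
        have "\<bar>F y - F s\<bar> \<le> \<bar>K\<bar> * \<bar>y - s\<bar> * \<bar>y - s\<bar>"
          using q[of s y] q[of y s] K0[of y s] K0[of s y] s y by (cases "s \<le> y") (auto simp: abs_minus_commute)
        then show ?thesis using y by (simp add: divide_le_eq)
      qed
      then show "\<forall>\<^sub>F y in at s within {0..T}. norm ((F y - F s) / (y - s)) \<le> \<bar>K\<bar> * \<bar>y - s\<bar>"
        by (auto simp: eventually_at_filter)
      have "((\<lambda>y. \<bar>K\<bar> * \<bar>y - s\<bar>) \<longlongrightarrow> \<bar>K\<bar> * \<bar>s - s\<bar>) (at s within {0..T})" by (intro tendsto_intros)
      then show "((\<lambda>y. \<bar>K\<bar> * \<bar>y - s\<bar>) \<longlongrightarrow> 0) (at s within {0..T})" by simp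
    qed
  qed simp
  then show ?thesis using t by auto
qed

text \<open>
  The chain rule for \<open>y\<^sup>2\<close> with \<open>y\<close> merely Lipschitz in time: \<open>y\<^sup>2 - 2 \<integral> u y\<close> has increments bounded
  by a multiple of the square of the step, hence is constant. No differentiation theorem is involved.
\<close>

lemma square_of_primitive:
  fixes u :: "real \<Rightarrow> real"
  assumes u: "u \<in> borel_measurable borel" and C: "\<And>r. 0 \<le> r \<Longrightarrow> r \<le> T \<Longrightarrow> \<bar>u r\<bar> \<le> C" and T: "0 \<le> T"
    and y: "\<And>t. 0 \<le> t \<Longrightarrow> t \<le> T \<Longrightarrow> y t = yi + (LINT r:{0..t}|lborel. u r)"
    and ym: "y \<in> borel_measurable borel"
  shows "(y T)\<^sup>2 = (y 0)\<^sup>2 + 2 * (LINT r:{0..T}|lborel. u r * y r)"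
proof -
  have C0: "C \<ge> 0" using C[of 0] T by simp
  have ui: "set_integrable lborel {a..b} u" if "0 \<le> a" "b \<le> T" for a b
    by (rule set_integrable_bounded[OF u, where C=C]) (use that C in auto)
  have inc: "y t - y s = (LINT r:{s..t}|lborel. u r)" if "0 \<le> s" "s \<le> t" "t \<le> T" for s t
    using set_integral_Icc_split[OF ui[of 0 t], of s] y[of s] y[of t] that by simp
  have incb: "\<bar>y t - y s\<bar> \<le> C * (t - s)" if "0 \<le> s" "s \<le> t" "t \<le> T" for s t
    unfolding inc[OF that] by (rule set_integral_bound[OF u that(2)]) (use that C in auto)
  have yb: "\<bar>y r\<bar> \<le> \<bar>y 0\<bar> + C * T" if "0 \<le> r" "r \<le> T" for r
  proof -
    have "\<bar>y r - y 0\<bar> \<le> C * (r - 0)" using incb[of 0 r] that by simp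
    also have "\<dots> \<le> C * T" using that C0 by (intro mult_left_mono) auto
    finally show ?thesis by linarith
  qed
  have uyi: "set_integrable lborel {a..b} (\<lambda>r. u r * y r)" if "0 \<le> a" "b \<le> T" for a b
  proof (rule set_integrable_bounded[where C="C * (\<bar>y 0\<bar> + C * T)"])
    show "\<bar>u r * y r\<bar> \<le> C * (\<bar>y 0\<bar> + C * T)" if "a \<le> r" "r \<le> b" for r
      unfolding abs_mult using C[of r] yb[of r] \<open>0 \<le> a\<close> \<open>b \<le> T\<close> that C0 by (intro mult_mono) auto
  qed (use u ym in measurable)
  define F where "F t = (y t)\<^sup>2 - 2 * (LINT r:{0..t}|lborel. u r * y r)" for t
  have "F T = F 0"
  proof (rule constant_if_quadratic_increments[OF _ T order_refl])
    fix s t assume st: "0 \<le> s" "s \<le> t" "t \<le> T"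
    have "F t - F s = (y t - y s) * (y t + y s) - 2 * (LINT r:{s..t}|lborel. u r * y r)"
      using set_integral_Icc_split[OF uyi[of 0 t], of s] st by (simp add: F_def power2_eq_square algebra_simps)
    also have "\<dots> = (LINT r:{s..t}|lborel. (y t + y s) * u r) - (LINT r:{s..t}|lborel. 2 * (u r * y r))"
      unfolding inc[OF st] by (simp add: set_lebesgue_integral_def mult.commute)
    also have "\<dots> = (LINT r:{s..t}|lborel. (y t + y s) * u r - 2 * (u r * y r))"
      using ui[of s t] uyi[of s t] st by (intro set_integral_diff(2)[symmetric] set_integrable_mult_right) auto
    also have "\<dots> = (LINT r:{s..t}|lborel. u r * ((y t - y r) + (y s - y r)))"
      by (simp add: algebra_simps)
    finally have eq: "F t - F s = (LINT r:{s..t}|lborel. u r * ((y t - y r) + (y s - y r)))" .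
    have "\<bar>LINT r:{s..t}|lborel. u r * ((y t - y r) + (y s - y r))\<bar> \<le> (C * (2 * C * (t - s))) * (t - s)"
    proof (rule set_integral_bound)
      show "s \<le> t" by (rule st)
    next
      fix r assume r: "s \<le> r" "r \<le> t"
      have "\<bar>y t - y r\<bar> \<le> C * (t - r)" "\<bar>y r - y s\<bar> \<le> C * (r - s)" using incb[of r t] incb[of s r] r st by auto
      moreover have "C * (t - r) \<le> C * (t - s)" "C * (r - s) \<le> C * (t - s)"
        using r C0 by (auto intro: mult_left_mono)
      ultimately have "\<bar>(y t - y r) + (y s - y r)\<bar> \<le> 2 * C * (t - s)" by linarith
      then show "\<bar>u r * ((y t - y r) + (y s - y r))\<bar> \<le> C * (2 * C * (t - s))"
        unfolding abs_mult using C[of r] r st C0 by (intro mult_mono) auto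
    next
      show "(\<lambda>r. u r * ((y t - y r) + (y s - y r))) \<in> borel_measurable borel"
        by (intro borel_measurable_times borel_measurable_add borel_measurable_diff borel_measurable_const u ym)
    qed
    then show "\<bar>F t - F s\<bar> \<le> (2 * C * C) * (t - s)\<^sup>2"
      unfolding eq by (simp add: power2_eq_square mult_ac)
  qed
  moreover have "(LINT r:{0..0}|lborel. u r * y r) = 0"
    using tint_nonpos[of 0 "\<lambda>r _. u r * y r" 0] by (simp add: tint_def)
  ultimately show ?thesis by (simp add: F_def)
qed

text \<open>
  \<open>X\<close> is a curve of functions with velocity \<open>\<xi>\<close>, in integrated form and pointwise in space.
\<close>

definition traj :: "(real \<Rightarrow> real \<Rightarrow> real) \<Rightarrow> (real \<Rightarrow> real \<Rightarrow> real) \<Rightarrow> bool" where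
  "traj X \<xi> \<longleftrightarrow> loc_bdd X \<and> loc_bdd \<xi> \<and> (\<forall>t\<ge>0. \<forall>x. X t x = X 0 x + tint \<xi> t x)"

lemma trajD: "traj X \<xi> \<Longrightarrow> 0 \<le> t \<Longrightarrow> X t x = X 0 x + tint \<xi> t x"
  unfolding traj_def by blast

lemma traj_loc_bdd: "traj X \<xi> \<Longrightarrow> loc_bdd X" "traj X \<xi> \<Longrightarrow> loc_bdd \<xi>"
  unfolding traj_def by blast+

lemma traj_tint: "loc_bdd \<xi> \<Longrightarrow> traj (tint \<xi>) \<xi>"
  by (simp add: traj_def tint_loc_bdd tint_nonpos)

lemma traj_lin:
  assumes "traj X \<xi>" "traj Y \<eta>"
  shows "traj (\<lambda>t x. a * X t x + b * Y t x) (\<lambda>t x. a * \<xi> t x + b * \<eta> t x)"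
  unfolding traj_def
proof (intro conjI allI impI)
  show "loc_bdd (\<lambda>t x. a * X t x + b * Y t x)" "loc_bdd (\<lambda>t x. a * \<xi> t x + b * \<eta> t x)"
    by (intro loc_bdd_lin traj_loc_bdd[OF assms(1)] traj_loc_bdd[OF assms(2)])+
  fix t x :: real assume t: "0 \<le> t"
  note 1 = trajD[OF assms(1) t, of x] trajD[OF assms(2) t, of x]
  show "a * X t x + b * Y t x = a * X 0 x + b * Y 0 x + tint (\<lambda>t x. a * \<xi> t x + b * \<eta> t x) t x"
    unfolding tint_lin[OF traj_loc_bdd(2)[OF assms(1)] traj_loc_bdd(2)[OF assms(2)]]
    by (subst 1(1), subst 1(2)) (simp add: algebra_simps)
qed

lemma traj_shift:
  assumes "traj X \<xi>" "0 \<le> \<sigma>"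
  shows "traj (\<lambda>t. X (t + \<sigma>)) (\<lambda>t. \<xi> (t + \<sigma>))"
  unfolding traj_def
proof (intro conjI allI impI)
  show "loc_bdd (\<lambda>t. X (t + \<sigma>))" "loc_bdd (\<lambda>t. \<xi> (t + \<sigma>))" by (intro loc_bdd_shift traj_loc_bdd[OF assms(1)])+
  fix t x :: real assume t: "0 \<le> t"
  have "X (t + \<sigma>) x = X 0 x + tint \<xi> (t + \<sigma>) x" "X \<sigma> x = X 0 x + tint \<xi> \<sigma> x"
    by (rule trajD[OF assms(1)], use assms(2) t in simp)+
  then show "X (t + \<sigma>) x = X (0 + \<sigma>) x + tint (\<lambda>t. \<xi> (t + \<sigma>)) t x"
    unfolding tint_shift[OF traj_loc_bdd(2)[OF assms(1)] assms(2) t] by simp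
qed

text \<open>
  The identity \<open>d/dt \<bar>X\<bar>\<^sup>2 = 2 \<langle>X', X\<rangle>\<close>, integrated in time: the pointwise chain rule, integrated over
  space with Fubini.
\<close>

lemma traj_energy:
  assumes X: "traj X \<xi>" and t: "0 \<le> t"
  shows "(L2n (X t))\<^sup>2 = (L2n (X 0))\<^sup>2 + 2 * (LINT r:{0..t}|lborel. LINT x|UI. \<xi> r x * X r x)"
    and "set_integrable lborel {0..t} (\<lambda>r. LINT x|UI. \<xi> r x * X r x)"
proof -
  have jX: "loc_bdd X" and j\<xi>: "loc_bdd \<xi>" by (rule traj_loc_bdd[OF X])+
  have jp: "loc_bdd (\<lambda>r x. \<xi> r x * X r x)" unfolding loc_bdd_def
  proof
    show "(\<lambda>p. \<xi> (fst p) (snd p) * X (fst p) (snd p)) \<in> borel_measurable (borel \<Otimes>\<^sub>M borel)"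
      using jX j\<xi> by (auto simp: loc_bdd_def)
    show "\<forall>T. \<exists>C. \<forall>t x. \<bar>t\<bar> \<le> T \<longrightarrow> \<bar>\<xi> t x * X t x\<bar> \<le> C"
    proof
      fix T
      obtain C where C: "C \<ge> 0" "\<And>t x. \<bar>t\<bar> \<le> T \<Longrightarrow> \<bar>\<xi> t x\<bar> \<le> C" using loc_bdd_bound[OF j\<xi>] by blast
      obtain D where D: "D \<ge> 0" "\<And>t x. \<bar>t\<bar> \<le> T \<Longrightarrow> \<bar>X t x\<bar> \<le> D" using loc_bdd_bound[OF jX] by blast
      have "\<bar>\<xi> t x * X t x\<bar> \<le> C * D" if "\<bar>t\<bar> \<le> T" for t x
        unfolding abs_mult using C D that by (intro mult_mono) auto
      then show "\<exists>C. \<forall>t x. \<bar>t\<bar> \<le> T \<longrightarrow> \<bar>\<xi> t x * X t x\<bar> \<le> C" by blast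
    qed
  qed
  have 1: "(X t x)\<^sup>2 = (X 0 x)\<^sup>2 + 2 * tint (\<lambda>r x. \<xi> r x * X r x) t x" for x
  proof -
    obtain C where C0: "C \<ge> 0" and C: "\<And>s x. \<bar>s\<bar> \<le> t \<Longrightarrow> \<bar>\<xi> s x\<bar> \<le> C" using loc_bdd_bound[OF j\<xi>] by blast
    show ?thesis unfolding tint_def
    proof (rule square_of_primitive[where C=C and yi="X 0 x"])
      show "(\<lambda>r. \<xi> r x) \<in> borel_measurable borel" "(\<lambda>t. X t x) \<in> borel_measurable borel"
        by (rule loc_bdd_time_measurable[OF j\<xi>], rule loc_bdd_time_measurable[OF jX])
      show "X t x = X 0 x + (LINT r:{0..t}|lborel. \<xi> r x)" if "0 \<le> t" for t
        using trajD[OF X that] by (simp only: tint_def)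
    qed (use C t in auto)
  qed
  note F = Fubini_time[OF _ jp, of "\<lambda>_. 1" t, simplified]
  have i: "integrable UI (\<lambda>x. (X 0 x)\<^sup>2)" "integrable UI (tint (\<lambda>r x. \<xi> r x * X r x) t)"
    using bmeas_sqint[OF loc_bdd_bmeas[OF jX]] bmeas_integrable[OF loc_bdd_bmeas[OF tint_loc_bdd[OF jp]]] by (auto simp: sqint_def)
  have "(L2n (X t))\<^sup>2 = (LINT x|UI. (X 0 x)\<^sup>2 + 2 * tint (\<lambda>r x. \<xi> r x * X r x) t x)"
    unfolding L2n_sq by (simp add: 1)
  also have "\<dots> = (L2n (X 0))\<^sup>2 + 2 * (LINT x|UI. tint (\<lambda>r x. \<xi> r x * X r x) t x)"
    using i by (simp add: L2n_sq)
  finally show "(L2n (X t))\<^sup>2 = (L2n (X 0))\<^sup>2 + 2 * (LINT r:{0..t}|lborel. LINT x|UI. \<xi> r x * X r x)"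
    using F(1) by simp
  show "set_integrable lborel {0..t} (\<lambda>r. LINT x|UI. \<xi> r x * X r x)" using F(2) .
qed

lemma traj_bmeas: "traj X \<xi> \<Longrightarrow> bmeas (X t)" "traj X \<xi> \<Longrightarrow> bmeas (\<xi> t)"
  by (blast intro: loc_bdd_bmeas traj_loc_bdd)+

lemma set_integral_mono_Icc:
  fixes u w :: "real \<Rightarrow> real"
  assumes "set_integrable lborel {a..b} u" "set_integrable lborel {a..b} w" "\<And>r. a \<le> r \<Longrightarrow> r \<le> b \<Longrightarrow> u r \<le> w r"
  shows "(LINT r:{a..b}|lborel. u r) \<le> (LINT r:{a..b}|lborel. w r)"
  by (rule set_integral_mono) (use assms in auto)

lemma set_integral_const_Icc: "a \<le> b \<Longrightarrow> (LINT r:{a..b}|lborel. c) = c * (b - a)" for a b c :: real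
  by (simp add: set_lebesgue_integral_def)

lemma set_integrable_const_Icc: "set_integrable lborel {a..b :: real} (\<lambda>_. c :: real)"
  by (rule set_integrable_bounded[where C="\<bar>c\<bar>"]) auto

lemma set_integral_le_const:
  fixes u :: "real \<Rightarrow> real"
  assumes "set_integrable lborel {a..b} u" "a \<le> b" "\<And>r. a \<le> r \<Longrightarrow> r \<le> b \<Longrightarrow> u r \<le> c"
  shows "(LINT r:{a..b}|lborel. u r) \<le> c * (b - a)"
  using set_integral_mono_Icc[OF assms(1) set_integrable_const_Icc assms(3)] set_integral_const_Icc[OF assms(2)] by simp

lemma traj_nonincreasing:
  assumes X: "traj X \<xi>" and d: "\<And>r. 0 \<le> r \<Longrightarrow> (LINT x|UI. \<xi> r x * X r x) \<le> 0" and st: "0 \<le> s" "s \<le> t"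
  shows "L2n (X t) \<le> L2n (X s)"
proof -
  have Y: "traj (\<lambda>r. X (r + s)) (\<lambda>r. \<xi> (r + s))" by (rule traj_shift[OF X st(1)])
  have "(LINT r:{0..t - s}|lborel. LINT x|UI. \<xi> (r + s) x * X (r + s) x) \<le> 0 * (t - s - 0)"
    by (rule set_integral_le_const[OF traj_energy(2)[OF Y]]) (use st d in auto)
  then have "(L2n (X t))\<^sup>2 \<le> (L2n (X s))\<^sup>2"
    using traj_energy(1)[OF Y, of "t - s"] st by simp
  then show ?thesis by (rule power2_le_imp_le) simp
qed

text \<open>
  Minkowski's inequality for time integrals, obtained by pairing the integral with itself and using
  Cauchy-Schwarz at each time.
\<close>

lemma L2n_tint_le:
  assumes \<xi>: "loc_bdd \<xi>" and S: "\<And>r. 0 \<le> r \<Longrightarrow> r \<le> t \<Longrightarrow> L2n (\<xi> r) \<le> S" and t: "0 \<le> t"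
  shows "L2n (tint \<xi> t) \<le> S * t"
proof -
  let ?k = "tint \<xi> t"
  have bk: "bmeas ?k" by (rule loc_bdd_bmeas[OF tint_loc_bdd[OF \<xi>]])
  have S0: "S \<ge> 0" using S[of 0] t L2n_nonneg[of "\<xi> 0"] by linarith
  have "(L2n ?k)\<^sup>2 = (LINT x|UI. ?k x * tint \<xi> t x)" unfolding L2n_sq by (simp add: power2_eq_square)
  also have "\<dots> = (LINT r:{0..t}|lborel. LINT x|UI. ?k x * \<xi> r x)"
    by (rule Fubini_time(1)[OF bmeas_integrable[OF bk] \<xi>])
  also have "\<dots> \<le> (L2n ?k * S) * (t - 0)"
  proof (rule set_integral_le_const[OF Fubini_time(2)[OF bmeas_integrable[OF bk] \<xi>] t])
    fix r assume r: "0 \<le> r" "r \<le> t"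
    have "(LINT x|UI. ?k x * \<xi> r x) \<le> L2n ?k * L2n (\<xi> r)"
      using L2_Cauchy_Schwarz[OF bmeas_sqint[OF bk] bmeas_sqint[OF loc_bdd_bmeas[OF \<xi>]], of r] by linarith
    also have "\<dots> \<le> L2n ?k * S" using S[OF r] by (intro mult_left_mono) auto
    finally show "(LINT x|UI. ?k x * \<xi> r x) \<le> L2n ?k * S" .
  qed
  finally have "L2n ?k * L2n ?k \<le> L2n ?k * (S * t)" by (simp add: power2_eq_square mult_ac)
  then show ?thesis
    using S0 t L2n_nonneg[of ?k] by (cases "L2n ?k = 0") (auto simp: mult_le_cancel_left)
qed

lemma traj_increment:
  assumes X: "traj X \<xi>" and S: "\<And>r. 0 \<le> r \<Longrightarrow> L2n (\<xi> r) \<le> S" and st: "0 \<le> s" "s \<le> t"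
  shows "L2n (\<lambda>x. X t x - X s x) \<le> S * (t - s)"
proof -
  have Y: "traj (\<lambda>r. X (r + s)) (\<lambda>r. \<xi> (r + s))" by (rule traj_shift[OF X st(1)])
  have "X t x - X s x = tint (\<lambda>r. \<xi> (r + s)) (t - s) x" for x
    using trajD[OF Y, of "t - s" x] st by simp
  then have "(\<lambda>x. X t x - X s x) = tint (\<lambda>r. \<xi> (r + s)) (t - s)" by blast
  then show ?thesis
    using st S traj_loc_bdd(2)[OF Y] by (auto intro: L2n_tint_le)
qed

section \<open>Green potentials\<close>

text \<open>
  What the class of driving functions provides for the operator, without the measure behind it.
\<close>

locale driver =
  fixes W :: "real \<Rightarrow> real"
  assumes W_strict: "strict_mono W" and W_0: "W 0 = 0" and W_shift: "W (x + 1) = W x + 1"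
    and W_right: "continuous (at_right x) W"
begin

lemma W_mono: "x \<le> y \<Longrightarrow> W x \<le> W y"
  using W_strict by (simp add: strict_mono_less_eq)

lemma W_less_iff [simp]: "W x < W y \<longleftrightarrow> x < y"
  using W_strict by (simp add: strict_mono_less)

lemma W_le_iff [simp]: "W x \<le> W y \<longleftrightarrow> x \<le> y"
  using W_strict by (simp add: strict_mono_less_eq)

lemma W_1: "W 1 = 1" using W_shift[of 0] W_0 by simp

lemma W_unit: "x \<in> {0..1} \<Longrightarrow> W x \<in> {0..1}"
  using W_mono[of 0 x] W_mono[of x 1] W_0 W_1 by simp

lemma W_measurable [measurable]: "W \<in> borel_measurable borel"
  by (rule borel_measurable_mono) (simp add: mono_def W_mono)

text \<open>
  For \<open>k\<close> with integral 0 the flux \<open>Gam k\<close>, as a function of \<open>s = W x\<close>, is the integral of \<open>k\<close> up to the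
  point \<open>x\<close>; subtracting its mean makes its primitive \<open>Pot k\<close> periodic. Thus \<open>Pot k\<close> is the periodic
  solution of \<open>f'' = w' \<cdot> (k \<circ> w)\<close> with value 0 at 0, where \<open>w\<close> is the inverse of \<open>W\<close>.
\<close>

definition Gam :: "(real \<Rightarrow> real) \<Rightarrow> real \<Rightarrow> real" where
  "Gam k s = (LINT z|UI. k z * indicator {..<s} (W z))"

definition dPot :: "(real \<Rightarrow> real) \<Rightarrow> real \<Rightarrow> real" where
  "dPot k s = Gam k s - (LINT r|UI. Gam k r)"

definition Pot :: "(real \<Rightarrow> real) \<Rightarrow> real \<Rightarrow> real" where
  "Pot k = prim (dPot k)"

lemma ind_measurable [measurable]: "(\<lambda>p. indicator {..<fst p} (W (snd p)) :: real) \<in> borel_measurable (UI \<Otimes>\<^sub>M UI)"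
   "(\<lambda>p. indicator {..<snd p} (W (fst p)) :: real) \<in> borel_measurable (UI \<Otimes>\<^sub>M UI)"
proof -
  have "(\<lambda>p. W (snd p)) \<in> borel_measurable (UI \<Otimes>\<^sub>M UI)" "(\<lambda>p. W (fst p)) \<in> borel_measurable (UI \<Otimes>\<^sub>M UI)"
    using borel_measurable_UI[OF W_measurable] by measurable
  moreover have "fst \<in> borel_measurable (UI \<Otimes>\<^sub>M UI)" "snd \<in> borel_measurable (UI \<Otimes>\<^sub>M UI)"
    by (rule measurable_compose[OF measurable_fst measurable_ident_UI], rule measurable_compose[OF measurable_snd measurable_ident_UI])
  ultimately show "(\<lambda>p. indicator {..<fst p} (W (snd p)) :: real) \<in> borel_measurable (UI \<Otimes>\<^sub>M UI)"
   "(\<lambda>p. indicator {..<snd p} (W (fst p)) :: real) \<in> borel_measurable (UI \<Otimes>\<^sub>M UI)"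
    unfolding indicator_def by simp_all
qed

lemma Gam_int:
  "integrable UI k \<Longrightarrow> integrable UI (\<lambda>z. k z * indicator {..<s} (W z))" for k :: "real \<Rightarrow> real"
  by (rule integrable_UI_mult_bounded[where C=1]) (auto simp: indicator_def intro!: borel_measurable_UI)

lemma Gam_integrable: "integrable UI k \<Longrightarrow> integrable UI (Gam k)"
  using Fubini_UI(2)[of k "\<lambda>z s. indicator {..<s} (W z)" 1]
  unfolding Gam_def[abs_def] by (auto simp: indicator_def[abs_def] split: if_splits)

lemma Gam_abs: assumes "integrable UI k" shows "\<bar>Gam k s\<bar> \<le> (LINT z|UI. \<bar>k z\<bar>)"
proof -
  have "\<bar>Gam k s\<bar> \<le> (LINT z|UI. norm (k z * indicator {..<s} (W z)))" unfolding Gam_def by simp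
  also have "\<dots> \<le> (LINT z|UI. \<bar>k z\<bar>)"
    using assms by (intro integral_mono integrable_norm Gam_int) (auto simp: indicator_def)
  finally show ?thesis .
qed

lemma dPot_integrable: "integrable UI k \<Longrightarrow> integrable UI (dPot k)"
  unfolding dPot_def[abs_def] by (intro Bochner_Integration.integrable_diff Gam_integrable) auto

lemma dPot_measurable [measurable]: "integrable UI k \<Longrightarrow> dPot k \<in> borel_measurable UI"
  using dPot_integrable by auto

lemma dPot_mean: "integrable UI k \<Longrightarrow> (LINT s|UI. dPot k s) = 0"
  unfolding dPot_def using Gam_integrable by simp

lemma dPot_abs: assumes "integrable UI k" shows "\<bar>dPot k s\<bar> \<le> 2 * (LINT z|UI. \<bar>k z\<bar>)"
proof -
  have "\<bar>LINT r|UI. Gam k r\<bar> \<le> (LINT r|UI. \<bar>Gam k r\<bar>)" by simp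
  also have "\<dots> \<le> (LINT r|UI. (LINT z|UI. \<bar>k z\<bar>))"
    using Gam_integrable[OF assms] by (intro integral_mono) (auto simp: Gam_abs[OF assms])
  finally have "\<bar>LINT r|UI. Gam k r\<bar> \<le> (LINT z|UI. \<bar>k z\<bar>)" by simp
  then show ?thesis using Gam_abs[OF assms, of s] unfolding dPot_def by linarith
qed

text \<open>
  Integration by parts in \<open>s\<close>. By Fubini the left side is \<open>\<integral> k(z) \<integral>\<^bsub>s > W z\<^esub> q(s) ds dz\<close>, and the
  inner integral is \<open>- prim q (W z)\<close> since \<open>q\<close> has integral 0.
\<close>

lemma Gam_parts:
  assumes k: "integrable UI k" and q: "q \<in> borel_measurable UI" "\<And>x. x \<in> {0..1} \<Longrightarrow> \<bar>q x\<bar> \<le> C"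
    and q0: "(LINT s|UI. q s) = 0"
  shows "(LINT s|UI. Gam k s * q s) = - (LINT z|UI. k z * prim q (W z))"
proof -
  have C0: "C \<ge> 0" using q(2)[of 0] by simp
  have qi: "integrable UI q" by (rule integrable_UI_bounded[OF q])
  have [measurable]: "q \<in> borel_measurable UI" by fact
  have "(LINT s|UI. Gam k s * q s) = (LINT s|UI. LINT z|UI. k z * (indicator {..<s} (W z) * q s))"
    unfolding Gam_def by (simp add: mult.assoc[symmetric])
  also have "\<dots> = (LINT z|UI. k z * (LINT s|UI. indicator {..<s} (W z) * q s))"
  proof (rule Fubini_UI(1)[where C=C, symmetric])
    show "\<bar>indicator {..<y} (W x) * q y\<bar> \<le> C" if "y \<in> {0..1}" for x y
      using q(2)[OF that] C0 by (auto simp: indicator_def)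
  qed (use k in measurable)
  also have "\<dots> = (LINT z|UI. k z * (- prim q (W z)))"
  proof (intro Bochner_Integration.integral_cong refl arg_cong2[where f="(*)"])
    fix z
    have "(LINT s|UI. indicator {..<s} (W z) * q s) = (LINT s|UI. q s - indicator {..W z} s * q s)"
      by (intro Bochner_Integration.integral_cong) (auto simp: indicator_def)
    also have "\<dots> = - prim q (W z)"
      using qi integrable_indicator_UI[OF qi] by (subst Bochner_Integration.integral_diff) (auto simp: q0 prim_def)
    finally show "(LINT s|UI. indicator {..<s} (W z) * q s) = - prim q (W z)" .
  qed
  finally show ?thesis by simp
qed

lemma dPot_parts:
  assumes k: "integrable UI k" and q: "q \<in> borel_measurable UI" "\<And>x. x \<in> {0..1} \<Longrightarrow> \<bar>q x\<bar> \<le> C"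
    and q0: "(LINT s|UI. q s) = 0"
  shows "(LINT s|UI. dPot k s * q s) = - (LINT z|UI. k z * prim q (W z))"
proof -
  have "(LINT s|UI. dPot k s * q s) = (LINT s|UI. Gam k s * q s - (LINT r|UI. Gam k r) * q s)"
    unfolding dPot_def by (simp add: algebra_simps)
  also have "\<dots> = (LINT s|UI. Gam k s * q s)"
    using integrable_UI_mult_bounded(1)[OF Gam_integrable[OF k] q] integrable_UI_bounded[OF q]
    by (subst Bochner_Integration.integral_diff) (auto simp: q0)
  finally show ?thesis using Gam_parts[OF assms] by simp
qed

text \<open>
  The bilinear form of the operator: the special case where \<open>q\<close> is itself a flux. It is symmetric in
  \<open>k\<close> and \<open>g\<close>, and nonnegative on the diagonal.
\<close>

lemma energy_form:
  assumes k: "integrable UI k" and g: "integrable UI g"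
  shows "(LINT s|UI. dPot k s * dPot g s) = - (LINT z|UI. k z * Pot g (W z))"
  unfolding Pot_def by (rule dPot_parts[OF k dPot_measurable[OF g] dPot_abs[OF g] dPot_mean[OF g]])

lemma Pot_symmetric:
  assumes k: "integrable UI k" and g: "integrable UI g"
  shows "(LINT z|UI. k z * Pot g (W z)) = (LINT z|UI. g z * Pot k (W z))"
  using energy_form[OF k g] energy_form[OF g k] by (simp add: mult.commute)

lemma Pot_Lipschitz:
  assumes k: "integrable UI k"
  shows "\<bar>Pot k t - Pot k s\<bar> \<le> 2 * (LINT z|UI. \<bar>k z\<bar>) * \<bar>t - s\<bar>"
  unfolding Pot_def by (rule prim_Lipschitz[OF dPot_measurable[OF k] dPot_abs[OF k]])

lemma Pot_0: "integrable UI k \<Longrightarrow> Pot k 0 = 0"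
  unfolding Pot_def by (rule prim_0[OF dPot_integrable])

lemma Pot_1: "integrable UI k \<Longrightarrow> Pot k 1 = 0"
  unfolding Pot_def prim_1 by (rule dPot_mean)

lemma Pot_measurable [measurable]: "integrable UI k \<Longrightarrow> Pot k \<in> borel_measurable borel"
  unfolding Pot_def by (intro prim_measurable dPot_integrable)

lemma Pot_W_measurable: "integrable UI k \<Longrightarrow> (\<lambda>x. Pot k (W x)) \<in> borel_measurable UI"
  by (intro borel_measurable_UI) measurable

lemma Pot_abs: assumes "integrable UI k" shows "\<bar>Pot k s\<bar> \<le> 2 * (LINT z|UI. \<bar>k z\<bar>)"
proof -
  have "\<bar>Pot k s\<bar> \<le> (LINT r|UI. \<bar>dPot k r\<bar>)"
    unfolding Pot_def by (rule prim_abs_bound[OF dPot_integrable[OF assms]])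
  also have "\<dots> \<le> (LINT r|UI. 2 * (LINT z|UI. \<bar>k z\<bar>))"
    using dPot_integrable[OF assms] by (intro integral_mono) (auto simp: dPot_abs[OF assms])
  finally show ?thesis by simp
qed

lemma Pot_W_integrable: "integrable UI k \<Longrightarrow> integrable UI (\<lambda>x. Pot k (W x))"
  by (rule integrable_UI_bounded[OF Pot_W_measurable Pot_abs])

lemma Gam_lin:
  assumes "integrable UI f" "integrable UI g"
  shows "Gam (\<lambda>x. a * f x + b * g x) s = a * Gam f s + b * Gam g s"
  unfolding Gam_def using Gam_int[OF assms(1)] Gam_int[OF assms(2)] by (simp add: algebra_simps)

lemma Pot_lin:
  assumes "integrable UI f" "integrable UI g"
  shows "Pot (\<lambda>x. a * f x + b * g x) s = a * Pot f s + b * Pot g s"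
proof -
  have "dPot (\<lambda>x. a * f x + b * g x) r = a * dPot f r + b * dPot g r" for r
    unfolding dPot_def Gam_lin[OF assms] using Gam_integrable[OF assms(1)] Gam_integrable[OF assms(2)]
    by (simp add: algebra_simps)
  then have "dPot (\<lambda>x. a * f x + b * g x) = (\<lambda>r. a * dPot f r + b * dPot g r)" by blast
  then show ?thesis
    unfolding Pot_def using prim_add[OF dPot_integrable dPot_integrable] assms by simp
qed

text \<open>
  \<open>weakL p k\<close> expresses \<open>d/dx d/dW p = k\<close> by testing against potentials of bounded functions. These are
  elements of the domain, and there are enough of them to recover \<open>p\<close> from \<open>k\<close> up to a constant and \<open>k\<close>
  from \<open>p\<close>.
\<close>

definition testg :: "(real \<Rightarrow> real) \<Rightarrow> bool" where
  "testg g \<longleftrightarrow> g \<in> borel_measurable borel \<and> (\<exists>C. \<forall>x. \<bar>g x\<bar> \<le> C) \<and> (LINT x|UI. g x) = 0"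

definition weakL :: "(real \<Rightarrow> real) \<Rightarrow> (real \<Rightarrow> real) \<Rightarrow> bool" where
  "weakL p k \<longleftrightarrow> integrable UI p \<and> integrable UI k \<and> (LINT x|UI. k x) = 0 \<and>
     (\<forall>g. testg g \<longrightarrow> (LINT x|UI. k x * Pot g (W x)) = (LINT x|UI. p x * g x))"

lemma testg_integrable: "testg g \<Longrightarrow> integrable UI g"
  unfolding testg_def by (auto intro: integrable_UI_bounded borel_measurable_UI)

lemma testg_mult: "testg g \<Longrightarrow> integrable UI p \<Longrightarrow> integrable UI (\<lambda>x. p x * g x)"
  unfolding testg_def by (auto intro!: integrable_UI_mult_bounded(1) borel_measurable_UI)

lemma mult_Pot_integrable:
  "integrable UI k \<Longrightarrow> integrable UI g \<Longrightarrow> integrable UI (\<lambda>x. k x * Pot g (W x))"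
  by (rule integrable_UI_mult_bounded(1)[OF _ Pot_W_measurable Pot_abs])

lemma weakL_lin:
  assumes "weakL p k" "weakL p' k'"
  shows "weakL (\<lambda>x. a * p x + b * p' x) (\<lambda>x. a * k x + b * k' x)"
  unfolding weakL_def
proof (intro conjI allI impI)
  show "integrable UI (\<lambda>x. a * p x + b * p' x)" "integrable UI (\<lambda>x. a * k x + b * k' x)"
    using assms by (auto simp: weakL_def)
  show "(LINT x|UI. a * k x + b * k' x) = 0" using assms by (simp add: weakL_def)
  fix g assume g: "testg g"
  have i: "integrable UI (\<lambda>x. k x * Pot g (W x))" "integrable UI (\<lambda>x. k' x * Pot g (W x))"
    "integrable UI (\<lambda>x. p x * g x)" "integrable UI (\<lambda>x. p' x * g x)"
    using assms g by (auto simp: weakL_def intro: mult_Pot_integrable testg_integrable testg_mult)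
  have "(LINT x|UI. (a * k x + b * k' x) * Pot g (W x)) = a * (LINT x|UI. k x * Pot g (W x)) + b * (LINT x|UI. k' x * Pot g (W x))"
    using i by (simp add: algebra_simps)
  also have "\<dots> = (LINT x|UI. (a * p x + b * p' x) * g x)"
    using i assms g by (simp add: algebra_simps weakL_def)
  finally show "(LINT x|UI. (a * k x + b * k' x) * Pot g (W x)) = (LINT x|UI. (a * p x + b * p' x) * g x)" .
qed

lemma weakL_Pot:
  assumes "integrable UI k" "(LINT x|UI. k x) = 0"
  shows "weakL (\<lambda>x. b + Pot k (W x)) k"
  unfolding weakL_def
proof (intro conjI allI impI)
  show "integrable UI (\<lambda>x. b + Pot k (W x))" using Pot_W_integrable[OF assms(1)] by simp
  fix g assume g: "testg g"
  have i: "integrable UI g" by (rule testg_integrable[OF g])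
  have "(LINT x|UI. (b + Pot k (W x)) * g x) = (LINT x|UI. b * g x + g x * Pot k (W x))"
    by (simp add: algebra_simps)
  also have "\<dots> = b * (LINT x|UI. g x) + (LINT x|UI. g x * Pot k (W x))"
    using i mult_Pot_integrable[OF i assms(1)] by simp
  also have "\<dots> = (LINT x|UI. k x * Pot g (W x))"
    using g Pot_symmetric[OF i assms(1)] by (simp add: testg_def)
  finally show "(LINT x|UI. k x * Pot g (W x)) = (LINT x|UI. (b + Pot k (W x)) * g x)" by simp
qed (use assms in auto)

lemma weakL_cong_AE:
  assumes "weakL p k" "AE x in UI. p x = p' x" "AE x in UI. k x = k' x"
    "p' \<in> borel_measurable UI" "k' \<in> borel_measurable UI"
  shows "weakL p' k'"
proof -
  have m: "p \<in> borel_measurable UI" "k \<in> borel_measurable UI" using assms(1) by (auto simp: weakL_def)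
  show ?thesis unfolding weakL_def
  proof (intro conjI allI impI)
    show "integrable UI p'"
      using integrable_cong_AE[OF m(1) assms(4,2)] assms(1) by (simp add: weakL_def)
    show "integrable UI k'"
      using integrable_cong_AE[OF m(2) assms(5,3)] assms(1) by (simp add: weakL_def)
    show "(LINT x|UI. k' x) = 0"
      using integral_cong_AE[OF m(2) assms(5,3)] assms(1) by (simp add: weakL_def)
    fix g assume tg: "testg g"
    have gm: "g \<in> borel_measurable UI" using tg by (auto simp: testg_def intro: borel_measurable_UI)
    have pm: "(\<lambda>x. Pot g (W x)) \<in> borel_measurable UI" by (rule Pot_W_measurable[OF testg_integrable[OF tg]])
    have "(LINT x|UI. k' x * Pot g (W x)) = (LINT x|UI. k x * Pot g (W x))"
    proof (rule integral_cong_AE)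
      show "AE x in UI. k' x * Pot g (W x) = k x * Pot g (W x)" using assms(3) by eventually_elim simp
    qed (intro borel_measurable_times m assms gm pm)+
    moreover have "(LINT x|UI. p' x * g x) = (LINT x|UI. p x * g x)"
    proof (rule integral_cong_AE)
      show "AE x in UI. p' x * g x = p x * g x" using assms(2) by eventually_elim simp
    qed (intro borel_measurable_times m assms gm pm)+
    ultimately show "(LINT x|UI. k' x * Pot g (W x)) = (LINT x|UI. p' x * g x)"
      using assms(1) tg by (simp add: weakL_def)
  qed
qed

text \<open>
  By symmetry of the potentials, \<open>p - Pot k \<circ> W\<close> is orthogonal to every bounded function with integral 0;
  it is bounded itself, so its oscillating part can be used as the test function.
\<close>

lemma weakL_representation:
  assumes p: "bmeas p" and w: "weakL p k"
  obtains b where "AE x in UI. p x = b + Pot k (W x)"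
proof -
  have k: "integrable UI k" "(LINT x|UI. k x) = 0" and pi: "integrable UI p" using w by (auto simp: weakL_def)
  define d where "d x = p x - Pot k (W x)" for x
  define b where "b = (LINT x|UI. d x)"
  define g where "g x = d x - b" for x
  have pm: "p \<in> borel_measurable borel" using p by (simp add: bmeas_def)
  have dm: "d \<in> borel_measurable borel" unfolding d_def
    by (intro borel_measurable_diff pm measurable_compose[OF W_measurable Pot_measurable[OF k(1)]])
  obtain C where C: "\<And>x. \<bar>p x\<bar> \<le> C" using p by (auto simp: bmeas_def)
  have dC: "\<bar>d x\<bar> \<le> C + 2 * (LINT z|UI. \<bar>k z\<bar>)" for x
    using C[of x] Pot_abs[OF k(1), of "W x"] unfolding d_def by linarith
  have di: "integrable UI d" by (rule integrable_UI_bounded[OF borel_measurable_UI[OF dm] dC])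
  have g: "testg g" unfolding testg_def
  proof (intro conjI)
    show "g \<in> borel_measurable borel" using dm unfolding g_def by measurable
    have "\<bar>g x\<bar> \<le> C + 2 * (LINT z|UI. \<bar>k z\<bar>) + \<bar>b\<bar>" for x using dC[of x] unfolding g_def by linarith
    then show "\<exists>C. \<forall>x. \<bar>g x\<bar> \<le> C" by blast
    show "(LINT x|UI. g x) = 0" unfolding g_def using di by (simp add: b_def)
  qed
  note gi = testg_integrable[OF g]
  have "(LINT x|UI. d x * g x) = (LINT x|UI. p x * g x) - (LINT x|UI. g x * Pot k (W x))"
    using testg_mult[OF g pi] mult_Pot_integrable[OF gi k(1)]
    by (subst Bochner_Integration.integral_diff[symmetric]) (auto simp: d_def algebra_simps)
  also have "\<dots> = 0" using w g Pot_symmetric[OF k(1) gi] by (simp add: weakL_def)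
  finally have "(LINT x|UI. d x * g x) = 0" .
  moreover have "(LINT x|UI. (g x)\<^sup>2) = (LINT x|UI. d x * g x - b * g x)"
    by (simp add: g_def power2_eq_square algebra_simps)
  moreover have "\<dots> = (LINT x|UI. d x * g x) - b * (LINT x|UI. g x)"
    using testg_mult[OF g di] gi by simp
  ultimately have "L2n g = 0" using g by (simp add: L2n_def testg_def)
  moreover have "sqint g" using g by (auto simp: testg_def intro: sqint_bounded borel_measurable_UI)
  ultimately have "AE x in UI. g x = 0" by (intro L2n_zero_AE)
  then have "AE x in UI. p x = b + Pot k (W x)" by eventually_elim (simp add: g_def d_def)
  then show ?thesis by (rule that)
qed

text \<open>
  The oscillation of a function on the unit interval is at most the \<open>L\<^sup>2\<close> norm of its derivative, which
  the energy identity evaluates.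
\<close>

lemma Pot_osc:
  assumes k: "integrable UI k"
  shows "(Pot k t - Pot k s)\<^sup>2 \<le> - (LINT x|UI. k x * Pot k (W x))"
proof -
  have sq: "sqint (dPot k)" by (rule sqint_bounded[OF dPot_measurable[OF k] dPot_abs[OF k]])
  have "\<bar>Pot k t - Pot k s\<bar> \<le> (LINT r|UI. \<bar>dPot k r\<bar>)"
    unfolding Pot_def by (rule prim_diff_le_L1[OF dPot_integrable[OF k]])
  also have "\<dots> \<le> L2n (dPot k)" by (rule L1_le_L2[OF sq])
  finally have "\<bar>Pot k t - Pot k s\<bar>\<^sup>2 \<le> (L2n (dPot k))\<^sup>2" by (rule power_mono) simp
  also have "\<dots> = - (LINT x|UI. k x * Pot k (W x))"
    unfolding L2n_sq using energy_form[OF k k] by (simp add: power2_eq_square)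
  finally show ?thesis by simp
qed

lemma energy_nonpos: "integrable UI k \<Longrightarrow> (LINT x|UI. k x * Pot k (W x)) \<le> 0"
  using Pot_osc[of k 0 0] by simp

text \<open>
  If \<open>L p = k\<close>, this is the continuous function of \<open>s = W x\<close> that represents \<open>p\<close>; the constant is fixed by
  prescribing the mean \<open>m\<close> of \<open>p\<close>, since \<open>Pot k\<close> is normalized at 0 instead.
\<close>

definition lift :: "real \<Rightarrow> (real \<Rightarrow> real) \<Rightarrow> real \<Rightarrow> real" where
  "lift m k s = m + Pot k s - (LINT x|UI. Pot k (W x))"

lemma weakL_lift:
  assumes p: "bmeas p" and w: "weakL p k"
  shows "AE x in UI. p x = lift (LINT x|UI. p x) k (W x)"
    and "(LINT x|UI. k x * p x) = (LINT x|UI. k x * Pot k (W x))"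
proof -
  have k: "integrable UI k" "(LINT x|UI. k x) = 0" and pi: "integrable UI p" using w by (auto simp: weakL_def)
  obtain b where b: "AE x in UI. p x = b + Pot k (W x)" using weakL_representation[OF p w] .
  have m: "p \<in> borel_measurable UI" "k \<in> borel_measurable UI" using pi k by auto
  have "(LINT x|UI. p x) = (LINT x|UI. b + Pot k (W x))"
    by (rule integral_cong_AE[OF _ _ b]) (use m Pot_W_measurable[OF k(1)] in measurable)
  also have "\<dots> = b + (LINT x|UI. Pot k (W x))" using Pot_W_integrable[OF k(1)] by simp
  finally have "b = (LINT x|UI. p x) - (LINT x|UI. Pot k (W x))" by simp
  note bm = this
  show "AE x in UI. p x = lift (LINT x|UI. p x) k (W x)"
    using b by eventually_elim (simp add: lift_def bm)
  have "(LINT x|UI. k x * p x) = (LINT x|UI. b * k x + k x * Pot k (W x))"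
  proof (rule integral_cong_AE)
    show "AE x in UI. k x * p x = b * k x + k x * Pot k (W x)" using b by eventually_elim (simp add: algebra_simps)
  qed (use m Pot_W_measurable[OF k(1)] in measurable)
  also have "\<dots> = (LINT x|UI. k x * Pot k (W x))" using k mult_Pot_integrable[OF k(1) k(1)] by simp
  finally show "(LINT x|UI. k x * p x) = (LINT x|UI. k x * Pot k (W x))" .
qed

lemma weakL_nonpos: "bmeas p \<Longrightarrow> weakL p k \<Longrightarrow> (LINT x|UI. k x * p x) \<le> 0"
  using weakL_lift(2) energy_nonpos by (simp add: weakL_def)

lemma lift_sup:
  assumes k: "integrable UI k" and s: "s \<in> {0..1}"
  shows "(lift m k s - m)\<^sup>2 \<le> - (LINT x|UI. k x * Pot k (W x))"
proof -
  define E where "E = - (LINT x|UI. k x * Pot k (W x))"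
  have E0: "E \<ge> 0" using energy_nonpos[OF k] by (simp add: E_def)
  have *: "\<bar>Pot k s - Pot k (W x)\<bar> \<le> sqrt E" for x
    using real_sqrt_le_mono[OF Pot_osc[OF k, of s "W x"]] by (simp add: E_def)
  have "lift m k s - m = (LINT x|UI. Pot k s - Pot k (W x))"
    using Pot_W_integrable[OF k] by (simp add: lift_def)
  also have "\<bar>\<dots>\<bar> \<le> (LINT x|UI. \<bar>Pot k s - Pot k (W x)\<bar>)" by simp
  also have "\<dots> \<le> (LINT x|UI. sqrt E)"
    using Pot_W_integrable[OF k] * by (intro integral_mono) auto
  finally have "\<bar>lift m k s - m\<bar> \<le> sqrt E" by simp
  then have "\<bar>lift m k s - m\<bar>\<^sup>2 \<le> (sqrt E)\<^sup>2" by (rule power_mono) simp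
  then show ?thesis using E0 by (simp add: E_def)
qed

text \<open>
  The estimate that turns \<open>L\<^sup>2\<close> control into uniform control: the energy \<open>- \<integral> k p\<close> bounds the square
  of the oscillation, and Cauchy-Schwarz separates \<open>k\<close> from \<open>p\<close>.
\<close>

lemma lift_sup_L2:
  assumes p: "bmeas p" and w: "weakL p k" and k2: "sqint k" and s: "s \<in> {0..1}"
  shows "(lift (LINT x|UI. p x) k s - (LINT x|UI. p x))\<^sup>2 \<le> L2n k * L2n p"
proof -
  have k: "integrable UI k" using w by (auto simp: weakL_def)
  have "(lift (LINT x|UI. p x) k s - (LINT x|UI. p x))\<^sup>2 \<le> - (LINT x|UI. k x * p x)"
    using lift_sup[OF k s] weakL_lift(2)[OF p w] by simp
  also have "\<dots> \<le> L2n k * L2n p" using L2_Cauchy_Schwarz[OF k2 bmeas_sqint[OF p]] by linarith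
  finally show ?thesis .
qed

lemma lift_Lipschitz:
  assumes "sqint k" shows "\<bar>lift m k t - lift m k s\<bar> \<le> 2 * L2n k * \<bar>t - s\<bar>"
proof -
  have "\<bar>lift m k t - lift m k s\<bar> \<le> 2 * (LINT z|UI. \<bar>k z\<bar>) * \<bar>t - s\<bar>"
    using Pot_Lipschitz[OF sqint_integrable[OF assms], of t s] by (simp add: lift_def)
  also have "\<dots> \<le> 2 * L2n k * \<bar>t - s\<bar>"
    using L1_le_L2[OF assms] by (intro mult_right_mono) auto
  finally show ?thesis .
qed

text \<open>
  Zero energy makes \<open>Gam k\<close> constant almost everywhere in \<open>s\<close>. The gaps in the range of \<open>W\<close> do not
  matter: approaching \<open>W x\<close> from the right by points where \<open>Gam k\<close> has that constant value recovers the
  primitive of \<open>k\<close> at \<open>x\<close>, because \<open>W\<close> is strictly increasing. So the primitive of \<open>k\<close> is constant, and it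
  vanishes at 0.
\<close>

lemma weakL_0_imp_0:
  assumes k: "bmeas k" and w: "weakL (\<lambda>_. 0) k"
  shows "AE x in UI. k x = 0"
proof -
  have ki: "integrable UI k" "(LINT x|UI. k x) = 0" using w by (auto simp: weakL_def)
  have b0: "bmeas (\<lambda>_. 0)" by (auto simp: bmeas_def)
  have "(LINT x|UI. k x * Pot k (W x)) = 0"
    using weakL_lift(2)[OF b0 w] by simp
  then have "L2n (dPot k) = 0"
    using energy_form[OF ki(1) ki(1)] by (simp add: L2n_def power2_eq_square)
  then have d0: "AE s in UI. dPot k s = 0"
    by (intro L2n_zero_AE sqint_bounded[OF dPot_measurable[OF ki(1)] dPot_abs[OF ki(1)]])
  define c where "c = (LINT r|UI. Gam k r)"
  have Gc: "AE s in UI. Gam k s = c" using d0 by eventually_elim (simp add: dPot_def c_def)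
  have pc: "prim k x = c" if x: "x \<in> {0..<1}" for x
  proof -
    have Wx: "W x \<in> {0..<1}" using x W_mono[of 0 x] W_strict[THEN strict_monoD, of x 1] W_0 W_1 by auto
    \<comment> \<open>points of the full-measure set accumulate at \<open>W x\<close> from the right\<close>
    have ex: "\<exists>s. W x < s \<and> s < W x + (1 - W x) / real (Suc n) \<and> Gam k s = c" for n
    proof (rule ccontr)
      assume "\<not> ?thesis"
      then have no: "\<And>s. W x < s \<Longrightarrow> s < W x + (1 - W x) / real (Suc n) \<Longrightarrow> Gam k s \<noteq> c" by blast
      let ?I = "{W x<..<W x + (1 - W x) / real (Suc n)}"
      have le1: "W x + (1 - W x) / real (Suc n) \<le> 1"
      proof -
        have "(1 - W x) / real (Suc n) \<le> (1 - W x) / 1" using Wx by (intro divide_left_mono) auto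
        then show ?thesis by simp
      qed
      have "AE s in lborel. s \<notin> ?I"
        using Gc[unfolded AE_UI_iff]
      proof eventually_elim
        case (elim s)
        then show ?case using no[of s] le1 Wx by auto
      qed
      then have "emeasure lborel ?I = 0"
        by (subst (asm) AE_iff_measurable[of ?I]) auto
      moreover have "emeasure lborel ?I > 0" using Wx by (subst emeasure_lborel_Ioo) auto
      ultimately show False by simp
    qed
    then obtain s where s: "\<And>n. W x < s n" "\<And>n. s n < W x + (1 - W x) / real (Suc n)" "\<And>n. Gam k (s n) = c"
      by metis
    have lim: "s \<longlonglongrightarrow> W x"
    proof (rule tendsto_sandwich[where f="\<lambda>_. W x"])
      show "(\<lambda>n. W x + (1 - W x) / real (Suc n)) \<longlonglongrightarrow> W x"
        using tendsto_add[OF tendsto_const[of "W x"] LIMSEQ_Suc[OF lim_const_over_n[of "1 - W x"]]] by simp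
    qed (use s in \<open>auto intro: less_imp_le always_eventually\<close>)
    have "(\<lambda>n. Gam k (s n)) \<longlonglongrightarrow> (LINT z|UI. k z * indicator {..x} z)"
      unfolding Gam_def
    proof (rule integral_dominated_convergence[where w="\<lambda>z. \<bar>k z\<bar>"])
      show "AE z in UI. (\<lambda>n. k z * indicator {..<s n} (W z)) \<longlonglongrightarrow> k z * indicator {..x} z"
      proof (rule AE_I2)
        fix z
        have "eventually (\<lambda>n. k z * indicator {..<s n} (W z) = k z * indicator {..x} z) sequentially"
        proof (cases "z \<le> x")
          case True
          have "W z < s n" for n by (rule order.strict_trans1[OF W_mono[OF True] s(1)])
          then show ?thesis using True by (intro always_eventually) (auto simp: indicator_def)
        next
          case False
          then have "W x < W z" by simp
          from order_tendstoD(2)[OF lim this] show ?thesis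
            by eventually_elim (use False in \<open>auto simp: indicator_def\<close>)
        qed
        then show "(\<lambda>n. k z * indicator {..<s n} (W z)) \<longlonglongrightarrow> k z * indicator {..x} z"
          by (rule tendsto_eventually)
      qed
      show "(\<lambda>z. k z * indicator {..x} z) \<in> borel_measurable UI"
        using borel_measurable_integrable[OF integrable_indicator_UI[OF ki(1), of "{..x}"]] by (simp add: mult.commute)
      show "(\<lambda>z. k z * indicator {..<s n} (W z)) \<in> borel_measurable UI" for n
        by (rule borel_measurable_integrable[OF Gam_int[OF ki(1)]])
      show "integrable UI (\<lambda>z. \<bar>k z\<bar>)" using ki(1) by simp
    qed (auto simp: indicator_def)
    then have "(\<lambda>_ :: nat. c) \<longlonglongrightarrow> prim k x" by (simp add: s(3) prim_def mult.commute)
    then show ?thesis by (simp add: LIMSEQ_const_iff)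
  qed
  have "c = 0" using pc[of 0] prim_0[OF ki(1)] by simp
  then show ?thesis using pc by (intro prim_eq_0_imp_AE_0[OF ki(1)]) auto
qed

end

context driver
begin

section \<open>The domain of the operator\<close>

definition WI :: "real measure" where "WI = restrict_space (interval_measure W) {0<..1}"

lemma IM_Ioc: "u \<le> v \<Longrightarrow> measure (interval_measure W) {u<..v} = W v - W u"
  "u \<le> v \<Longrightarrow> emeasure (interval_measure W) {u<..v} = ennreal (W v - W u)"
  by (auto intro!: measure_interval_measure_Ioc emeasure_interval_measure_Ioc W_right)

lemma space_WI [simp]: "space WI = {0<..1}" by (simp add: WI_def space_restrict_space)

lemma measurable_ident_WI [measurable]: "(\<lambda>x. x) \<in> borel_measurable WI"
  unfolding WI_def by (intro measurable_restrict_space1) (simp cong: measurable_cong_sets)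

lemma borel_measurable_WI: "f \<in> borel_measurable borel \<Longrightarrow> f \<in> borel_measurable WI"
  unfolding WI_def by (intro measurable_restrict_space1) (simp cong: measurable_cong_sets)

lemma prob_WI: "prob_space WI"
proof
  show "emeasure WI (space WI) = 1"
    unfolding WI_def by (subst emeasure_restrict_space) (auto simp: space_restrict_space IM_Ioc W_0 W_1)
qed

sublocale WI: prob_space WI by (rule prob_WI)

sublocale WU: pair_prob_space WI UI ..

lemma LINT_WI: assumes "A \<subseteq> {0<..1}"
  shows "(LINT y:A|interval_measure W. f y :: real) = (LINT y|WI. indicator A y * f y)"
  unfolding WI_def set_lebesgue_integral_def using assms
  by (subst integral_restrict_space) (auto intro!: Bochner_Integration.integral_cong simp: indicator_def)

lemma measure_WI: assumes "A \<subseteq> {0<..1}" "A \<in> sets borel" shows "(LINT y|WI. indicator A y) = measure (interval_measure W) A"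
proof -
  have "(LINT y|WI. indicator A y :: real) = (LINT y:A|interval_measure W. 1)"
    using LINT_WI[OF assms(1), of "\<lambda>_. 1"] by simp
  also have "\<dots> = measure (interval_measure W) A" using assms by (simp add: set_lebesgue_integral_def)
  finally show ?thesis .
qed

lemma measure_Icc_isCont:
  assumes z: "0 < z" "z \<le> x" and c: "isCont W z"
  shows "measure (interval_measure W) {z..x} = W x - W z"
proof (rule antisym)
  let ?N = "interval_measure W"
  have fm: "{u<..x} \<in> fmeasurable ?N" for u
    by (cases "u \<le> x") (auto intro!: fmeasurableI simp: IM_Ioc)
  have le: "measure ?N {z..x} \<le> W x - W u" if "u < z" for u
  proof -
    have "measure ?N {z..x} \<le> measure ?N {u<..x}"
      by (rule measure_mono_fmeasurable) (use that fm in auto)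
    then show ?thesis using IM_Ioc(1)[of u x] that z by simp
  qed
  show "measure ?N {z..x} \<le> W x - W z"
  proof (rule field_le_epsilon)
    fix e :: real assume "e > 0"
    with c obtain d where d: "d > 0" "\<And>y. dist y z < d \<Longrightarrow> dist (W y) (W z) < e"
      unfolding continuous_at_eps_delta by blast
    have "dist (z - d / 2) z < d" using d(1) by (simp add: dist_real_def)
    from d(2)[OF this] have "W z - W (z - d / 2) < e" by (simp add: dist_real_def)
    then show "measure ?N {z..x} \<le> W x - W z + e" using le[of "z - d / 2"] d(1) by simp
  qed
  have fz: "{z..x} \<in> fmeasurable ?N"
    by (rule fmeasurableI2[OF fm[of "z - 1"]]) auto
  have "measure ?N {z<..x} \<le> measure ?N {z..x}"
    by (rule measure_mono_fmeasurable) (use fz in auto)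
  then show "W x - W z \<le> measure ?N {z..x}" using IM_Ioc(1)[of z x] z by simp
qed

lemma AE_isCont_W: "AE z in UI. isCont W z"
proof -
  have "mono W" by (simp add: mono_def W_mono)
  then have "countable {a. \<not> isCont W a}" by (rule mono_ctble_discont)
  then have "{a. \<not> isCont W a} \<in> null_sets lborel" by (rule countable_imp_null_set_lborel)
  then have "AE z in lborel. z \<notin> {a. \<not> isCont W a}" by (rule AE_not_in)
  then show ?thesis unfolding AE_UI_iff by eventually_elim simp
qed

lemma LINT_UI_Ioc: assumes "u \<in> {0..1}" "v \<in> {0..1}"
  shows "(LINT r|UI. indicator {u<..v} r) = max 0 (v - u)"
proof -
  have "(LINT r|UI. indicator {u<..v} r :: real) = (LINT r:{0..1}|lborel. indicator {u<..v} r)"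
    by (rule LINT_UI[symmetric])
  also have "\<dots> = (LINT r|lborel. indicator {u<..v} r)"
    unfolding set_lebesgue_integral_def using assms
    by (intro Bochner_Integration.integral_cong) (auto simp: indicator_def)
  also have "\<dots> = max 0 (v - u)" by (cases "u \<le> v") auto
  finally show ?thesis .
qed

lemma prim_Gam:
  assumes g: "integrable UI g" and x: "x \<in> {0..1}"
  shows "prim (Gam g) (W x) = (LINT z|UI. g z * max 0 (W x - W z))"
proof -
  have "prim (Gam g) (W x) = (LINT r|UI. LINT z|UI. g z * (indicator {..<r} (W z) * indicator {..W x} r))"
    unfolding prim_def Gam_def
    by (intro Bochner_Integration.integral_cong refl)
      (simp add: mult.assoc[symmetric] mult.commute[of "indicator {..W x} _"])
  also have "\<dots> = (LINT z|UI. g z * (LINT r|UI. indicator {..<r} (W z) * indicator {..W x} r))"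
  proof (rule Fubini_UI(1)[OF g, where C=1, symmetric])
    have "(\<lambda>p. indicator {..W x} (snd p) :: real) \<in> borel_measurable (UI \<Otimes>\<^sub>M UI)"
      by (rule measurable_compose[OF measurable_snd]) (rule borel_measurable_UI, measurable)
    then show "(\<lambda>p. indicator {..<snd p} (W (fst p)) * indicator {..W x} (snd p) :: real) \<in> borel_measurable (UI \<Otimes>\<^sub>M UI)"
      using ind_measurable(2) by measurable
  qed (auto simp: indicator_def)
  also have "\<dots> = (LINT z|UI. g z * max 0 (W x - W z))"
  proof (intro Bochner_Integration.integral_cong refl arg_cong2[where f="(*)"])
    fix z assume "z \<in> space UI"
    then have "(LINT r|UI. indicator {W z<..W x} r) = max 0 (W x - W z)"
      using x by (intro LINT_UI_Ioc W_unit) auto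
    moreover have "(LINT r|UI. indicator {W z<..W x} r) = (LINT r|UI. indicator {..<r} (W z) * indicator {..W x} r :: real)"
      by (intro Bochner_Integration.integral_cong) (auto simp: indicator_def)
    ultimately show "(LINT r|UI. indicator {..<r} (W z) * indicator {..W x} r) = max 0 (W x - W z)" by simp
  qed
  finally show ?thesis .
qed

text \<open>
  The outer integral against \<open>dW\<close> becomes an integral in \<open>s\<close> after Fubini: both sides are
  \<open>\<integral> g(z) max 0 (W x - W z) dz\<close>. At a fixed \<open>z\<close> the \<open>dW\<close>-mass of \<open>[z,x]\<close> is \<open>W x - W z\<close> unless \<open>z\<close> is an
  atom, and there are only countably many atoms.
\<close>

lemma LINT_prim_dW:
  assumes g: "integrable UI g" and x: "x \<in> {0..1}"
  shows "(LINT y:{0<..x}|interval_measure W. prim g y) = prim (Gam g) (W x)"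
proof -
  have [measurable]: "g \<in> borel_measurable UI" using g by auto
  have m: "(\<lambda>p. indicator {..x} (fst p) * (indicator {..fst p} (snd p) * g (snd p))) \<in> borel_measurable (WI \<Otimes>\<^sub>M UI)"
  proof -
    have f: "fst \<in> borel_measurable (WI \<Otimes>\<^sub>M UI)" by (rule measurable_compose[OF measurable_fst measurable_ident_WI])
    have s: "snd \<in> borel_measurable (WI \<Otimes>\<^sub>M UI)" by (rule measurable_compose[OF measurable_snd measurable_ident_UI])
    have [measurable]: "(\<lambda>p. g (snd p)) \<in> borel_measurable (WI \<Otimes>\<^sub>M UI)" by measurable
    have "(\<lambda>p. of_bool (fst p \<le> x) * (of_bool (snd p \<le> fst p) * g (snd p))) \<in> borel_measurable (WI \<Otimes>\<^sub>M UI)"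
      using f s unfolding of_bool_def by measurable
    then show ?thesis by (simp add: indicator_def of_bool_def cong: if_cong)
  qed
  have i: "integrable (WI \<Otimes>\<^sub>M UI) (\<lambda>p. indicator {..x} (fst p) * (indicator {..fst p} (snd p) * g (snd p)))"
  proof (rule Bochner_Integration.integrable_bound[OF _ m])
    have "integrable (WI \<Otimes>\<^sub>M UI) (case_prod (\<lambda>y z. g z))"
      using g by (intro WU.Fubini_integrable) auto
    then show "integrable (WI \<Otimes>\<^sub>M UI) (\<lambda>p. g (snd p))" by (simp add: case_prod_beta')
  qed (auto simp: indicator_def)
  have "(LINT y:{0<..x}|interval_measure W. prim g y) = (LINT y|WI. indicator {0<..x} y * prim g y)"
    using x by (intro LINT_WI) auto
  also have "\<dots> = (LINT y|WI. LINT z|UI. indicator {..x} y * (indicator {..y} z * g z))"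
    by (intro Bochner_Integration.integral_cong) (auto simp: prim_def indicator_def)
  also have "\<dots> = (LINT z|UI. LINT y|WI. indicator {..x} y * (indicator {..y} z * g z))"
    using WU.Fubini_integral[of "\<lambda>y z. indicator {..x} y * (indicator {..y} z * g z)"] i
    by (simp add: case_prod_beta')
  also have "\<dots> = (LINT z|UI. g z * (LINT y|WI. indicator {..x} y * indicator {z..} y))"
    by (auto simp: indicator_def intro!: Bochner_Integration.integral_cong)
       (simp add: integral_mult_right_zero[symmetric] mult_ac del: integral_mult_right_zero)
  also have "\<dots> = (LINT z|UI. g z * max 0 (W x - W z))"
  proof (rule integral_cong_AE)
    show "(\<lambda>z. g z * max 0 (W x - W z)) \<in> borel_measurable UI"
      using borel_measurable_UI[OF W_measurable] by measurable
    have "(\<lambda>z. LINT y|WI. indicator {..x} y * indicator {z..} y :: real) \<in> borel_measurable UI"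
    proof (rule WI.borel_measurable_lebesgue_integral)
      have f: "snd \<in> borel_measurable (UI \<Otimes>\<^sub>M WI)" by (rule measurable_compose[OF measurable_snd measurable_ident_WI])
      have s: "fst \<in> borel_measurable (UI \<Otimes>\<^sub>M WI)" by (rule measurable_compose[OF measurable_fst measurable_ident_UI])
      have "(\<lambda>p. of_bool (snd p \<le> x) * of_bool (fst p \<le> snd p) :: real) \<in> borel_measurable (UI \<Otimes>\<^sub>M WI)"
        using f s unfolding of_bool_def by measurable
      then show "(\<lambda>(z, y). indicator {..x} y * indicator {z..} y :: real) \<in> borel_measurable (UI \<Otimes>\<^sub>M WI)"
        by (simp add: indicator_def of_bool_def case_prod_beta' cong: if_cong)
    qed
    then show "(\<lambda>z. g z * (LINT y|WI. indicator {..x} y * indicator {z..} y)) \<in> borel_measurable UI"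
      by measurable
    have "AE z in UI. z \<in> {0..1}" by (rule AE_I2) simp
    then show "AE z in UI. g z * (LINT y|WI. indicator {..x} y * indicator {z..} y) = g z * max 0 (W x - W z)"
      using AE_isCont_W AE_UI_neq[of 0]
    proof eventually_elim
      case (elim z)
      then have z0: "0 < z" by simp
      have "(LINT y|WI. indicator {..x} y * indicator {z..} y :: real) = (LINT y|WI. indicator {z..x} y)"
        by (intro Bochner_Integration.integral_cong) (auto simp: indicator_def)
      also have "\<dots> = measure (interval_measure W) {z..x}" using z0 x by (intro measure_WI) auto
      also have "\<dots> = max 0 (W x - W z)"
        using measure_Icc_isCont[OF z0 _ elim(2), of x] W_mono[of x z] W_mono[of z x] by (cases "z \<le> x") auto
      finally show ?case by simp
    qed
  qed
  also have "\<dots> = prim (Gam g) (W x)" by (rule prim_Gam[OF g x, symmetric])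
  finally show ?thesis .
qed

lemma prim_const: "s \<in> {0..1} \<Longrightarrow> prim (\<lambda>_. c) s = c * s"
proof -
  assume s: "s \<in> {0..1}"
  have "(LINT r|UI. indicator {..s} r) = (LINT r|UI. indicator {0<..s} r :: real)"
  proof (rule integral_cong_AE)
    show "AE r in UI. indicator {..s} r = (indicator {0<..s} r :: real)"
      using AE_UI_neq[of 0] AE_space[of UI] by eventually_elim (auto simp: indicator_def)
  qed (auto intro: borel_measurable_UI)
  also have "\<dots> = s" using LINT_UI_Ioc[of 0 s] s by simp
  finally show ?thesis by (simp add: prim_def)
qed

lemma Pot_W_eq:
  assumes g: "integrable UI g" and x: "x \<in> {0..1}"
  shows "Pot g (W x) = - (LINT r|UI. Gam g r) * W x + (LINT y:{0<..x}|interval_measure W. prim g y)"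
proof -
  have "Pot g (W x) = prim (\<lambda>s. 1 * Gam g s + (- 1) * (LINT r|UI. Gam g r)) (W x)"
    unfolding Pot_def by (simp add: dPot_def[abs_def])
  also have "\<dots> = 1 * prim (Gam g) (W x) + (- 1) * prim (\<lambda>_. LINT r|UI. Gam g r) (W x)"
    by (rule prim_add[OF Gam_integrable[OF g]]) simp
  finally have "Pot g (W x) = prim (Gam g) (W x) - prim (\<lambda>_. LINT r|UI. Gam g r) (W x)" by simp
  then show ?thesis using prim_const[OF W_unit[OF x]] LINT_prim_dW[OF g x] by simp
qed

lemma set_LINT_prim:
  assumes "x \<le> 1"
  shows "(LINT y:{0<..x}|interval_measure W. (LINT z:{0..y}|lborel. g z)) = (LINT y:{0<..x}|interval_measure W. prim g y)"
  by (rule set_lebesgue_integral_cong) (use assms in \<open>auto simp: prim_eq\<close>)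

text \<open>
  Over a short interval the increment of \<open>\<psi>\<close> is the integral of \<open>c + prim g\<close> against \<open>dW\<close>, and \<open>prim g\<close> is
  continuous; so the difference quotient with respect to \<open>W\<close> converges at every interior point, atoms
  included.
\<close>

lemma W_deriv_of_representation:
  assumes g: "integrable UI g"
    and rep: "\<And>x. x \<in> {0..1} \<Longrightarrow> \<psi> x = b + c * W x + (LINT y:{0<..x}|interval_measure W. prim g y)"
    and x: "x \<in> {0<..<1}"
  shows "W_deriv W \<psi> x = c + prim g x"
proof -
  obtain C where C: "\<And>y. \<bar>prim g y\<bar> \<le> C" using prim_abs_bound[OF g] by blast
  have int: "integrable WI (\<lambda>y. indicator A y * prim g y)" if "A \<in> sets borel" for A
  proof (rule WI.integrable_const_bound[where B=C])
    show "AE y in WI. norm (indicator A y * prim g y) \<le> C"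
      using C order_trans[OF abs_ge_zero C] by (intro AE_I2) (auto simp: indicator_def)
    have "(\<lambda>y. indicator A y * prim g y) \<in> borel_measurable borel"
      using that prim_measurable[OF g] by measurable
    then show "(\<lambda>y. indicator A y * prim g y) \<in> borel_measurable WI" by (rule borel_measurable_WI)
  qed
  have near: "\<bar>(\<psi> v - \<psi> u) - (c + prim g x) * (W v - W u)\<bar> \<le> s * (W v - W u)"
    if uv: "0 \<le> u" "u \<le> v" "v \<le> 1" and s: "\<And>y. u < y \<Longrightarrow> y \<le> v \<Longrightarrow> \<bar>prim g y - prim g x\<bar> \<le> s" for u v s
  proof -
    have A: "{0<..v} \<subseteq> {0<..1}" "{0<..u} \<subseteq> {0<..1}" "{u<..v} \<subseteq> {0<..1}" using uv by auto
    have iI: "integrable WI (indicator {u<..v} :: real \<Rightarrow> real)"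
      by (rule WI.integrable_const_bound[where B=1]) (auto intro: borel_measurable_WI simp: indicator_def)
    have m: "(LINT y|WI. indicator {u<..v} y) = W v - W u"
      using measure_WI[OF A(3)] IM_Ioc(1)[OF uv(2)] by simp
    have "\<psi> v - \<psi> u = c * (W v - W u) + ((LINT y|WI. indicator {0<..v} y * prim g y) - (LINT y|WI. indicator {0<..u} y * prim g y))"
      using uv LINT_WI[OF A(1)] LINT_WI[OF A(2)] by (simp add: rep algebra_simps)
    also have "(LINT y|WI. indicator {0<..v} y * prim g y) - (LINT y|WI. indicator {0<..u} y * prim g y)
       = (LINT y|WI. indicator {u<..v} y * prim g y)"
    proof -
      have "(LINT y|WI. indicator {0<..v} y * prim g y) - (LINT y|WI. indicator {0<..u} y * prim g y)
         = (LINT y|WI. indicator {0<..v} y * prim g y - indicator {0<..u} y * prim g y)"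
        by (rule Bochner_Integration.integral_diff[symmetric]) (rule int, simp)+
      also have "\<dots> = (LINT y|WI. indicator {u<..v} y * prim g y)"
        by (intro Bochner_Integration.integral_cong refl) (use uv in \<open>auto simp: indicator_def\<close>)
      finally show ?thesis .
    qed
    finally have "(\<psi> v - \<psi> u) - (c + prim g x) * (W v - W u)
        = (LINT y|WI. indicator {u<..v} y * prim g y) - prim g x * (W v - W u)"
      by (simp add: algebra_simps)
    also have "\<dots> = (LINT y|WI. indicator {u<..v} y * prim g y) - prim g x * (LINT y|WI. indicator {u<..v} y)"
      by (simp only: m)
    also have "\<dots> = (LINT y|WI. indicator {u<..v} y * prim g y) - (LINT y|WI. prim g x * indicator {u<..v} y)"
      by simp
    also have "\<dots> = (LINT y|WI. indicator {u<..v} y * prim g y - prim g x * indicator {u<..v} y)"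
      by (rule Bochner_Integration.integral_diff[symmetric]) (use int[of "{u<..v}"] iI in auto)
    also have "\<dots> = (LINT y|WI. indicator {u<..v} y * (prim g y - prim g x))"
      by (simp only: right_diff_distrib mult.commute[of "prim g x"])
    finally have "\<bar>(\<psi> v - \<psi> u) - (c + prim g x) * (W v - W u)\<bar>
        = \<bar>LINT y|WI. indicator {u<..v} y * (prim g y - prim g x)\<bar>" by simp
    also have "\<dots> \<le> (LINT y|WI. norm (indicator {u<..v} y * (prim g y - prim g x)))"
      unfolding real_norm_def by (rule integral_abs_bound)
    also have "\<dots> \<le> (LINT y|WI. s * indicator {u<..v} y)"
    proof (rule integral_mono)
      have "integrable WI (\<lambda>y. indicator {u<..v} y * prim g y - prim g x * indicator {u<..v} y)"
        using int[of "{u<..v}"] iI by simp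
      then have "integrable WI (\<lambda>y. indicator {u<..v} y * (prim g y - prim g x))"
        by (simp only: right_diff_distrib mult.commute[of "prim g x"])
      then show "integrable WI (\<lambda>y. norm (indicator {u<..v} y * (prim g y - prim g x)))" by (rule integrable_norm)
      show "integrable WI (\<lambda>y. s * indicator {u<..v} y)" using iI by (intro integrable_mult_right)
    qed (use s in \<open>auto simp: indicator_def\<close>)
    also have "\<dots> = s * (W v - W u)" using m by simp
    finally show ?thesis .
  qed
  have "(\<lambda>e. (\<psi> (x + e) - \<psi> x) / (W (x + e) - W x)) \<midarrow>0\<rightarrow> c + prim g x"
  proof (rule LIM_I)
    fix r :: real assume r: "0 < r"
    have "isCont (prim g) x" using continuous_prim[OF g] by (simp add: continuous_on_eq_continuous_at)
    moreover have "r / 2 > 0" using r by simp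
    ultimately obtain d where d: "d > 0" "\<And>y. \<bar>y - x\<bar> < d \<Longrightarrow> \<bar>prim g y - prim g x\<bar> < r / 2"
      unfolding continuous_at_eps_delta dist_real_def by blast
    let ?d = "min d (min x (1 - x))"
    have "norm ((\<psi> (x + e) - \<psi> x) / (W (x + e) - W x) - (c + prim g x)) < r"
      if e: "e \<noteq> 0" "norm (e - 0) < ?d" for e
    proof -
      have ed: "\<bar>e\<bar> < d" "\<bar>e\<bar> < x" "\<bar>e\<bar> < 1 - x" using e(2) by auto
      have ne: "W (x + e) - W x \<noteq> 0" using W_less_iff[of "x + e" x] W_less_iff[of x "x + e"] e(1) by linarith
      have b: "\<bar>(\<psi> (x + e) - \<psi> x) - (c + prim g x) * (W (x + e) - W x)\<bar> \<le> r / 2 * \<bar>W (x + e) - W x\<bar>"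
      proof (cases "e > 0")
        case True
        have "\<bar>(\<psi> (x + e) - \<psi> x) - (c + prim g x) * (W (x + e) - W x)\<bar> \<le> r / 2 * (W (x + e) - W x)"
          using True ed x by (intro near less_imp_le[OF d(2)]) auto
        then show ?thesis using W_mono[of x "x + e"] True by simp
      next
        case False
        then have "e < 0" using e by simp
        have "\<bar>(\<psi> x - \<psi> (x + e)) - (c + prim g x) * (W x - W (x + e))\<bar> \<le> r / 2 * (W x - W (x + e))"
          using \<open>e < 0\<close> ed x by (intro near less_imp_le[OF d(2)]) auto
        moreover have "(\<psi> x - \<psi> (x + e)) - (c + prim g x) * (W x - W (x + e))
           = - ((\<psi> (x + e) - \<psi> x) - (c + prim g x) * (W (x + e) - W x))" by (simp add: algebra_simps)
        ultimately have "\<bar>(\<psi> (x + e) - \<psi> x) - (c + prim g x) * (W (x + e) - W x)\<bar> \<le> r / 2 * (W x - W (x + e))"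
          by (metis abs_minus_cancel)
        moreover have "\<bar>W (x + e) - W x\<bar> = W x - W (x + e)" using W_mono[of "x + e" x] \<open>e < 0\<close> by simp
        ultimately show ?thesis by simp
      qed
      have "(\<psi> (x + e) - \<psi> x) / (W (x + e) - W x) - (c + prim g x)
         = ((\<psi> (x + e) - \<psi> x) - (c + prim g x) * (W (x + e) - W x)) / (W (x + e) - W x)"
        using ne by (simp add: diff_divide_distrib)
      then have "norm ((\<psi> (x + e) - \<psi> x) / (W (x + e) - W x) - (c + prim g x)) \<le> r / 2"
        using b ne by (simp add: pos_divide_le_eq)
      then show ?thesis using r by simp
    qed
    moreover have "?d > 0" using d(1) x by simp
    ultimately show "\<exists>s>0. \<forall>e. e \<noteq> 0 \<and> norm (e - 0) < s \<longrightarrow>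
        norm ((\<psi> (x + e) - \<psi> x) / (W (x + e) - W x) - (c + prim g x)) < r" by blast
  qed
  then show ?thesis unfolding W_deriv_def by (intro tendsto_Lim) auto
qed

text \<open>
  The compatibility condition on \<open>b\<close>, \<open>c\<close> and \<open>g\<close> says exactly that \<open>c\<close> is the constant that makes the
  potential periodic.
\<close>

lemma dom_W_representation:
  assumes "\<psi> \<in> dom_W W"
  obtains b g where "g \<in> L2T" "(LINT z|UI. g z) = 0" "\<And>x. x \<in> {0..1} \<Longrightarrow> \<psi> x = b + Pot g (W x)"
    "AE x in UI. L_op W \<psi> x = g x" "L_op W \<psi> \<in> borel_measurable UI"
proof -
  from assms obtain g b c where g: "g \<in> L2T"
    and c: "c * W 1 + (LINT y:{0<..1}|interval_measure W. (LINT z:{0..y}|lborel. g z)) = 0"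
    and g0: "(LINT z:{0..1}|lborel. g z) = 0"
    and r: "\<forall>x\<in>{0..1}. \<psi> x = b + c * W x + (LINT y:{0<..x}|interval_measure W. (LINT z:{0..y}|lborel. g z))"
    unfolding dom_W_def by blast
  have sq: "sqint g" using g by (auto simp: L2T_def sqint_def integrable_UI_iff borel_measurable_UI)
  note gi = sqint_integrable[OF sq]
  have rep: "\<psi> x = b + c * W x + (LINT y:{0<..x}|interval_measure W. prim g y)" if "x \<in> {0..1}" for x
    using r that by (simp add: set_LINT_prim)
  have "c = - (LINT r|UI. Gam g r)"
    using c W_1 LINT_prim_dW[OF gi, of 1] by (simp add: set_LINT_prim prim_1)
  then have 1: "\<psi> x = b + Pot g (W x)" if "x \<in> {0..1}" for x
    using rep[OF that] Pot_W_eq[OF gi that] by simp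
  have F: "W_deriv W \<psi> x = c + prim g x" if "x \<in> {0<..<1}" for x
    by (rule W_deriv_of_representation[OF gi rep that])
  have dp: "AE x in UI. deriv (W_deriv W \<psi>) x = g x" "deriv (W_deriv W \<psi>) \<in> borel_measurable UI"
    by (rule deriv_prim[OF gi F], assumption)+
  show ?thesis
    by (rule that[OF g _ 1]) (use g0 dp in \<open>auto simp: LINT_UI L_op_def\<close>)
qed

lemma frac_AE_UI: "AE x in UI. frac x = x"
  using AE_UI_neq[of 1] AE_space[of UI] by eventually_elim (auto simp: frac_eq)

lemma frac_measurable [measurable]: "(frac :: real \<Rightarrow> real) \<in> borel_measurable borel"
  unfolding frac_def[abs_def] by (intro borel_measurable_diff borel_measurable_real_floor) auto

lemma frac_shift: "frac (x + 1 :: real) = frac x"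
  by (simp add: frac_def)

text \<open>
  The converse of the representation: potentials of bounded functions are admissible test functions.
\<close>

lemma dom_W_Pot:
  assumes g: "testg g"
  obtains \<psi> where "\<psi> \<in> dom_W W" "\<And>x. x \<in> {0..1} \<Longrightarrow> \<psi> x = Pot g (W x)"
    "AE x in UI. L_op W \<psi> x = g x" "L_op W \<psi> \<in> borel_measurable UI"
proof -
  define g' where "g' x = g (frac x)" for x
  obtain C where C: "\<And>x. \<bar>g x\<bar> \<le> C" using g by (auto simp: testg_def)
  have gm [measurable]: "g \<in> borel_measurable borel" using g by (simp add: testg_def)
  have g'm [measurable]: "g' \<in> borel_measurable borel" unfolding g'_def by measurable
  have eq: "AE x in UI. g' x = g x" using frac_AE_UI by eventually_elim (simp add: g'_def)
  have sq: "sqint g'" using C by (intro sqint_bounded[where C=C] borel_measurable_UI) (auto simp: g'_def)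
  have L2: "g' \<in> L2T"
    using sq by (auto simp: L2T_def periodic1_def sqint_def integrable_UI_iff g'_def[abs_def] frac_shift)
  note gi = sqint_integrable[OF sq]
  have mean: "(LINT z|UI. g' z) = 0"
    using g eq by (subst integral_cong_AE[where g=g]) (auto simp: testg_def intro: borel_measurable_UI)
  have PP: "Pot g' = Pot g"
  proof -
    have "Gam g' s = Gam g s" for s
      unfolding Gam_def
    proof (rule integral_cong_AE)
      show "AE z in UI. g' z * indicator {..<s} (W z) = g z * indicator {..<s} (W z)"
        using eq by eventually_elim simp
    qed (auto intro!: borel_measurable_UI)
    then have "Gam g' = Gam g" by blast
    then show ?thesis by (simp add: Pot_def dPot_def[abs_def])
  qed
  define \<psi> where "\<psi> x = Pot g (W (frac x))" for x
  have rep1: "\<psi> x = Pot g' (W x)" if "x \<in> {0..1}" for x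
  proof (cases "x = 1")
    case True
    then show ?thesis using Pot_0[OF gi] Pot_1[OF gi] by (simp add: \<psi>_def PP W_0 W_1)
  next
    case False
    then have "frac x = x" using that by (simp add: frac_eq)
    then show ?thesis by (simp add: \<psi>_def PP)
  qed
  define c where "c = - (LINT r|UI. Gam g' r)"
  have rep: "\<psi> x = 0 + c * W x + (LINT y:{0<..x}|interval_measure W. prim g' y)" if "x \<in> {0..1}" for x
    using rep1[OF that] Pot_W_eq[OF gi that] by (simp add: c_def)
  have dom: "\<psi> \<in> dom_W W" unfolding dom_W_def
  proof (intro CollectI conjI bexI[OF _ L2] exI)
    show "periodic1 \<psi>" by (simp add: periodic1_def \<psi>_def frac_shift)
    show "c * W 1 + (LINT y:{0<..1}|interval_measure W. (LINT z:{0..y}|lborel. g' z)) = 0"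
      using W_1 LINT_prim_dW[OF gi, of 1] by (simp add: set_LINT_prim prim_1 c_def)
    show "(LINT z:{0..1}|lborel. g' z) = 0" using mean by (simp add: LINT_UI)
    show "\<forall>x\<in>{0..1}. \<psi> x = 0 + c * W x + (LINT y:{0<..x}|interval_measure W. (LINT z:{0..y}|lborel. g' z))"
      using rep by (simp add: set_LINT_prim)
  qed
  have F: "W_deriv W \<psi> x = c + prim g' x" if "x \<in> {0<..<1}" for x
    by (rule W_deriv_of_representation[OF gi rep that])
  have dp: "AE x in UI. deriv (W_deriv W \<psi>) x = g' x" "deriv (W_deriv W \<psi>) \<in> borel_measurable UI"
    by (rule deriv_prim[OF gi F], assumption)+
  have "AE x in UI. L_op W \<psi> x = g x"
    using dp(1) eq unfolding L_op_def by eventually_elim simp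
  then show ?thesis
    using dom rep1 dp(2) by (intro that[of \<psi>]) (auto simp: PP L_op_def)
qed

lemma dom_W_const: "(\<lambda>_. 1) \<in> dom_W W" "AE x in UI. L_op W (\<lambda>_. 1) x = 0" "L_op W (\<lambda>_. 1) \<in> borel_measurable UI"
proof -
  have z: "integrable UI (\<lambda>_. 0 :: real)" by simp
  have [simp]: "prim (\<lambda>_. 0) y = 0" for y by (simp add: prim_def)
  have rep: "1 = 1 + 0 * W x + (LINT y:{0<..x}|interval_measure W. prim (\<lambda>_. 0) y)" for x by simp
  show "(\<lambda>_. 1) \<in> dom_W W" unfolding dom_W_def
  proof (intro CollectI conjI, simp add: periodic1_def, rule bexI[of _ "\<lambda>_. 0"], rule exI[of _ 1], rule exI[of _ 0])
    show "(\<lambda>_. 0) \<in> L2T" by (simp add: L2T_def periodic1_def set_integrable_def)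
  qed (simp add: set_lebesgue_integral_def)
  have F: "W_deriv W (\<lambda>_. 1) x = 0 + prim (\<lambda>_. 0) x" if "x \<in> {0<..<1}" for x
    by (rule W_deriv_of_representation[OF z _ that]) (rule rep)
  have dp: "AE x in UI. deriv (W_deriv W (\<lambda>_. 1)) x = 0" "deriv (W_deriv W (\<lambda>_. 1)) \<in> borel_measurable UI"
    by (rule deriv_prim[OF z F], assumption)+
  show "AE x in UI. L_op W (\<lambda>_. 1) x = 0" using dp(1) by (simp add: L_op_def)
  show "L_op W (\<lambda>_. 1) \<in> borel_measurable UI" using dp(2) by (simp add: L_op_def)
qed

end

section \<open>Regularity of the given solution\<close>

text \<open>
  For a double time integral this is the average over \<open>[t, t + 2\<sigma>]\<close> with a tent-shaped weight.
\<close>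

definition second_diff :: "real \<Rightarrow> (real \<Rightarrow> real \<Rightarrow> real) \<Rightarrow> real \<Rightarrow> real \<Rightarrow> real" where
  "second_diff \<sigma> X t x = (X (t + 2 * \<sigma>) x - 2 * X (t + \<sigma>) x + X t x) / \<sigma>\<^sup>2"

lemma second_diff_eq: "second_diff \<sigma> X = (\<lambda>t x. 1 / \<sigma>\<^sup>2 * (1 * X (t + 2 * \<sigma>) x + (- 2) * X (t + \<sigma>) x) + 1 / \<sigma>\<^sup>2 * X t x)"
  by (simp add: fun_eq_iff second_diff_def field_simps add_divide_distrib diff_divide_distrib)

lemma traj_second_diff: assumes "traj X \<xi>" "0 \<le> \<sigma>" shows "traj (second_diff \<sigma> X) (second_diff \<sigma> \<xi>)"
proof -
  have 2: "0 \<le> 2 * \<sigma>" using assms(2) by simp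
  show ?thesis unfolding second_diff_eq
    by (rule traj_lin[OF traj_lin[OF traj_shift[OF assms(1) 2] traj_shift[OF assms]] assms(1)])
qed

lemma tint_linear_time:
  assumes "0 \<le> t" shows "tint (\<lambda>r x. r * p x) t x = t\<^sup>2 / 2 * p x"
proof -
  have "(LINT r:{0..t}|lborel. r) = t\<^sup>2 / 2"
  proof -
    have "((\<lambda>x. x) has_integral t\<^sup>2 / 2 - 0\<^sup>2 / 2) {0..t}"
      using assms by (intro fundamental_theorem_of_calculus)
        (auto intro!: derivative_eq_intros simp: has_real_derivative_iff_has_vector_derivative[symmetric])
    then have "integral {0..t} (\<lambda>x. x) = t\<^sup>2 / 2" by (simp add: integral_unique)
    moreover have "(LINT r:{0..t}|lborel. r) = integral {0..t} (\<lambda>x. x)"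
      by (rule set_borel_integral_eq_integral) (rule set_integrable_bounded[where C=t], use assms in auto)
    ultimately show ?thesis by simp
  qed
  then show ?thesis unfolding tint_def set_lebesgue_integral_def
    by (simp add: mult.assoc[symmetric])
qed

lemma prim_parts:
  assumes q: "integrable UI q" "(LINT s|UI. q s) = 0"
    and a: "a \<in> borel_measurable UI" "\<And>r. r \<in> {0..1} \<Longrightarrow> \<bar>a r\<bar> \<le> C"
  shows "(LINT s|UI. q s * prim a s) = - (LINT r|UI. a r * prim q r)"
proof -
  have C0: "C \<ge> 0" using a(2)[of 0] by simp
  have [measurable]: "a \<in> borel_measurable UI" by fact
  have [measurable]: "q \<in> borel_measurable UI" using q by auto
  have 1: "fst \<in> borel_measurable (UI \<Otimes>\<^sub>M UI)" "snd \<in> borel_measurable (UI \<Otimes>\<^sub>M UI)"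
    by (rule measurable_compose[OF measurable_fst measurable_ident_UI], rule measurable_compose[OF measurable_snd measurable_ident_UI])
  have m: "(\<lambda>p. indicator {..fst p} (snd p) * a (snd p)) \<in> borel_measurable (UI \<Otimes>\<^sub>M UI)"
  proof (rule borel_measurable_times)
    have "(\<lambda>p. snd p - fst p) \<in> borel_measurable (UI \<Otimes>\<^sub>M UI)" using 1 by (intro borel_measurable_diff)
    then have "(\<lambda>p. indicator {..0} (snd p - fst p) :: real) \<in> borel_measurable (UI \<Otimes>\<^sub>M UI)"
      by (rule measurable_compose) simp
    moreover have "(\<lambda>p. indicator {..0} (snd p - fst p) :: real) = (\<lambda>p :: real \<times> real. indicator {..fst p} (snd p))"
      by (auto simp: fun_eq_iff indicator_def)
    ultimately show "(\<lambda>p. indicator {..fst p} (snd p) :: real) \<in> borel_measurable (UI \<Otimes>\<^sub>M UI)" by simp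
    show "(\<lambda>p. a (snd p)) \<in> borel_measurable (UI \<Otimes>\<^sub>M UI)" by measurable
  qed
  have "(LINT s|UI. q s * prim a s) = (LINT s|UI. q s * (LINT r|UI. indicator {..s} r * a r))"
    by (simp add: prim_def)
  also have "\<dots> = (LINT r|UI. LINT s|UI. q s * (indicator {..s} r * a r))"
    by (rule Fubini_UI(1)[OF q(1) m, where C=C]) (use a(2) C0 in \<open>auto simp: indicator_def\<close>)
  also have "\<dots> = (LINT r|UI. - (a r * prim q r))"
  proof (intro Bochner_Integration.integral_cong refl)
    fix r
    have "(LINT s|UI. q s * (indicator {..s} r * a r)) = (LINT s|UI. q s * indicator {..s} r) * a r"
      by (simp add: mult.assoc[symmetric])
    also have "(LINT s|UI. q s * indicator {..s} r) = (LINT s|UI. q s - indicator {..r} s * q s)"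
    proof (rule integral_cong_AE)
      show "AE s in UI. q s * indicator {..s} r = q s - indicator {..r} s * q s"
        using AE_UI_neq[of r] by eventually_elim (auto simp: indicator_def)
      have "(\<lambda>s. q s * indicator {r..} s) \<in> borel_measurable UI" using borel_measurable_UI[of "indicator {r..}"] by simp
      moreover have "(\<lambda>s. q s * indicator {r..} s) = (\<lambda>s. q s * indicator {..s} r)" by (auto simp: indicator_def fun_eq_iff)
      ultimately show "(\<lambda>s. q s * indicator {..s} r) \<in> borel_measurable UI" by simp
      show "(\<lambda>s. q s - indicator {..r} s * q s) \<in> borel_measurable UI"
        using borel_measurable_integrable[OF integrable_indicator_UI[OF q(1), of "{..r}"]] by simp
    qed
    also have "\<dots> = - prim q r"
      using q integrable_indicator_UI[OF q(1), of "{..r}"] by (simp add: prim_def)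
    finally show "(LINT s|UI. q s * (indicator {..s} r * a r)) = - (a r * prim q r)" by simp
  qed
  also have "\<dots> = - (LINT r|UI. a r * prim q r)" by simp
  finally show ?thesis .
qed

context driver
begin

lemma weakL_diff: "weakL p k \<Longrightarrow> weakL p' k' \<Longrightarrow> weakL (\<lambda>x. p x - p' x) (\<lambda>x. k x - k' x)"
  using weakL_lin[of p k p' k' 1 "-1"] by simp

lemma weakL_tint:
  assumes p: "loc_bdd p" and k: "loc_bdd k" and w: "\<And>r. 0 \<le> r \<Longrightarrow> r \<le> t \<Longrightarrow> weakL (p r) (k r)" and t: "0 \<le> t"
  shows "weakL (tint p t) (tint k t)"
  unfolding weakL_def
proof (intro conjI allI impI)
  show "integrable UI (tint p t)" "integrable UI (tint k t)"
    by (auto intro!: bmeas_integrable loc_bdd_bmeas tint_loc_bdd p k)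
  have "(LINT x|UI. 1 * tint k t x) = (LINT r:{0..t}|lborel. LINT x|UI. 1 * k r x)"
    by (rule Fubini_time(1)[OF _ k]) simp
  also have "\<dots> = (LINT r:{0..t}|lborel. 0)"
    by (rule set_lebesgue_integral_cong) (use w in \<open>auto simp: weakL_def\<close>)
  finally show "(LINT x|UI. tint k t x) = 0" by (simp add: set_lebesgue_integral_def)
  fix g assume g: "testg g"
  note gi = testg_integrable[OF g]
  have "(LINT x|UI. tint k t x * Pot g (W x)) = (LINT x|UI. Pot g (W x) * tint k t x)" by (simp add: mult.commute)
  also have "\<dots> = (LINT r:{0..t}|lborel. LINT x|UI. Pot g (W x) * k r x)"
    by (rule Fubini_time(1)[OF Pot_W_integrable[OF gi] k])
  also have "\<dots> = (LINT r:{0..t}|lborel. LINT x|UI. g x * p r x)"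
    by (rule set_lebesgue_integral_cong) (use w g in \<open>auto simp: weakL_def mult.commute\<close>)
  also have "\<dots> = (LINT x|UI. g x * tint p t x)"
    by (rule Fubini_time(1)[OF gi p, symmetric])
  finally show "(LINT x|UI. tint k t x * Pot g (W x)) = (LINT x|UI. tint p t x * g x)" by (simp add: mult.commute)
qed

lemma weakL_second_diff:
  assumes "\<And>t. 0 \<le> t \<Longrightarrow> weakL (X t) (\<xi> t)" "0 \<le> \<sigma>" "0 \<le> t"
  shows "weakL (second_diff \<sigma> X t) (second_diff \<sigma> \<xi> t)"
  unfolding second_diff_eq using assms by (intro weakL_lin) auto

text \<open>
  Energy: \<open>d/dt \<bar>Z\<bar>\<^sup>2 = 2 \<langle>\<zeta>, Z\<rangle> \<le> 0\<close> for \<open>Z = \<integral> \<zeta>\<close>, because \<open>L Z = \<zeta>\<close> and the operator is nonpositive.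
  So \<open>Z\<close> vanishes, and then \<open>\<zeta> = L 0\<close>.
\<close>

lemma weak_uniqueness:
  assumes z: "loc_bdd \<zeta>" and w: "\<And>t. 0 < t \<Longrightarrow> t \<le> T \<Longrightarrow> weakL (tint \<zeta> t) (\<zeta> t)" and T: "0 \<le> T"
    and wT: "weakL (tint \<zeta> T) (\<zeta> T)"
  shows "AE x in UI. tint \<zeta> T x = 0" and "AE x in UI. \<zeta> T x = 0"
proof -
  have X: "traj (tint \<zeta>) \<zeta>" by (rule traj_tint[OF z])
  have b: "bmeas (tint \<zeta> t)" "bmeas (\<zeta> t)" for t using traj_bmeas[OF X] by auto
  have "(LINT r:{0..T}|lborel. LINT x|UI. \<zeta> r x * tint \<zeta> r x) \<le> 0 * (T - 0)"
  proof (rule set_integral_le_const[OF traj_energy(2)[OF X T] T])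
    fix r assume "0 \<le> r" "r \<le> T"
    then show "(LINT x|UI. \<zeta> r x * tint \<zeta> r x) \<le> 0"
      using weakL_nonpos[OF b(1) w, of r] by (cases "r = 0") (auto simp: tint_nonpos)
  qed
  then have "(L2n (tint \<zeta> T))\<^sup>2 \<le> (L2n (tint \<zeta> 0))\<^sup>2" using traj_energy(1)[OF X T] by simp
  also have "L2n (tint \<zeta> 0) = 0" by (simp add: L2n_def tint_nonpos)
  finally have "L2n (tint \<zeta> T) = 0" by simp
  then show 0: "AE x in UI. tint \<zeta> T x = 0" by (intro L2n_zero_AE bmeas_sqint b)
  have "weakL (\<lambda>_. 0) (\<zeta> T)"
    by (rule weakL_cong_AE[OF wT 0])
      (auto intro: borel_measurable_UI bmeas_measurable b)
  then show "AE x in UI. \<zeta> T x = 0" by (rule weakL_0_imp_0[OF b(2)])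
qed

lemma lift_mean_bound:
  assumes k: "sqint k" and s: "s \<in> {0..1}"
  shows "\<bar>lift m k s - m\<bar> \<le> 2 * L2n k"
proof -
  note ki = sqint_integrable[OF k]
  have *: "\<bar>Pot k s - Pot k (W x)\<bar> \<le> 2 * L2n k" if "x \<in> {0..1}" for x
  proof -
    have "\<bar>Pot k s - Pot k (W x)\<bar> \<le> 2 * L2n k * \<bar>s - W x\<bar>"
      using lift_Lipschitz[OF k, of 0 s "W x"] by (simp add: lift_def)
    also have "\<dots> \<le> 2 * L2n k * 1" using s W_unit[OF that] by (intro mult_left_mono) auto
    finally show ?thesis by simp
  qed
  have "lift m k s - m = (LINT x|UI. Pot k s - Pot k (W x))"
    using Pot_W_integrable[OF ki] by (simp add: lift_def)
  then have "\<bar>lift m k s - m\<bar> \<le> (LINT x|UI. \<bar>Pot k s - Pot k (W x)\<bar>)"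
    by (simp only: integral_abs_bound)
  also have "\<dots> \<le> (LINT x|UI. 2 * L2n k)"
    using Pot_W_integrable[OF ki] * by (intro integral_mono) auto
  finally show ?thesis by simp
qed

text \<open>
  Two integrations by parts move both derivatives from \<open>lift m k\<close> to \<open>\<phi>\<close>, whose second derivative
  is \<open>q\<close>; the mean \<open>m\<close> disappears since \<open>q\<close> has integral 0.
\<close>

lemma Pot_mult_parts:
  assumes k: "integrable UI k" "(LINT x|UI. k x) = 0"
    and q: "integrable UI q" "(LINT s|UI. q s) = 0"
    and \<phi>: "\<And>s. s \<in> {0..1} \<Longrightarrow> \<phi> s = c + prim (\<lambda>r. d + prim q r) s"
    and \<phi>0: "(LINT s|UI. d + prim q s) = 0"
  shows "(LINT s|UI. q s * lift m k s) = (LINT x|UI. k x * \<phi> (W x))"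
proof -
  have qb: "\<bar>d + prim q s\<bar> \<le> \<bar>d\<bar> + (LINT r|UI. \<bar>q r\<bar>)" for s using prim_abs_bound[OF q(1), of s] by linarith
  have pm: "(\<lambda>s. d + prim q s) \<in> borel_measurable UI"
    by (intro borel_measurable_UI borel_measurable_add prim_measurable q) simp
  have pi: "integrable UI (prim q)"
    by (rule integrable_UI_bounded[OF borel_measurable_UI[OF prim_measurable[OF q(1)]] prim_abs_bound[OF q(1)]])
  have di: "integrable UI (\<lambda>s. d * dPot k s)" "integrable UI (\<lambda>s. dPot k s * prim q s)"
    using dPot_integrable[OF k(1)]
    by (auto intro!: integrable_UI_mult_bounded(1)[OF _ borel_measurable_UI[OF prim_measurable[OF q(1)]] prim_abs_bound[OF q(1)]])
  have Pm: "integrable UI (\<lambda>s. q s * Pot k s)"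
    by (rule integrable_UI_mult_bounded(1)[OF q(1) borel_measurable_UI[OF Pot_measurable[OF k(1)]] Pot_abs[OF k(1)]])
  have "(LINT s|UI. q s * lift m k s) = (LINT s|UI. (m - (LINT x|UI. Pot k (W x))) * q s + q s * Pot k s)"
    by (simp add: lift_def algebra_simps)
  also have "\<dots> = (LINT s|UI. q s * Pot k s)" using q Pm by simp
  also have "\<dots> = - (LINT r|UI. dPot k r * prim q r)"
    unfolding Pot_def by (rule prim_parts[OF q dPot_measurable[OF k(1)] dPot_abs[OF k(1)]])
  also have "(LINT r|UI. dPot k r * prim q r) = (LINT r|UI. d * dPot k r) + (LINT r|UI. dPot k r * prim q r)"
    using dPot_mean[OF k(1)] by simp
  also have "\<dots> = (LINT r|UI. d * dPot k r + dPot k r * prim q r)"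
    by (rule Bochner_Integration.integral_add[OF di, symmetric])
  also have "\<dots> = (LINT r|UI. dPot k r * (d + prim q r))" by (simp add: algebra_simps)
  also have "\<dots> = - (LINT z|UI. k z * prim (\<lambda>s. d + prim q s) (W z))"
    by (rule dPot_parts[OF k(1) pm qb \<phi>0])
  finally have 1: "(LINT s|UI. q s * lift m k s) = (LINT z|UI. k z * prim (\<lambda>s. d + prim q s) (W z))" by simp
  have ki: "integrable UI (\<lambda>z. k z * prim (\<lambda>s. d + prim q s) (W z))"
  proof (rule integrable_UI_mult_bounded(1)[OF k(1)])
    have i: "integrable UI (\<lambda>s. d + prim q s)" using pi by simp
    show "(\<lambda>z. prim (\<lambda>s. d + prim q s) (W z)) \<in> borel_measurable UI"
      by (rule borel_measurable_UI[OF measurable_compose[OF W_measurable prim_measurable[OF i]]])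
    show "\<bar>prim (\<lambda>s. d + prim q s) (W x)\<bar> \<le> (LINT r|UI. \<bar>d + prim q r\<bar>)" for x
      by (rule prim_abs_bound[OF i])
  qed
  have "(LINT x|UI. k x * \<phi> (W x)) = (LINT z|UI. c * k z + k z * prim (\<lambda>s. d + prim q s) (W z))"
    by (intro Bochner_Integration.integral_cong refl) (use \<phi> W_unit in \<open>simp add: algebra_simps\<close>)
  also have "\<dots> = (LINT z|UI. k z * prim (\<lambda>s. d + prim q s) (W z))" using k ki by simp
  finally show ?thesis using 1 by simp
qed

end

text \<open>
  A solution with initial datum \<open>h\<close> in the integrated form \<open>L (\<integral>\<^sub>0\<^sup>t \<rho>) = \<rho>(t) - h\<close>, where \<open>L h = g\<close>.
\<close>

locale flow = driver +
  fixes \<rho> :: "real \<Rightarrow> real \<Rightarrow> real" and h g :: "real \<Rightarrow> real"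
  assumes loc_bdd_\<rho>: "loc_bdd \<rho>" and bh: "bmeas h"
    and weak: "0 \<le> t \<Longrightarrow> weakL (tint \<rho> t) (\<lambda>x. \<rho> t x - h x)"
    and g2: "sqint g" and weak_h: "weakL h g"
begin

text \<open>
  \<open>P\<close> and \<open>B\<close> are the first and second time integrals of \<open>\<rho>\<close>, and \<open>R\<close> is what remains of \<open>P\<close> when \<open>\<rho>\<close> is
  replaced by \<open>\<rho> - h\<close>. The velocity of \<open>R\<close> is \<open>\<rho> - h\<close>, and \<open>L R = \<rho> - h - t g\<close>.
\<close>

abbreviation K where "K \<equiv> L2n g"
abbreviation P where "P \<equiv> tint \<rho>"
abbreviation B where "B \<equiv> tint P"
definition R where "R t x = P t x - t * h x"

lemma loc_bdd_P: "loc_bdd P" by (rule tint_loc_bdd[OF loc_bdd_\<rho>])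
lemma loc_bdd_B: "loc_bdd B" by (rule tint_loc_bdd[OF loc_bdd_P])
lemma traj_P: "traj P \<rho>" by (rule traj_tint[OF loc_bdd_\<rho>])
lemma traj_B: "traj B P" by (rule traj_tint[OF loc_bdd_P])

lemma traj_R: "traj R (\<lambda>t x. \<rho> t x - h x)"
proof -
  have "traj (\<lambda>t x. t * h x) (\<lambda>t. h)"
    unfolding traj_def using loc_bdd_tmult[OF bh] loc_bdd_tconst[OF bh] by (simp add: tint_const)
  from traj_lin[OF traj_P this, of 1 "-1"] show ?thesis by (simp add: R_def[abs_def])
qed

lemma R_0: "R 0 x = 0" by (simp add: R_def tint_nonpos)

lemma R_weak: assumes "0 \<le> r" shows "weakL (R r) (\<lambda>x. \<rho> r x - h x - r * g x)"
  using weakL_lin[OF weak[OF assms] weak_h, of 1 "- r"] by (simp add: R_def[abs_def])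

lemma R_dissipation: assumes "0 \<le> r" shows "(LINT x|UI. (\<rho> r x - h x) * R r x) \<le> r * K * L2n (R r)"
proof -
  have bR: "bmeas (R r)" by (rule traj_bmeas[OF traj_R])
  have b1: "bmeas (\<lambda>x. \<rho> r x - h x)" by (rule traj_bmeas(2)[OF traj_R])
  have i: "integrable UI (\<lambda>x. (\<rho> r x - h x) * R r x)" "integrable UI (\<lambda>x. g x * R r x)"
    by (intro bmeas_mult_integrable bR bmeas_integrable[OF b1] sqint_integrable[OF g2])+
  have "(LINT x|UI. (\<rho> r x - h x - r * g x) * R r x) \<le> 0" by (rule weakL_nonpos[OF bR R_weak[OF assms]])
  also have "(\<lambda>x. (\<rho> r x - h x - r * g x) * R r x) = (\<lambda>x. (\<rho> r x - h x) * R r x - r * (g x * R r x))"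
    by (simp add: fun_eq_iff algebra_simps)
  finally have "(LINT x|UI. (\<rho> r x - h x) * R r x) \<le> r * (LINT x|UI. g x * R r x)" using i by simp
  also have "\<dots> \<le> r * (K * L2n (R r))"
    using L2_Cauchy_Schwarz[OF g2 bmeas_sqint[OF bR]] assms by (intro mult_left_mono) auto
  finally show ?thesis by (simp add: mult.assoc)
qed

text \<open>
  From \<open>d/dt \<bar>R\<bar>\<^sup>2 \<le> 2 t K \<bar>R\<bar>\<close> one gets \<open>\<bar>R\<bar>\<^sup>2 \<le> 2 K T\<^sup>2 sup \<bar>R\<bar>\<close> on \<open>[0,T]\<close>; taking the supremum on
  the left divides out one factor. The order \<open>T\<^sup>2\<close> is what makes second differences of \<open>P\<close> bounded
  at time 0.
\<close>

lemma R_bound: assumes T: "0 \<le> T" shows "L2n (R T) \<le> 2 * K * T\<^sup>2"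
proof -
  obtain C where C: "C \<ge> 0" "\<And>t x. \<bar>t\<bar> \<le> T \<Longrightarrow> \<bar>R t x\<bar> \<le> C"
    using loc_bdd_bound[OF traj_loc_bdd(1)[OF traj_R]] by blast
  have bC: "L2n (R t) \<le> C" if "t \<in> {0..T}" for t
    by (rule L2n_le_bound) (use C that borel_measurable_UI[OF bmeas_measurable[OF traj_bmeas(1)[OF traj_R]]] in auto)
  define S where "S = (SUP t\<in>{0..T}. L2n (R t))"
  have bdd: "bdd_above ((\<lambda>t. L2n (R t)) ` {0..T})" using bC by (intro bdd_aboveI2) auto
  have le: "L2n (R t) \<le> S" if "t \<in> {0..T}" for t unfolding S_def by (rule cSUP_upper[OF that bdd])
  have S0: "S \<ge> 0" using le[of 0] T L2n_nonneg[of "R 0"] by (meson atLeastAtMost_iff order_refl order_trans)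
  have sq: "(L2n (R t))\<^sup>2 \<le> 2 * K * T\<^sup>2 * S" if t: "t \<in> {0..T}" for t
  proof -
    have t0: "0 \<le> t" "t \<le> T" using t by auto
    have "(LINT r:{0..t}|lborel. LINT x|UI. (\<rho> r x - h x) * R r x) \<le> (T * K * S) * (t - 0)"
    proof (rule set_integral_le_const[OF traj_energy(2)[OF traj_R t0(1)] t0(1)])
      fix r assume r: "0 \<le> r" "r \<le> t"
      have "r * K * L2n (R r) \<le> T * K * S" using r t0 le[of r] by (intro mult_mono) auto
      then show "(LINT x|UI. (\<rho> r x - h x) * R r x) \<le> T * K * S" using R_dissipation[OF r(1)] by linarith
    qed
    also have "\<dots> \<le> (T * K * S) * T" using t0 T S0 by (intro mult_left_mono) auto
    finally have "(LINT r:{0..t}|lborel. LINT x|UI. (\<rho> r x - h x) * R r x) \<le> K * T\<^sup>2 * S"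
      by (simp add: power2_eq_square mult_ac)
    moreover have "L2n (R 0) = 0" by (simp add: L2n_def R_0)
    ultimately show ?thesis using traj_energy(1)[OF traj_R t0(1)] by simp
  qed
  have "S \<le> sqrt (2 * K * T\<^sup>2 * S)"
    unfolding S_def[of]
  proof (rule cSUP_least)
    show "{0..T} \<noteq> {}" using T by simp
    show "L2n (R t) \<le> sqrt (2 * K * T\<^sup>2 * (SUP t\<in>{0..T}. L2n (R t)))" if "t \<in> {0..T}" for t
      using sq[OF that] by (intro real_le_rsqrt) (simp add: S_def)
  qed
  then have "S\<^sup>2 \<le> (sqrt (2 * K * T\<^sup>2 * S))\<^sup>2" using S0 by (rule power_mono)
  also have "\<dots> = 2 * K * T\<^sup>2 * S" using S0 by simp
  finally have "S * S \<le> S * (2 * K * T\<^sup>2)" by (simp add: power2_eq_square mult_ac)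
  then have "S \<le> 2 * K * T\<^sup>2" using S0 by (cases "S = 0") (auto simp: mult_le_cancel_left)
  then show ?thesis using le[of T] T by simp
qed

text \<open>
  \<open>A \<sigma>\<close> is the average of \<open>\<rho>\<close>, and \<open>LA \<sigma>\<close> is both its velocity and its image under the operator. Since
  the average of a solution is again a solution, energy estimates apply to both.
\<close>

definition A where "A \<sigma> = second_diff \<sigma> B"
definition LA where "LA \<sigma> = second_diff \<sigma> P"

lemma traj_A: "0 \<le> \<sigma> \<Longrightarrow> traj (A \<sigma>) (LA \<sigma>)"
  unfolding A_def LA_def by (rule traj_second_diff[OF traj_B])

lemma traj_LA: "0 \<le> \<sigma> \<Longrightarrow> traj (LA \<sigma>) (second_diff \<sigma> \<rho>)"
  unfolding LA_def by (rule traj_second_diff[OF traj_P])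

lemma bA: "0 \<le> \<sigma> \<Longrightarrow> bmeas (A \<sigma> t)" and bk: "0 \<le> \<sigma> \<Longrightarrow> bmeas (LA \<sigma> t)"
  using traj_bmeas[OF traj_A] by auto

lemma weak_LA: assumes "0 \<le> \<sigma>" "0 \<le> t" shows "weakL (LA \<sigma> t) (second_diff \<sigma> \<rho> t)"
proof -
  have "weakL (second_diff \<sigma> P t) (second_diff \<sigma> (\<lambda>t x. \<rho> t x - h x) t)" by (rule weakL_second_diff[OF weak assms])
  also have "second_diff \<sigma> (\<lambda>t x. \<rho> t x - h x) t = second_diff \<sigma> \<rho> t" by (simp add: second_diff_def fun_eq_iff)
  finally show ?thesis by (simp add: LA_def)
qed

lemma weak_B: assumes "0 \<le> t" shows "weakL (B t) (R t)"
proof -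
  have j: "loc_bdd (\<lambda>t x. \<rho> t x - h x)" by (rule traj_loc_bdd(2)[OF traj_R])
  have "weakL (B t) (tint (\<lambda>t x. \<rho> t x - h x) t)"
    by (rule weakL_tint[OF loc_bdd_P j weak assms])
  also have "tint (\<lambda>t x. \<rho> t x - h x) t = R t"
    using trajD[OF traj_R assms] by (simp add: fun_eq_iff R_0)
  finally show ?thesis .
qed

lemma weak_A: assumes "0 \<le> \<sigma>" "0 \<le> t" shows "weakL (A \<sigma> t) (LA \<sigma> t)"
proof -
  have "weakL (second_diff \<sigma> B t) (second_diff \<sigma> R t)" by (rule weakL_second_diff[OF weak_B assms])
  also have "second_diff \<sigma> R t = second_diff \<sigma> P t" by (simp add: second_diff_def R_def fun_eq_iff algebra_simps)
  finally show ?thesis by (simp add: LA_def A_def)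
qed

lemma L2n_second_diff_0:
  assumes b: "bmeas p" "bmeas q" "bmeas r" and r0: "L2n r = 0"
    and pq: "L2n p \<le> \<alpha>" "L2n q \<le> \<beta>"
  shows "L2n (\<lambda>x. (p x - 2 * q x + r x) / \<sigma>\<^sup>2) \<le> (\<alpha> + 2 * \<beta>) / \<sigma>\<^sup>2"
proof -
  have s: "sqint p" "sqint q" "sqint r" using b by (auto intro: bmeas_sqint)
  have s2: "sqint (\<lambda>x. p x - 2 * q x)" using sqint_lin[OF s(1,2), of 1 "-2"] by simp
  have s3: "sqint (\<lambda>x. 2 * q x)" using sqint_lin[OF s(2,2), of 2 0] by simp
  have "L2n (\<lambda>x. (p x - 2 * q x) + r x) \<le> L2n (\<lambda>x. p x - 2 * q x) + L2n r" by (rule L2n_triangle[OF s2 s(3)])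
  also have "\<dots> \<le> L2n p + L2n (\<lambda>x. 2 * q x)" using L2n_diff_triangle[OF s(1) s3] r0 by simp
  also have "\<dots> \<le> \<alpha> + 2 * \<beta>" using pq by (simp add: L2n_cmult)
  finally have "L2n (\<lambda>x. p x - 2 * q x + r x) \<le> \<alpha> + 2 * \<beta>" .
  then have "L2n (\<lambda>x. 1 / \<sigma>\<^sup>2 * (p x - 2 * q x + r x)) \<le> 1 / \<sigma>\<^sup>2 * (\<alpha> + 2 * \<beta>)"
    unfolding L2n_cmult by (simp add: divide_right_mono)
  then show ?thesis by simp
qed

text \<open>
  The norm decreases in time, because \<open>LA\<close> has velocity \<open>L LA\<close>. At time 0 the part of \<open>P\<close> that is linear
  in time drops out of the second difference, and the bound on \<open>R\<close> at \<open>2\<sigma>\<close> and at \<open>\<sigma>\<close> gives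
  \<open>(8 + 4) K\<close>.
\<close>

lemma LA_bound: assumes "0 < \<sigma>" "0 \<le> t" shows "L2n (LA \<sigma> t) \<le> 12 * K"
proof -
  have s: "0 \<le> \<sigma>" using assms by simp
  have bR: "bmeas (R t)" for t by (rule traj_bmeas(1)[OF traj_R])
  have "L2n (LA \<sigma> t) \<le> L2n (LA \<sigma> 0)"
    by (rule traj_nonincreasing[OF traj_LA[OF s] _ order_refl assms(2)])
       (rule weakL_nonpos[OF bk[OF s] weak_LA[OF s]])
  also have "L2n (LA \<sigma> 0) = L2n (\<lambda>x. (R (2 * \<sigma>) x - 2 * R \<sigma> x + R 0 x) / \<sigma>\<^sup>2)"
    by (rule arg_cong[where f=L2n]) (simp add: LA_def second_diff_def R_def fun_eq_iff)
  also have "\<dots> \<le> (2 * K * (2 * \<sigma>)\<^sup>2 + 2 * (2 * K * \<sigma>\<^sup>2)) / \<sigma>\<^sup>2"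
    by (rule L2n_second_diff_0[OF bR bR bR _ R_bound R_bound]) (use s in \<open>auto simp: L2n_def R_0\<close>)
  also have "\<dots> = 12 * K" using assms(1) by (simp add: field_simps power2_eq_square)
  finally show ?thesis .
qed

text \<open>
  The second difference reproduces \<open>h\<close> from the quadratic part of \<open>B\<close>; the remainder is the second
  difference of \<open>\<integral> R\<close>, which is at most \<open>2 K t\<^sup>3\<close>, and \<open>(16 + 4) K \<sigma>\<^sup>3 / \<sigma>\<^sup>2 = 20 K \<sigma>\<close>.
\<close>

lemma A_0_bound: assumes "0 < \<sigma>" shows "L2n (\<lambda>x. A \<sigma> 0 x - h x) \<le> 20 * K * \<sigma>"
proof -
  have s: "0 \<le> \<sigma>" using assms by simp
  have jR: "loc_bdd R" by (rule traj_loc_bdd(1)[OF traj_R])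
  have b: "bmeas (tint R t)" for t by (rule loc_bdd_bmeas[OF tint_loc_bdd[OF jR]])
  have tR: "tint R t x = B t x - t\<^sup>2 / 2 * h x" if "0 \<le> t" for t x
  proof -
    have "tint R t x = tint (\<lambda>t x. 1 * P t x + (- 1) * (t * h x)) t x" by (simp add: R_def[abs_def])
    also have "\<dots> = 1 * B t x + (- 1) * tint (\<lambda>t x. t * h x) t x" by (rule tint_lin[OF loc_bdd_P loc_bdd_tmult[OF bh]])
    finally show ?thesis using tint_linear_time[OF that] by simp
  qed
  have est: "L2n (tint R t) \<le> 2 * K * t\<^sup>2 * t" if t: "0 \<le> t" for t
  proof (rule L2n_tint_le[OF jR _ t])
    fix r assume r: "0 \<le> r" "r \<le> t"
    have "L2n (R r) \<le> 2 * K * r\<^sup>2" by (rule R_bound[OF r(1)])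
    also have "\<dots> \<le> 2 * K * t\<^sup>2" using r by (intro mult_left_mono power_mono) auto
    finally show "L2n (R r) \<le> 2 * K * t\<^sup>2" .
  qed
  have "A \<sigma> 0 x - h x = (tint R (2 * \<sigma>) x - 2 * tint R \<sigma> x + tint R 0 x) / \<sigma>\<^sup>2" for x
    using assms by (simp add: A_def second_diff_def tR field_simps power2_eq_square)
  then have "L2n (\<lambda>x. A \<sigma> 0 x - h x) = L2n (\<lambda>x. (tint R (2 * \<sigma>) x - 2 * tint R \<sigma> x + tint R 0 x) / \<sigma>\<^sup>2)"
    by (simp only:)
  also have "\<dots> \<le> (2 * K * (2 * \<sigma>)\<^sup>2 * (2 * \<sigma>) + 2 * (2 * K * \<sigma>\<^sup>2 * \<sigma>)) / \<sigma>\<^sup>2"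
    by (rule L2n_second_diff_0[OF b b b _ est est]) (use s in \<open>auto simp: L2n_def tint_nonpos\<close>)
  also have "\<dots> = 20 * K * \<sigma>" using assms(1) by (simp add: field_simps power2_eq_square)
  finally show ?thesis .
qed

definition m where "m = (LINT x|UI. h x)"

lemma mean_A: assumes s: "0 < \<sigma>" and t: "0 \<le> t" shows "(LINT x|UI. A \<sigma> t x) = m"
proof -
  have mr: "(LINT x|UI. \<rho> r x) = m" if "0 \<le> r" for r
    using weak[OF that] bmeas_integrable[OF traj_bmeas(2)[OF traj_P, of r]] bmeas_integrable[OF bh]
    by (simp add: weakL_def m_def)
  have mP: "(LINT x|UI. P r x) = r * m" if "0 \<le> r" for r
  proof -
    have "(LINT x|UI. 1 * P r x) = (LINT u:{0..r}|lborel. LINT x|UI. 1 * \<rho> u x)"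
      by (rule Fubini_time(1)[OF _ loc_bdd_\<rho>]) simp
    also have "\<dots> = (LINT u:{0..r}|lborel. m)"
      by (rule set_lebesgue_integral_cong) (use mr in auto)
    finally show ?thesis using set_integral_const_Icc[OF that, of m] by simp
  qed
  have mB: "(LINT x|UI. B r x) = r\<^sup>2 / 2 * m" if "0 \<le> r" for r
  proof -
    have "(LINT x|UI. 1 * B r x) = (LINT u:{0..r}|lborel. LINT x|UI. 1 * P u x)"
      by (rule Fubini_time(1)[OF _ loc_bdd_P]) simp
    also have "\<dots> = (LINT u:{0..r}|lborel. u * m)"
      by (rule set_lebesgue_integral_cong) (use mP in auto)
    also have "\<dots> = tint (\<lambda>u x. u * m) r 0" by (simp only: tint_def)
    finally show ?thesis using tint_linear_time[OF that, of "\<lambda>_. m" 0] by simp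
  qed
  have i: "integrable UI (B r)" for r by (rule bmeas_integrable[OF loc_bdd_bmeas[OF loc_bdd_B]])
  have "(LINT x|UI. A \<sigma> t x) = ((t + 2 * \<sigma>)\<^sup>2 / 2 * m - 2 * ((t + \<sigma>)\<^sup>2 / 2 * m) + t\<^sup>2 / 2 * m) / \<sigma>\<^sup>2"
    unfolding A_def second_diff_def using i s t by (simp add: mB)
  also have "\<dots> = m" using s by (simp add: field_simps power2_eq_square)
  finally show ?thesis .
qed

text \<open>
  The continuous function of \<open>s = W x\<close> that represents \<open>A \<sigma> t\<close>.
\<close>

definition V where "V \<sigma> t = lift m (LA \<sigma> t)"

lemma A_rep: assumes "0 < \<sigma>" "0 \<le> t" shows "AE x in UI. A \<sigma> t x = V \<sigma> t (W x)"
  using weakL_lift(1)[OF bA weak_A, of \<sigma> t] assms mean_A[OF assms] by (simp add: V_def)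

text \<open>
  Differences of solutions contract, so it suffices to compare the averages at time 0, where both are
  close to \<open>h\<close>.
\<close>

lemma A_Cauchy:
  assumes "0 < \<sigma>" "0 < \<tau>" "0 \<le> t"
  shows "L2n (\<lambda>x. A \<sigma> t x - A \<tau> t x) \<le> 20 * K * (\<sigma> + \<tau>)"
proof -
  have s: "0 \<le> \<sigma>" "0 \<le> \<tau>" using assms by auto
  have X: "traj (\<lambda>t x. A \<sigma> t x - A \<tau> t x) (\<lambda>t x. LA \<sigma> t x - LA \<tau> t x)"
    using traj_lin[OF traj_A[OF s(1)] traj_A[OF s(2)], of 1 "-1"] by simp
  have "L2n (\<lambda>x. A \<sigma> t x - A \<tau> t x) \<le> L2n (\<lambda>x. A \<sigma> 0 x - A \<tau> 0 x)"
  proof (rule traj_nonincreasing[OF X _ order_refl assms(3)])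
    fix r :: real assume "0 \<le> r"
    then show "(LINT x|UI. (LA \<sigma> r x - LA \<tau> r x) * (A \<sigma> r x - A \<tau> r x)) \<le> 0"
      by (intro weakL_nonpos weakL_diff weak_A s bmeas_diff bA)
  qed
  also have "\<dots> = L2n (\<lambda>x. (A \<sigma> 0 x - h x) - (A \<tau> 0 x - h x))" by simp
  also have "\<dots> \<le> L2n (\<lambda>x. A \<sigma> 0 x - h x) + L2n (\<lambda>x. A \<tau> 0 x - h x)"
    by (intro L2n_diff_triangle bmeas_sqint bmeas_diff bA s bh)
  also have "\<dots> \<le> 20 * K * \<sigma> + 20 * K * \<tau>" by (intro add_mono A_0_bound assms)
  finally show ?thesis by (simp add: algebra_simps)
qed

text \<open>
  Both averages have mean \<open>m\<close>, so the difference of their representatives is the lift of a difference;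
  \<open>24 K\<close> bounds the \<open>L\<^sup>2\<close> norm of the difference of the images under the operator. All uniform
  estimates below come from inserting an \<open>L\<^sup>2\<close> estimate for \<open>A\<close> here.
\<close>

lemma V_diff:
  assumes s: "0 < \<sigma>" "0 < \<tau>" "0 \<le> t" "0 \<le> u" "y \<in> {0..1}"
  shows "(V \<sigma> t y - V \<tau> u y)\<^sup>2 \<le> 24 * K * L2n (\<lambda>x. A \<sigma> t x - A \<tau> u x)"
proof -
  have s': "0 \<le> \<sigma>" "0 \<le> \<tau>" using s by auto
  let ?k = "\<lambda>x. LA \<sigma> t x - LA \<tau> u x" and ?p = "\<lambda>x. A \<sigma> t x - A \<tau> u x"
  have ki: "integrable UI (LA \<sigma> t)" "integrable UI (LA \<tau> u)" by (auto intro!: bmeas_integrable bk s')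
  have Pk: "Pot ?k r = Pot (LA \<sigma> t) r - Pot (LA \<tau> u) r" for r
    using Pot_lin[OF ki, of 1 "-1" r] by simp
  have w: "weakL ?p ?k" by (intro weakL_diff weak_A s' s)
  have bp: "bmeas ?p" by (intro bmeas_diff bA s')
  have sk: "sqint ?k" by (intro bmeas_sqint bmeas_diff bk s')
  have mp: "(LINT x|UI. ?p x) = 0"
    using mean_A[OF s(1,3)] mean_A[OF s(2,4)] bmeas_integrable[OF bA[OF s'(1)], of t] bmeas_integrable[OF bA[OF s'(2)], of u] by simp
  have "V \<sigma> t y - V \<tau> u y = lift 0 ?k y"
    unfolding V_def lift_def Pk using Pot_W_integrable[OF ki(1)] Pot_W_integrable[OF ki(2)] by simp
  then have "(V \<sigma> t y - V \<tau> u y)\<^sup>2 \<le> L2n ?k * L2n ?p"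
    using lift_sup_L2[OF bp w sk s(5)] mp by simp
  also have "\<dots> \<le> (24 * K) * L2n ?p"
  proof (rule mult_right_mono)
    have "L2n ?k \<le> L2n (LA \<sigma> t) + L2n (LA \<tau> u)" by (intro L2n_diff_triangle bmeas_sqint bk s')
    also have "\<dots> \<le> 12 * K + 12 * K" by (intro add_mono LA_bound s)
    finally show "L2n ?k \<le> 24 * K" by simp
  qed simp
  finally show ?thesis .
qed

lemma V_lip: assumes "0 < \<sigma>" "0 \<le> t" shows "\<bar>V \<sigma> t y - V \<sigma> t z\<bar> \<le> 24 * K * \<bar>y - z\<bar>"
proof -
  have s: "sqint (LA \<sigma> t)" using assms by (intro bmeas_sqint bk) auto
  have "\<bar>V \<sigma> t y - V \<sigma> t z\<bar> \<le> 2 * L2n (LA \<sigma> t) * \<bar>y - z\<bar>" unfolding V_def by (rule lift_Lipschitz[OF s])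
  also have "\<dots> \<le> 24 * K * \<bar>y - z\<bar>" using LA_bound[OF assms] by (intro mult_right_mono) auto
  finally show ?thesis .
qed

lemma V_mean: assumes "0 < \<sigma>" "0 \<le> t" "y \<in> {0..1}" shows "\<bar>V \<sigma> t y - m\<bar> \<le> 24 * K"
proof -
  have s: "sqint (LA \<sigma> t)" using assms by (intro bmeas_sqint bk) auto
  show ?thesis using lift_mean_bound[OF s assms(3), of m] LA_bound[OF assms(1,2)] unfolding V_def by linarith
qed

text \<open>
  \<open>A\<close> moves with velocity at most \<open>12 K\<close> in \<open>L\<^sup>2\<close>, and \<open>24 \<cdot> 12 = 288\<close>.
\<close>

lemma V_time:
  assumes "0 < \<sigma>" "0 \<le> t" "0 \<le> u" "y \<in> {0..1}"
  shows "(V \<sigma> t y - V \<sigma> u y)\<^sup>2 \<le> 288 * K\<^sup>2 * \<bar>t - u\<bar>"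
proof -
  have *: "(V \<sigma> t y - V \<sigma> u y)\<^sup>2 \<le> 288 * K\<^sup>2 * \<bar>t - u\<bar>" if tu: "0 \<le> u" "u \<le> t" for t u
  proof -
    have s: "0 \<le> \<sigma>" using assms(1) by simp
    have "L2n (\<lambda>x. A \<sigma> t x - A \<sigma> u x) \<le> 12 * K * (t - u)"
      by (rule traj_increment[OF traj_A[OF s] LA_bound[OF assms(1)] tu])
    then have "24 * K * L2n (\<lambda>x. A \<sigma> t x - A \<sigma> u x) \<le> 24 * K * (12 * K * (t - u))"
      by (intro mult_left_mono) auto
    moreover have "(V \<sigma> t y - V \<sigma> u y)\<^sup>2 \<le> 24 * K * L2n (\<lambda>x. A \<sigma> t x - A \<sigma> u x)"
      using tu by (intro V_diff assms) auto
    moreover have "24 * K * (12 * K * (t - u)) = 288 * K\<^sup>2 * \<bar>t - u\<bar>" using tu by (simp add: power2_eq_square)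
    ultimately show ?thesis by linarith
  qed
  show ?thesis using *[of u t] *[of t u] assms by (cases "u \<le> t") (auto simp: power2_commute abs_minus_commute)
qed

text \<open>
  Let \<open>E = \<bar>A - m\<bar>\<^sup>2\<close> and let \<open>D = - \<langle>L A, A - m\<rangle>\<close> be the dissipation, so \<open>E' = - 2 D\<close>. The sup bound by the
  energy gives \<open>E \<le> D\<close>; as \<open>E\<close> decreases, \<open>E(t) (1 + 2 t) \<le> E(0) \<le> (24 K)\<^sup>2\<close>. The sup bound once
  more gives \<open>(V - m)\<^sup>2 \<le> D \<le> 12 K sqrt E\<close>.
\<close>

lemma V_decay:
  assumes s: "0 < \<sigma>" and t: "0 \<le> t" and y: "y \<in> {0..1}"
  shows "(V \<sigma> t y - m)\<^sup>2 \<le> 288 * K\<^sup>2 / sqrt (1 + 2 * t)"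
proof -
  have s': "0 \<le> \<sigma>" using s by simp
  let ?p = "\<lambda>t x. A \<sigma> t x - m"
  have X: "traj ?p (LA \<sigma>)"
  proof -
    have "traj (\<lambda>t x. m) (\<lambda>t x. 0)"
      unfolding traj_def using loc_bdd_tconst[OF bmeas_const[of m]] loc_bdd_tconst[OF bmeas_const[of 0]] by (simp add: tint_const)
    from traj_lin[OF traj_A[OF s'] this, of 1 "-1"] show ?thesis by simp
  qed
  have bp: "bmeas (?p r)" for r by (rule traj_bmeas(1)[OF X])
  have w: "weakL (?p r) (LA \<sigma> r)" if r: "0 \<le> r" for r
  proof -
    have i0: "integrable UI (\<lambda>_. 0 :: real)" by simp
    have "weakL (\<lambda>x. - m + Pot (\<lambda>_. 0) (W x)) (\<lambda>_. 0)" by (rule weakL_Pot) auto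
    moreover have "Pot (\<lambda>_. 0) z = 0" for z using Pot_lin[OF i0 i0, of 0 0 z] by simp
    ultimately have "weakL (\<lambda>x. - m) (\<lambda>_. 0)" by simp
    from weakL_lin[OF weak_A[OF s' r] this, of 1 1] show ?thesis by simp
  qed
  define E where "E r = (L2n (?p r))\<^sup>2" for r
  have sup: "(V \<sigma> r z - m)\<^sup>2 \<le> - (LINT x|UI. LA \<sigma> r x * ?p r x)" if r: "0 \<le> r" "z \<in> {0..1}" for r z
  proof -
    have "(V \<sigma> r z - m)\<^sup>2 \<le> - (LINT x|UI. LA \<sigma> r x * Pot (LA \<sigma> r) (W x))"
      unfolding V_def by (rule lift_sup[OF bmeas_integrable[OF bk[OF s']] r(2)])
    then show ?thesis using weakL_lift(2)[OF bp w[OF r(1)]] by simp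
  qed
  have diss: "E r \<le> - (LINT x|UI. LA \<sigma> r x * ?p r x)" if r: "0 \<le> r" for r
  proof -
    have "E r \<le> (LINT x|UI. - (LINT x|UI. LA \<sigma> r x * ?p r x))"
      unfolding E_def L2n_sq
    proof (rule integral_mono_AE)
      show "integrable UI (\<lambda>x. (?p r x)\<^sup>2)" using bmeas_sqint[OF bp] by (simp add: sqint_def)
      show "AE x in UI. (?p r x)\<^sup>2 \<le> - (LINT x|UI. LA \<sigma> r x * ?p r x)"
        using A_rep[OF s r] AE_space[of UI]
      proof eventually_elim
        case (elim x)
        then show ?case using sup[OF r, of "W x"] W_unit[of x] by simp
      qed
    qed simp
    then show ?thesis by simp
  qed
  have mono: "E t \<le> E r" if "0 \<le> r" "r \<le> t" for r
    unfolding E_def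
    by (intro power_mono traj_nonincreasing[OF X _ that]) (auto intro!: weakL_nonpos bp w)
  have Em: "E t * (1 + 2 * t) \<le> E 0"
  proof -
    have "(LINT r:{0..t}|lborel. LINT x|UI. LA \<sigma> r x * ?p r x) \<le> (- E t) * (t - 0)"
    proof (rule set_integral_le_const[OF traj_energy(2)[OF X t] t])
      fix r assume r: "0 \<le> r" "r \<le> t"
      show "(LINT x|UI. LA \<sigma> r x * ?p r x) \<le> - E t" using diss[OF r(1)] mono[OF r] by linarith
    qed
    then show ?thesis using traj_energy(1)[OF X t] unfolding E_def by (simp add: algebra_simps)
  qed
  have "L2n (?p 0) \<le> 24 * K"
  proof -
    have m': "(\<lambda>x. V \<sigma> 0 (W x) - m) \<in> borel_measurable UI"
      unfolding V_def lift_def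
      by (intro borel_measurable_diff borel_measurable_add borel_measurable_const Pot_W_measurable bmeas_integrable bk s')
    have "L2n (?p 0) = L2n (\<lambda>x. V \<sigma> 0 (W x) - m)"
    proof (rule L2n_cong_AE[OF _ _ m'])
      show "AE x in UI. ?p 0 x = V \<sigma> 0 (W x) - m" using A_rep[OF s order_refl] by eventually_elim simp
      show "?p 0 \<in> borel_measurable UI" by (rule borel_measurable_UI[OF bmeas_measurable[OF bp]])
    qed
    also have "\<dots> \<le> 24 * K" by (rule L2n_le_bound[OF _ _ m']) (auto intro!: V_mean s W_unit)
    finally show ?thesis .
  qed
  then have E0: "E 0 \<le> (24 * K)\<^sup>2" unfolding E_def by (rule power_mono) simp
  have "E t \<le> (24 * K)\<^sup>2 / (1 + 2 * t)" using Em E0 t by (simp add: pos_le_divide_eq)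
  then have "sqrt (E t) \<le> sqrt ((24 * K)\<^sup>2 / (1 + 2 * t))" by (rule real_sqrt_le_mono)
  moreover have "sqrt ((24 * K)\<^sup>2 / (1 + 2 * t)) = 24 * K / sqrt (1 + 2 * t)"
    unfolding real_sqrt_divide real_sqrt_abs by simp
  moreover have "sqrt (E t) = L2n (?p t)" unfolding E_def real_sqrt_abs by simp
  ultimately have Lp: "L2n (?p t) \<le> 24 * K / sqrt (1 + 2 * t)" by (simp only:)
  have "(V \<sigma> t y - m)\<^sup>2 \<le> - (LINT x|UI. LA \<sigma> t x * ?p t x)" by (rule sup[OF t y])
  also have "\<dots> \<le> L2n (LA \<sigma> t) * L2n (?p t)"
    using L2_Cauchy_Schwarz[OF bmeas_sqint[OF bk[OF s']] bmeas_sqint[OF bp], of t t] by linarith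
  also have "\<dots> \<le> (12 * K) * (24 * K / sqrt (1 + 2 * t))" by (intro mult_mono LA_bound s t Lp) auto
  finally show ?thesis by (simp add: power2_eq_square)
qed

end

lemma LIMSEQ_square_le:
  fixes X :: "nat \<Rightarrow> real"
  assumes "X \<longlonglongrightarrow> l" "\<And>n. (X n)\<^sup>2 \<le> c" shows "l\<^sup>2 \<le> c"
  by (rule LIMSEQ_le_const2[OF tendsto_power[OF assms(1)]]) (use assms(2) in auto)

lemma abs_le_sqrt_iff_square: "x\<^sup>2 \<le> c \<Longrightarrow> \<bar>x\<bar> \<le> sqrt c" for x c :: real
  by (metis real_sqrt_abs real_sqrt_le_mono)

text \<open>
  A fixed sequence of averaging lengths; the limit along it exists by the Cauchy estimate.
\<close>

definition step :: "nat \<Rightarrow> real" where "step n = 1 / real (Suc n)"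

lemma step_pos [simp]: "0 < step n" by (simp add: step_def)

lemma step_lim: "step \<longlonglongrightarrow> 0"
  unfolding step_def[abs_def] using LIMSEQ_inverse_real_of_nat by (simp add: inverse_eq_divide)

context flow
begin

text \<open>
  The distance from \<open>V (step n)\<close> to the limit, from the Cauchy estimate with constant
  \<open>24 \<cdot> 20 = 480\<close>.
\<close>

definition lift_err where "lift_err n = sqrt (480 * K\<^sup>2 * step n)"

lemma lift_err_lim: "lift_err \<longlonglongrightarrow> 0"
proof -
  have "(\<lambda>n. sqrt (480 * K\<^sup>2 * step n)) \<longlonglongrightarrow> sqrt (480 * K\<^sup>2 * 0)" by (intro tendsto_intros step_lim)
  then show ?thesis by (simp add: lift_err_def[abs_def])
qed

lemma V_Cauchy:
  assumes "0 \<le> t" "y \<in> {0..1}"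
  shows "(V (step n) t y - V (step k) t y)\<^sup>2 \<le> 480 * K\<^sup>2 * (step n + step k)"
proof -
  have "(V (step n) t y - V (step k) t y)\<^sup>2 \<le> 24 * K * L2n (\<lambda>x. A (step n) t x - A (step k) t x)"
    by (rule V_diff) (use assms in auto)
  also have "\<dots> \<le> 24 * K * (20 * K * (step n + step k))"
    by (intro mult_left_mono A_Cauchy) (use assms in auto)
  finally show ?thesis by (simp add: power2_eq_square algebra_simps)
qed

definition v where "v t y = lim (\<lambda>n. V (step n) t y)"

lemma V_lim: assumes "0 \<le> t" "y \<in> {0..1}" shows "(\<lambda>n. V (step n) t y) \<longlonglongrightarrow> v t y"
proof -
  have "Cauchy (\<lambda>n. V (step n) t y)"
  proof (rule metric_CauchyI)
    fix e :: real assume e: "0 < e"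
    have "(\<lambda>n. 480 * K\<^sup>2 * (step n + 0)) \<longlonglongrightarrow> 480 * K\<^sup>2 * (0 + 0)" by (intro tendsto_intros step_lim)
    then have "(\<lambda>n. 480 * K\<^sup>2 * step n) \<longlonglongrightarrow> 0" by simp
    moreover have "0 < e\<^sup>2 / 2" using e by simp
    ultimately have "eventually (\<lambda>n. 480 * K\<^sup>2 * step n < e\<^sup>2 / 2) sequentially" by (rule order_tendstoD(2))
    then obtain N where N: "\<And>n. n \<ge> N \<Longrightarrow> 480 * K\<^sup>2 * step n < e\<^sup>2 / 2" by (auto simp: eventually_sequentially)
    have "dist (V (step i) t y) (V (step j) t y) < e" if "i \<ge> N" "j \<ge> N" for i j
    proof -
      have "(V (step i) t y - V (step j) t y)\<^sup>2 < e\<^sup>2"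
        using V_Cauchy[OF assms, of i j] N[OF that(1)] N[OF that(2)] by (simp add: algebra_simps)
      then have "\<bar>V (step i) t y - V (step j) t y\<bar>\<^sup>2 < e\<^sup>2" by simp
      then have "\<bar>V (step i) t y - V (step j) t y\<bar> < e" by (rule power2_less_imp_less) (use e in simp)
      then show ?thesis by (simp add: dist_real_def)
    qed
    then show "\<exists>M. \<forall>i\<ge>M. \<forall>j\<ge>M. dist (V (step i) t y) (V (step j) t y) < e" by blast
  qed
  then show ?thesis unfolding v_def by (simp add: Cauchy_convergent_iff convergent_LIMSEQ_iff)
qed

lemma V_v: assumes "0 \<le> t" "y \<in> {0..1}" shows "\<bar>V (step n) t y - v t y\<bar> \<le> lift_err n"
proof -
  have "(\<lambda>k. (V (step n) t y - V (step k) t y)\<^sup>2) \<longlonglongrightarrow> (V (step n) t y - v t y)\<^sup>2"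
    by (intro tendsto_intros V_lim assms)
  moreover have "(\<lambda>k. 480 * K\<^sup>2 * (step n + step k)) \<longlonglongrightarrow> 480 * K\<^sup>2 * (step n + 0)"
    by (intro tendsto_intros step_lim)
  ultimately have "(V (step n) t y - v t y)\<^sup>2 \<le> 480 * K\<^sup>2 * (step n + 0)"
    by (rule LIMSEQ_le) (use V_Cauchy[OF assms] in auto)
  then show ?thesis using abs_le_sqrt_iff_square by (simp add: lift_err_def)
qed

lemma v_time:
  assumes "0 \<le> t" "0 \<le> u" "y \<in> {0..1}" shows "(v t y - v u y)\<^sup>2 \<le> 288 * K\<^sup>2 * \<bar>t - u\<bar>"
  by (rule LIMSEQ_square_le[OF tendsto_diff[OF V_lim V_lim]]) (use assms V_time in auto)

lemma v_lip:
  assumes "0 \<le> t" "y \<in> {0..1}" "z \<in> {0..1}" shows "\<bar>v t y - v t z\<bar> \<le> 24 * K * \<bar>y - z\<bar>"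
  by (rule LIMSEQ_le_const2[OF tendsto_rabs[OF tendsto_diff[OF V_lim V_lim]]]) (use assms V_lip in auto)

lemma v_mean: assumes "0 \<le> t" "y \<in> {0..1}" shows "\<bar>v t y - m\<bar> \<le> 24 * K"
  by (rule LIMSEQ_le_const2[OF tendsto_rabs[OF tendsto_diff[OF V_lim tendsto_const]]]) (use assms V_mean in auto)

lemma v_decay: assumes "0 \<le> t" "y \<in> {0..1}" shows "(v t y - m)\<^sup>2 \<le> 288 * K\<^sup>2 / sqrt (1 + 2 * t)"
  by (rule LIMSEQ_square_le[OF tendsto_diff[OF V_lim tendsto_const]]) (use assms V_decay in auto)

text \<open>
  Potentials have equal values at 0 and 1; so \<open>v\<close> extends periodically.
\<close>

lemma v_ends: assumes "0 \<le> t" shows "v t 0 = v t 1"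
proof -
  have k: "integrable UI (LA (step n) t)" for n by (rule bmeas_integrable[OF bk]) (simp add: step_def)
  have "V (step n) t 0 = V (step n) t 1" for n by (simp add: V_def lift_def Pot_0[OF k] Pot_1[OF k])
  then show ?thesis by (simp add: v_def)
qed

text \<open>
  Clamping both arguments extends \<open>v\<close> to a continuous function on the plane, which gives joint
  measurability.
\<close>

definition vc where "vc t y = v (max 0 t) (max 0 (min 1 y))"

lemma vc_eq: "0 \<le> t \<Longrightarrow> y \<in> {0..1} \<Longrightarrow> vc t y = v t y" by (simp add: vc_def)

lemma vc_diff: "\<bar>vc t y - vc u z\<bar> \<le> 24 * K * \<bar>y - z\<bar> + sqrt (288 * K\<^sup>2 * \<bar>t - u\<bar>)"
proof -
  let ?y = "max 0 (min 1 y)" and ?z = "max 0 (min 1 z)" and ?t = "max 0 t" and ?u = "max 0 u"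
  have "\<bar>v ?t ?y - v ?t ?z\<bar> \<le> 24 * K * \<bar>?y - ?z\<bar>" by (rule v_lip) auto
  also have "\<dots> \<le> 24 * K * \<bar>y - z\<bar>" by (intro mult_left_mono) auto
  finally have 1: "\<bar>v ?t ?y - v ?t ?z\<bar> \<le> 24 * K * \<bar>y - z\<bar>" .
  have "\<bar>v ?t ?z - v ?u ?z\<bar> \<le> sqrt (288 * K\<^sup>2 * \<bar>?t - ?u\<bar>)"
    by (rule abs_le_sqrt_iff_square[OF v_time]) auto
  also have "\<dots> \<le> sqrt (288 * K\<^sup>2 * \<bar>t - u\<bar>)" by (intro real_sqrt_le_mono mult_left_mono) auto
  finally have 2: "\<bar>v ?t ?z - v ?u ?z\<bar> \<le> sqrt (288 * K\<^sup>2 * \<bar>t - u\<bar>)" .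
  have "vc t y - vc u z = (v ?t ?y - v ?t ?z) + (v ?t ?z - v ?u ?z)" by (simp add: vc_def)
  then have "\<bar>vc t y - vc u z\<bar> \<le> \<bar>v ?t ?y - v ?t ?z\<bar> + \<bar>v ?t ?z - v ?u ?z\<bar>" by (simp only: abs_triangle_ineq)
  then show ?thesis using add_mono[OF 1 2] by (rule order_trans)
qed

lemma vc_continuous: "continuous_on UNIV (\<lambda>p. vc (fst p) (snd p))"
  unfolding continuous_on_def
proof
  fix q :: "real \<times> real"
  define G where "G = (\<lambda>p :: real \<times> real. 24 * K * \<bar>snd p - snd q\<bar> + sqrt (288 * K\<^sup>2 * \<bar>fst p - fst q\<bar>))"
  have "continuous_on UNIV G" unfolding G_def by (intro continuous_intros)
  then have "(G \<longlongrightarrow> G q) (at q within UNIV)" unfolding continuous_on_def by blast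
  then have G: "(G \<longlongrightarrow> 0) (at q)" by (simp add: G_def)
  have "((\<lambda>p. vc (fst p) (snd p) - vc (fst q) (snd q)) \<longlongrightarrow> 0) (at q)"
  proof (rule Lim_null_comparison[OF _ G])
    show "\<forall>\<^sub>F p in at q. norm (vc (fst p) (snd p) - vc (fst q) (snd q)) \<le> G p"
      unfolding G_def real_norm_def by (rule always_eventually, rule allI, rule vc_diff)
  qed
  then show "((\<lambda>p. vc (fst p) (snd p)) \<longlongrightarrow> vc (fst q) (snd q)) (at q within UNIV)"
    by (simp only: LIM_zero_iff)
qed

lemma vc_bound: "\<bar>vc t y\<bar> \<le> \<bar>m\<bar> + 24 * K"
proof -
  have "\<bar>v (max 0 t) (max 0 (min 1 y)) - m\<bar> \<le> 24 * K" by (rule v_mean) auto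
  moreover have "\<bar>a\<bar> \<le> \<bar>c\<bar> + b" if "\<bar>a - c\<bar> \<le> b" for a b c :: real using that by linarith
  ultimately show ?thesis unfolding vc_def by blast
qed

lemma loc_bdd_vc: "loc_bdd vc"
  unfolding loc_bdd_def
proof
  have "(\<lambda>p. vc (fst p) (snd p)) \<in> borel_measurable borel" by (rule borel_measurable_continuous_onI[OF vc_continuous])
  then show "(\<lambda>p. vc (fst p) (snd p)) \<in> borel_measurable (borel \<Otimes>\<^sub>M borel)" by (simp only: borel_prod)
  show "\<forall>T. \<exists>C. \<forall>t x. \<bar>t\<bar> \<le> T \<longrightarrow> \<bar>vc t x\<bar> \<le> C"
    by (intro allI exI[of _ "\<bar>m\<bar> + 24 * K"] impI vc_bound)
qed

definition vW where "vW t x = vc t (W x)"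

lemma loc_bdd_vW: "loc_bdd vW"
  unfolding loc_bdd_def
proof
  show "(\<lambda>p. vW (fst p) (snd p)) \<in> borel_measurable (borel \<Otimes>\<^sub>M borel)"
    unfolding vW_def
    by (rule loc_bdd_compose[OF loc_bdd_vc measurable_fst measurable_compose[OF measurable_snd W_measurable]])
  show "\<forall>T. \<exists>C. \<forall>t x. \<bar>t\<bar> \<le> T \<longrightarrow> \<bar>vW t x\<bar> \<le> C"
    unfolding vW_def by (intro allI exI[of _ "\<bar>m\<bar> + 24 * K"] impI vc_bound)
qed

lemma vW_eq: "0 \<le> t \<Longrightarrow> x \<in> {0..1} \<Longrightarrow> vW t x = v t (W x)"
  unfolding vW_def by (rule vc_eq[OF _ W_unit])

lemma bvW: "bmeas (vW t)" by (rule loc_bdd_bmeas[OF loc_bdd_vW])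

lemma A_vW: assumes "0 \<le> t" shows "L2n (\<lambda>x. A (step n) t x - vW t x) \<le> lift_err n"
proof -
  have sgn: "0 \<le> step n" by (simp add: less_imp_le)
  have m': "(\<lambda>x. V (step n) t (W x) - vW t x) \<in> borel_measurable UI"
    unfolding V_def lift_def
    by (intro borel_measurable_diff borel_measurable_add borel_measurable_const Pot_W_measurable bmeas_integrable bk sgn
        borel_measurable_UI bmeas_measurable bvW)
  have "L2n (\<lambda>x. A (step n) t x - vW t x) = L2n (\<lambda>x. V (step n) t (W x) - vW t x)"
  proof (rule L2n_cong_AE[OF _ _ m'])
    show "AE x in UI. A (step n) t x - vW t x = V (step n) t (W x) - vW t x"
      using A_rep[OF step_pos assms] by eventually_elim simp
    show "(\<lambda>x. A (step n) t x - vW t x) \<in> borel_measurable UI"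
      by (rule borel_measurable_UI[OF bmeas_measurable[OF bmeas_diff[OF bA[OF sgn] bvW]]])
  qed
  also have "\<dots> \<le> lift_err n"
  proof (rule L2n_le_bound[OF _ _ m'])
    show "\<bar>V (step n) t (W x) - vW t x\<bar> \<le> lift_err n" if "x \<in> {0..1}" for x
      using V_v[OF assms W_unit[OF that], of n] by (simp add: vW_eq[OF assms that])
    show "0 \<le> lift_err n" by (simp add: lift_err_def less_imp_le)
  qed
  finally show ?thesis .
qed

lemma vW_0: "AE x in UI. vW 0 x = h x"
proof -
  have sgn: "0 \<le> step n" for n by (simp add: less_imp_le)
  have b: "bmeas (\<lambda>x. vW 0 x - h x)" by (intro bmeas_diff bvW bh)
  have le: "L2n (\<lambda>x. vW 0 x - h x) \<le> 20 * K * step n + lift_err n" for n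
  proof -
    have "L2n (\<lambda>x. vW 0 x - h x) = L2n (\<lambda>x. (A (step n) 0 x - h x) - (A (step n) 0 x - vW 0 x))" by simp
    also have "\<dots> \<le> L2n (\<lambda>x. A (step n) 0 x - h x) + L2n (\<lambda>x. A (step n) 0 x - vW 0 x)"
      by (intro L2n_diff_triangle bmeas_sqint bmeas_diff bA sgn bh bvW)
    also have "\<dots> \<le> 20 * K * step n + lift_err n" by (intro add_mono A_0_bound A_vW step_pos order_refl)
    finally show ?thesis .
  qed
  have "(\<lambda>n. 20 * K * step n + lift_err n) \<longlonglongrightarrow> 20 * K * 0 + 0" by (intro tendsto_intros step_lim lift_err_lim)
  then have "L2n (\<lambda>x. vW 0 x - h x) \<le> 20 * K * 0 + 0" by (rule LIMSEQ_le_const) (use le in auto)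
  then have "L2n (\<lambda>x. vW 0 x - h x) = 0" using L2n_nonneg[of "\<lambda>x. vW 0 x - h x"] by linarith
  then have "AE x in UI. vW 0 x - h x = 0" by (rule L2n_zero_AE[OF bmeas_sqint[OF b]])
  then show ?thesis by simp
qed

lemma AE_test_limit:
  assumes c: "sqint ww" and t: "0 \<le> t"
  shows "(\<lambda>n. LINT x|UI. ww x * A (step n) t x) \<longlonglongrightarrow> (LINT x|UI. ww x * vW t x)"
proof (rule Lim_transform2[OF tendsto_const], rule Lim_null_comparison)
  have sgn: "0 \<le> step n" for n by (simp add: less_imp_le)
  have "norm ((LINT x|UI. ww x * vW t x) - (LINT x|UI. ww x * A (step n) t x)) \<le> L2n ww * lift_err n" for n
  proof -
    have "(LINT x|UI. ww x * vW t x) - (LINT x|UI. ww x * A (step n) t x) = (LINT x|UI. ww x * vW t x - ww x * A (step n) t x)"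
      by (rule Bochner_Integration.integral_diff[symmetric])
        (intro sqint_mult c bmeas_sqint bvW bA sgn)+
    also have "\<dots> = - (LINT x|UI. ww x * (A (step n) t x - vW t x))"
      by (subst integral_minus[symmetric]) (simp add: algebra_simps)
    finally have "norm ((LINT x|UI. ww x * vW t x) - (LINT x|UI. ww x * A (step n) t x)) \<le> L2n ww * L2n (\<lambda>x. A (step n) t x - vW t x)"
      using L2_Cauchy_Schwarz[OF c bmeas_sqint[OF bmeas_diff[OF bA[OF sgn] bvW]], of n t t] by simp
    also have "\<dots> \<le> L2n ww * lift_err n" by (intro mult_left_mono A_vW t) auto
    finally show ?thesis .
  qed
  then show "\<forall>\<^sub>F n in sequentially. norm ((LINT x|UI. ww x * vW t x) - (LINT x|UI. ww x * A (step n) t x)) \<le> L2n ww * lift_err n"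
    by (intro always_eventually allI)
  have "(\<lambda>n. L2n ww * lift_err n) \<longlonglongrightarrow> L2n ww * 0" by (intro tendsto_intros lift_err_lim)
  then show "(\<lambda>n. L2n ww * lift_err n) \<longlonglongrightarrow> 0" by simp
qed

lemma LA_test_limit:
  assumes c: "bmeas ww" and T: "0 \<le> T"
  shows "(\<lambda>n. LINT r:{0..T}|lborel. LINT x|UI. ww x * LA (step n) r x) \<longlonglongrightarrow> (LINT x|UI. ww x * (vW T x - h x))"
proof -
  have sgn: "0 \<le> step n" for n by (simp add: less_imp_le)
  have sc: "sqint ww" by (rule bmeas_sqint[OF c])
  have eq: "(LINT r:{0..T}|lborel. LINT x|UI. ww x * LA (step n) r x)
      = (LINT x|UI. ww x * A (step n) T x) - (LINT x|UI. ww x * A (step n) 0 x)" for n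
  proof -
    have "(LINT r:{0..T}|lborel. LINT x|UI. ww x * LA (step n) r x) = (LINT x|UI. ww x * tint (LA (step n)) T x)"
      by (rule Fubini_time(1)[OF bmeas_integrable[OF c] traj_loc_bdd(2)[OF traj_A[OF sgn]], symmetric])
    also have "\<dots> = (LINT x|UI. ww x * A (step n) T x - ww x * A (step n) 0 x)"
      using trajD[OF traj_A[OF sgn, of n] T] by (simp add: algebra_simps)
    also have "\<dots> = (LINT x|UI. ww x * A (step n) T x) - (LINT x|UI. ww x * A (step n) 0 x)"
      by (rule Bochner_Integration.integral_diff) (intro sqint_mult sc bmeas_sqint bA sgn)+
    finally show ?thesis .
  qed
  have e0: "(LINT x|UI. ww x * vW 0 x) = (LINT x|UI. ww x * h x)"
  proof (rule integral_cong_AE)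
    show "AE x in UI. ww x * vW 0 x = ww x * h x" using vW_0 by eventually_elim simp
  qed (intro borel_measurable_times borel_measurable_UI bmeas_measurable c bvW bh)+
  have "(LINT x|UI. ww x * (vW T x - h x)) = (LINT x|UI. ww x * vW T x - ww x * h x)" by (simp add: algebra_simps)
  also have "\<dots> = (LINT x|UI. ww x * vW T x) - (LINT x|UI. ww x * vW 0 x)"
    unfolding e0 by (rule Bochner_Integration.integral_diff) (intro sqint_mult sc bmeas_sqint bvW bh)+
  finally have e1: "(LINT x|UI. ww x * (vW T x - h x)) = (LINT x|UI. ww x * vW T x) - (LINT x|UI. ww x * vW 0 x)" .
  show ?thesis unfolding eq e1 by (intro tendsto_diff AE_test_limit sc T order_refl)
qed

lemma time_integral_limit:
  fixes T :: real
  assumes i: "\<And>n. set_integrable lborel {0..T} (F n)" "set_integrable lborel {0..T} G"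
    and b: "\<And>n r. 0 \<le> r \<Longrightarrow> r \<le> T \<Longrightarrow> \<bar>F n r - G r\<bar> \<le> C * lift_err n" and T: "0 \<le> T"
  shows "(\<lambda>n. LINT r:{0..T}|lborel. F n r) \<longlonglongrightarrow> (LINT r:{0..T}|lborel. G r :: real)"
proof (rule Lim_transform2[OF tendsto_const], rule Lim_null_comparison)
  have "norm ((LINT r:{0..T}|lborel. G r) - (LINT r:{0..T}|lborel. F n r)) \<le> C * lift_err n * (T - 0)" for n
  proof -
    have d: "set_integrable lborel {0..T} (\<lambda>r. F n r - G r)" "set_integrable lborel {0..T} (\<lambda>r. G r - F n r)"
      by (intro set_integral_diff(1) i)+
    have "(LINT r:{0..T}|lborel. F n r - G r) \<le> C * lift_err n * (T - 0)"
      by (rule set_integral_le_const[OF d(1) T]) (use b[of _ n] in \<open>simp add: abs_le_iff\<close>)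
    moreover have "(LINT r:{0..T}|lborel. G r - F n r) \<le> C * lift_err n * (T - 0)"
      by (rule set_integral_le_const[OF d(2) T]) (use b[of _ n] in \<open>simp add: abs_le_iff\<close>)
    ultimately show ?thesis using set_integral_diff(2)[OF i(1)[of n] i(2)] set_integral_diff(2)[OF i(2) i(1)[of n]] by (simp add: abs_le_iff)
  qed
  then show "\<forall>\<^sub>F n in sequentially. norm ((LINT r:{0..T}|lborel. G r) - (LINT r:{0..T}|lborel. F n r)) \<le> C * lift_err n * (T - 0)"
    by (intro always_eventually allI)
  have "(\<lambda>n. C * lift_err n * (T - 0)) \<longlonglongrightarrow> C * 0 * (T - 0)" by (intro tendsto_intros lift_err_lim)
  then show "(\<lambda>n. C * lift_err n * (T - 0)) \<longlonglongrightarrow> 0" by simp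
qed

text \<open>
  The equation \<open>L (\<integral> A) = A(T) - A(0)\<close> for the averages passes to the limit, since \<open>A\<close> converges to
  \<open>vW\<close> in \<open>L\<^sup>2\<close> uniformly in time and \<open>A(0)\<close> converges to \<open>h\<close>.
\<close>

lemma vW_weak: assumes T: "0 \<le> T" shows "weakL (tint vW T) (\<lambda>x. vW T x - h x)"
  unfolding weakL_def
proof (intro conjI allI impI)
  have sgn: "0 \<le> step n" for n by (simp add: less_imp_le)
  show "integrable UI (tint vW T)" "integrable UI (\<lambda>x. vW T x - h x)"
    by (intro bmeas_integrable loc_bdd_bmeas tint_loc_bdd loc_bdd_vW bmeas_diff bvW bh)+
  have "(\<lambda>n. LINT r:{0..T}|lborel. LINT x|UI. 1 * LA (step n) r x) \<longlonglongrightarrow> (LINT x|UI. 1 * (vW T x - h x))"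
    by (rule LA_test_limit[OF bmeas_const T])
  moreover have "(LINT r:{0..T}|lborel. LINT x|UI. 1 * LA (step n) r x) = 0" for n
  proof -
    have "(LINT r:{0..T}|lborel. LINT x|UI. 1 * LA (step n) r x) = (LINT r:{0..T}|lborel. 0)"
      by (rule set_lebesgue_integral_cong) (use weak_A[OF sgn, of _ n] in \<open>auto simp: weakL_def\<close>)
    then show ?thesis by (simp add: set_lebesgue_integral_def)
  qed
  ultimately have "(\<lambda>n. 0 :: real) \<longlonglongrightarrow> (LINT x|UI. vW T x - h x)" by simp
  then show "(LINT x|UI. vW T x - h x) = 0" by (simp add: LIMSEQ_const_iff)
  fix g' assume g': "testg g'"
  have bg: "bmeas g'" using g' by (auto simp: testg_def bmeas_def)
  note gi = testg_integrable[OF g']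
  have bP: "bmeas (\<lambda>x. Pot g' (W x))"
    unfolding bmeas_def using measurable_compose[OF W_measurable Pot_measurable[OF gi]] Pot_abs[OF gi] by blast
  have eq: "(LINT r:{0..T}|lborel. LINT x|UI. Pot g' (W x) * LA (step n) r x) = (LINT r:{0..T}|lborel. LINT x|UI. g' x * A (step n) r x)" for n
    by (rule set_lebesgue_integral_cong) (use weak_A[OF sgn, of _ n] g' in \<open>auto simp: weakL_def mult.commute\<close>)
  have "(\<lambda>n. LINT r:{0..T}|lborel. LINT x|UI. g' x * A (step n) r x) \<longlonglongrightarrow> (LINT x|UI. Pot g' (W x) * (vW T x - h x))"
    using LA_test_limit[OF bP T] unfolding eq .
  moreover have "(\<lambda>n. LINT r:{0..T}|lborel. LINT x|UI. g' x * A (step n) r x) \<longlonglongrightarrow> (LINT r:{0..T}|lborel. LINT x|UI. g' x * vW r x)"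
  proof (rule time_integral_limit[OF _ _ _ T])
    show "set_integrable lborel {0..T} (\<lambda>r. LINT x|UI. g' x * A (step n) r x)" for n
      by (rule Fubini_time(2)[OF gi traj_loc_bdd(1)[OF traj_A[OF sgn]]])
    show "set_integrable lborel {0..T} (\<lambda>r. LINT x|UI. g' x * vW r x)" by (rule Fubini_time(2)[OF gi loc_bdd_vW])
    fix n r :: real and n' :: nat assume r: "0 \<le> r" "r \<le> T"
    have "(LINT x|UI. g' x * A (step n') r x) - (LINT x|UI. g' x * vW r x) = (LINT x|UI. g' x * A (step n') r x - g' x * vW r x)"
      by (rule Bochner_Integration.integral_diff[symmetric]) (intro sqint_mult bmeas_sqint bg bvW bA sgn)+
    also have "\<dots> = (LINT x|UI. g' x * (A (step n') r x - vW r x))" by (simp add: algebra_simps)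
    finally have "\<bar>(LINT x|UI. g' x * A (step n') r x) - (LINT x|UI. g' x * vW r x)\<bar> \<le> L2n g' * L2n (\<lambda>x. A (step n') r x - vW r x)"
      using L2_Cauchy_Schwarz[OF bmeas_sqint[OF bg] bmeas_sqint[OF bmeas_diff[OF bA[OF sgn] bvW]], of n' r r] by simp
    also have "\<dots> \<le> L2n g' * lift_err n'" by (intro mult_left_mono A_vW r) auto
    finally show "\<bar>(LINT x|UI. g' x * A (step n') r x) - (LINT x|UI. g' x * vW r x)\<bar> \<le> L2n g' * lift_err n'" .
  qed
  ultimately have "(LINT x|UI. Pot g' (W x) * (vW T x - h x)) = (LINT r:{0..T}|lborel. LINT x|UI. g' x * vW r x)"
    by (rule LIMSEQ_unique)
  also have "\<dots> = (LINT x|UI. g' x * tint vW T x)" by (rule Fubini_time(1)[OF gi loc_bdd_vW, symmetric])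
  finally show "(LINT x|UI. (vW T x - h x) * Pot g' (W x)) = (LINT x|UI. tint vW T x * g' x)" by (simp add: mult.commute)
qed

text \<open>
  Both sides solve the same integrated equation.
\<close>

lemma rho_eq_vW: assumes T: "0 \<le> T" shows "AE x in UI. \<rho> T x = vW T x"
proof -
  let ?z = "\<lambda>t x. \<rho> t x - vW t x"
  have j: "loc_bdd ?z" using loc_bdd_lin[OF loc_bdd_\<rho> loc_bdd_vW, of 1 "-1"] by simp
  have w: "weakL (tint ?z t) (?z t)" if t: "0 \<le> t" for t
  proof -
    have "weakL (\<lambda>x. P t x - tint vW t x) (\<lambda>x. (\<rho> t x - h x) - (vW t x - h x))"
      by (rule weakL_diff[OF weak[OF t] vW_weak[OF t]])
    moreover have "(\<lambda>x. P t x - tint vW t x) = tint ?z t"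
      using tint_lin[OF loc_bdd_\<rho> loc_bdd_vW, of 1 "-1" t] by (simp add: fun_eq_iff)
    ultimately show ?thesis by simp
  qed
  have "AE x in UI. ?z T x = 0"
    by (rule weak_uniqueness(2)[OF j w T w]) (use T in auto)
  then show ?thesis by simp
qed

text \<open>
  For each average, the two integrations by parts turn \<open>\<integral> q V\<close> into \<open>\<integral> (L A) (\<phi> \<circ> W)\<close>, and \<open>L A\<close> is the
  time derivative of \<open>A\<close>; integrate in time and let the averaging length tend to 0.
\<close>

lemma v_weak_H2:
  assumes T: "0 \<le> T" and q: "integrable UI q" "(LINT s|UI. q s) = 0"
    and \<phi>: "\<And>s. s \<in> {0..1} \<Longrightarrow> \<phi> s = c + prim (\<lambda>r. d + prim q r) s" and \<phi>0: "(LINT s|UI. d + prim q s) = 0"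
    and b\<phi>: "bmeas \<phi>"
  shows "(LINT r:{0..T}|lborel. LINT s|UI. q s * v r s) = (LINT x|UI. \<phi> (W x) * (vW T x - h x))"
proof -
  have sgn: "0 \<le> step n" for n by (simp add: less_imp_le)
  have b: "bmeas (\<lambda>x. \<phi> (W x))"
    unfolding bmeas_def using measurable_compose[OF W_measurable bmeas_measurable[OF b\<phi>]] b\<phi> by (auto simp: bmeas_def)
  have bV: "bmeas (V (step n) r)" for n r
  proof -
    have k: "integrable UI (LA (step n) r)" by (intro bmeas_integrable bk sgn)
    have "bmeas (Pot (LA (step n) r))" unfolding bmeas_def using Pot_measurable[OF k] Pot_abs[OF k] by blast
    from bmeas_add[OF this bmeas_const[of "m - (LINT x|UI. Pot (LA (step n) r) (W x))"]]
    show ?thesis by (simp add: V_def lift_def[abs_def] algebra_simps)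
  qed
  have eq: "(LINT x|UI. \<phi> (W x) * LA (step n) r x) = (LINT s|UI. q s * V (step n) r s)" if "0 \<le> r" for n r
    unfolding V_def using Pot_mult_parts[OF _ _ q \<phi> \<phi>0, of "LA (step n) r" m] weak_A[OF sgn that, of n]
    by (simp add: weakL_def mult.commute)
  have eqT: "(LINT r:{0..T}|lborel. LINT x|UI. \<phi> (W x) * LA (step n) r x) = (LINT r:{0..T}|lborel. LINT s|UI. q s * V (step n) r s)" for n
    by (rule set_lebesgue_integral_cong) (use eq in auto)
  have vq: "(LINT s|UI. q s * v r s) = (LINT s|UI. q s * vc r s)" if "0 \<le> r" for r
    by (intro Bochner_Integration.integral_cong refl) (use that in \<open>simp add: vc_eq\<close>)
  have vqT: "(LINT r:{0..T}|lborel. LINT s|UI. q s * v r s) = (LINT r:{0..T}|lborel. LINT s|UI. q s * vc r s)"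
    by (rule set_lebesgue_integral_cong) (use vq in auto)
  have "(\<lambda>n. LINT r:{0..T}|lborel. LINT s|UI. q s * V (step n) r s) \<longlonglongrightarrow> (LINT x|UI. \<phi> (W x) * (vW T x - h x))"
    using LA_test_limit[OF b T] unfolding eqT .
  moreover have "(\<lambda>n. LINT r:{0..T}|lborel. LINT s|UI. q s * V (step n) r s) \<longlonglongrightarrow> (LINT r:{0..T}|lborel. LINT s|UI. q s * vc r s)"
  proof (rule time_integral_limit[OF _ _ _ T])
    show "set_integrable lborel {0..T} (\<lambda>r. LINT s|UI. q s * V (step n) r s)" for n
    proof -
      have "set_integrable lborel {0..T} (\<lambda>r. LINT x|UI. \<phi> (W x) * LA (step n) r x)"
        by (rule Fubini_time(2)[OF bmeas_integrable[OF b] traj_loc_bdd(2)[OF traj_A[OF sgn]]])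
      moreover have "set_integrable lborel {0..T} (\<lambda>r. LINT x|UI. \<phi> (W x) * LA (step n) r x)
         \<longleftrightarrow> set_integrable lborel {0..T} (\<lambda>r. LINT s|UI. q s * V (step n) r s)"
        by (rule set_integrable_cong) (use eq in auto)
      ultimately show ?thesis by simp
    qed
    show "set_integrable lborel {0..T} (\<lambda>r. LINT s|UI. q s * vc r s)" by (rule Fubini_time(2)[OF q(1) loc_bdd_vc])
    fix n :: nat and r :: real assume r: "0 \<le> r" "r \<le> T"
    have i: "integrable UI (\<lambda>s. q s * V (step n) r s)" "integrable UI (\<lambda>s. q s * vc r s)"
      by (intro bmeas_mult_integrable bV loc_bdd_bmeas loc_bdd_vc q)+
    have "(LINT s|UI. q s * V (step n) r s) - (LINT s|UI. q s * vc r s) = (LINT s|UI. q s * V (step n) r s - q s * vc r s)"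
      by (rule Bochner_Integration.integral_diff[symmetric, OF i])
    then have "\<bar>(LINT s|UI. q s * V (step n) r s) - (LINT s|UI. q s * vc r s)\<bar> \<le> (LINT s|UI. \<bar>q s * V (step n) r s - q s * vc r s\<bar>)"
      by (simp only: integral_abs_bound)
    also have "\<dots> \<le> (LINT s|UI. \<bar>q s\<bar> * lift_err n)"
    proof (rule integral_mono)
      show "integrable UI (\<lambda>s. \<bar>q s * V (step n) r s - q s * vc r s\<bar>)" using i by auto
      show "integrable UI (\<lambda>s. \<bar>q s\<bar> * lift_err n)" using q(1) by simp
      fix s assume s: "s \<in> space UI"
      then have "\<bar>V (step n) r s - vc r s\<bar> \<le> lift_err n" using V_v[OF r(1), of s n] by (simp add: vc_eq[OF r(1)])
      then have "\<bar>q s\<bar> * \<bar>V (step n) r s - vc r s\<bar> \<le> \<bar>q s\<bar> * lift_err n" by (intro mult_left_mono) auto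
      then show "\<bar>q s * V (step n) r s - q s * vc r s\<bar> \<le> \<bar>q s\<bar> * lift_err n"
        by (simp only: abs_mult[symmetric] right_diff_distrib)
    qed
    also have "\<dots> = (LINT s|UI. \<bar>q s\<bar>) * lift_err n" by simp
    finally show "\<bar>(LINT s|UI. q s * V (step n) r s) - (LINT s|UI. q s * vc r s)\<bar> \<le> (LINT s|UI. \<bar>q s\<bar>) * lift_err n" .
  qed
  ultimately have "(LINT x|UI. \<phi> (W x) * (vW T x - h x)) = (LINT r:{0..T}|lborel. LINT s|UI. q s * vc r s)"
    by (rule LIMSEQ_unique)
  then show ?thesis unfolding vqT by simp
qed

end

section \<open>Trigonometric polynomials as test functions\<close>

text \<open>
  The algebra generated by \<open>cos (2 \<pi> x)\<close> and \<open>sin (2 \<pi> x)\<close>. It is closed under derivatives and consists of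
  smooth periodic functions, and Stone-Weierstrass makes it dense; so it supplies all the smooth test
  functions that weak derivatives have to be tested with.
\<close>

inductive trig_poly :: "(real \<Rightarrow> real) \<Rightarrow> bool" where
  trig_poly_const: "trig_poly (\<lambda>_. c)"
| trig_poly_cos: "trig_poly (\<lambda>x. cos (2 * pi * x))"
| trig_poly_sin: "trig_poly (\<lambda>x. sin (2 * pi * x))"
| trig_poly_add: "trig_poly f \<Longrightarrow> trig_poly g \<Longrightarrow> trig_poly (\<lambda>x. f x + g x)"
| trig_poly_mult: "trig_poly f \<Longrightarrow> trig_poly g \<Longrightarrow> trig_poly (\<lambda>x. f x * g x)"

lemma trig_poly_derivative: "trig_poly f \<Longrightarrow> \<exists>f'. trig_poly f' \<and> (\<forall>x. (f has_real_derivative f' x) (at x))"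
proof (induction rule: trig_poly.induct)
  case (trig_poly_const c)
  show ?case by (intro exI[of _ "\<lambda>_. 0"]) (auto intro: trig_poly.intros)
next
  case trig_poly_cos
  have "trig_poly (\<lambda>x. - (2 * pi) * sin (2 * pi * x))" by (intro trig_poly.intros)
  then show ?case by (intro exI[of _ "\<lambda>x. - (2 * pi) * sin (2 * pi * x)"]) (auto intro!: derivative_eq_intros)
next
  case trig_poly_sin
  have "trig_poly (\<lambda>x. (2 * pi) * cos (2 * pi * x))" by (intro trig_poly.intros)
  then show ?case by (intro exI[of _ "\<lambda>x. (2 * pi) * cos (2 * pi * x)"]) (auto intro!: derivative_eq_intros)
next
  case (trig_poly_add f g)
  then obtain f' g' where "trig_poly f'" "\<forall>x. (f has_real_derivative f' x) (at x)" "trig_poly g'" "\<forall>x. (g has_real_derivative g' x) (at x)"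
    by blast
  then show ?case by (intro exI[of _ "\<lambda>x. f' x + g' x"]) (auto intro!: derivative_intros trig_poly.intros)
next
  case (trig_poly_mult f g)
  then obtain f' g' where d: "trig_poly f'" "\<forall>x. (f has_real_derivative f' x) (at x)" "trig_poly g'" "\<forall>x. (g has_real_derivative g' x) (at x)"
    by blast
  have "trig_poly (\<lambda>x. f' x * g x + g' x * f x)" using d trig_poly_mult by (intro trig_poly.intros) auto
  moreover have "((\<lambda>x. f x * g x) has_real_derivative f' x * g x + g' x * f x) (at x)" for x
    using d by (intro DERIV_mult) auto
  ultimately show ?case by blast
qed

lemma trig_poly_periodic: "trig_poly f \<Longrightarrow> f (x + 1) = f x"
proof (induction rule: trig_poly.induct)
  case trig_poly_cos
  have "cos (2 * pi * (x + 1)) = cos (2 * pi * x + 2 * pi)" by (simp add: algebra_simps)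
  then show ?case by simp
next
  case trig_poly_sin
  have "sin (2 * pi * (x + 1)) = sin (2 * pi * x + 2 * pi)" by (simp add: algebra_simps)
  then show ?case by simp
qed auto

lemma trig_poly_bounded: "trig_poly f \<Longrightarrow> \<exists>C. \<forall>x. \<bar>f x\<bar> \<le> C"
proof (induction rule: trig_poly.induct)
  case (trig_poly_add f g)
  then obtain C D where "\<forall>x. \<bar>f x\<bar> \<le> C" "\<forall>x. \<bar>g x\<bar> \<le> D" by blast
  then have "\<bar>f x + g x\<bar> \<le> C + D" for x by (meson abs_triangle_ineq add_mono order_trans)
  then show ?case by blast
next
  case (trig_poly_mult f g)
  then obtain C D where CD: "\<And>x. \<bar>f x\<bar> \<le> C" "\<And>x. \<bar>g x\<bar> \<le> D" by blast
  have "\<bar>f x * g x\<bar> \<le> C * D" for x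
    unfolding abs_mult by (intro mult_mono CD) (use CD[of 0] in auto)
  then show ?case by blast
qed (auto intro: abs_cos_le_one abs_sin_le_one exI[of _ 1])

lemma trig_poly_continuous: "trig_poly f \<Longrightarrow> continuous_on S f"
  using trig_poly_derivative[of f] by (meson DERIV_isCont continuous_at_imp_continuous_on)

lemma trig_poly_bmeas: "trig_poly f \<Longrightarrow> bmeas f"
  unfolding bmeas_def using trig_poly_bounded borel_measurable_continuous_onI[OF trig_poly_continuous] by blast

lemma trig_poly_iterated_deriv: "trig_poly f \<Longrightarrow> trig_poly ((deriv ^^ k) f)"
proof (induction k)
  case (Suc k)
  then obtain f' where "trig_poly f'" "\<forall>x. ((deriv ^^ k) f has_real_derivative f' x) (at x)" using trig_poly_derivative by blast
  then have "deriv ((deriv ^^ k) f) = f'" by (auto simp: fun_eq_iff intro: DERIV_imp_deriv)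
  then show ?case using \<open>trig_poly f'\<close> by simp
qed simp

lemma trig_poly_differentiable: "trig_poly f \<Longrightarrow> f field_differentiable (at x)"
  using trig_poly_derivative[of f] by (auto simp: field_differentiable_def)

lemma test_fun_trig_poly: "trig_poly f \<Longrightarrow> test_fun f"
  unfolding test_fun_def periodic1_def using trig_poly_periodic trig_poly_differentiable trig_poly_iterated_deriv by blast

text \<open>
  The antiderivative is periodic because the integral over a period vanishes; it is smooth because its
  derivative is a trigonometric polynomial.
\<close>

lemma test_fun_antiderivative:
  assumes f: "trig_poly f" and 0: "(LINT x|UI. f x) = 0"
  obtains F where "test_fun F" "deriv F = f" "\<And>x. (F has_real_derivative f x) (at x)"
proof -
  define F where "F x = (LBINT y=ereal 0..ereal x. f y)" for x :: real
  have der: "(F has_real_derivative f x) (at x)" for x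
  proof -
    let ?a = "- \<bar>x\<bar> - 1" and ?b = "\<bar>x\<bar> + 1"
    have "((\<lambda>u. LBINT y=ereal 0..ereal u. f y) has_vector_derivative f x) (at x within {?a..?b})"
      by (rule interval_integral_FTC2[where c=0]) (auto intro: trig_poly_continuous[OF f])
    moreover have "at x within {?a..?b} = at x" by (rule at_within_interior) auto
    ultimately show ?thesis unfolding F_def by (simp add: has_real_derivative_iff_has_vector_derivative)
  qed
  have dF: "deriv F = f" using der by (auto simp: fun_eq_iff intro: DERIV_imp_deriv)
  have per: "F (x + 1) = F x" for x
  proof -
    have "((\<lambda>x. F (x + 1) - F x) has_real_derivative 0) (at x)" for x
    proof -
      have "((\<lambda>x. F (x + 1)) has_real_derivative f (x + 1)) (at x)"
        using DERIV_shift[of F "f (x + 1)" x 1] der[of "x + 1"] by simp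
      from DERIV_diff[OF this der] show ?thesis by (simp add: trig_poly_periodic[OF f])
    qed
    then have "F (x + 1) - F x = F (0 + 1) - F 0" by (intro DERIV_isconst_all) blast
    moreover have "F 0 = 0" by (simp add: F_def)
    moreover have "F 1 = 0" unfolding F_def using 0 by (simp add: interval_integral_Icc LINT_UI)
    ultimately show ?thesis by simp
  qed
  have "(deriv ^^ k) F field_differentiable (at x)" for k x
  proof (cases k)
    case 0
    then show ?thesis using der by (auto simp: field_differentiable_def)
  next
    case (Suc j)
    have "(deriv ^^ Suc j) F = (deriv ^^ j) f" unfolding funpow_Suc_right by (simp add: dF)
    then show ?thesis using Suc trig_poly_differentiable[OF trig_poly_iterated_deriv[OF f]] by simp
  qed
  then have "test_fun F" by (simp add: test_fun_def periodic1_def per)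
  then show ?thesis using dF der by (rule that)
qed

lemma periodic1_int: assumes "periodic1 p" shows "p (x + of_int n) = p x"
proof -
  have s: "p (x + 1) = p x" for x using assms by (simp add: periodic1_def)
  have nat: "p (x + real k) = p x" for x k
  proof (induction k)
    case (Suc k)
    have "p (x + real (Suc k)) = p ((x + real k) + 1)" by (simp add: add_ac)
    then show ?case using s Suc by simp
  qed simp
  show ?thesis
  proof (cases "n \<ge> 0")
    case True
    then show ?thesis using nat[of x "nat n"] by simp
  next
    case False
    then show ?thesis using nat[of "x + of_int n" "nat (- n)"] by simp
  qed
qed

lemma trig_poly_circle: "real_polynomial_function g \<Longrightarrow> trig_poly (\<lambda>x. g (cis (2 * pi * x)))"
proof (induction rule: real_polynomial_function.induct)
  case (linear f)
  interpret f: bounded_linear f by fact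
  have "f (cis \<theta>) = f 1 * cos \<theta> + f \<i> * sin \<theta>" for \<theta>
  proof -
    have "cis \<theta> = cos \<theta> *\<^sub>R 1 + sin \<theta> *\<^sub>R \<i>" by (simp add: complex_eq_iff)
    then show ?thesis by (simp only: f.add f.scaleR) simp
  qed
  then show ?case by (simp add: trig_poly.intros)
next
  case (add f g)
  then show ?case by (intro trig_poly.intros)
next
  case (mult f g)
  then show ?case by (intro trig_poly.intros)
qed (rule trig_poly.intros)

text \<open>
  A periodic function is a continuous function on the unit circle, where real polynomials in the
  coordinates are uniformly dense.
\<close>

lemma trig_poly_dense:
  assumes p: "continuous_on UNIV p" "periodic1 p" and e: "0 < e"
  obtains f where "trig_poly f" "\<And>x. \<bar>p x - f x\<bar> < e"
proof -
  define F where "F z = p (Arg z / (2 * pi))" for z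
  have key: "p (a / (2 * pi)) = p (b / (2 * pi))" if "cis a = cis b" for a b
  proof -
    have "exp (\<i> * of_real a) = exp (\<i> * of_real b)" using that by (simp add: cis_conv_exp)
    then obtain n :: int where "\<i> * of_real a = \<i> * of_real b + (of_int (2 * n) * pi) * \<i>"
      unfolding exp_eq by blast
    then have "\<i> * of_real a = \<i> * of_real (b + of_int (2 * n) * pi)" by (simp add: algebra_simps)
    then have "complex_of_real a = of_real (b + of_int (2 * n) * pi)" by (simp only: mult_cancel_left) simp
    then have "a = b + of_int (2 * n) * pi" by (simp only: of_real_eq_iff)
    then have "a / (2 * pi) = b / (2 * pi) + of_int n" by (simp add: field_simps)
    then show ?thesis by (simp add: periodic1_int[OF p(2)])
  qed
  \<comment> \<open>the two branches of the argument have disjoint cuts, which gives continuity on the whole circle\<close>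
  have F2: "F z = p (Arg2pi z / (2 * pi))" if "z \<in> sphere 0 1" for z
  proof -
    have z: "z \<noteq> 0" "norm z = 1" using that by auto
    have "cis (Arg z) = z" using z cis_Arg[of z] by (simp add: sgn_eq)
    moreover have "cis (Arg2pi z) = z" using z Arg2pi_eq[of z] by (simp add: cis_conv_exp)
    ultimately show ?thesis unfolding F_def by (intro key) simp
  qed
  have pc: "isCont p y" for y using p(1) by (simp add: continuous_on_eq_continuous_at)
  have "continuous_on (sphere 0 1) F"
    unfolding continuous_on_eq_continuous_within
  proof
    fix z :: complex assume z: "z \<in> sphere 0 1"
    show "continuous (at z within sphere 0 1) F"
    proof (cases "z \<in> \<real>\<^sub>\<le>\<^sub>0")
      case False
      have "isCont (\<lambda>z. Arg z / (2 * pi)) z" using False by (intro continuous_intros continuous_at_Arg) auto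
      then have "isCont F z" unfolding F_def by (rule isCont_o2[OF _ pc])
      then show ?thesis by (rule continuous_at_imp_continuous_at_within)
    next
      case True
      then have "z \<notin> \<real>\<^sub>\<ge>\<^sub>0" using z by (auto simp: complex_nonpos_Reals_iff complex_nonneg_Reals_iff cmod_def)
      then have "isCont (\<lambda>z. Arg2pi z / (2 * pi)) z" by (intro continuous_intros continuous_at_Arg2pi) auto
      then have "isCont (\<lambda>z. p (Arg2pi z / (2 * pi))) z" by (rule isCont_o2[OF _ pc])
      then have "continuous (at z within sphere 0 1) (\<lambda>z. p (Arg2pi z / (2 * pi)))"
        by (rule continuous_at_imp_continuous_at_within)
      then show ?thesis
        by (rule continuous_transform_within[where \<delta>=1]) (use z F2 in auto)
    qed
  qed
  from Stone_Weierstrass_real_polynomial_function[OF compact_sphere this e]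
  obtain g where g: "real_polynomial_function g" "\<And>z. z \<in> sphere 0 1 \<Longrightarrow> \<bar>F z - g z\<bar> < e" by blast
  have "\<bar>p x - g (cis (2 * pi * x))\<bar> < e" for x
  proof -
    have c: "cis (Arg (cis (2 * pi * x))) = cis (2 * pi * x)" using cis_Arg[of "cis (2 * pi * x)"] by (simp add: sgn_eq)
    have "F (cis (2 * pi * x)) = p (2 * pi * x / (2 * pi))" unfolding F_def by (rule key[OF c])
    then show ?thesis using g(2)[of "cis (2 * pi * x)"] by simp
  qed
  then show ?thesis by (rule that[OF trig_poly_circle[OF g(1)]])
qed

lemma frac_Lipschitz:
  fixes f :: "real \<Rightarrow> real"
  assumes L: "\<And>s t. s \<in> {0..1} \<Longrightarrow> t \<in> {0..1} \<Longrightarrow> \<bar>f s - f t\<bar> \<le> L * \<bar>s - t\<bar>" and e: "f 0 = f 1"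
  shows "\<bar>f (frac s) - f (frac t)\<bar> \<le> L * \<bar>s - t\<bar>"
proof -
  have L0: "L \<ge> 0" using L[of 0 1] e by simp
  have fr: "frac x \<in> {0..1}" for x :: real using frac_lt_1[of x] by auto
  have *: "\<bar>f (frac s) - f (frac t)\<bar> \<le> L * \<bar>s - t\<bar>" if "s \<le> t" for s t
  proof (cases "\<lfloor>s\<rfloor> = \<lfloor>t\<rfloor>")
    case True
    then have "frac s - frac t = s - t" by (simp add: frac_def)
    then show ?thesis using L[OF fr fr, of s t] by simp
  next
    case False
    then have "\<lfloor>s\<rfloor> + 1 \<le> \<lfloor>t\<rfloor>" using that floor_mono[of s t] by linarith
    then have fl: "of_int \<lfloor>s\<rfloor> + 1 \<le> (of_int \<lfloor>t\<rfloor> :: real)" by linarith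
    have "\<bar>f (frac s) - f 1\<bar> \<le> L * (1 - frac s)" "\<bar>f 0 - f (frac t)\<bar> \<le> L * frac t"
      using L[OF fr, of 1 s] L[OF _ fr, of 0 t] fr[of s] fr[of t] by (auto simp: abs_minus_commute)
    then have "\<bar>f (frac s) - f (frac t)\<bar> \<le> L * (1 - frac s) + L * frac t" using e by linarith
    also have "\<dots> = L * ((1 - frac s) + frac t)" by (simp add: algebra_simps)
    also have "\<dots> \<le> L * \<bar>s - t\<bar>" using fl L0 by (intro mult_left_mono) (auto simp: frac_def)
    finally show ?thesis .
  qed
  show ?thesis using *[of s t] *[of t s] by (cases "s \<le> t") (auto simp: abs_minus_commute)
qed

lemma Lipschitz_continuous:
  fixes f :: "real \<Rightarrow> real"
  assumes "\<And>s t. \<bar>f s - f t\<bar> \<le> L * \<bar>s - t\<bar>" shows "continuous_on UNIV f"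
proof (rule continuous_on_subset[OF lipschitz_on_continuous_on])
  have "0 \<le> L" using assms[of 0 1] by simp
  then show "L-lipschitz_on UNIV f" using assms by (auto simp: lipschitz_on_def dist_real_def)
qed simp

lemma frac_continuous:
  fixes f :: "real \<Rightarrow> real"
  assumes "\<And>s t. s \<in> {0..1} \<Longrightarrow> t \<in> {0..1} \<Longrightarrow> \<bar>f s - f t\<bar> \<le> L * \<bar>s - t\<bar>" "f 0 = f 1"
  shows "continuous_on UNIV (\<lambda>t. f (frac t))"
  by (rule Lipschitz_continuous[OF frac_Lipschitz[OF assms]])

text \<open>
  By density \<open>k\<close> is orthogonal to continuous periodic functions, and trapezoids with steepening sides
  approximate the indicator of \<open>(0,x)\<close>; hence the primitive of \<open>k\<close> vanishes.
\<close>

lemma AE_0_if_orthogonal_trig_poly: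
  assumes k: "integrable UI k" and o: "\<And>f. trig_poly f \<Longrightarrow> (LINT x|UI. k x * f x) = 0"
  shows "AE x in UI. k x = 0"
proof (rule prim_eq_0_imp_AE_0[OF k])
  fix x :: real assume x: "x \<in> {0<..<1}"
  have cont0: "(LINT y|UI. k y * p y) = 0" if p: "continuous_on UNIV p" "periodic1 p" and pb: "bmeas p" for p
  proof (rule ccontr)
    assume n: "(LINT y|UI. k y * p y) \<noteq> 0"
    define M where "M = (LINT y|UI. \<bar>k y\<bar>) + 1"
    have M0: "M > 0" by (simp add: M_def add_nonneg_pos)
    define e where "e = \<bar>LINT y|UI. k y * p y\<bar> / M"
    have e: "e > 0" using n M0 by (simp add: e_def)
    obtain f where f: "trig_poly f" "\<And>x. \<bar>p x - f x\<bar> < e" using trig_poly_dense[OF p e] by blast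
    note i = bmeas_mult_integrable[OF pb k] bmeas_mult_integrable[OF trig_poly_bmeas[OF f(1)] k]
    have "(LINT y|UI. k y * p y) = (LINT y|UI. k y * p y) - (LINT y|UI. k y * f y)" using o[OF f(1)] by simp
    also have "\<dots> = (LINT y|UI. k y * p y - k y * f y)" by (rule Bochner_Integration.integral_diff[symmetric, OF i])
    finally have "\<bar>LINT y|UI. k y * p y\<bar> \<le> (LINT y|UI. \<bar>k y * p y - k y * f y\<bar>)" by (simp only: integral_abs_bound)
    also have "\<dots> \<le> (LINT y|UI. \<bar>k y\<bar> * e)"
    proof (rule integral_mono)
      show "integrable UI (\<lambda>y. \<bar>k y * p y - k y * f y\<bar>)" using i by auto
      show "integrable UI (\<lambda>y. \<bar>k y\<bar> * e)" using k by simp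
      show "\<bar>k y * p y - k y * f y\<bar> \<le> \<bar>k y\<bar> * e" for y
        unfolding right_diff_distrib[symmetric] abs_mult using f(2)[of y] by (intro mult_left_mono) auto
    qed
    also have "\<dots> = (LINT y|UI. \<bar>k y\<bar>) * e" by simp
    also have "\<dots> < M * e" using e by (simp add: M_def)
    also have "\<dots> = \<bar>LINT y|UI. k y * p y\<bar>" using M0 by (simp add: e_def)
    finally show False by simp
  qed
  define p where "p n t = max 0 (min 1 (min (real n * t) (real n * (x - t))))" for n t
  have lip: "\<bar>p n s - p n t\<bar> \<le> real n * \<bar>s - t\<bar>" for n s t
  proof -
    have "\<bar>real n * s - real n * t\<bar> = real n * \<bar>s - t\<bar>" "\<bar>real n * (x - s) - real n * (x - t)\<bar> = real n * \<bar>s - t\<bar>"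
      by (simp_all add: abs_mult[symmetric] right_diff_distrib[symmetric] abs_mult abs_minus_commute)
    moreover have "\<bar>max 0 (min 1 (min a b)) - max 0 (min 1 (min c d))\<bar> \<le> \<delta>" if "\<bar>a - c\<bar> = \<delta>" "\<bar>b - d\<bar> = \<delta>" for a b c d \<delta> :: real
      using that by (auto simp: max_def min_def)
    ultimately show ?thesis unfolding p_def by blast
  qed
  have pe: "p n 0 = p n 1" for n
  proof -
    have "real n * (x - 1) \<le> 0" "0 \<le> real n * x" using x by (simp_all add: mult_le_0_iff)
    then show ?thesis unfolding p_def by simp
  qed
  have pm: "bmeas (\<lambda>t. p n (frac t))" for n
    unfolding bmeas_def
  proof
    show "(\<lambda>t. p n (frac t)) \<in> borel_measurable borel"
      by (rule borel_measurable_continuous_onI[OF frac_continuous[OF lip]]) (rule pe)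
    show "\<exists>C. \<forall>t. \<bar>p n (frac t)\<bar> \<le> C" by (rule exI[of _ 1]) (auto simp: p_def)
  qed
  have z: "(LINT y|UI. k y * p n (frac y)) = 0" for n
  proof (rule cont0[OF _ _ pm])
    show "continuous_on UNIV (\<lambda>t. p n (frac t))"
      by (rule frac_continuous[OF lip]) (rule pe)
    show "periodic1 (\<lambda>t. p n (frac t))" by (simp add: periodic1_def frac_def)
  qed
  have "(\<lambda>n. LINT y|UI. k y * p n (frac y)) \<longlonglongrightarrow> (LINT y|UI. indicator {..x} y * k y)"
  proof (rule integral_dominated_convergence)
    show "integrable UI (\<lambda>y. \<bar>k y\<bar>)" using k by simp
    show "(\<lambda>y. indicator {..x} y * k y) \<in> borel_measurable UI"
      by (rule borel_measurable_integrable[OF integrable_indicator_UI[OF k]]) simp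
    show "(\<lambda>y. k y * p n (frac y)) \<in> borel_measurable UI" for n
      by (rule borel_measurable_integrable[OF bmeas_mult_integrable[OF pm k]])
    show "AE y in UI. norm (k y * p n (frac y)) \<le> \<bar>k y\<bar>" for n
      by (rule AE_I2) (auto simp: abs_mult p_def intro!: mult_left_le)
    show "AE y in UI. (\<lambda>n. k y * p n (frac y)) \<longlonglongrightarrow> indicator {..x} y * k y"
      using AE_UI_neq[of 0] AE_UI_neq[of 1] AE_UI_neq[of x] AE_space[of UI]
    proof eventually_elim
      case (elim y)
      then have y: "0 < y" "y < 1" "y \<noteq> x" "frac y = y" by (auto simp: frac_eq)
      show ?case
      proof (cases "y < x")
        case True
        define c where "c = min y (x - y)"
        have c: "c > 0" using True y by (simp add: c_def)
        obtain N where N: "1 / c < real N" using reals_Archimedean2 by blast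
        have "eventually (\<lambda>n. k y * p n (frac y) = indicator {..x} y * k y) sequentially"
          using eventually_ge_at_top[of N]
        proof eventually_elim
          case (elim n)
          have "1 \<le> real N * c" using N c by (simp add: field_simps)
          also have "\<dots> \<le> real n * c" using elim c by (intro mult_right_mono) auto
          finally have "1 \<le> real n * c" .
          moreover have "real n * c \<le> real n * y" "real n * c \<le> real n * (x - y)"
            by (auto intro!: mult_left_mono simp: c_def)
          ultimately have "p n y = 1" unfolding p_def by simp
          then show ?case using True y by simp
        qed
        then show ?thesis by (rule tendsto_eventually)
      next
        case False
        have "p n y = 0" for n
        proof -
          have "real n * (x - y) \<le> 0" "0 \<le> real n * y" using y False by (simp_all add: mult_le_0_iff)
          then show ?thesis unfolding p_def by simp
        qed
        then show ?thesis using False y by simp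
      qed
    qed
  qed
  then have "(\<lambda>_ :: nat. 0 :: real) \<longlonglongrightarrow> prim k x" unfolding z prim_def .
  then show "prim k x = 0" by (simp add: LIMSEQ_const_iff)
qed

section \<open>Weak derivatives\<close>

lemma L2T_sqint: "g \<in> L2T \<Longrightarrow> sqint g"
  by (auto simp: L2T_def sqint_def integrable_UI_iff intro: borel_measurable_UI)

lemma L2T_integrable: "g \<in> L2T \<Longrightarrow> integrable UI g"
  by (intro sqint_integrable L2T_sqint)

lemma ipT_UI: "ipT p q = (LINT x|UI. p x * q x)"
  unfolding ipT_def by (rule LINT_UI)

lemma test_fun_derivative: "test_fun \<phi> \<Longrightarrow> (\<phi> has_real_derivative deriv \<phi> x) (at x)"
proof -
  assume "test_fun \<phi>"
  then have "(deriv ^^ 0) \<phi> field_differentiable (at x)" unfolding test_fun_def by blast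
  then show ?thesis by (simp add: field_differentiable_derivI)
qed

lemma test_fun_deriv: assumes "test_fun \<phi>" shows "test_fun (deriv \<phi>)"
  unfolding test_fun_def periodic1_def
proof (intro conjI allI)
  fix x k
  have "(deriv ^^ Suc k) \<phi> field_differentiable (at x)" using assms unfolding test_fun_def by blast
  then show "(deriv ^^ k) (deriv \<phi>) field_differentiable (at x)" unfolding funpow_Suc_right by simp
  have p: "\<phi> (y + 1) = \<phi> y" for y using assms by (simp add: test_fun_def periodic1_def)
  have "((\<lambda>y. \<phi> (y + 1)) has_real_derivative deriv \<phi> (x + 1)) (at x)"
    using DERIV_shift[of \<phi> "deriv \<phi> (x + 1)" x 1] test_fun_derivative[OF assms, of "x + 1"] by simp
  then have "(\<phi> has_real_derivative deriv \<phi> (x + 1)) (at x)" by (simp add: p)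
  then show "deriv \<phi> (x + 1) = deriv \<phi> x" by (metis DERIV_imp_deriv)
qed

lemma periodic_continuous_bmeas:
  assumes c: "continuous_on UNIV p" and p: "periodic1 p" shows "bmeas p"
  unfolding bmeas_def
proof
  show "p \<in> borel_measurable borel" by (rule borel_measurable_continuous_onI[OF c])
  have "compact (p ` {0..1})" by (rule compact_continuous_image[OF continuous_on_subset[OF c]]) auto
  then obtain C where "\<forall>y\<in>p ` {0..1}. norm y \<le> C"
    unfolding compact_eq_bounded_closed bounded_iff by blast
  then have C: "\<And>x. x \<in> {0..1} \<Longrightarrow> \<bar>p x\<bar> \<le> C" by simp
  have "\<bar>p x\<bar> \<le> C" for x
  proof -
    have "p x = p (frac x)" using periodic1_int[OF p, of "frac x" "\<lfloor>x\<rfloor>"] by (simp add: frac_def)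
    then show ?thesis using C[of "frac x"] frac_lt_1[of x] by auto
  qed
  then show "\<exists>C. \<forall>x. \<bar>p x\<bar> \<le> C" by blast
qed

lemma test_fun_bmeas: assumes "test_fun \<phi>" shows "bmeas \<phi>"
proof (rule periodic_continuous_bmeas)
  show "continuous_on UNIV \<phi>" using test_fun_derivative[OF assms] by (meson DERIV_isCont continuous_at_imp_continuous_on)
  show "periodic1 \<phi>" using assms by (simp add: test_fun_def)
qed

lemma prim_FTC:
  assumes d: "\<And>x. (F has_real_derivative f x) (at x)" and f: "continuous_on UNIV f" and s: "s \<in> {0..1}"
  shows "prim f s = F s - F 0"
proof -
  have s': "0 \<le> s" "s \<le> 1" using s by auto
  have "prim f s = (LINT z:{0..s}|lborel. f z)" by (rule prim_eq[symmetric, OF s'(2)])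
  also have "\<dots> = (LBINT z. f z * indicator {0..s} z)" by (simp add: set_lebesgue_integral_def mult.commute)
  also have "\<dots> = F s - F 0"
    by (rule integral_FTC_Icc_real[OF s'(1)]) (use d f in \<open>auto intro: has_field_derivative_at_within simp: continuous_on_eq_continuous_at\<close>)
  finally show ?thesis .
qed

lemma test_fun_prim:
  assumes "test_fun \<phi>" "s \<in> {0..1}" shows "prim (deriv \<phi>) s = \<phi> s - \<phi> 0"
proof (rule prim_FTC[OF test_fun_derivative[OF assms(1)] _ assms(2)])
  show "continuous_on UNIV (deriv \<phi>)"
    using test_fun_derivative[OF test_fun_deriv[OF assms(1)]] by (meson DERIV_isCont continuous_at_imp_continuous_on)
qed

lemma test_fun_deriv_mean: assumes "test_fun \<phi>" shows "(LINT x|UI. deriv \<phi> x) = 0"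
proof -
  have "\<phi> (0 + 1) = \<phi> 0" using assms unfolding test_fun_def periodic1_def by blast
  then show ?thesis using test_fun_prim[OF assms, of 1] by (simp add: prim_1)
qed

lemma test_fun_const: "test_fun (\<lambda>_. c)" by (rule test_fun_trig_poly[OF trig_poly_const])

lemma weak_deriv_mean: assumes "has_weak_deriv u g" shows "(LINT x|UI. g x) = 0"
proof -
  have "ipT u (deriv (\<lambda>_. 1 :: real)) = - ipT g (\<lambda>_. 1)" using assms test_fun_const unfolding has_weak_deriv_def by blast
  then show ?thesis by (simp add: ipT_UI)
qed

lemma prim_test_parts:
  assumes g: "integrable UI g" "(LINT x|UI. g x) = 0" and f: "test_fun \<phi>"
  shows "(LINT x|UI. prim g x * deriv \<phi> x) = - (LINT x|UI. g x * \<phi> x)"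
proof -
  have b: "bmeas (deriv \<phi>)" by (rule test_fun_bmeas[OF test_fun_deriv[OF f]])
  then obtain C where C: "\<And>x. \<bar>deriv \<phi> x\<bar> \<le> C" by (auto simp: bmeas_def)
  have "(LINT s|UI. g s * prim (deriv \<phi>) s) = - (LINT r|UI. deriv \<phi> r * prim g r)"
    by (rule prim_parts[OF g borel_measurable_UI[OF bmeas_measurable[OF b]] C])
  moreover have "(LINT s|UI. g s * prim (deriv \<phi>) s) = (LINT s|UI. g s * \<phi> s - \<phi> 0 * g s)"
    by (intro Bochner_Integration.integral_cong refl) (simp add: test_fun_prim[OF f] algebra_simps)
  moreover have "\<dots> = (LINT s|UI. g s * \<phi> s)"
    using g bmeas_mult_integrable[OF test_fun_bmeas[OF f] g(1)] by simp
  ultimately show ?thesis by (simp add: mult.commute)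
qed

text \<open>
  The difference of \<open>u\<close> and the primitive of \<open>g\<close> is orthogonal to derivatives of test functions, in
  particular to all trigonometric polynomials with integral 0; so it is a constant.
\<close>

lemma weak_deriv_primitive:
  assumes w: "has_weak_deriv u g"
  obtains c where "AE x in UI. u x = c + prim g x"
proof -
  have g: "integrable UI g" "(LINT x|UI. g x) = 0" and u: "integrable UI u"
    using w weak_deriv_mean[OF w] by (auto simp: has_weak_deriv_def intro: L2T_integrable)
  have bp: "bmeas (prim g)" unfolding bmeas_def using prim_measurable[OF g(1)] prim_abs_bound[OF g(1)] by blast
  define c where "c = (LINT x|UI. u x - prim g x)"
  have i: "integrable UI (\<lambda>x. u x - prim g x)" using u bmeas_integrable[OF bp] by simp
  have "AE x in UI. (u x - prim g x) - c = 0"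
  proof (rule AE_0_if_orthogonal_trig_poly)
    show "integrable UI (\<lambda>x. (u x - prim g x) - c)" using i by simp
    fix f assume f: "trig_poly f"
    define a where "a = (LINT x|UI. f x)"
    have f': "trig_poly (\<lambda>x. f x + (- a))" by (intro trig_poly.intros f)
    have fi: "integrable UI f" by (rule bmeas_integrable[OF trig_poly_bmeas[OF f]])
    have m0: "(LINT x|UI. f x + (- a)) = 0" using fi by (simp add: a_def)
    obtain F where F: "test_fun F" "deriv F = (\<lambda>x. f x + (- a))" using test_fun_antiderivative[OF f' m0] by metis
    have "(LINT x|UI. u x * deriv F x) = - (LINT x|UI. g x * F x)"
      using w F(1) by (simp add: has_weak_deriv_def ipT_UI)
    also have "\<dots> = (LINT x|UI. prim g x * deriv F x)" using prim_test_parts[OF g F(1)] by simp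
    finally have e1: "(LINT x|UI. u x * (f x - a)) = (LINT x|UI. prim g x * (f x - a))" by (simp add: F(2))
    have fb: "bmeas (\<lambda>x. f x - a)" using trig_poly_bmeas[OF f'] by simp
    have "(LINT x|UI. ((u x - prim g x) - c) * f x)
        = (LINT x|UI. (u x * (f x - a) - prim g x * (f x - a)) + (a * (u x - prim g x) - c * f x))"
      by (simp add: algebra_simps)
    also have "\<dots> = (LINT x|UI. u x * (f x - a) - prim g x * (f x - a)) + (LINT x|UI. a * (u x - prim g x) - c * f x)"
      using bmeas_mult_integrable[OF fb u] bmeas_mult_integrable[OF fb bmeas_integrable[OF bp]] i fi
      by (intro Bochner_Integration.integral_add) auto
    also have "(LINT x|UI. u x * (f x - a) - prim g x * (f x - a)) = 0"
      using bmeas_mult_integrable[OF fb u] bmeas_mult_integrable[OF fb bmeas_integrable[OF bp]] e1 by simp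
    also have "(LINT x|UI. a * (u x - prim g x) - c * f x) = (LINT x|UI. a * (u x - prim g x)) - (LINT x|UI. c * f x)"
      using i fi by (intro Bochner_Integration.integral_diff) auto
    also have "\<dots> = a * c - c * a" unfolding c_def a_def by (simp only: integral_mult_right_zero)
    finally show "(LINT x|UI. ((u x - prim g x) - c) * f x) = 0" by simp
  qed
  then have "AE x in UI. u x = c + prim g x" by eventually_elim simp
  then show ?thesis by (rule that)
qed

lemma weak_deriv_unique:
  assumes "has_weak_deriv u g" "has_weak_deriv u' g'" "AE x in UI. u x = u' x"
  shows "AE x in UI. g x = g' x"
proof -
  have g: "integrable UI g" "integrable UI g'" and m: "u \<in> borel_measurable UI" "u' \<in> borel_measurable UI"
    using assms by (auto simp: has_weak_deriv_def L2T_def intro: L2T_integrable borel_measurable_UI)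
  have "AE x in UI. g x - g' x = 0"
  proof (rule AE_0_if_orthogonal_trig_poly)
    show "integrable UI (\<lambda>x. g x - g' x)" using g by simp
    fix f assume f: "trig_poly f"
    note t = test_fun_trig_poly[OF f]
    have "(LINT x|UI. u x * deriv f x) = (LINT x|UI. u' x * deriv f x)"
    proof (rule integral_cong_AE)
      show "AE x in UI. u x * deriv f x = u' x * deriv f x" using assms(3) by eventually_elim simp
    qed (intro borel_measurable_times m borel_measurable_UI bmeas_measurable test_fun_bmeas test_fun_deriv t)+
    then have "(LINT x|UI. g x * f x) = (LINT x|UI. g' x * f x)"
      using assms t by (simp add: has_weak_deriv_def ipT_UI)
    moreover have "(LINT x|UI. (g x - g' x) * f x) = (LINT x|UI. g x * f x) - (LINT x|UI. g' x * f x)"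
      using bmeas_mult_integrable[OF trig_poly_bmeas[OF f]] g by (simp add: left_diff_distrib)
    ultimately show "(LINT x|UI. (g x - g' x) * f x) = 0" by simp
  qed
  then show ?thesis by eventually_elim simp
qed

lemma has_weak_deriv_cong:
  assumes w: "has_weak_deriv u g" and u': "u' \<in> L2T" and ae: "AE x in UI. u x = u' x"
  shows "has_weak_deriv u' g"
  unfolding has_weak_deriv_def
proof (intro conjI allI impI)
  show "u' \<in> L2T" "g \<in> L2T" using w u' by (auto simp: has_weak_deriv_def)
  have m: "u \<in> borel_measurable UI" "u' \<in> borel_measurable UI"
    using w u' by (auto simp: has_weak_deriv_def L2T_def intro: borel_measurable_UI)
  fix \<phi> assume t: "test_fun \<phi>"
  have "ipT u (deriv \<phi>) = ipT u' (deriv \<phi>)" unfolding ipT_UI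
  proof (rule integral_cong_AE)
    show "AE x in UI. u x * deriv \<phi> x = u' x * deriv \<phi> x" using ae by eventually_elim simp
  qed (intro borel_measurable_times m borel_measurable_UI bmeas_measurable test_fun_bmeas test_fun_deriv t)+
  then show "ipT u' (deriv \<phi>) = - ipT g \<phi>" using w t by (simp add: has_weak_deriv_def)
qed

lemma L2T_diff: assumes "f \<in> L2T" "g \<in> L2T" shows "(\<lambda>x. f x - g x) \<in> L2T"
proof -
  have "sqint (\<lambda>x. 1 * f x + (- 1) * g x)" by (intro sqint_lin L2T_sqint assms)
  then show ?thesis using assms by (auto simp: L2T_def periodic1_def sqint_def integrable_UI_iff)
qed

lemma has_weak_deriv_diff:
  assumes "has_weak_deriv u g" "has_weak_deriv u' g'"
  shows "has_weak_deriv (\<lambda>x. u x - u' x) (\<lambda>x. g x - g' x)"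
  unfolding has_weak_deriv_def
proof (intro conjI allI impI)
  have L: "u \<in> L2T" "g \<in> L2T" "u' \<in> L2T" "g' \<in> L2T" using assms by (auto simp: has_weak_deriv_def)
  then show "(\<lambda>x. u x - u' x) \<in> L2T" "(\<lambda>x. g x - g' x) \<in> L2T" by (auto intro: L2T_diff)
  fix \<phi> assume t: "test_fun \<phi>"
  note b = test_fun_bmeas[OF t] test_fun_bmeas[OF test_fun_deriv[OF t]]
  have "ipT (\<lambda>x. u x - u' x) (deriv \<phi>) = ipT u (deriv \<phi>) - ipT u' (deriv \<phi>)"
    unfolding ipT_UI using bmeas_mult_integrable[OF b(2)] L by (simp add: left_diff_distrib L2T_integrable)
  also have "\<dots> = - (ipT g \<phi> - ipT g' \<phi>)" using assms t by (simp add: has_weak_deriv_def)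
  also have "\<dots> = - ipT (\<lambda>x. g x - g' x) \<phi>"
    unfolding ipT_UI using bmeas_mult_integrable[OF b(1)] L by (simp add: left_diff_distrib L2T_integrable)
  finally show "ipT (\<lambda>x. u x - u' x) (deriv \<phi>) = - ipT (\<lambda>x. g x - g' x) \<phi>" .
qed

lemma weak_deriv_has: assumes "\<exists>g. has_weak_deriv u g" shows "has_weak_deriv u (weak_deriv u)"
  unfolding weak_deriv_def using assms by (rule someI_ex)

lemma H2T_D:
  assumes "f \<in> H2T"
  shows "has_weak_deriv f (weak_deriv f)" "has_weak_deriv (weak_deriv f) (weak_deriv (weak_deriv f))" "bmeas f"
    "continuous_on UNIV f" "periodic1 f"
  using assms weak_deriv_has periodic_continuous_bmeas unfolding H2T_def by blast+

text \<open>
  The set where they differ is relatively open in the unit interval, hence empty if it is null.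
\<close>

lemma continuous_AE_eq:
  fixes f g :: "real \<Rightarrow> real"
  assumes "continuous_on {0..1} f" "continuous_on {0..1} g" "AE x in UI. f x = g x" "x \<in> {0..1}"
  shows "f x = g x"
proof -
  have ne: "x \<in> closure {y \<in> {0..1}. f y = g y}" if x: "x \<in> {0..1}" for x
  proof (rule ccontr)
    assume "x \<notin> closure {y \<in> {0..1}. f y = g y}"
    then obtain e where e: "e > 0" "\<And>y. dist y x < e \<Longrightarrow> y \<notin> {y \<in> {0..1}. f y = g y}"
      unfolding closure_approachable by blast
    define a where "a = max 0 (x - e / 2)"
    define b where "b = min 1 (x + e / 2)"
    have ab: "a < b" using x e(1) by (auto simp: a_def b_def)
    have "AE y in lborel. y \<notin> {a<..<b}"
      using assms(3)[unfolded AE_UI_iff]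
    proof eventually_elim
      case (elim y)
      have "y \<notin> {y \<in> {0..1}. f y = g y}" "y \<in> {0..1}" if "y \<in> {a<..<b}"
        using that e by (auto simp: a_def b_def dist_real_def intro!: e(2))
      then show ?case using elim by blast
    qed
    then have "emeasure lborel {a<..<b} = 0" by (subst (asm) AE_iff_measurable[of "{a<..<b}"]) auto
    then show False using ab by simp
  qed
  have "closed {y \<in> {0..1}. f y = g y}"
  proof -
    have "closed ({0..1} \<inter> (\<lambda>y. f y - g y) -` {0})"
      by (intro continuous_closed_preimage continuous_on_diff assms) auto
    then show ?thesis by (rule back_subst[of closed]) auto
  qed
  then show ?thesis using ne[OF assms(4)] by (simp add: closure_closed)
qed

text \<open>
  Integrating the weak derivatives twice; the representation holds everywhere because both sides are
  continuous. The two integral conditions are the periodicity of \<open>f'\<close> and of \<open>f\<close>.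
\<close>

lemma H2T_representation:
  assumes f: "f \<in> H2T"
  defines "q \<equiv> weak_deriv (weak_deriv f)"
  obtains c d where "q \<in> L2T" "(LINT s|UI. q s) = 0" "(LINT s|UI. d + prim q s) = 0"
    "\<And>s. s \<in> {0..1} \<Longrightarrow> f s = c + prim (\<lambda>r. d + prim q r) s"
    "\<And>s. s \<in> {0..1} \<Longrightarrow> f s = c + prim (weak_deriv f) s"
proof -
  note D = H2T_D[OF f]
  let ?g = "weak_deriv f"
  have qL: "q \<in> L2T" "?g \<in> L2T" using D(2) by (auto simp: has_weak_deriv_def q_def)
  have q0: "(LINT s|UI. q s) = 0" "(LINT s|UI. ?g s) = 0" using weak_deriv_mean D(1,2) unfolding q_def by blast+
  obtain d where d: "AE x in UI. ?g x = d + prim q x" using weak_deriv_primitive[OF D(2)] unfolding q_def by blast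
  obtain c where c: "AE x in UI. f x = c + prim ?g x" using weak_deriv_primitive[OF D(1)] by blast
  have pq: "prim q \<in> borel_measurable UI" by (intro borel_measurable_UI prim_measurable L2T_integrable qL)
  have gm: "?g \<in> borel_measurable UI" using qL(2) by (auto simp: L2T_def intro: borel_measurable_UI)
  have pp: "prim ?g s = prim (\<lambda>r. d + prim q r) s" for s
    unfolding prim_def[of _ s]
  proof (rule integral_cong_AE)
    show "AE r in UI. indicator {..s} r * ?g r = indicator {..s} r * (d + prim q r)" using d by eventually_elim simp
    have i: "(indicator {..s} :: real \<Rightarrow> real) \<in> borel_measurable UI" by (rule borel_measurable_UI) simp
    show "(\<lambda>r. indicator {..s} r * ?g r) \<in> borel_measurable UI" by (intro borel_measurable_times i gm)
    show "(\<lambda>r. indicator {..s} r * (d + prim q r)) \<in> borel_measurable UI"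
      by (intro borel_measurable_times borel_measurable_add borel_measurable_const i pq)
  qed
  have mean: "(LINT s|UI. d + prim q s) = 0"
    using q0(2) integral_cong_AE[OF gm _ d] pq by simp
  have f1: "f s = c + prim ?g s" if "s \<in> {0..1}" for s
  proof (rule continuous_AE_eq[OF _ _ c that])
    show "continuous_on {0..1} f" by (rule continuous_on_subset[OF D(4)]) simp
    show "continuous_on {0..1} (\<lambda>x. c + prim ?g x)"
      by (intro continuous_intros continuous_on_subset[OF continuous_prim[OF L2T_integrable[OF qL(2)]]]) simp
  qed
  then have "f s = c + prim (\<lambda>r. d + prim q r) s" if "s \<in> {0..1}" for s using pp that by simp
  then show ?thesis using that[OF qL(1) q0(1) mean _ f1] by blast
qed

text \<open>
  The one-dimensional Sobolev embedding: \<open>f\<close> differs from each of its values by at most \<open>\<bar>f'\<bar>\<^sub>1\<close>, so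
  \<open>\<bar>f x\<bar> \<le> \<bar>f\<bar>\<^sub>2 + \<bar>f'\<bar>\<^sub>2\<close>.
\<close>

lemma H2T_sup:
  assumes f: "f \<in> H2T" shows "\<bar>f x\<bar> \<le> 2 * H2_norm f"
proof -
  note D = H2T_D[OF f]
  obtain c d where r: "\<And>s. s \<in> {0..1} \<Longrightarrow> f s = c + prim (weak_deriv f) s"
    using H2T_representation[OF f] by metis
  let ?g = "weak_deriv f" and ?q = "weak_deriv (weak_deriv f)"
  have step: "sqint ?g" "sqint f" using D(1) by (auto simp: has_weak_deriv_def intro: L2T_sqint)
  have n: "L2n f \<le> H2_norm f" "L2n ?g \<le> H2_norm f"
    unfolding L2n_def H2_norm_def ipT_UI power2_eq_square by (intro real_sqrt_le_mono, simp)+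
  have "\<bar>f s\<bar> \<le> L2n f + L2n ?g" if s: "s \<in> {0..1}" for s
  proof -
    have i: "integrable UI f" by (rule bmeas_integrable[OF D(3)])
    have "f s = (LINT y|UI. f y + (f s - f y))" by simp
    also have "\<dots> = (LINT y|UI. f y) + (LINT y|UI. f s - f y)" using i by (intro Bochner_Integration.integral_add) auto
    finally have "\<bar>f s\<bar> \<le> \<bar>LINT y|UI. f y\<bar> + \<bar>LINT y|UI. f s - f y\<bar>" by linarith
    also have "\<dots> \<le> (LINT y|UI. \<bar>f y\<bar>) + (LINT y|UI. \<bar>f s - f y\<bar>)" by (intro add_mono integral_abs_bound)
    also have "\<dots> \<le> L2n f + L2n ?g"
    proof (rule add_mono[OF L1_le_L2[OF step(2)]])
      have "(LINT y|UI. \<bar>f s - f y\<bar>) \<le> (LINT y|UI. L2n ?g)"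
      proof (rule integral_mono)
        show "integrable UI (\<lambda>y. \<bar>f s - f y\<bar>)" using i by simp
        fix y assume "y \<in> space UI"
        then have "\<bar>f s - f y\<bar> = \<bar>prim ?g s - prim ?g y\<bar>" using r[OF s] r[of y] by simp
        also have "\<dots> \<le> (LINT r|UI. \<bar>?g r\<bar>)" by (rule prim_diff_le_L1[OF sqint_integrable[OF step(1)]])
        also have "\<dots> \<le> L2n ?g" by (rule L1_le_L2[OF step(1)])
        finally show "\<bar>f s - f y\<bar> \<le> L2n ?g" .
      qed simp
      then show "(LINT y|UI. \<bar>f s - f y\<bar>) \<le> L2n ?g" by simp
    qed
    finally show ?thesis .
  qed
  moreover have "f x = f (frac x)" using periodic1_int[OF D(5), of "frac x" "\<lfloor>x\<rfloor>"] by (simp add: frac_def)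
  moreover have "frac x \<in> {0..1}" using frac_lt_1[of x] by auto
  ultimately have "\<bar>f x\<bar> \<le> L2n f + L2n ?g" by metis
  then show ?thesis using n by linarith
qed

lemma H2T_diff:
  assumes f: "f \<in> H2T" and g: "g \<in> H2T" shows "(\<lambda>x. f x - g x) \<in> H2T"
proof -
  note Df = H2T_D[OF f] and Dg = H2T_D[OF g]
  have w: "has_weak_deriv (\<lambda>x. f x - g x) (\<lambda>x. weak_deriv f x - weak_deriv g x)"
    by (rule has_weak_deriv_diff[OF Df(1) Dg(1)])
  have w': "has_weak_deriv (\<lambda>x. f x - g x) (weak_deriv (\<lambda>x. f x - g x))" by (rule weak_deriv_has) (use w in blast)
  have "AE x in UI. weak_deriv f x - weak_deriv g x = weak_deriv (\<lambda>x. f x - g x) x"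
    by (rule weak_deriv_unique[OF w w']) simp
  then have "has_weak_deriv (weak_deriv (\<lambda>x. f x - g x)) (\<lambda>x. weak_deriv (weak_deriv f) x - weak_deriv (weak_deriv g) x)"
    by (intro has_weak_deriv_cong[OF has_weak_deriv_diff[OF Df(2) Dg(2)]]) (use w' in \<open>auto simp: has_weak_deriv_def\<close>)
  moreover have "continuous_on UNIV (\<lambda>x. f x - g x)" by (intro continuous_intros Df Dg)
  moreover have "periodic1 (\<lambda>x. f x - g x)" using Df(5) Dg(5) by (simp add: periodic1_def)
  ultimately show ?thesis using w unfolding H2T_def by blast
qed

text \<open>
  Integrate \<open>q\<close> twice, choosing the first constant of integration so that the second primitive is
  periodic.
\<close>

lemma H2T_construct:
  assumes q: "bmeas q" "periodic1 q" "(LINT s|UI. q s) = 0"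
  obtains \<phi> where "\<phi> \<in> H2T" "AE x in UI. weak_deriv (weak_deriv \<phi>) x = q x"
proof -
  note qi = bmeas_integrable[OF q(1)]
  have bp: "bmeas (prim q)" unfolding bmeas_def using prim_measurable[OF qi] prim_abs_bound[OF qi] by blast
  define d where "d = - (LINT s|UI. prim q s)"
  define p1 where "p1 s = d + prim q s" for s
  have b1: "bmeas p1" unfolding p1_def[abs_def] by (intro bmeas_add bmeas_const bp)
  have m1: "(LINT s|UI. p1 s) = 0" using bmeas_integrable[OF bp] by (simp add: p1_def d_def)
  note i1 = bmeas_integrable[OF b1]
  obtain C where C: "\<And>x. \<bar>q x\<bar> \<le> C" using q(1) by (auto simp: bmeas_def)
  obtain C1 where C1: "\<And>x. \<bar>p1 x\<bar> \<le> C1" using b1 by (auto simp: bmeas_def)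
  define \<phi> where "\<phi> s = prim p1 (frac s)" for s
  define \<phi>1 where "\<phi>1 s = p1 (frac s)" for s
  have e1: "p1 0 = p1 1" using prim_0[OF qi] q(3) by (simp add: p1_def prim_1)
  have e0: "prim p1 0 = prim p1 1" using prim_0[OF i1] m1 by (simp add: prim_1)
  have l1: "\<bar>p1 s - p1 t\<bar> \<le> C * \<bar>s - t\<bar>" for s t
    using prim_Lipschitz[OF borel_measurable_UI[OF bmeas_measurable[OF q(1)]] C, of s t] by (simp add: p1_def)
  have l0: "\<bar>prim p1 s - prim p1 t\<bar> \<le> C1 * \<bar>s - t\<bar>" for s t
    by (rule prim_Lipschitz[OF borel_measurable_UI[OF bmeas_measurable[OF b1]] C1])
  have c0: "continuous_on UNIV \<phi>" unfolding \<phi>_def[abs_def] by (rule frac_continuous[OF l0 e0])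
  have c1: "continuous_on UNIV \<phi>1" unfolding \<phi>1_def[abs_def] by (rule frac_continuous[OF l1 e1])
  have fr: "frac (x + 1) = frac x" for x :: real by (simp add: frac_def)
  have per: "periodic1 \<phi>" "periodic1 \<phi>1" by (auto simp: periodic1_def \<phi>_def \<phi>1_def fr)
  have bb: "bmeas \<phi>" "bmeas \<phi>1" by (auto intro: periodic_continuous_bmeas c0 c1 per)
  have frac_ae: "AE x in UI. frac x = x"
    using AE_UI_neq[of 1] AE_space[of UI] by eventually_elim (auto simp: frac_eq)
  have ae: "AE x in UI. \<phi> x = prim p1 x" "AE x in UI. \<phi>1 x = p1 x"
    using frac_ae by (eventually_elim, simp add: \<phi>_def \<phi>1_def)+
  have L: "r \<in> L2T" if "bmeas r" "periodic1 r" for r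
    using that bmeas_sqint[OF that(1)] by (auto simp: L2T_def bmeas_def sqint_def integrable_UI_iff)
  have cong: "(LINT x|UI. r x * \<psi> x) = (LINT x|UI. r' x * \<psi> x)" if "AE x in UI. r x = r' x" "bmeas r" "bmeas r'" "bmeas \<psi>" for r r' \<psi>
  proof (rule integral_cong_AE)
    show "AE x in UI. r x * \<psi> x = r' x * \<psi> x" using that(1) by eventually_elim simp
  qed (intro borel_measurable_times borel_measurable_UI bmeas_measurable that)+
  have bpp: "bmeas (prim p1)" unfolding bmeas_def using prim_measurable[OF i1] prim_abs_bound[OF i1] by blast
  have w0: "has_weak_deriv \<phi> \<phi>1"
    unfolding has_weak_deriv_def ipT_UI
  proof (intro conjI allI impI L bb per)
    fix \<psi> assume t: "test_fun \<psi>"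
    note b = test_fun_bmeas[OF t] test_fun_bmeas[OF test_fun_deriv[OF t]]
    show "(LINT x|UI. \<phi> x * deriv \<psi> x) = - (LINT x|UI. \<phi>1 x * \<psi> x)"
      using cong[OF ae(1) bb(1) bpp b(2)] cong[OF ae(2) bb(2) b1 b(1)] prim_test_parts[OF i1 m1 t] by simp
  qed
  have w1: "has_weak_deriv \<phi>1 q"
    unfolding has_weak_deriv_def ipT_UI
  proof (intro conjI allI impI L bb per q)
    fix \<psi> assume t: "test_fun \<psi>"
    note b = test_fun_bmeas[OF t] test_fun_bmeas[OF test_fun_deriv[OF t]]
    have "(LINT x|UI. p1 x * deriv \<psi> x) = (LINT x|UI. d * deriv \<psi> x + prim q x * deriv \<psi> x)"
      by (simp add: p1_def algebra_simps)
    also have "\<dots> = (LINT x|UI. d * deriv \<psi> x) + (LINT x|UI. prim q x * deriv \<psi> x)"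
      using bmeas_integrable[OF b(2)] bmeas_mult_integrable[OF b(2) bmeas_integrable[OF bp]]
      by (intro Bochner_Integration.integral_add) auto
    also have "\<dots> = - (LINT x|UI. q x * \<psi> x)"
      using test_fun_deriv_mean[OF t] prim_test_parts[OF qi q(3) t] by simp
    finally show "(LINT x|UI. \<phi>1 x * deriv \<psi> x) = - (LINT x|UI. q x * \<psi> x)"
      using cong[OF ae(2) bb(2) b1 b(2)] by simp
  qed
  have v0: "has_weak_deriv \<phi> (weak_deriv \<phi>)" by (rule weak_deriv_has) (use w0 in blast)
  have "AE x in UI. \<phi>1 x = weak_deriv \<phi> x" by (rule weak_deriv_unique[OF w0 v0]) simp
  then have w2: "has_weak_deriv (weak_deriv \<phi>) q"
    by (intro has_weak_deriv_cong[OF w1]) (use v0 in \<open>auto simp: has_weak_deriv_def\<close>)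
  have v1: "has_weak_deriv (weak_deriv \<phi>) (weak_deriv (weak_deriv \<phi>))" by (rule weak_deriv_has) (use w2 in blast)
  have "AE x in UI. weak_deriv (weak_deriv \<phi>) x = q x" by (rule weak_deriv_unique[OF v1 w2]) simp
  moreover have "\<phi> \<in> H2T" using c0 per(1) w0 w2 unfolding H2T_def by blast
  ultimately show ?thesis using that by blast
qed

section \<open>Driving functions and their generalized inverses\<close>

text \<open>
  Strict monotonicity is where absolute continuity enters: an arc of \<open>\<mu>\<close>-mass 0 has length 0.
\<close>

lemma class_W_driver:
  assumes "W \<in> class_W" shows "driver W"
proof -
  obtain \<mu> where pt: "prob_torus \<mu>" and d: "distribution_of \<mu> W"
    and ac: "absolutely_continuous \<mu> (restrict_space lborel {0..<1})"
    using assms unfolding class_W_def by blast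
  interpret prob_space \<mu> using pt by (simp add: prob_torus_def)
  have sets: "sets \<mu> = sets (restrict_space borel {0..<1})" using pt by (simp add: prob_torus_def)
  have rc: "continuous (at_right x) W" and W0: "W 0 = 0" and sh: "W (x + 1) = W x + 1" for x
    using d by (auto simp: distribution_of_def algebra_simps)
  have arc: "measure \<mu> (frac ` {\<alpha><..\<beta>}) = W \<beta> - W \<alpha>" if "\<alpha> \<le> \<beta>" "\<beta> \<le> \<alpha> + 1" for \<alpha> \<beta>
    using d that by (simp add: distribution_of_def)
  have mono1: "W \<alpha> \<le> W \<beta>" if "\<alpha> \<le> \<beta>" "\<beta> \<le> \<alpha> + 1" for \<alpha> \<beta>
    using arc[OF that] measure_nonneg[of \<mu> "frac ` {\<alpha><..\<beta>}"] by linarith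
  have small: "W x < W y" if xy: "x < y" "y \<le> x + 1" for x y
  proof -
    define \<beta> where "\<beta> = min y ((of_int \<lfloor>x\<rfloor> + 1 + x) / 2)"
    have fx: "of_int \<lfloor>x\<rfloor> \<le> x" "x < of_int \<lfloor>x\<rfloor> + 1" by linarith+
    have \<beta>: "x < \<beta>" "\<beta> \<le> y" "\<beta> < of_int \<lfloor>x\<rfloor> + 1" using xy fx by (auto simp: \<beta>_def min_def field_simps)
    have fr: "frac t = t - of_int \<lfloor>x\<rfloor>" if "x \<le> t" "t \<le> \<beta>" for t
    proof -
      have "\<lfloor>t\<rfloor> = \<lfloor>x\<rfloor>" using that fx \<beta> by (intro floor_unique) linarith+
      then show ?thesis by (simp add: frac_def)
    qed
    have img: "frac ` {x<..\<beta>} = {frac x<..frac \<beta>}"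
    proof
      show "frac ` {x<..\<beta>} \<subseteq> {frac x<..frac \<beta>}" using fr \<beta> by auto
      show "{frac x<..frac \<beta>} \<subseteq> frac ` {x<..\<beta>}"
      proof
        fix z assume z: "z \<in> {frac x<..frac \<beta>}"
        then have "z + of_int \<lfloor>x\<rfloor> \<in> {x<..\<beta>}" using fr[of x] fr[of \<beta>] \<beta> by auto
        moreover then have "frac (z + of_int \<lfloor>x\<rfloor>) = z" using fr[of "z + of_int \<lfloor>x\<rfloor>"] by auto
        ultimately show "z \<in> frac ` {x<..\<beta>}" by (metis imageI)
      qed
    qed
    have sub: "{frac x<..frac \<beta>} \<subseteq> {0..<1}"
    proof
      fix z assume "z \<in> {frac x<..frac \<beta>}"
      moreover have "0 \<le> frac x" "frac \<beta> < 1" by (simp_all add: frac_lt_1)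
      ultimately show "z \<in> {0..<1}" unfolding atLeastLessThan_iff greaterThanAtMost_iff by linarith
    qed
    have inS: "{frac x<..frac \<beta>} \<in> sets \<mu>" unfolding sets sets_restrict_space
      using sub by (intro image_eqI[of _ _ "{frac x<..frac \<beta>}"]) auto
    have "W x \<noteq> W \<beta>"
    proof
      assume "W x = W \<beta>"
      then have "measure \<mu> {frac x<..frac \<beta>} = 0" using arc[of x \<beta>] \<beta> xy img by simp
      then have "{frac x<..frac \<beta>} \<in> null_sets \<mu>" using inS by (intro null_setsI) (simp add: emeasure_eq_measure)
      then have "{frac x<..frac \<beta>} \<in> null_sets (restrict_space lborel {0..<1})" using ac by (auto simp: absolutely_continuous_def)
      then have "emeasure (restrict_space lborel {0..<1}) {frac x<..frac \<beta>} = 0" by auto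
      then have "emeasure lborel {frac x<..frac \<beta>} = 0" using sub by (subst (asm) emeasure_restrict_space) auto
      moreover have "frac x < frac \<beta>" using fr[of x] fr[of \<beta>] \<beta> by simp
      ultimately show False by simp
    qed
    moreover have "W x \<le> W \<beta>" "W \<beta> \<le> W y" using \<beta> xy by (auto intro!: mono1)
    ultimately show ?thesis by linarith
  qed
  have per: "periodic1 (\<lambda>x. W x - x)" by (simp add: periodic1_def sh)
  have "strict_mono W"
  proof (rule strict_monoI)
    fix x y :: real assume xy: "x < y"
    define n where "n = \<lceil>y - x\<rceil> - 1"
    have n: "0 \<le> n" "x < y - of_int n" "y - of_int n \<le> x + 1"
    proof -
      have c: "y - x \<le> of_int \<lceil>y - x\<rceil>" "of_int \<lceil>y - x\<rceil> < y - x + 1" by linarith+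
      have "0 < \<lceil>y - x\<rceil>" using xy by simp
      then show "0 \<le> n" by (simp add: n_def)
      show "x < y - of_int n" "y - of_int n \<le> x + 1" unfolding n_def of_int_diff of_int_1 using c by linarith+
    qed
    have "W x < W (y - of_int n)" by (rule small[OF n(2,3)])
    moreover have "W (y - of_int n + of_int n) - (y - of_int n + of_int n) = W (y - of_int n) - (y - of_int n)"
      using periodic1_int[OF per, of "y - of_int n" n] .
    then have "W y = W (y - of_int n) + of_int n" by simp
    moreover have "(of_int n :: real) \<ge> 0" using n(1) by simp
    ultimately show "W x < W y" by linarith
  qed
  then show ?thesis by unfold_locales (use rc W0 sh in auto)
qed

context driver
begin

abbreviation w where "w \<equiv> gen_inverse W"

lemma W_int: "W (x + of_int n) = W x + of_int n"
proof -
  have "periodic1 (\<lambda>x. W x - x)" by (simp add: periodic1_def W_shift)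
  from periodic1_int[OF this, of x n] show ?thesis by simp
qed

lemma W_frac: "frac (W x) = W (frac x)"
proof -
  have "W x = W (frac x) + of_int \<lfloor>x\<rfloor>" using W_int[of "frac x" "\<lfloor>x\<rfloor>"] by (simp add: frac_def)
  moreover have "0 \<le> W (frac x)" using W_mono[of 0 "frac x"] W_0 by simp
  moreover have "W (frac x) < 1" using W_less_iff[of "frac x" 1] frac_lt_1[of x] W_1 by simp
  ultimately show ?thesis by (simp add: frac_unique_iff)
qed

lemma sublevel_bounds: "{y. W y \<le> r} \<noteq> {}" "bdd_above {y. W y \<le> r}"
proof -
  have "W (of_int \<lfloor>r\<rfloor>) \<le> r" using W_int[of 0 "\<lfloor>r\<rfloor>"] W_0 by simp
  then show "{y. W y \<le> r} \<noteq> {}" by blast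
  show "bdd_above {y. W y \<le> r}"
  proof (rule bdd_aboveI[of _ "of_int (\<lceil>r\<rceil>)"], clarify)
    fix y assume y: "W y \<le> r"
    have "r \<le> W (of_int \<lceil>r\<rceil>)" using W_int[of 0 "\<lceil>r\<rceil>"] W_0 by simp
    with y have "W y \<le> W (of_int \<lceil>r\<rceil>)" by (rule order_trans)
    then show "y \<le> of_int \<lceil>r\<rceil>" by simp
  qed
qed

lemma inverse_upper: "W y \<le> r \<Longrightarrow> y \<le> w r"
  unfolding gen_inverse_def by (rule cSup_upper) (use sublevel_bounds in auto)

text \<open>
  The Galois connection between \<open>W\<close> and its inverse, from right continuity; all further properties of
  \<open>w\<close> come from it.
\<close>

lemma inverse_le_iff: "w r \<le> x \<longleftrightarrow> r \<le> W x"
proof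
  assume l: "w r \<le> x"
  have "r \<le> W z" if "x < z" for z
  proof (rule ccontr)
    assume "\<not> r \<le> W z"
    then have "z \<le> w r" by (intro inverse_upper) simp
    then show False using l that by simp
  qed
  then have "\<forall>\<^sub>F z in at_right x. r \<le> W z" by (intro eventually_at_rightI[of x "x + 1"]) auto
  moreover have "(W \<longlongrightarrow> W x) (at_right x)" using W_right by (simp add: continuous_within)
  ultimately show "r \<le> W x" by (intro tendsto_lowerbound) auto
next
  assume r: "r \<le> W x"
  show "w r \<le> x" unfolding gen_inverse_def
  proof (rule cSup_least[OF sublevel_bounds(1)])
    fix y assume "y \<in> {y. W y \<le> r}"
    then have "W y \<le> W x" by (intro order_trans[OF _ r]) simp
    then show "y \<le> x" by simp
  qed
qed

lemma less_inverse_iff: "x < w r \<longleftrightarrow> W x < r"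
  using inverse_le_iff[of r x] by (simp add: not_le[symmetric])

lemma inverse_mono: "r \<le> s \<Longrightarrow> w r \<le> w s"
  using inverse_le_iff[of s "w s"] inverse_le_iff[of r "w s"] by simp

lemma inverse_measurable [measurable]: "w \<in> borel_measurable borel"
  by (rule borel_measurable_mono) (simp add: mono_def inverse_mono)

lemma inverse_at_continuity_point:
  assumes "isCont W (w r)" shows "W (w r) = r"
proof (rule antisym)
  show "r \<le> W (w r)" using inverse_le_iff[of r "w r"] by simp
  have "W y \<le> r" if "y < w r" for y using that less_inverse_iff[of y r] by simp
  then have "\<forall>\<^sub>F y in at_left (w r). W y \<le> r" by (intro eventually_at_leftI[of "w r - 1"]) auto
  moreover have "(W \<longlongrightarrow> W (w r)) (at_left (w r))" using assms by (simp add: isCont_def filterlim_at_split)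
  ultimately show "W (w r) \<le> r" by (intro tendsto_upperbound) auto
qed

lemma measure_sublevel:
  assumes s: "s \<in> {0<..<1}" shows "measure UI {x \<in> {0..1}. W x \<le> s} = w s"
proof -
  have w01: "0 \<le> w s" "w s \<le> 1" using inverse_upper[of 0 s] inverse_le_iff[of s 1] s W_0 W_1 by auto
  have "(LINT x|UI. indicator {x. W x \<le> s} x) = (LINT x|UI. indicator {0<..w s} x :: real)"
  proof (rule integral_cong_AE)
    show "AE x in UI. indicator {x. W x \<le> s} x = (indicator {0<..w s} x :: real)"
      using AE_UI_neq[of 0] AE_UI_neq[of "w s"] AE_space[of UI]
    proof eventually_elim
      case (elim x)
      have "W x \<le> s \<longleftrightarrow> x \<le> w s"
      proof
        assume "x \<le> w s"
        then have "x < w s" using elim by simp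
        then show "W x \<le> s" using less_inverse_iff by (simp add: less_imp_le)
      qed (rule inverse_upper)
      then show ?case using elim by (auto simp: indicator_def)
    qed
    show "(indicator {x. W x \<le> s} :: real \<Rightarrow> real) \<in> borel_measurable UI"
      by (rule borel_measurable_UI) (rule borel_measurable_indicator, measurable)
    show "(indicator {0<..w s} :: real \<Rightarrow> real) \<in> borel_measurable UI"
      by (rule borel_measurable_UI) simp
  qed
  also have "\<dots> = w s" using LINT_UI_Ioc[of 0 "w s"] w01 by simp
  finally have "(LINT x|UI. indicator {x. W x \<le> s} x) = w s" .
  moreover have "(LINT x|UI. indicator {x. W x \<le> s} x :: real) = measure UI ({x. W x \<le> s} \<inter> space UI)"
    by simp
  moreover have "{x. W x \<le> s} \<inter> space UI = {x \<in> {0..1}. W x \<le> s}" by auto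
  ultimately show ?thesis by simp
qed

end

text \<open>
  On an arc \<open>(0,\<beta>]\<close> the measure \<open>\<mu>\<close> is the image of Lebesgue measure under \<open>w\<close>, as both give
  \<open>(x,\<beta>]\<close> the mass \<open>W \<beta> - W x\<close>. At continuity points \<open>W (w r) = r\<close>, so the \<open>\<mu>\<close>-mass of the continuity
  points \<open>x\<close> with \<open>W x \<in> N\<close> is at most the measure of \<open>N\<close>, which is 0; absolute continuity of Lebesgue
  measure with respect to \<open>\<mu>\<close> turns this into a statement about Lebesgue measure.
\<close>

lemma class_W_pullback_null:
  assumes W: "W \<in> class_W" and N: "N \<in> null_sets lborel"
  shows "AE x in UI. W x \<notin> N"
proof -
  interpret driver W by (rule class_W_driver[OF W])
  obtain \<mu> where pt: "prob_torus \<mu>" and d: "distribution_of \<mu> W"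
    and ac: "absolutely_continuous \<mu> (restrict_space lborel {0..<1})"
    using W unfolding class_W_def by blast
  interpret \<mu>: prob_space \<mu> using pt by (simp add: prob_torus_def)
  have sets: "sets \<mu> = sets (restrict_space borel {0..<1})" using pt by (simp add: prob_torus_def)
  have space: "space \<mu> = {0..<1}" using sets_eq_imp_space_eq[OF sets] by (simp add: space_restrict_space)
  have N': "N \<in> sets borel" "emeasure lborel N = 0" using N by auto
  have cnt: "{x. \<not> isCont W x} \<in> sets borel"
  proof -
    have "mono W" by (simp add: mono_def W_mono)
    from mono_ctble_discont[OF this] show ?thesis by (rule sets.countable[rotated]) auto
  qed
  define D where "D = W -` N - {x. \<not> isCont W x}"
  have D: "D \<in> sets borel" unfolding D_def
    using measurable_sets[OF W_measurable N'(1)] cnt by (intro sets.Diff) auto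
  have arc: "measure \<mu> (frac ` {\<alpha><..\<beta>}) = W \<beta> - W \<alpha>" if "\<alpha> \<le> \<beta>" "\<beta> \<le> \<alpha> + 1" for \<alpha> \<beta>
    using d that by (simp add: distribution_of_def)
  have nullD: "emeasure lborel (D \<inter> {0<..\<beta>}) = 0" if \<beta>: "0 < \<beta>" "\<beta> < 1" for \<beta>
  proof -
    have mS: "A \<in> sets \<mu>" if "A \<in> sets borel" "A \<subseteq> {0..<1}" for A
      unfolding sets sets_restrict_space using that by (intro image_eqI[of _ _ A]) auto
    have Ioc: "emeasure \<mu> {x<..\<beta>} = ennreal (W \<beta> - W x)" if "0 \<le> x" "x \<le> \<beta>" for x
    proof -
      have "frac ` {x<..\<beta>} = {x<..\<beta>}" using that \<beta> by (force simp: frac_eq image_iff)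
      moreover have "measure \<mu> (frac ` {x<..\<beta>}) = W \<beta> - W x" by (rule arc) (use that \<beta> in auto)
      ultimately show ?thesis by (simp add: \<mu>.emeasure_eq_measure)
    qed
    define m1 where "m1 = distr (restrict_space \<mu> {0<..\<beta>}) borel (\<lambda>x. x)"
    define m2 where "m2 = distr (restrict_space lborel {0<..W \<beta>}) borel w"
    have i1: "(\<lambda>x. x) \<in> borel_measurable (restrict_space \<mu> {0<..\<beta>})"
    proof (intro measurable_restrict_space1)
      show "(\<lambda>x. x) \<in> borel_measurable \<mu>"
        unfolding measurable_cong_sets[OF sets refl] by (intro measurable_restrict_space1) simp
    qed
    have i2: "w \<in> borel_measurable (restrict_space lborel {0<..W \<beta>})"
      by (intro measurable_restrict_space1) (simp add: inverse_measurable)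
    have e1: "emeasure m1 A = emeasure \<mu> (A \<inter> {0<..\<beta>})" if A: "A \<in> sets borel" for A
    proof -
      have "emeasure m1 A = emeasure (restrict_space \<mu> {0<..\<beta>}) (A \<inter> space (restrict_space \<mu> {0<..\<beta>}))"
        unfolding m1_def by (subst emeasure_distr[OF i1 A]) simp
      also have "A \<inter> space (restrict_space \<mu> {0<..\<beta>}) = A \<inter> {0<..\<beta>}"
        using \<beta> by (auto simp: space_restrict_space space)
      also have "emeasure (restrict_space \<mu> {0<..\<beta>}) (A \<inter> {0<..\<beta>}) = emeasure \<mu> (A \<inter> {0<..\<beta>})"
        using \<beta> by (intro emeasure_restrict_space) (auto simp: space intro!: mS)
      finally show ?thesis .
    qed
    have e2: "emeasure m2 A = emeasure lborel (w -` A \<inter> {0<..W \<beta>})" if A: "A \<in> sets borel" for A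
    proof -
      have "emeasure m2 A = emeasure (restrict_space lborel {0<..W \<beta>}) (w -` A \<inter> {0<..W \<beta>})"
        unfolding m2_def by (subst emeasure_distr[OF i2 A]) (simp add: space_restrict_space)
      also have "\<dots> = emeasure lborel (w -` A \<inter> {0<..W \<beta>})"
        by (intro emeasure_restrict_space) auto
      finally show ?thesis .
    qed
    have "m1 = m2"
    proof (rule measure_eqI_lessThan)
      show "sets m1 = sets borel" "sets m2 = sets borel" by (auto simp: m1_def m2_def)
      fix x
      have 1: "emeasure m1 {x<..} = ennreal (max 0 (W \<beta> - max 0 (W x)))"
      proof -
        have "{x<..} \<inter> {0<..\<beta>} = {max 0 x<..\<beta>}" by auto
        moreover have "emeasure \<mu> {max 0 x<..\<beta>} = ennreal (max 0 (W \<beta> - max 0 (W x)))"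
        proof (cases "max 0 x \<le> \<beta>")
          case True
          have "W (max 0 x) = max 0 (W x)" using W_mono[of 0 x] W_mono[of x 0] W_0 by (cases "0 \<le> x") auto
          moreover have "W (max 0 x) \<le> W \<beta>" using True by simp
          ultimately show ?thesis using Ioc[of "max 0 x"] True by simp
        next
          case False
          then have "\<beta> < x" using \<beta> by auto
          then have "W \<beta> \<le> W x" by simp
          then have "max 0 (W \<beta> - max 0 (W x)) = 0" by linarith
          moreover have "{max 0 x<..\<beta>} = {}" using False by auto
          ultimately show ?thesis by (simp only: emeasure_empty ennreal_0)
        qed
        ultimately show ?thesis by (simp add: e1)
      qed
      show "emeasure m1 {x<..} < \<infinity>" unfolding 1 by simp
      have "w -` {x<..} \<inter> {0<..W \<beta>} = {max 0 (W x)<..W \<beta>}" by (auto simp: less_inverse_iff)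
      then have "emeasure m2 {x<..} = emeasure lborel {max 0 (W x)<..W \<beta>}" by (simp add: e2)
      also have "\<dots> = ennreal (max 0 (W \<beta> - max 0 (W x)))"
      proof -
        have "emeasure lborel {l<..r} = ennreal (max 0 (r - l))" for l r :: real
          by (cases "l \<le> r") (auto simp: ennreal_neg)
        then show ?thesis .
      qed
      finally show "emeasure m1 {x<..} = emeasure m2 {x<..}" using 1 by simp
    qed
    then have "emeasure \<mu> (D \<inter> {0<..\<beta>}) = emeasure lborel (w -` D \<inter> {0<..W \<beta>})" using e1[OF D] e2[OF D] by simp
    also have "\<dots> \<le> emeasure lborel N"
    proof (rule emeasure_mono)
      show "w -` D \<inter> {0<..W \<beta>} \<subseteq> N"
        using inverse_at_continuity_point by (auto simp: D_def)
    qed (use N' in auto)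
    finally have "emeasure \<mu> (D \<inter> {0<..\<beta>}) = 0" using N' by simp
    moreover have "D \<inter> {0<..\<beta>} \<in> sets \<mu>" using D \<beta> by (intro mS) auto
    ultimately have "D \<inter> {0<..\<beta>} \<in> null_sets \<mu>" by (intro null_setsI)
    then have "D \<inter> {0<..\<beta>} \<in> null_sets (restrict_space lborel {0..<1})" using ac by (auto simp: absolutely_continuous_def)
    then have "emeasure (restrict_space lborel {0..<1}) (D \<inter> {0<..\<beta>}) = 0" by auto
    then show ?thesis using \<beta> by (subst (asm) emeasure_restrict_space) auto
  qed
  have "D \<inter> {0<..1 - 1 / real (n + 2)} \<in> null_sets lborel" for n
    using D by (intro null_setsI nullD) (auto simp: field_simps)
  then have "(\<Union>n. D \<inter> {0<..1 - 1 / real (n + 2)}) \<in> null_sets lborel" by (rule null_sets_UN)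
  then have "AE x in lborel. x \<notin> (\<Union>n. D \<inter> {0<..1 - 1 / real (n + 2)})" by (rule AE_not_in)
  then have "AE x in UI. x \<notin> (\<Union>n. D \<inter> {0<..1 - 1 / real (n + 2)})" unfolding AE_UI_iff by eventually_elim simp
  then show ?thesis using AE_isCont_W AE_UI_neq[of 0] AE_UI_neq[of 1] AE_space[of UI]
  proof eventually_elim
    case (elim x)
    then have x: "0 < x" "x < 1" by auto
    obtain n where n: "1 / real (Suc n) < 1 - x" using reals_Archimedean[of "1 - x"] x by (auto simp: inverse_eq_divide)
    have "1 / real (n + 2) \<le> 1 / real (Suc n)" by (intro divide_left_mono) auto
    then have "x \<in> {0<..1 - 1 / real (n + 2)}" using x n by auto
    then have "x \<notin> D" using elim(1) by blast
    then show ?case using elim(2) by (auto simp: D_def)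
  qed
qed

text \<open>
  Let \<open>\<nu>\<close> be the image of the uniform distribution under \<open>W\<close>. It has a density, because \<open>W\<close> pulls null
  sets back to null sets, and its distribution function on \<open>(0,1)\<close> is \<open>w\<close>. By Lebesgue
  differentiation the density is \<open>w'\<close>.
\<close>

lemma weight_formula:
  assumes W: "W \<in> class_W" and q: "bmeas q"
  shows "(LINT s|UI. deriv (gen_inverse W) s * q s) = (LINT x|UI. q (W x))"
proof -
  interpret driver W by (rule class_W_driver[OF W])
  define \<nu> where "\<nu> = distr UI borel W"
  have Wm: "W \<in> borel_measurable UI" by (rule borel_measurable_UI) simp
  have pn: "prob_space \<nu>" unfolding \<nu>_def by (rule UI.prob_space_distr[OF Wm])
  interpret \<nu>: prob_space \<nu> by (rule pn)
  have sn: "sets \<nu> = sets lborel" by (simp add: \<nu>_def)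
  have ac: "absolutely_continuous lborel \<nu>"
    unfolding absolutely_continuous_def
  proof
    fix N :: "real set" assume N: "N \<in> null_sets lborel"
    then have Nb: "N \<in> sets borel" by auto
    have "AE x in \<nu>. x \<notin> N"
      unfolding \<nu>_def by (subst AE_distr_iff[OF Wm]) (use class_W_pullback_null[OF W N] Nb in auto)
    then show "N \<in> null_sets \<nu>" using Nb by (subst (asm) AE_iff_null_sets[symmetric]) (auto simp: \<nu>_def)
  qed
  obtain D where D: "D \<in> borel_measurable lborel" "AE x in lborel. RN_deriv lborel \<nu> x = ennreal (D x)"
    "AE x in \<nu>. 0 < D x" "\<And>x. 0 \<le> D x"
    by (rule sigma_finite_measure.real_RN_deriv[OF lborel.sigma_finite_measure_axioms \<nu>.finite_measure_axioms ac sn]) blast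
  have Dm [measurable]: "D \<in> borel_measurable borel" using D(1) by simp
  have dens: "\<nu> = density lborel (\<lambda>x. ennreal (D x))"
  proof -
    have "density lborel (RN_deriv lborel \<nu>) = \<nu>" by (rule sigma_finite_measure.density_RN_deriv[OF lborel.sigma_finite_measure_axioms ac sn])
    moreover have "density lborel (RN_deriv lborel \<nu>) = density lborel (\<lambda>x. ennreal (D x))"
      by (rule density_cong) (use D in auto)
    ultimately show ?thesis by simp
  qed
  have Dint: "integrable lborel D"
  proof (rule integrableI_nonneg)
    have "(\<integral>\<^sup>+x. ennreal (D x) \<partial>lborel) = emeasure \<nu> (space \<nu>)"
      unfolding dens by (subst emeasure_density) auto
    then show "(\<integral>\<^sup>+x. ennreal (D x) \<partial>lborel) < \<infinity>" using \<nu>.emeasure_space_1 by simp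
  qed (use D in auto)
  have chg: "(LINT s|lborel. D s * p s) = (LINT x|UI. p (W x))" if p: "p \<in> borel_measurable borel" for p :: "real \<Rightarrow> real"
  proof -
    have "(LINT x|UI. p (W x)) = (LINT s|\<nu>. p s)" unfolding \<nu>_def by (rule integral_distr[symmetric, OF Wm p])
    also have "\<dots> = (LINT s|lborel. D s *\<^sub>R p s)" unfolding dens
      by (rule integral_density) (use p D in auto)
    finally show ?thesis by simp
  qed
  have "w s = 0 + (LINT z:{..s}|lborel. D z)" if s: "s \<in> {0<..<1}" for s
  proof -
    have "(LINT z:{..s}|lborel. D z) = (LINT z|lborel. D z * indicator {..s} z)"
      by (simp add: set_lebesgue_integral_def mult.commute)
    also have "\<dots> = (LINT x|UI. indicator {..s} (W x))" by (rule chg) simp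
    also have "\<dots> = (LINT x|UI. indicator {x. W x \<le> s} x)"
      by (intro Bochner_Integration.integral_cong) (auto simp: indicator_def)
    also have "\<dots> = measure UI ({x. W x \<le> s} \<inter> space UI)" by simp
    also have "{x. W x \<le> s} \<inter> space UI = {x \<in> {0..1}. W x \<le> s}" by auto
    finally show ?thesis using measure_sublevel[OF s] by simp
  qed
  note dI = deriv_of_integral[OF Dint this]
  have "AE x in lborel. x \<noteq> 0 \<and> x \<noteq> 1" using AE_lborel_singleton[of 0] AE_lborel_singleton[of 1] by simp
  then have ae: "AE s in UI. deriv w s = D s"
    unfolding AE_UI_iff using dI(1)[simplified] by eventually_elim auto
  have dm: "deriv w \<in> borel_measurable UI"
    using dI(2) unfolding UI_def by (subst borel_measurable_restrict_space_iff) auto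
  have qm: "q \<in> borel_measurable borel" by (rule bmeas_measurable[OF q])
  have "(LINT s|UI. deriv w s * q s) = (LINT s|UI. D s * q s)"
  proof (rule integral_cong_AE)
    show "AE s in UI. deriv w s * q s = D s * q s" using ae by eventually_elim simp
  qed (intro borel_measurable_times dm borel_measurable_UI qm Dm)+
  also have "\<dots> = (LINT s:{0..1}|lborel. D s * q s)" by (rule LINT_UI[symmetric])
  also have "\<dots> = (LINT s|lborel. D s * (indicator {0..1} s * q s))" by (simp add: set_lebesgue_integral_def mult_ac)
  also have "\<dots> = (LINT x|UI. indicator {0..1} (W x) * q (W x))" by (rule chg) (use qm in measurable)
  also have "\<dots> = (LINT x|UI. q (W x))"
    by (intro Bochner_Integration.integral_cong refl) (use W_unit in simp)
  finally show ?thesis .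
qed

lemma ipT_weighted_eq:
  assumes W: "W \<in> class_W" and p: "bmeas p" and q: "bmeas q"
  shows "ipT_weighted (deriv (gen_inverse W)) p q = (LINT x|UI. p (W x) * q (W x))"
proof -
  obtain C D where C: "\<And>x. \<bar>p x\<bar> \<le> C" "\<And>x. \<bar>q x\<bar> \<le> D" using p q unfolding bmeas_def by blast
  have b: "bmeas (\<lambda>x. p x * q x)" unfolding bmeas_def
  proof
    show "(\<lambda>x. p x * q x) \<in> borel_measurable borel" by (intro borel_measurable_times bmeas_measurable p q)
    have "\<bar>p x * q x\<bar> \<le> C * D" for x unfolding abs_mult by (intro mult_mono C) (use C(1)[of 0] in auto)
    then show "\<exists>C. \<forall>x. \<bar>p x * q x\<bar> \<le> C" by blast
  qed
  have "ipT_weighted (deriv (gen_inverse W)) p q = (LINT x|UI. deriv (gen_inverse W) x * p x * q x)"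
    unfolding ipT_weighted_def by (rule LINT_UI)
  then show ?thesis using weight_formula[OF W b] by (simp add: mult.assoc)
qed

section \<open>Uniqueness for the equation with coefficient\<close>

lemma H2T_const: "(\<lambda>_. c) \<in> H2T" "AE x in UI. weak_deriv (weak_deriv (\<lambda>_. c)) x = 0"
proof -
  have L: "(\<lambda>_. a) \<in> L2T" for a :: real
    by (auto simp: L2T_def periodic1_def intro: set_integrable_const_Icc)
  have w: "has_weak_deriv (\<lambda>_. a) (\<lambda>_. 0)" for a :: real
    unfolding has_weak_deriv_def ipT_UI using L test_fun_deriv_mean by simp
  have v0: "has_weak_deriv (\<lambda>_. c) (weak_deriv (\<lambda>_. c))" by (rule weak_deriv_has) (use w in blast)
  have "AE x in UI. 0 = weak_deriv (\<lambda>_. c) x" by (rule weak_deriv_unique[OF w v0]) simp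
  then have w2: "has_weak_deriv (weak_deriv (\<lambda>_. c)) (\<lambda>_. 0)"
    by (intro has_weak_deriv_cong[OF w[of 0]]) (use v0 in \<open>auto simp: has_weak_deriv_def\<close>)
  have v1: "has_weak_deriv (weak_deriv (\<lambda>_. c)) (weak_deriv (weak_deriv (\<lambda>_. c)))" by (rule weak_deriv_has) (use w2 in blast)
  show "AE x in UI. weak_deriv (weak_deriv (\<lambda>_. c)) x = 0" by (rule weak_deriv_unique[OF v1 w2]) simp
  show "(\<lambda>_. c) \<in> H2T" using w w2 unfolding H2T_def by (auto simp: periodic1_def)
qed

text \<open>
  Freezing a function outside the time interval \<open>[0,T]\<close> makes it defined, and bounded, at all times.
\<close>

definition clip :: "real \<Rightarrow> (real \<Rightarrow> real \<Rightarrow> real) \<Rightarrow> real \<Rightarrow> real \<Rightarrow> real" where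
  "clip T u t s = u (max 0 (min T t)) s"

lemma clip_eq: "0 \<le> t \<Longrightarrow> t \<le> T \<Longrightarrow> clip T u t = u t"
  by (simp add: clip_def[abs_def])

lemma clip_continuous:
  assumes T: "0 \<le> T" and c: "continuous_on ({0..T} \<times> UNIV) (\<lambda>p. u (fst p) (snd p))"
  shows "continuous_on UNIV (\<lambda>p. clip T u (fst p) (snd p))"
proof -
  have "continuous_on UNIV (\<lambda>p. (\<lambda>p. u (fst p) (snd p)) (max 0 (min T (fst p)), snd p))"
    by (rule continuous_on_compose2[OF c]) (use T in \<open>auto intro!: continuous_intros\<close>)
  then show ?thesis by (simp add: clip_def)
qed

lemma clip_periodic:
  assumes "0 \<le> T" "\<And>t. 0 \<le> t \<Longrightarrow> t \<le> T \<Longrightarrow> periodic1 (u t)" shows "periodic1 (clip T u t)"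
  using assms(2)[of "max 0 (min T t)"] assms(1) unfolding clip_def[abs_def] periodic1_def by simp

lemma loc_bdd_clip:
  assumes T: "0 \<le> T" and c: "continuous_on ({0..T} \<times> UNIV) (\<lambda>p. u (fst p) (snd p))"
    and per: "\<And>t. 0 \<le> t \<Longrightarrow> t \<le> T \<Longrightarrow> periodic1 (u t)"
  shows "loc_bdd (clip T u)"
  unfolding loc_bdd_def
proof
  have "(\<lambda>p. clip T u (fst p) (snd p)) \<in> borel_measurable borel"
    by (rule borel_measurable_continuous_onI[OF clip_continuous[OF T c]])
  then show "(\<lambda>p. clip T u (fst p) (snd p)) \<in> borel_measurable (borel \<Otimes>\<^sub>M borel)" by (simp only: borel_prod)
  have "compact ((\<lambda>p. u (fst p) (snd p)) ` ({0..T} \<times> {0..1}))"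
    by (rule compact_continuous_image[OF continuous_on_subset[OF c]]) (auto intro!: compact_Times)
  then obtain C where "\<forall>y\<in>(\<lambda>p. u (fst p) (snd p)) ` ({0..T} \<times> {0..1}). norm y \<le> C"
    unfolding compact_eq_bounded_closed bounded_iff by blast
  then have C: "\<bar>u t s\<bar> \<le> C" if "0 \<le> t" "t \<le> T" "0 \<le> s" "s \<le> 1" for t s using that by force
  have "\<bar>clip T u t s\<bar> \<le> C" for t s
  proof -
    have "clip T u t s = clip T u t (frac s)"
      using periodic1_int[OF clip_periodic[where u=u, OF T per], of t "frac s" "\<lfloor>s\<rfloor>"] by (simp add: frac_def)
    also have "\<bar>\<dots>\<bar> \<le> C" unfolding clip_def using T frac_lt_1[of s] by (intro C) (auto intro: less_imp_le)
    finally show ?thesis .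
  qed
  then show "\<forall>S. \<exists>C. \<forall>t x. \<bar>t\<bar> \<le> S \<longrightarrow> \<bar>clip T u t x\<bar> \<le> C" by blast
qed

lemma ipT_time_integral:
  assumes T: "0 \<le> T" "T \<le> T0" and c: "continuous_on ({0..T0} \<times> UNIV) (\<lambda>p. u (fst p) (snd p))"
    and per: "\<And>t. 0 \<le> t \<Longrightarrow> t \<le> T0 \<Longrightarrow> periodic1 (u t)" and q: "integrable UI q"
  shows "(LINT t:{0..T}|lborel. ipT (u t) q) = (LINT s|UI. q s * tint (clip T0 u) T s)"
    and "set_integrable lborel {0..T} (\<lambda>t. ipT (u t) q)"
proof -
  have T0: "0 \<le> T0" using T by simp
  note j = loc_bdd_clip[where u=u, OF T0 c per]
  have eq: "ipT (u t) q = (LINT s|UI. q s * clip T0 u t s)" if "t \<in> {0..T}" for t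
    using that T by (simp add: ipT_UI clip_eq mult.commute)
  have "(LINT t:{0..T}|lborel. ipT (u t) q) = (LINT t:{0..T}|lborel. LINT s|UI. q s * clip T0 u t s)"
    by (rule set_lebesgue_integral_cong) (use eq in auto)
  then show "(LINT t:{0..T}|lborel. ipT (u t) q) = (LINT s|UI. q s * tint (clip T0 u) T s)"
    using Fubini_time(1)[OF q j] by simp
  have "set_integrable lborel {0..T} (\<lambda>t. ipT (u t) q) \<longleftrightarrow> set_integrable lborel {0..T} (\<lambda>t. LINT s|UI. q s * clip T0 u t s)"
    by (rule set_integrable_cong) (use eq in auto)
  then show "set_integrable lborel {0..T} (\<lambda>t. ipT (u t) q)" using Fubini_time(2)[OF q j] by simp
qed

text \<open>
  Let \<open>U = \<integral>\<^sub>0\<^sup>t u\<close>. Testing with \<open>\<phi>\<close> whose second derivative is an arbitrary bounded function with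
  integral 0 gives \<open>U = b + Pot z\<close>, where \<open>z = u \<circ> W\<close>. Composing with \<open>W\<close>, \<open>L (\<integral> z) = z\<close>, so \<open>z\<close> and the
  potential vanish by the energy argument, and then \<open>b = 0\<close>. Thus \<open>U = 0\<close> almost everywhere, and the
  continuity of \<open>u\<close> gives \<open>u = 0\<close>.

  The finite horizon and the formulation with a single difference \<open>u\<close> allow the use for limits of
  subsequences, which are known on a bounded time interval only.
\<close>

lemma a_equation_uniqueness:
  fixes T0 t x :: real
  assumes W: "W \<in> class_W" and T0: "0 < T0"
    and c: "continuous_on ({0..T0} \<times> UNIV) (\<lambda>p. u (fst p) (snd p))"
    and per: "\<And>t. 0 \<le> t \<Longrightarrow> t \<le> T0 \<Longrightarrow> periodic1 (u t)"
    and eq: "\<And>\<phi> T. \<phi> \<in> H2T \<Longrightarrow> 0 < T \<Longrightarrow> T \<le> T0 \<Longrightarrow>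
      (LINT x|UI. u T (W x) * \<phi> (W x)) = (LINT t:{0..T}|lborel. ipT (u t) (weak_deriv (weak_deriv \<phi>)))"
    and t: "0 \<le> t" "t \<le> T0"
  shows "u t x = 0"
proof -
  interpret driver W by (rule class_W_driver[OF W])
  have T0': "0 \<le> T0" using T0 by simp
  let ?uc = "clip T0 u"
  note ju = loc_bdd_clip[where u=u, OF T0' c per]
  define z where "z t x = ?uc t (W x)" for t x
  have jz: "loc_bdd z" unfolding loc_bdd_def
  proof
    show "(\<lambda>p. z (fst p) (snd p)) \<in> borel_measurable (borel \<Otimes>\<^sub>M borel)" unfolding z_def
      by (rule loc_bdd_compose[OF ju measurable_fst measurable_compose[OF measurable_snd W_measurable]])
    show "\<forall>T. \<exists>C. \<forall>t x. \<bar>t\<bar> \<le> T \<longrightarrow> \<bar>z t x\<bar> \<le> C"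
      using ju unfolding loc_bdd_def z_def by blast
  qed
  have bz: "bmeas (z T)" for T by (rule loc_bdd_bmeas[OF jz])
  have zm: "z T \<in> borel_measurable UI" for T by (rule borel_measurable_UI[OF bmeas_measurable[OF bz]])
  have tm: "tint z T \<in> borel_measurable UI" for T
    by (rule borel_measurable_UI[OF bmeas_measurable[OF loc_bdd_bmeas[OF tint_loc_bdd[OF jz]]]])
  have bU: "bmeas (tint ?uc T)" for T by (rule loc_bdd_bmeas[OF tint_loc_bdd[OF ju]])
  have tz: "tint z T x = tint ?uc T (W x)" for T x by (simp add: tint_def z_def)
  have uz: "u T (W x) = z T x" if "0 \<le> T" "T \<le> T0" for T x using that by (simp add: z_def clip_eq)
  have main: "(LINT x|UI. z T x) = 0 \<and> (\<exists>b. AE s in UI. tint ?uc T s = b + Pot (z T) s)" if T: "0 < T" "T \<le> T0" for T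
  proof
    have T': "0 \<le> T" using T by simp
    let ?k = "z T"
    note ki = bmeas_integrable[OF bz, of T]
    have test: "(LINT x|UI. ?k x * \<phi> (W x)) = (LINT s|UI. weak_deriv (weak_deriv \<phi>) s * tint ?uc T s)" if "\<phi> \<in> H2T" for \<phi>
    proof -
      have "integrable UI (weak_deriv (weak_deriv \<phi>))"
        using H2T_D(2)[OF that] by (auto simp: has_weak_deriv_def intro: L2T_integrable)
      from ipT_time_integral(1)[where u=u, OF T' T(2) c per this]
      show ?thesis using eq[OF that T] uz[OF T' T(2)] by simp
    qed
    have "(LINT x|UI. ?k x * 1) = (LINT s|UI. weak_deriv (weak_deriv (\<lambda>_. 1)) s * tint ?uc T s)"
      by (rule test[OF H2T_const(1)])
    also have "\<dots> = (LINT s|UI. 0)"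
    proof (rule integral_cong_AE)
      show "AE s in UI. weak_deriv (weak_deriv (\<lambda>_. 1)) s * tint ?uc T s = 0"
        using H2T_const(2)[of 1] by eventually_elim simp
      have "weak_deriv (weak_deriv (\<lambda>_. 1)) \<in> borel_measurable UI"
        using H2T_D(2)[OF H2T_const(1)] by (auto simp: has_weak_deriv_def L2T_def intro: borel_measurable_UI)
      then show "(\<lambda>s. weak_deriv (weak_deriv (\<lambda>_. 1)) s * tint ?uc T s) \<in> borel_measurable UI"
        by (rule borel_measurable_times) (rule borel_measurable_UI[OF bmeas_measurable[OF bU]])
    qed simp
    finally show k0: "(LINT x|UI. ?k x) = 0" by simp
    define d where "d s = tint ?uc T s - Pot ?k s" for s
    have bP: "bmeas (Pot ?k)" unfolding bmeas_def using Pot_measurable[OF ki] Pot_abs[OF ki] by blast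
    have bd: "bmeas d" unfolding d_def[abs_def] by (rule bmeas_diff[OF bU bP])
    define \<beta> where "\<beta> = (LINT s|UI. d s)"
    \<comment> \<open>the oscillating part of \<open>d\<close> is itself an admissible second derivative, so \<open>d\<close> is orthogonal to it\<close>
    define q where "q s = d (frac s) - \<beta>" for s
    have bq: "bmeas q"
    proof -
      have "bmeas (\<lambda>s. d (frac s))" using bd measurable_compose[OF frac_measurable bmeas_measurable[OF bd]]
        unfolding bmeas_def by blast
      then show ?thesis unfolding q_def[abs_def] by (intro bmeas_diff bmeas_const)
    qed
    have qm: "q \<in> borel_measurable UI" and dm: "d \<in> borel_measurable UI"
      by (rule borel_measurable_UI[OF bmeas_measurable[OF bq]], rule borel_measurable_UI[OF bmeas_measurable[OF bd]])
    have qd: "AE s in UI. q s = d s - \<beta>" using frac_AE_UI by eventually_elim (simp add: q_def)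
    have pq: "periodic1 q" by (simp add: periodic1_def q_def frac_shift)
    have mq: "(LINT s|UI. q s) = 0"
    proof -
      have "(LINT s|UI. q s) = (LINT s|UI. d s - \<beta>)"
        by (rule integral_cong_AE[OF qm _ qd]) (intro borel_measurable_diff dm borel_measurable_const)
      then show ?thesis using bmeas_integrable[OF bd] by (simp add: \<beta>_def)
    qed
    obtain \<phi> where \<phi>: "\<phi> \<in> H2T" "AE x in UI. weak_deriv (weak_deriv \<phi>) x = q x" using H2T_construct[OF bq pq mq] by metis
    let ?q = "weak_deriv (weak_deriv \<phi>)"
    obtain c' d' where r: "?q \<in> L2T" "(LINT s|UI. ?q s) = 0" "(LINT s|UI. d' + prim ?q s) = 0"
      "\<And>s. s \<in> {0..1} \<Longrightarrow> \<phi> s = c' + prim (\<lambda>r. d' + prim ?q r) s"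
      using H2T_representation[OF \<phi>(1)] by metis
    note qi = L2T_integrable[OF r(1)]
    have i: "integrable UI (\<lambda>s. ?q s * tint ?uc T s)" "integrable UI (\<lambda>s. ?q s * Pot ?k s)"
      by (intro bmeas_mult_integrable bU bP qi)+
    have "(LINT s|UI. ?q s * lift 0 ?k s) = (LINT x|UI. ?k x * \<phi> (W x))"
      by (rule Pot_mult_parts[OF ki k0 qi r(2) r(4) r(3)])
    also have "\<dots> = (LINT s|UI. ?q s * tint ?uc T s)" by (rule test[OF \<phi>(1)])
    finally have "(LINT s|UI. ?q s * lift 0 ?k s) = (LINT s|UI. ?q s * tint ?uc T s)" .
    moreover have "(LINT s|UI. ?q s * lift 0 ?k s) = (LINT s|UI. ?q s * Pot ?k s - (LINT x|UI. Pot ?k (W x)) * ?q s)"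
      by (simp add: lift_def algebra_simps)
    moreover have "\<dots> = (LINT s|UI. ?q s * Pot ?k s)" using i(2) qi r(2) by simp
    ultimately have "(LINT s|UI. ?q s * d s) = 0" using i by (simp add: d_def right_diff_distrib)
    moreover have "(LINT s|UI. ?q s * d s) = (LINT s|UI. q s * d s)"
    proof (rule integral_cong_AE)
      show "AE s in UI. ?q s * d s = q s * d s" using \<phi>(2) by eventually_elim simp
    qed (intro borel_measurable_times borel_measurable_integrable[OF qi] qm dm)+
    moreover have "(LINT s|UI. (q s)\<^sup>2) = (LINT s|UI. q s * d s - \<beta> * q s)"
    proof (rule integral_cong_AE)
      show "AE s in UI. (q s)\<^sup>2 = q s * d s - \<beta> * q s" using qd by eventually_elim (metis power2_eq_square right_diff_distrib mult.commute)
    qed (intro borel_measurable_times borel_measurable_power borel_measurable_diff borel_measurable_const qm dm)+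
    moreover have "\<dots> = (LINT s|UI. q s * d s) - \<beta> * (LINT s|UI. q s)"
      using bmeas_mult_integrable[OF bd bmeas_integrable[OF bq]] bmeas_integrable[OF bq] by simp
    ultimately have "L2n q = 0" using mq by (simp add: L2n_def)
    then have "AE s in UI. q s = 0" by (rule L2n_zero_AE[OF bmeas_sqint[OF bq]])
    then have "AE s in UI. tint ?uc T s = \<beta> + Pot ?k s" using qd by eventually_elim (simp add: d_def)
    then show "\<exists>b. AE s in UI. tint ?uc T s = b + Pot ?k s" by blast
  qed
  have wk: "weakL (tint z T) (z T)" if T: "0 < T" "T \<le> T0" for T
  proof -
    note ki = bmeas_integrable[OF bz, of T]
    obtain b where b: "AE s in UI. tint ?uc T s = b + Pot (z T) s" using main[OF T] by blast
    have "{s \<in> space lborel. \<not> (s \<in> {0..1} \<longrightarrow> tint ?uc T s = b + Pot (z T) s)} \<in> null_sets lborel"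
    proof (rule AE_iff_null[THEN iffD1, OF _ b[unfolded AE_UI_iff]])
      have "{s \<in> space lborel. \<not> (s \<in> {0..1} \<longrightarrow> tint ?uc T s = b + Pot (z T) s)}
         = {0..1} - {s. tint ?uc T s - Pot (z T) s = b}" by (auto simp: algebra_simps)
      moreover have "(\<lambda>s. tint ?uc T s - Pot (z T) s) \<in> borel_measurable borel"
        by (intro borel_measurable_diff bmeas_measurable[OF bU] Pot_measurable ki)
      then have "{s. tint ?uc T s - Pot (z T) s = b} \<in> sets borel"
        using measurable_sets[of _ borel borel "{b}"] by (auto simp: vimage_def)
      ultimately show "{s \<in> space lborel. \<not> (s \<in> {0..1} \<longrightarrow> tint ?uc T s = b + Pot (z T) s)} \<in> sets lborel" by simp
    qed
    from class_W_pullback_null[OF W this]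
    have ae: "AE x in UI. b + Pot (z T) (W x) = tint z T x"
      using AE_space[of UI]
    proof eventually_elim
      case (elim x)
      then show ?case using W_unit[of x] by (auto simp: tz)
    qed
    have k0: "(LINT x|UI. z T x) = 0" using main[OF T] by blast
    show ?thesis
      by (rule weakL_cong_AE[OF weakL_Pot[OF ki k0] ae _ tm zm]) simp
  qed
  have U0: "AE s in UI. tint ?uc T s = 0" if T: "0 < T" "T \<le> T0" for T
  proof -
    have T': "0 \<le> T" using T by simp
    have w': "weakL (tint z t) (z t)" if "0 < t" "t \<le> T" for t by (rule wk) (use that T in auto)
    have wu: "AE x in UI. tint z T x = 0" "AE x in UI. z T x = 0"
      by (rule weak_uniqueness[OF jz w' T' wk[OF T]], assumption+)+
    obtain b where b: "AE s in UI. tint ?uc T s = b + Pot (z T) s" using main[OF T] by blast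
    have "Gam (z T) s = 0" for s
    proof -
      have "Gam (z T) s = (LINT z|UI. 0)" unfolding Gam_def
      proof (rule integral_cong_AE)
        show "AE x in UI. z T x * indicator {..<s} (W x) = 0" using wu(2) by eventually_elim simp
        show "(\<lambda>x. z T x * indicator {..<s} (W x)) \<in> borel_measurable UI"
          by (rule borel_measurable_integrable[OF Gam_int[OF bmeas_integrable[OF bz]]])
      qed simp
      then show ?thesis by simp
    qed
    then have G0: "Gam (z T) = (\<lambda>_. 0)" by (simp add: fun_eq_iff)
    have P0: "Pot (z T) s = 0" for s by (simp add: Pot_def dPot_def[abs_def] prim_def G0)
    have "b = 0"
    proof -
      have "weakL (tint z T) (z T)" by (rule wk[OF T])
      have "(LINT x|UI. tint z T x) = (LINT x|UI. 0)"
        by (rule integral_cong_AE[OF tm _ wu(1)]) simp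
      moreover have "AE x in UI. tint z T x = b"
      proof -
        have "{s \<in> space lborel. \<not> (s \<in> {0..1} \<longrightarrow> tint ?uc T s = b)} \<in> null_sets lborel"
        proof (rule AE_iff_null[THEN iffD1])
          show "AE s in lborel. s \<in> {0..1} \<longrightarrow> tint ?uc T s = b" using b[unfolded AE_UI_iff] by (simp add: P0)
          have "{s \<in> space lborel. \<not> (s \<in> {0..1} \<longrightarrow> tint ?uc T s = b)} = {0..1} - (tint ?uc T -` {b} \<inter> space borel)" by auto
          then show "{s \<in> space lborel. \<not> (s \<in> {0..1} \<longrightarrow> tint ?uc T s = b)} \<in> sets lborel"
            using measurable_sets[OF bmeas_measurable[OF bU, of T], of "{b}"] by simp
        qed
        from class_W_pullback_null[OF W this] show ?thesis
          using AE_space[of UI]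
        proof eventually_elim
          case (elim x)
          then show ?case using W_unit[of x] by (auto simp: tz)
        qed
      qed
      then have "(LINT x|UI. tint z T x) = (LINT x|UI. b)"
        by (intro integral_cong_AE tm) simp_all
      ultimately show ?thesis by simp
    qed
    then show ?thesis using b by (simp add: P0)
  qed
  show "u t x = 0"
  proof (rule ccontr)
    assume nz: "u t x \<noteq> 0"
    define y where "y = frac x"
    have y: "0 \<le> y" "y < 1" by (auto simp: y_def frac_lt_1)
    have uy: "u t x = ?uc t y"
      using periodic1_int[OF per[OF t], of y "\<lfloor>x\<rfloor>"] t by (simp add: y_def frac_def clip_eq)
    define e where "e = \<bar>?uc t y\<bar>"
    have e: "e > 0" using nz uy by (simp add: e_def)
    have cc: "isCont (\<lambda>p. ?uc (fst p) (snd p)) (t, y)"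
      using clip_continuous[where u=u, OF T0' c] by (simp add: continuous_on_eq_continuous_at)
    have "e / 2 > 0" using e by simp
    with cc obtain \<delta> where \<delta>: "\<delta> > 0" "\<And>p. dist p (t, y) < \<delta> \<Longrightarrow> dist (?uc (fst p) (snd p)) (?uc t y) < e / 2"
      unfolding continuous_at_eps_delta by fastforce
    \<comment> \<open>a time interval of length \<open>r / 2\<close> next to \<open>t\<close> inside \<open>[0,T0]\<close>, to the right of \<open>t\<close> if there is room
      and to the left otherwise, and a space interval to the right of \<open>y\<close>\<close>
    define r where "r = min (\<delta> / 2) (min (T0 / 2) (1 - y))"
    have r: "r > 0" "r \<le> \<delta> / 2" "r \<le> T0 / 2" "r \<le> 1 - y" using \<delta>(1) T0 y by (auto simp: r_def min_def)
    define a where "a = (if t + r \<le> T0 then t else t - r / 2)"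
    define b where "b = (if t + r \<le> T0 then t + r / 2 else t)"
    have ab: "0 \<le> a" "a < b" "b \<le> T0" "\<And>\<tau>. a \<le> \<tau> \<Longrightarrow> \<tau> \<le> b \<Longrightarrow> \<bar>\<tau> - t\<bar> \<le> r / 2"
      using r t by (auto simp: a_def b_def split: if_splits)
    have near: "\<bar>?uc \<tau> s - ?uc t y\<bar> < e / 2" if "a \<le> \<tau>" "\<tau> \<le> b" "y < s" "s < y + r / 2" for \<tau> s
    proof -
      have "dist (\<tau>, s) (t, y) \<le> dist \<tau> t + dist s y"
        unfolding dist_Pair_Pair by (rule sqrt_sum_squares_le_sum) auto
      also have "\<dots> < \<delta>" using ab(4)[OF that(1,2)] that(3,4) r \<delta>(1) by (simp add: dist_real_def)
      finally show ?thesis using \<delta>(2)[of "(\<tau>, s)"] by (simp add: dist_real_def)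
    qed
    have pos: "tint ?uc b s - tint ?uc a s \<noteq> 0" if s: "y < s" "s < y + r / 2" for s
    proof -
      have d: "tint ?uc b s - tint ?uc a s = (LINT \<tau>:{a..b}|lborel. ?uc \<tau> s)"
        by (rule tint_diff[OF ju]) (use ab in auto)
      note si = loc_bdd_set_integrable[OF ju, of a b s]
      show ?thesis
      proof (cases "?uc t y > 0")
        case True
        have "(LINT \<tau>:{a..b}|lborel. e / 2) \<le> (LINT \<tau>:{a..b}|lborel. ?uc \<tau> s)"
        proof (rule set_integral_mono_Icc[OF set_integrable_const_Icc si])
          fix \<tau> assume \<tau>: "a \<le> \<tau>" "\<tau> \<le> b"
          have "e = ?uc t y" using True by (simp add: e_def)
          then show "e / 2 \<le> ?uc \<tau> s" using near[OF \<tau> s] by linarith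
        qed
        moreover have "(LINT \<tau>:{a..b}|lborel. e / 2) > 0"
          using ab e by (simp add: set_integral_const_Icc)
        ultimately show ?thesis unfolding d by linarith
      next
        case False
        have "(LINT \<tau>:{a..b}|lborel. ?uc \<tau> s) \<le> (- (e / 2)) * (b - a)"
        proof (rule set_integral_le_const[OF si less_imp_le[OF ab(2)]])
          fix \<tau> assume \<tau>: "a \<le> \<tau>" "\<tau> \<le> b"
          have "e = - ?uc t y" using False by (simp add: e_def)
          then show "?uc \<tau> s \<le> - (e / 2)" using near[OF \<tau> s] by linarith
        qed
        also have "\<dots> < 0" using ab e by (simp add: mult_neg_pos)
        finally show ?thesis unfolding d by linarith
      qed
    qed
    have "AE s in UI. tint ?uc a s = 0"
    proof (cases "a = 0")
      case True
      then show ?thesis by (simp add: tint_nonpos)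
    next
      case False
      then show ?thesis using U0[of a] ab by auto
    qed
    moreover have "AE s in UI. tint ?uc b s = 0" using U0[of b] ab by auto
    ultimately have "AE s in UI. s \<notin> {y<..<y + r / 2}"
    proof eventually_elim
      case (elim s)
      then show ?case using pos[of s] by auto
    qed
    then have "AE s in lborel. s \<notin> {y<..<y + r / 2}"
      unfolding AE_UI_iff by eventually_elim (use y r in auto)
    then have "emeasure lborel {y<..<y + r / 2} = 0" by (subst (asm) AE_iff_measurable[of "{y<..<y + r / 2}"]) auto
    then show False using r by simp
  qed
qed

section \<open>The regular representative of a weak solution\<close>

lemma AE_UI_periodic: assumes "AE x in UI. P x" shows "AE x in lborel. P (frac x)"
proof -
  obtain N where N: "{x \<in> space lborel. \<not> (x \<in> {0..1} \<longrightarrow> P x)} \<subseteq> N" "emeasure lborel N = 0" "N \<in> sets lborel"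
    using assms[unfolded AE_UI_iff] by (rule AE_E)
  have N0: "N \<in> null_sets lborel" using N by (intro null_setsI) auto
  have "{x. x - of_int n \<in> N} \<in> null_sets lborel" for n :: int
    by (rule null_sets_translation[OF N0])
  then have "(\<Union>n. {x. x - of_int n \<in> N}) \<in> null_sets lborel" by (intro null_sets_UN') auto
  then have "AE x in lborel. x \<notin> (\<Union>n. {x. x - of_int n \<in> N})" by (rule AE_not_in)
  then show ?thesis
  proof eventually_elim
    case (elim x)
    then have "frac x \<notin> N" by (auto simp: frac_def)
    moreover have "frac x \<in> {0..1}" using frac_lt_1[of x] by (auto intro: less_imp_le)
    ultimately show ?case using N(1) by fastforce
  qed
qed

text \<open>
  The estimates for \<open>v\<close> that depend on the solution only through the bound \<open>K\<close> on \<open>\<bar>L h\<bar>\<^sub>2\<close> and the mean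
  \<open>m\<close>. They give equicontinuity, and control at large times, uniformly along a sequence with bounded \<open>K\<close>.
\<close>

definition parabolic_bounds :: "real \<Rightarrow> real \<Rightarrow> (real \<Rightarrow> real \<Rightarrow> real) \<Rightarrow> bool" where
  "parabolic_bounds K m v \<longleftrightarrow> (\<forall>t\<ge>0. periodic1 (v t)) \<and>
     (\<forall>t\<ge>0. \<forall>x y. \<bar>v t x - v t y\<bar> \<le> 24 * K * \<bar>x - y\<bar>) \<and>
     (\<forall>t\<ge>0. \<forall>u\<ge>0. \<forall>x. (v t x - v u x)\<^sup>2 \<le> 288 * K\<^sup>2 * \<bar>t - u\<bar>) \<and>
     (\<forall>t\<ge>0. \<forall>x. \<bar>v t x - m\<bar> \<le> 24 * K) \<and>
     (\<forall>t\<ge>0. \<forall>x. (v t x - m)\<^sup>2 \<le> 288 * K\<^sup>2 / sqrt (1 + 2 * t))"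

lemma parabolic_bounds_diff:
  assumes p: "parabolic_bounds K m v" and t: "0 \<le> t" "0 \<le> u"
  shows "\<bar>v t x - v u y\<bar> \<le> 24 * K * \<bar>x - y\<bar> + sqrt (288 * K\<^sup>2 * \<bar>t - u\<bar>)"
proof -
  have "\<bar>v t x - v t y\<bar> \<le> 24 * K * \<bar>x - y\<bar>" "(v t y - v u y)\<^sup>2 \<le> 288 * K\<^sup>2 * \<bar>t - u\<bar>"
    using p t unfolding parabolic_bounds_def by blast+
  then show ?thesis using abs_le_sqrt_iff_square[of "v t y - v u y"] by fastforce
qed

lemma parabolic_bounds_continuous:
  assumes p: "parabolic_bounds K m v"
  shows "continuous_on ({0..} \<times> UNIV) (\<lambda>p. v (fst p) (snd p))"
  unfolding continuous_on_def
proof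
  fix q :: "real \<times> real" assume q: "q \<in> {0..} \<times> UNIV"
  define G where "G = (\<lambda>p :: real \<times> real. 24 * K * \<bar>snd p - snd q\<bar> + sqrt (288 * K\<^sup>2 * \<bar>fst p - fst q\<bar>))"
  have "continuous_on ({0..} \<times> UNIV) G" unfolding G_def by (intro continuous_intros)
  then have "(G \<longlongrightarrow> G q) (at q within {0..} \<times> UNIV)" using q unfolding continuous_on_def by blast
  then have G: "(G \<longlongrightarrow> 0) (at q within {0..} \<times> UNIV)" by (simp add: G_def)
  have "((\<lambda>p. v (fst p) (snd p) - v (fst q) (snd q)) \<longlongrightarrow> 0) (at q within {0..} \<times> UNIV)"
  proof (rule Lim_null_comparison[OF _ G])
    have "norm (v (fst p) (snd p) - v (fst q) (snd q)) \<le> G p" if "p \<in> {0..} \<times> UNIV" for p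
      unfolding G_def real_norm_def by (rule parabolic_bounds_diff[OF p]) (use that q in auto)
    then show "\<forall>\<^sub>F p in at q within {0..} \<times> UNIV. norm (v (fst p) (snd p) - v (fst q) (snd q)) \<le> G p"
      unfolding eventually_at_filter by (intro always_eventually allI impI) blast
  qed
  then show "((\<lambda>p. v (fst p) (snd p)) \<longlongrightarrow> v (fst q) (snd q)) (at q within {0..} \<times> UNIV)"
    by (simp only: LIM_zero_iff)
qed

lemma weak_sol_a_section:
  assumes "weak_sol_a a f u" "0 \<le> t" shows "bmeas (u t)"
proof (rule periodic_continuous_bmeas)
  have c: "continuous_on ({0..} \<times> UNIV) (\<lambda>p. u (fst p) (snd p))" using assms(1) by (simp add: weak_sol_a_def)
  have "continuous_on UNIV (\<lambda>x. (\<lambda>p. u (fst p) (snd p)) (t, x))"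
    by (rule continuous_on_compose2[OF c]) (use assms(2) in \<open>auto intro!: continuous_intros\<close>)
  then show "continuous_on UNIV (u t)" by simp
  show "periodic1 (u t)" using assms by (simp add: weak_sol_a_def)
qed

text \<open>
  The weight \<open>w'\<close> is absorbed by the change of variable, so the unknown coefficient appears only
  through \<open>W\<close>; this is the form that passes to limits.
\<close>

lemma weak_sol_a_test:
  assumes W: "W \<in> class_W" and f: "bmeas f" and u: "weak_sol_a (deriv (gen_inverse W)) f u"
    and \<phi>: "\<phi> \<in> H2T" and T: "0 < T"
  shows "(LINT x|UI. u T (W x) * \<phi> (W x)) - (LINT x|UI. f (W x) * \<phi> (W x))
     = (LINT t:{0..T}|lborel. ipT (u t) (weak_deriv (weak_deriv \<phi>)))"
proof -
  have bu: "bmeas (u T)" by (rule weak_sol_a_section[OF u]) (use T in simp)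
  have "ipT_weighted (deriv (gen_inverse W)) (u T) \<phi> - ipT_weighted (deriv (gen_inverse W)) f \<phi>
     = (LINT t:{0..T}|lborel. ipT (u t) (weak_deriv (weak_deriv \<phi>)))"
    using u \<phi> T unfolding weak_sol_a_def by blast
  then show ?thesis
    unfolding ipT_weighted_eq[OF W bu H2T_D(3)[OF \<phi>]] ipT_weighted_eq[OF W f H2T_D(3)[OF \<phi>]] .
qed

lemma weak_sol_a_unique:
  assumes W: "W \<in> class_W" and f: "bmeas f"
    and u: "weak_sol_a (deriv (gen_inverse W)) f u" and v: "weak_sol_a (deriv (gen_inverse W)) f v"
    and t: "0 \<le> t"
  shows "u t x = v t x"
proof -
  interpret driver W by (rule class_W_driver[OF W])
  have cu: "continuous_on ({0..} \<times> UNIV) (\<lambda>p. u (fst p) (snd p))" "continuous_on ({0..} \<times> UNIV) (\<lambda>p. v (fst p) (snd p))"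
    and pu: "\<And>t. 0 \<le> t \<Longrightarrow> periodic1 (u t)" "\<And>t. 0 \<le> t \<Longrightarrow> periodic1 (v t)"
    using u v unfolding weak_sol_a_def by blast+
  let ?T = "t + 1"
  have sub: "{0..?T} \<times> UNIV \<subseteq> {0..} \<times> (UNIV :: real set)" by auto
  note c = continuous_on_subset[OF cu(1) sub] continuous_on_subset[OF cu(2) sub]
  have T0: "0 < ?T" "t \<le> ?T" using t by auto
  have "u t x - v t x = 0"
  proof (rule a_equation_uniqueness[where u="\<lambda>t x. u t x - v t x", OF W T0(1) _ _ _ t T0(2)])
    show "continuous_on ({0..?T} \<times> UNIV) (\<lambda>p. u (fst p) (snd p) - v (fst p) (snd p))"
      by (intro continuous_on_diff c)
    show "periodic1 (\<lambda>x. u s x - v s x)" if "0 \<le> s" for s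
      using pu(1)[OF that] pu(2)[OF that] by (simp add: periodic1_def)
    fix \<phi> T assume \<phi>: "\<phi> \<in> H2T" and T: "0 < T" "T \<le> ?T"
    let ?q = "weak_deriv (weak_deriv \<phi>)"
    have q: "integrable UI ?q" using H2T_D(2)[OF \<phi>] by (auto simp: has_weak_deriv_def intro: L2T_integrable)
    have T': "0 \<le> T" using T by simp
    have b: "bmeas (\<lambda>x. r (W x))" if "bmeas r" for r
      using that measurable_compose[OF W_measurable bmeas_measurable[OF that]] unfolding bmeas_def by blast
    note bu = b[OF weak_sol_a_section[OF u T']] b[OF weak_sol_a_section[OF v T']] b[OF H2T_D(3)[OF \<phi>]]
    have "(LINT x|UI. (u T (W x) - v T (W x)) * \<phi> (W x)) = (LINT x|UI. u T (W x) * \<phi> (W x)) - (LINT x|UI. v T (W x) * \<phi> (W x))"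
      unfolding left_diff_distrib by (intro Bochner_Integration.integral_diff sqint_mult bmeas_sqint bu)
    also have "\<dots> = (LINT t:{0..T}|lborel. ipT (u t) ?q) - (LINT t:{0..T}|lborel. ipT (v t) ?q)"
      using weak_sol_a_test[OF W f u \<phi> T(1)] weak_sol_a_test[OF W f v \<phi> T(1)] by linarith
    also have "\<dots> = (LINT t:{0..T}|lborel. ipT (u t) ?q - ipT (v t) ?q)"
      by (intro set_integral_diff(2)[symmetric] ipT_time_integral(2)[OF T' T(2) c(1) pu(1) q] ipT_time_integral(2)[OF T' T(2) c(2) pu(2) q])
    also have "\<dots> = (LINT t:{0..T}|lborel. ipT (\<lambda>x. u t x - v t x) ?q)"
    proof (rule set_lebesgue_integral_cong, simp, intro allI impI)
      fix s assume "s \<in> {0..T}"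
      then have s: "0 \<le> s" by simp
      show "ipT (u s) ?q - ipT (v s) ?q = ipT (\<lambda>x. u s x - v s x) ?q"
        unfolding ipT_UI left_diff_distrib
        by (rule Bochner_Integration.integral_diff[symmetric])
          (use bmeas_mult_integrable[OF weak_sol_a_section[OF u s] q] bmeas_mult_integrable[OF weak_sol_a_section[OF v s] q]
            in \<open>simp_all add: mult.commute\<close>)
    qed
    finally show "(LINT x|UI. (u T (W x) - v T (W x)) * \<phi> (W x)) = (LINT t:{0..T}|lborel. ipT (\<lambda>x. u t x - v t x) ?q)" .
  qed
  then show ?thesis by simp
qed

text \<open>
  Testing with potentials and with constants gives exactly the integrated equation. Negative times
  carry no information and are filled with 0.
\<close>

lemma weak_sol_W_flow:
  assumes W: "W \<in> class_W" and hd: "h \<in> dom_W W" and bh: "bmeas h" and sol: "weak_sol_W W h \<rho>"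
  obtains g where "flow W (\<lambda>t x. if 0 \<le> t then \<rho> t x else 0) h g" "L2n g = L2n (L_op W h)"
proof -
  interpret driver W by (rule class_W_driver[OF W])
  obtain b g where g: "g \<in> L2T" "(LINT z|UI. g z) = 0" and hr: "\<And>x. x \<in> {0..1} \<Longrightarrow> h x = b + Pot g (W x)"
    and Lh: "AE x in UI. L_op W h x = g x" "L_op W h \<in> borel_measurable UI"
    using dom_W_representation[OF hd] by metis
  note gi = L2T_integrable[OF g(1)]
  have gm: "g \<in> borel_measurable UI" by (rule borel_measurable_integrable[OF gi])
  have hm: "h \<in> borel_measurable UI" by (rule borel_measurable_UI[OF bmeas_measurable[OF bh]])
  have weak_h: "weakL h g"
  proof (rule weakL_cong_AE[OF weakL_Pot[OF gi g(2), of b] _ _ hm gm])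
    show "AE x in UI. b + Pot g (W x) = h x" by (rule AE_I2) (use hr in simp)
  qed simp
  define rb where "rb t x = (if 0 \<le> t then \<rho> t x else 0)" for t x
  obtain C where C: "\<And>t x. 0 \<le> t \<Longrightarrow> \<bar>\<rho> t x\<bar> \<le> C" using sol by (auto simp: weak_sol_W_def)
  have j: "loc_bdd rb" unfolding loc_bdd_def
  proof
    have S: "({0..} \<times> UNIV :: (real \<times> real) set) \<in> sets borel" by (intro borel_closed closed_Times) auto
    have "(\<lambda>p. \<rho> (fst p) (snd p)) \<in> borel_measurable (restrict_space borel ({0..} \<times> UNIV))"
      using sol by (simp add: weak_sol_W_def)
    then have "(\<lambda>p. indicator ({0..} \<times> UNIV) p *\<^sub>R \<rho> (fst p) (snd p)) \<in> borel_measurable borel"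
      using S by (subst (asm) borel_measurable_restrict_space_iff) auto
    moreover have "(\<lambda>p. indicator ({0..} \<times> UNIV) p *\<^sub>R \<rho> (fst p) (snd p)) = (\<lambda>p. rb (fst p) (snd p))"
      by (auto simp: fun_eq_iff rb_def indicator_def)
    ultimately show "(\<lambda>p. rb (fst p) (snd p)) \<in> borel_measurable (borel \<Otimes>\<^sub>M borel)" by (simp only: borel_prod)
    have "\<bar>rb t x\<bar> \<le> max C 0" for t x using C[of t x] by (simp add: rb_def le_max_iff_disj)
    then show "\<forall>T. \<exists>C. \<forall>t x. \<bar>t\<bar> \<le> T \<longrightarrow> \<bar>rb t x\<bar> \<le> C" by blast
  qed
  have brb: "bmeas (rb t)" "bmeas (tint rb t)" for t by (rule loc_bdd_bmeas[OF j], rule loc_bdd_bmeas[OF tint_loc_bdd[OF j]])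
  have key: "(LINT x|UI. rb t x * \<psi> x) - (LINT x|UI. h x * \<psi> x) = (LINT x|UI. gg x * tint rb t x)"
    if t: "0 < t" and \<psi>: "\<psi> \<in> dom_W W" "AE x in UI. L_op W \<psi> x = gg x" "L_op W \<psi> \<in> borel_measurable UI"
      and gg: "integrable UI gg" for t \<psi> gg
  proof -
    have "ipT (\<rho> t) \<psi> - ipT h \<psi> = (LINT r:{0..t}|lborel. ipT (\<rho> r) (L_op W \<psi>))"
      using sol \<psi>(1) t by (simp add: weak_sol_W_def)
    also have "\<dots> = (LINT r:{0..t}|lborel. LINT x|UI. gg x * rb r x)"
    proof (rule set_lebesgue_integral_cong, simp, intro allI impI)
      fix r assume r: "r \<in> {0..t}"
      have e: "\<rho> r = rb r" using r by (simp add: rb_def fun_eq_iff)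
      show "ipT (\<rho> r) (L_op W \<psi>) = (LINT x|UI. gg x * rb r x)" unfolding ipT_UI e
      proof (rule integral_cong_AE)
        show "AE x in UI. rb r x * L_op W \<psi> x = gg x * rb r x" using \<psi>(2) by eventually_elim simp
        show "(\<lambda>x. rb r x * L_op W \<psi> x) \<in> borel_measurable UI"
          by (intro borel_measurable_times \<psi>(3) borel_measurable_UI[OF bmeas_measurable[OF brb(1)]])
        show "(\<lambda>x. gg x * rb r x) \<in> borel_measurable UI"
          by (intro borel_measurable_times borel_measurable_integrable[OF gg] borel_measurable_UI[OF bmeas_measurable[OF brb(1)]])
      qed
    qed
    also have "\<dots> = (LINT x|UI. gg x * tint rb t x)" by (rule Fubini_time(1)[OF gg j, symmetric])
    finally show ?thesis using t by (simp add: ipT_UI rb_def)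
  qed
  have weak: "weakL (tint rb t) (\<lambda>x. rb t x - h x)" if t: "0 \<le> t" for t
  \<comment> \<open>at time 0 the tested identity is not available; the initial condition takes its place\<close>
  proof (cases "t = 0")
    case True
    have 0: "weakL (\<lambda>_. 0) (\<lambda>_. 0)" by (simp add: weakL_def)
    have "AE x in lborel. \<rho> 0 x = h x" using sol by (simp add: weak_sol_W_def)
    then have k: "AE x in UI. 0 = rb t x - h x" unfolding AE_UI_iff by eventually_elim (simp add: rb_def True)
    show ?thesis
    proof (rule weakL_cong_AE[OF 0 _ k borel_measurable_UI[OF bmeas_measurable[OF brb(2)]]])
      show "AE x in UI. 0 = tint rb t x" by (simp add: True tint_nonpos)
    qed (rule borel_measurable_UI[OF bmeas_measurable[OF bmeas_diff[OF brb(1) bh]]])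
  next
    case False
    then have t0: "0 < t" using t by simp
    show ?thesis unfolding weakL_def
    proof (intro conjI allI impI)
      show "integrable UI (tint rb t)" "integrable UI (\<lambda>x. rb t x - h x)"
        by (intro bmeas_integrable brb bmeas_diff bh)+
      have "(LINT x|UI. rb t x * 1) - (LINT x|UI. h x * 1) = (LINT x|UI. 0 * tint rb t x)"
        by (rule key[OF t0 dom_W_const]) simp
      then show "(LINT x|UI. rb t x - h x) = 0" using bmeas_integrable[OF brb(1), of t] bmeas_integrable[OF bh] by simp
      fix g' assume g': "testg g'"
      note gi' = testg_integrable[OF g']
      obtain \<psi> where \<psi>: "\<psi> \<in> dom_W W" "\<And>x. x \<in> {0..1} \<Longrightarrow> \<psi> x = Pot g' (W x)"
        "AE x in UI. L_op W \<psi> x = g' x" "L_op W \<psi> \<in> borel_measurable UI"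
        using dom_W_Pot[OF g'] by metis
      have eq: "(LINT x|UI. r x * \<psi> x) = (LINT x|UI. r x * Pot g' (W x))" for r
        by (intro Bochner_Integration.integral_cong refl) (use \<psi>(2) in simp)
      have "(LINT x|UI. (rb t x - h x) * Pot g' (W x)) = (LINT x|UI. rb t x * Pot g' (W x)) - (LINT x|UI. h x * Pot g' (W x))"
        unfolding left_diff_distrib
        by (intro Bochner_Integration.integral_diff mult_Pot_integrable bmeas_integrable brb bh gi')
      also have "\<dots> = (LINT x|UI. g' x * tint rb t x)" using key[OF t0 \<psi>(1,3,4) gi'] unfolding eq .
      finally show "(LINT x|UI. (rb t x - h x) * Pot g' (W x)) = (LINT x|UI. tint rb t x * g' x)" by (simp add: mult.commute)
    qed
  qed
  have "flow W rb h g"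
    by unfold_locales (rule j, rule bh, erule weak, rule L2T_sqint[OF g(1)], rule weak_h)
  moreover have "rb = (\<lambda>t x. if 0 \<le> t then \<rho> t x else 0)" by (simp add: rb_def fun_eq_iff)
  moreover have "L2n g = L2n (L_op W h)" by (rule L2n_cong_AE[OF _ gm Lh(2)]) (use Lh(1) in eventually_elim, simp)
  ultimately show ?thesis using that by simp
qed

text \<open>
  The function \<open>v\<close> from the flow lives on the unit interval and is extended periodically; \<open>W\<close> maps \<open>x\<close>
  and \<open>frac x\<close> to points with the same fractional part.
\<close>

lemma extraction:
  assumes W: "W \<in> class_W" and hd: "h \<in> dom_W W" and fc: "continuous_on UNIV f" and fp: "periodic1 f"
    and hf: "\<And>y. h y = f (W y)" and sol: "weak_sol_W W h \<rho>"
  shows "\<exists>v. unique_weak_sol_a (deriv (gen_inverse W)) f v \<and> (\<forall>t\<ge>0. AE x in lborel. \<rho> t x = v t (W x)) \<and>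
    parabolic_bounds (L2n (L_op W h)) (LINT x|UI. f (W x)) v"
proof -
  interpret driver W by (rule class_W_driver[OF W])
  have bf: "bmeas f" by (rule periodic_continuous_bmeas[OF fc fp])
  have bh: "bmeas h"
  proof -
    have "h = (\<lambda>x. f (W x))" using hf by blast
    then show ?thesis using bf measurable_compose[OF W_measurable bmeas_measurable[OF bf]] unfolding bmeas_def by auto
  qed
  let ?rb = "\<lambda>t x. if 0 \<le> t then \<rho> t x else 0"
  obtain g where fl: "flow W ?rb h g" and K: "L2n g = L2n (L_op W h)" using weak_sol_W_flow[OF W hd bh sol] by metis
  interpret F: flow W ?rb h g by (rule fl)
  define v where "v t x = F.v t (frac x)" for t x
  have fr: "frac x \<in> {0..1}" for x :: real using frac_lt_1[of x] by (auto intro: less_imp_le)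
  have per: "periodic1 (v t)" for t by (simp add: periodic1_def v_def frac_shift)
  have pb: "parabolic_bounds (L2n g) F.m v"
    unfolding parabolic_bounds_def
  proof (intro conjI allI impI per)
    fix t u x y :: real assume t: "0 \<le> t"
    show "\<bar>v t x - v t y\<bar> \<le> 24 * L2n g * \<bar>x - y\<bar>" unfolding v_def
      by (rule frac_Lipschitz[OF F.v_lip[OF t] F.v_ends[OF t]])
    show "\<bar>v t x - F.m\<bar> \<le> 24 * L2n g" unfolding v_def by (rule F.v_mean[OF t fr])
    show "(v t x - F.m)\<^sup>2 \<le> 288 * (L2n g)\<^sup>2 / sqrt (1 + 2 * t)" unfolding v_def by (rule F.v_decay[OF t fr])
    assume u: "0 \<le> u"
    show "(v t x - v u x)\<^sup>2 \<le> 288 * (L2n g)\<^sup>2 * \<bar>t - u\<bar>" unfolding v_def by (rule F.v_time[OF t u fr])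
  qed
  have vW: "v t (W x) = F.vW t (frac x)" if "0 \<le> t" for t x
    unfolding v_def W_frac by (rule F.vW_eq[OF that fr, symmetric])
  have vW_ae: "AE x in UI. v t (W x) = F.vW t x" if "0 \<le> t" for t
    using frac_AE_UI by eventually_elim (simp add: vW[OF that])
  have rho: "AE x in lborel. \<rho> t x = v t (W x)" if t: "0 \<le> t" for t
  proof -
    have "periodic1 (\<rho> t)" using sol t by (simp add: weak_sol_W_def)
    from periodic1_int[OF this] have rf: "\<rho> t (frac x) = \<rho> t x" for x
      by (metis frac_def diff_add_cancel)
    have "AE x in UI. \<rho> t x = F.vW t x" using F.rho_eq_vW[OF t] t by simp
    then have "AE x in lborel. \<rho> t (frac x) = F.vW t (frac x)" by (rule AE_UI_periodic)
    then show ?thesis by (simp add: rf vW[OF t])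
  qed
  have cont: "continuous_on ({0..} \<times> UNIV) (\<lambda>p. v (fst p) (snd p))" by (rule parabolic_bounds_continuous[OF pb])
  have bv: "bmeas (v t)" if "0 \<le> t" for t
  proof (rule periodic_continuous_bmeas[OF Lipschitz_continuous per])
    show "\<bar>v t x - v t y\<bar> \<le> 24 * L2n g * \<bar>x - y\<bar>" for x y using pb that unfolding parabolic_bounds_def by blast
  qed
  have ws: "weak_sol_a (deriv (gen_inverse W)) f v"
    unfolding weak_sol_a_def
  proof (intro conjI ballI allI impI cont per)
    fix \<phi> T assume \<phi>: "\<phi> \<in> H2T" and T0: "(0 :: real) < T"
    then have T: "0 \<le> T" by simp
    note b\<phi> = H2T_D(3)[OF \<phi>]
    let ?q = "weak_deriv (weak_deriv \<phi>)"
    obtain c d where r: "?q \<in> L2T" "(LINT s|UI. ?q s) = 0" "(LINT s|UI. d + prim ?q s) = 0"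
      "\<And>s. s \<in> {0..1} \<Longrightarrow> \<phi> s = c + prim (\<lambda>r. d + prim ?q r) s"
      using H2T_representation[OF \<phi>] by metis
    note qi = L2T_integrable[OF r(1)]
    have bW: "bmeas (\<lambda>x. r (W x))" if "bmeas r" for r
      using that measurable_compose[OF W_measurable bmeas_measurable[OF that]] unfolding bmeas_def by blast
    have "ipT_weighted (deriv w) (v T) \<phi> - ipT_weighted (deriv w) f \<phi>
       = (LINT x|UI. v T (W x) * \<phi> (W x)) - (LINT x|UI. f (W x) * \<phi> (W x))"
      by (simp only: ipT_weighted_eq[OF W bv[OF T] b\<phi>] ipT_weighted_eq[OF W bf b\<phi>])
    also have "\<dots> = (LINT x|UI. v T (W x) * \<phi> (W x) - f (W x) * \<phi> (W x))"
      by (intro Bochner_Integration.integral_diff[symmetric] sqint_mult bmeas_sqint bW bv T bf b\<phi>)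
    also have "\<dots> = (LINT x|UI. \<phi> (W x) * (F.vW T x - h x))"
    proof (rule integral_cong_AE)
      show "AE x in UI. v T (W x) * \<phi> (W x) - f (W x) * \<phi> (W x) = \<phi> (W x) * (F.vW T x - h x)"
        using vW_ae[OF T] by eventually_elim (simp add: hf algebra_simps)
      note m = borel_measurable_UI[OF bmeas_measurable]
      show "(\<lambda>x. v T (W x) * \<phi> (W x) - f (W x) * \<phi> (W x)) \<in> borel_measurable UI"
        by (intro borel_measurable_diff borel_measurable_times m[OF bW[OF bv[OF T]]] m[OF bW[OF bf]] m[OF bW[OF b\<phi>]])
      show "(\<lambda>x. \<phi> (W x) * (F.vW T x - h x)) \<in> borel_measurable UI"
        by (intro borel_measurable_diff borel_measurable_times m[OF bW[OF b\<phi>]] m[OF F.bvW] m[OF bh])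
    qed
    also have "\<dots> = (LINT r:{0..T}|lborel. LINT s|UI. ?q s * F.v r s)"
      by (rule F.v_weak_H2[OF T qi r(2) r(4) r(3) b\<phi>, symmetric])
    also have "\<dots> = (LINT r:{0..T}|lborel. ipT (v r) ?q)"
    proof (rule set_lebesgue_integral_cong, simp, intro allI impI)
      fix r assume "r \<in> {0..T}"
      then have r0: "0 \<le> r" by simp
      have "(LINT s|UI. ?q s * F.v r s) = (LINT s|UI. ?q s * F.vc r s)"
        by (intro Bochner_Integration.integral_cong refl) (use r0 in \<open>simp add: F.vc_eq\<close>)
      also have "\<dots> = (LINT s|UI. v r s * ?q s)"
      proof (rule integral_cong_AE)
        note m = borel_measurable_UI[OF bmeas_measurable]
        show "AE s in UI. ?q s * F.vc r s = v r s * ?q s"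
          using frac_AE_UI AE_space[of UI] by eventually_elim (use r0 in \<open>simp add: v_def F.vc_eq\<close>)
        show "(\<lambda>s. ?q s * F.vc r s) \<in> borel_measurable UI"
          by (intro borel_measurable_times borel_measurable_integrable[OF qi] m[OF loc_bdd_bmeas[OF F.loc_bdd_vc]])
        show "(\<lambda>s. v r s * ?q s) \<in> borel_measurable UI"
          by (intro borel_measurable_times borel_measurable_integrable[OF qi] m[OF bv[OF r0]])
      qed
      finally show "(LINT s|UI. ?q s * F.v r s) = ipT (v r) ?q" by (simp add: ipT_UI)
    qed
    finally show "ipT_weighted (deriv w) (v T) \<phi> - ipT_weighted (deriv w) f \<phi> = (LINT r:{0..T}|lborel. ipT (v r) ?q)" .
  qed
  have "unique_weak_sol_a (deriv (gen_inverse W)) f v"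
    unfolding unique_weak_sol_a_def using ws weak_sol_a_unique[OF W bf _ ws] by blast
  moreover have "F.m = (LINT x|UI. f (W x))" unfolding F.m_def by (intro Bochner_Integration.integral_cong refl hf)
  ultimately show ?thesis using rho pb K by (intro exI[of _ v]) auto
qed

section \<open>Almost everywhere convergence of the driving functions\<close>

text \<open>
  The essential bound becomes a bound on an almost everywhere equal truncation.
\<close>

lemma L_op_norm_bound:
  assumes W: "W \<in> class_W" and h: "h \<in> dom_W W" and C: "0 \<le> C" and L: "AE x in lborel. \<bar>L_op W h x\<bar> \<le> C"
  shows "L2n (L_op W h) \<le> C"
proof -
  interpret driver W by (rule class_W_driver[OF W])
  have m: "L_op W h \<in> borel_measurable UI" using dom_W_representation[OF h] by metis
  have mc: "(\<lambda>x. max (- C) (min C (L_op W h x))) \<in> borel_measurable UI"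
    by (intro borel_measurable_max borel_measurable_min borel_measurable_const m)
  have ae: "AE x in UI. L_op W h x = max (- C) (min C (L_op W h x))"
    unfolding AE_UI_iff using L by eventually_elim auto
  have "L2n (L_op W h) = L2n (\<lambda>x. max (- C) (min C (L_op W h x)))" by (rule L2n_cong_AE[OF ae m mc])
  also have "\<dots> \<le> C" by (rule L2n_le_bound[OF _ C mc]) (use C in auto)
  finally show ?thesis .
qed

lemma max_diff_le: fixes a b c d :: real assumes "\<bar>a - c\<bar> \<le> L" "\<bar>b - d\<bar> \<le> L" shows "\<bar>max a b - max c d\<bar> \<le> L"
  using assms by (auto simp: max_def)

lemma min_diff_le: fixes a b c d :: real assumes "\<bar>a - c\<bar> \<le> L" "\<bar>b - d\<bar> \<le> L" shows "\<bar>min a b - min c d\<bar> \<le> L"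
  using assms by (auto simp: min_def)

context driver
begin

lemma integrable_WI_bounded:
  fixes p :: "real \<Rightarrow> real"
  assumes "p \<in> borel_measurable borel" "\<And>y. \<bar>p y\<bar> \<le> C" shows "integrable WI p"
  by (rule WI.integrable_const_bound[where B=C]) (use assms borel_measurable_WI in auto)

lemma LINT_Ioc_ge:
  assumes p: "p \<in> borel_measurable borel" "\<And>y. \<bar>p y\<bar> \<le> C" and u: "0 \<le> u" "u \<le> v" "v \<le> 1"
    and le: "\<And>y. y \<in> {0<..1} \<Longrightarrow> indicator {u<..v} y \<le> p y"
  shows "W v - W u \<le> (LINT y:{0<..1}|interval_measure W. p y)"
proof -
  have "W v - W u = (LINT y|WI. indicator {u<..v} y)"
    using u by (subst measure_WI) (auto simp: IM_Ioc)
  also have "\<dots> \<le> (LINT y|WI. p y)"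
    by (rule integral_mono[OF integrable_WI_bounded[of _ 1] integrable_WI_bounded[OF p]]) (use le in \<open>auto simp: indicator_def\<close>)
  also have "\<dots> = (LINT y|WI. indicator {0<..1} y * p y)" by (intro Bochner_Integration.integral_cong) auto
  also have "\<dots> = (LINT y:{0<..1}|interval_measure W. p y)" by (rule LINT_WI[symmetric]) simp
  finally show ?thesis .
qed

lemma LINT_Ioc_le:
  assumes p: "p \<in> borel_measurable borel" "\<And>y. \<bar>p y\<bar> \<le> C" and u: "0 \<le> u" "u \<le> 1" "0 \<le> v" "v \<le> 1"
    and le: "\<And>y. y \<in> {0<..1} \<Longrightarrow> p y \<le> indicator {0<..u} y + indicator {v<..1} y"
  shows "(LINT y:{0<..1}|interval_measure W. p y) \<le> W u + (1 - W v)"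
proof -
  have i: "integrable WI (indicator {a<..b} :: real \<Rightarrow> real)" for a b
    by (rule integrable_WI_bounded[of _ 1]) (auto simp: indicator_def)
  have "(LINT y:{0<..1}|interval_measure W. p y) = (LINT y|WI. indicator {0<..1} y * p y)" by (rule LINT_WI) simp
  also have "\<dots> = (LINT y|WI. p y)" by (intro Bochner_Integration.integral_cong) auto
  also have "\<dots> \<le> (LINT y|WI. indicator {0<..u} y + indicator {v<..1} y)"
    by (rule integral_mono[OF integrable_WI_bounded[OF p] Bochner_Integration.integrable_add[OF i i]]) (use le in auto)
  also have "\<dots> = (LINT y|WI. indicator {0<..u} y) + (LINT y|WI. indicator {v<..1} y)"
    by (rule Bochner_Integration.integral_add[OF i i])
  also have "\<dots> = W u + (1 - W v)"
    using u by (subst (1 2) measure_WI) (auto simp: IM_Ioc W_0 W_1)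
  finally show ?thesis .
qed

end

text \<open>
  Squeeze the indicator of \<open>(0,x]\<close> between continuous periodic trapezoids. The upper one has to be 1 at
  the integers as well, so it picks up mass on \<open>(1 - \<delta>, 1]\<close>; this mass is \<open>W 0 - W (- \<delta>)\<close> and is small
  because \<open>W\<close> is continuous at 0.
\<close>

lemma vague_pointwise:
  assumes Wn: "\<And>n. Wn n \<in> class_W" and W: "W \<in> class_W" and vague: "vaguely_tendsto Wn W"
    and c0: "isCont W 0" and x: "0 < x" "x < 1" and cx: "isCont W x"
  shows "(\<lambda>n. Wn n x) \<longlonglongrightarrow> W x"
proof -
  interpret driver W by (rule class_W_driver[OF W])
  note dn = class_W_driver[OF Wn]
  have fr: "frac y = (if y = 1 then 0 else y)" if "y \<in> {0<..1}" for y :: real using that by (auto simp: frac_eq)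
  have per: "periodic1 (\<lambda>y :: real. G (frac y))" for G :: "real \<Rightarrow> real" by (simp add: periodic1_def frac_1_eq)
  have lin: "\<bar>(a + s / \<delta>) - (a + t / \<delta>)\<bar> \<le> 1 / \<delta> * \<bar>s - t\<bar>" if "\<delta> > 0" for a s t \<delta> :: real
    using that by (simp add: diff_divide_distrib[symmetric])
  have lin': "\<bar>(a - s / \<delta>) - (a - t / \<delta>)\<bar> \<le> 1 / \<delta> * \<bar>s - t\<bar>" if "\<delta> > 0" for a s t \<delta> :: real
    using lin[OF that, of 0 t s] by (simp add: abs_minus_commute)
  have upper: "\<exists>\<phi> :: real \<Rightarrow> real. continuous_on UNIV \<phi> \<and> periodic1 \<phi> \<and> (\<forall>y. \<bar>\<phi> y\<bar> \<le> 1) \<and>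
      (\<forall>y\<in>{0<..1}. indicator {0<..x} y \<le> \<phi> y) \<and> (\<forall>y\<in>{0<..1}. \<phi> y \<le> indicator {0<..x + \<delta>} y + indicator {1 - \<delta><..1} y)"
    if \<delta>: "0 < \<delta>" "x + \<delta> \<le> 1" "\<delta> \<le> x" for \<delta>
  proof -
    define G where "G s = max (max 0 (min 1 ((1 + x / \<delta>) - s / \<delta>))) (max 0 ((1 - 1 / \<delta>) + s / \<delta>))" for s
    have L: "\<bar>G s - G t\<bar> \<le> 1 / \<delta> * \<bar>s - t\<bar>" for s t
      unfolding G_def by (intro max_diff_le min_diff_le lin lin' \<delta>) (use \<delta> in auto)
    have G0: "G 0 = 1" "G 1 = 1" using \<delta> x by (auto simp: G_def max_def min_def field_simps)
    have G1: "0 \<le> G s" "s \<le> 1 \<Longrightarrow> G s \<le> 1" for s using \<delta> by (auto simp: G_def field_simps)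
    show ?thesis
    proof (intro exI[of _ "\<lambda>y. G (frac y)"] conjI allI ballI per frac_continuous[OF L])
      show "G 0 = G 1" by (simp add: G0)
      show "\<bar>G (frac y)\<bar> \<le> 1" for y using G1(1)[of "frac y"] G1(2)[of "frac y"] frac_lt_1[of y] by simp
      fix y :: real assume y: "y \<in> {0<..1}"
      have "y \<le> x \<Longrightarrow> 1 \<le> G y" using \<delta> by (auto simp: G_def le_max_iff_disj field_simps)
      then show "indicator {0<..x} y \<le> G (frac y)" using y G1(1)[of "frac y"] G0 fr[OF y] x by (auto simp: indicator_def)
      have "G y \<le> 0" if "x + \<delta> < y" "y \<le> 1 - \<delta>"
      proof -
        have "(1 + x / \<delta>) - y / \<delta> = (x + \<delta> - y) / \<delta>" "(1 - 1 / \<delta>) + y / \<delta> = (y - (1 - \<delta>)) / \<delta>"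
          using \<delta> by (simp_all add: field_simps)
        moreover have "(x + \<delta> - y) / \<delta> \<le> 0" "(y - (1 - \<delta>)) / \<delta> \<le> 0"
          using that \<delta> by (auto intro!: divide_nonpos_pos)
        ultimately show ?thesis by (simp add: G_def min_le_iff_disj)
      qed
      then show "G (frac y) \<le> indicator {0<..x + \<delta>} y + indicator {1 - \<delta><..1} y"
        using y G1(2)[of y] G0 fr[OF y] \<delta> by (auto simp: indicator_def)
    qed
  qed
  have lower: "\<exists>\<phi> :: real \<Rightarrow> real. continuous_on UNIV \<phi> \<and> periodic1 \<phi> \<and> (\<forall>y. \<bar>\<phi> y\<bar> \<le> 1) \<and>
      (\<forall>y\<in>{0<..1}. indicator {\<delta><..x - \<delta>} y \<le> \<phi> y) \<and> (\<forall>y\<in>{0<..1}. \<phi> y \<le> indicator {0<..x} y + indicator {1<..1} y)"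
    if \<delta>: "0 < \<delta>" "2 * \<delta> \<le> x" for \<delta>
  proof -
    define G where "G s = max 0 (min 1 (min (0 + s / \<delta>) (x / \<delta> - s / \<delta>)))" for s
    have L: "\<bar>G s - G t\<bar> \<le> 1 / \<delta> * \<bar>s - t\<bar>" for s t
      unfolding G_def by (intro max_diff_le min_diff_le lin lin' \<delta>) (use \<delta> in auto)
    have G0: "G 0 = 0" "G 1 = 0" using \<delta> x by (auto simp: G_def max_def min_def field_simps)
    have G1: "0 \<le> G s" "G s \<le> 1" for s using \<delta> by (auto simp: G_def)
    show ?thesis
    proof (intro exI[of _ "\<lambda>y. G (frac y)"] conjI allI ballI per frac_continuous[OF L])
      show "G 0 = G 1" by (simp add: G0)
      show "\<bar>G (frac y)\<bar> \<le> 1" for y using G1[of "frac y"] by simp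
      fix y :: real assume y: "y \<in> {0<..1}"
      have "\<delta> \<le> y \<Longrightarrow> y \<le> x - \<delta> \<Longrightarrow> 1 \<le> G y" using \<delta> by (auto simp: G_def le_max_iff_disj field_simps)
      then show "indicator {\<delta><..x - \<delta>} y \<le> G (frac y)" using y G1(1)[of "frac y"] fr[OF y] x \<delta> by (auto simp: indicator_def)
      have "x < y \<Longrightarrow> G y \<le> 0" using \<delta> by (auto simp: G_def min_le_iff_disj field_simps)
      then show "G (frac y) \<le> indicator {0<..x} y + indicator {1<..1} y"
        using y G1(2)[of y] G0 fr[OF y] \<delta> by (auto simp: indicator_def)
    qed
  qed
  have lim: "(\<lambda>n. LINT y:{0<..1}|interval_measure (Wn n). \<phi> y) \<longlonglongrightarrow> (LINT y:{0<..1}|interval_measure W. \<phi> y)"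
    if "continuous_on UNIV \<phi>" "periodic1 \<phi>" for \<phi> :: "real \<Rightarrow> real" using vague[unfolded vaguely_tendsto_def, rule_format, OF conjI[OF that]] .
  have m: "\<phi> \<in> borel_measurable borel" if "continuous_on UNIV \<phi>" for \<phi> :: "real \<Rightarrow> real"
    using that by (rule borel_measurable_continuous_onI)
  have tid: "((\<lambda>\<delta>. \<delta>) \<longlongrightarrow> 0) (at_right (0 :: real))" by (rule tendsto_ident_at)
  have W00: "W 0 = 0" by (rule W_0)
  show ?thesis
  proof (rule order_tendstoI)
    fix a assume a: "a < W x"
    have "((\<lambda>\<delta>. W (x - \<delta>) - W \<delta>) \<longlongrightarrow> W x - W 0) (at_right 0)"
      by (intro tendsto_diff isCont_tendsto_compose[OF cx] isCont_tendsto_compose[OF c0] tid)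
        (use tendsto_diff[OF tendsto_const[of x] tid] in simp)
    then have "eventually (\<lambda>\<delta>. a < W (x - \<delta>) - W \<delta>) (at_right 0)" by (rule order_tendstoD) (use a W00 in simp)
    moreover have "eventually (\<lambda>\<delta>. 0 < \<delta> \<and> \<delta> < x / 2) (at_right (0 :: real))"
      using eventually_at_right_real[of 0 "x / 2"] x by (auto elim!: eventually_mono)
    ultimately have "eventually (\<lambda>\<delta>. a < W (x - \<delta>) - W \<delta> \<and> 0 < \<delta> \<and> \<delta> < x / 2) (at_right 0)" by (rule eventually_conj)
    then obtain \<delta> where \<delta>: "a < W (x - \<delta>) - W \<delta>" "0 < \<delta>" "\<delta> < x / 2"
      using eventually_happens trivial_limit_at_right_real by blast
    have "2 * \<delta> \<le> x" using \<delta> by simp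
    with lower[OF \<delta>(2)] obtain \<phi> :: "real \<Rightarrow> real" where \<phi>: "continuous_on UNIV \<phi>" "periodic1 \<phi>" "\<And>y. \<bar>\<phi> y\<bar> \<le> 1"
      "\<And>y. y \<in> {0<..1} \<Longrightarrow> indicator {\<delta><..x - \<delta>} y \<le> \<phi> y"
      "\<And>y. y \<in> {0<..1} \<Longrightarrow> \<phi> y \<le> indicator {0<..x} y + indicator {1<..1} y" by blast
    have "W (x - \<delta>) - W \<delta> \<le> (LINT y:{0<..1}|interval_measure W. \<phi> y)"
      by (rule LINT_Ioc_ge[OF m[OF \<phi>(1)] \<phi>(3) _ _ _ \<phi>(4)]) (use \<delta> x in auto)
    then have "a < (LINT y:{0<..1}|interval_measure W. \<phi> y)" using \<delta>(1) by linarith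
    from order_tendstoD(1)[OF lim[OF \<phi>(1,2)] this]
    show "eventually (\<lambda>n. a < Wn n x) sequentially"
    proof eventually_elim
      case (elim n)
      have "(LINT y:{0<..1}|interval_measure (Wn n). \<phi> y) \<le> Wn n x + (1 - Wn n 1)"
        by (rule driver.LINT_Ioc_le[OF dn m[OF \<phi>(1)] \<phi>(3) _ _ _ _ \<phi>(5)]) (use x in auto)
      then show ?case using elim driver.W_1[OF dn, of n] by linarith
    qed
  next
    fix a assume a: "W x < a"
    have "((\<lambda>\<delta>. W (x + \<delta>) + (0 - W (0 - \<delta>))) \<longlongrightarrow> W x + (0 - W 0)) (at_right 0)"
      by (intro tendsto_add tendsto_diff tendsto_const isCont_tendsto_compose[OF cx] isCont_tendsto_compose[OF c0])
        (use tendsto_add[OF tendsto_const[of x] tid] tendsto_diff[OF tendsto_const[of 0] tid] in simp_all)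
    then have "eventually (\<lambda>\<delta>. W (x + \<delta>) + (0 - W (0 - \<delta>)) < a) (at_right 0)" by (rule order_tendstoD) (use a W00 in simp)
    moreover have "eventually (\<lambda>\<delta>. 0 < \<delta> \<and> \<delta> < min x (1 - x)) (at_right (0 :: real))"
      using eventually_at_right_real[of 0 "min x (1 - x)"] x by (auto elim!: eventually_mono)
    ultimately have "eventually (\<lambda>\<delta>. W (x + \<delta>) + (0 - W (0 - \<delta>)) < a \<and> 0 < \<delta> \<and> \<delta> < min x (1 - x)) (at_right 0)"
      by (rule eventually_conj)
    then obtain \<delta> where \<delta>: "W (x + \<delta>) + (0 - W (0 - \<delta>)) < a" "0 < \<delta>" "\<delta> < min x (1 - x)"
      using eventually_happens trivial_limit_at_right_real by blast
    have \<delta>': "x + \<delta> \<le> 1" "\<delta> \<le> x" using \<delta> by simp_all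
    from upper[OF \<delta>(2) \<delta>'] obtain \<phi> :: "real \<Rightarrow> real" where \<phi>: "continuous_on UNIV \<phi>" "periodic1 \<phi>" "\<And>y. \<bar>\<phi> y\<bar> \<le> 1"
      "\<And>y. y \<in> {0<..1} \<Longrightarrow> indicator {0<..x} y \<le> \<phi> y"
      "\<And>y. y \<in> {0<..1} \<Longrightarrow> \<phi> y \<le> indicator {0<..x + \<delta>} y + indicator {1 - \<delta><..1} y" by blast
    have "(LINT y:{0<..1}|interval_measure W. \<phi> y) \<le> W (x + \<delta>) + (1 - W (1 - \<delta>))"
      by (rule LINT_Ioc_le[OF m[OF \<phi>(1)] \<phi>(3) _ _ _ _ \<phi>(5)]) (use \<delta> \<delta>' x in auto)
    moreover have "W (1 - \<delta>) = W (0 - \<delta>) + 1" using W_shift[of "- \<delta>"] by (simp add: add.commute)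
    ultimately have "(LINT y:{0<..1}|interval_measure W. \<phi> y) < a" using \<delta>(1) by linarith
    from order_tendstoD(2)[OF lim[OF \<phi>(1,2)] this]
    show "eventually (\<lambda>n. Wn n x < a) sequentially"
    proof eventually_elim
      case (elim n)
      have "Wn n x - Wn n 0 \<le> (LINT y:{0<..1}|interval_measure (Wn n). \<phi> y)"
        by (rule driver.LINT_Ioc_ge[OF dn m[OF \<phi>(1)] \<phi>(3) _ _ _ \<phi>(4)]) (use x in auto)
      then show ?case using elim driver.W_0[OF dn, of n] by linarith
    qed
  qed
qed

lemma vague_AE:
  assumes Wn: "\<And>n. Wn n \<in> class_W" and W: "W \<in> class_W" and vague: "vaguely_tendsto Wn W"
    and atom: "\<And>x. \<not> isCont W 0 \<Longrightarrow> isCont W x \<Longrightarrow> (\<lambda>n. Wn n x) \<longlonglongrightarrow> W x"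
  shows "AE x in UI. (\<lambda>n. Wn n x) \<longlonglongrightarrow> W x"
proof -
  interpret driver W by (rule class_W_driver[OF W])
  show ?thesis using AE_isCont_W AE_UI_neq[of 0] AE_UI_neq[of 1] AE_space[of UI]
  proof eventually_elim
    case (elim x)
    then have "0 < x" "x < 1" by auto
    then show ?case using vague_pointwise[OF Wn W vague _ _ _ elim(1)] atom[OF _ elim(1)] by blast
  qed
qed

section \<open>Hoelder norms by interpolation\<close>

lemma holder_norm_bounds:
  assumes A: "\<And>t. 0 \<le> t \<Longrightarrow> \<bar>u t\<bar> \<le> A" and B: "\<And>s t. 0 \<le> s \<Longrightarrow> 0 \<le> t \<Longrightarrow> \<bar>u s - u t\<bar> \<le> B * \<bar>s - t\<bar> powr \<alpha>"
  shows "0 \<le> holder_norm \<alpha> u" "holder_norm \<alpha> u \<le> A + B"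
proof -
  let ?P = "{(s, t). 0 \<le> s \<and> 0 \<le> t \<and> s \<noteq> t} :: (real \<times> real) set"
  let ?q = "\<lambda>p. \<bar>u (fst p) - u (snd p)\<bar> / \<bar>fst p - snd p\<bar> powr \<alpha>"
  have q: "?q p \<le> B" if p: "p \<in> ?P" for p
  proof -
    have "\<bar>fst p - snd p\<bar> powr \<alpha> > 0" using p by auto
    then show ?thesis using B[of "fst p" "snd p"] p by (simp add: pos_divide_le_eq split: prod.splits)
  qed
  have ne: "\<exists>a b. (0 :: real) \<le> a \<and> (0 :: real) \<le> b \<and> a \<noteq> b" "\<exists>a b. (0 :: real) \<le> b \<and> (0 :: real) \<le> a \<and> a \<noteq> b"
    by (rule exI[of _ 0], rule exI[of _ 1], simp)+
  have "\<bar>u 0\<bar> \<le> (SUP t\<in>{0..}. \<bar>u t\<bar>)" by (rule cSUP_upper) (use A in \<open>auto intro!: bdd_aboveI\<close>)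
  moreover have "?q (0, 1) \<le> (SUP p\<in>?P. ?q p)" by (rule cSUP_upper) (use q in \<open>auto intro!: bdd_aboveI2\<close>)
  moreover have "0 \<le> ?q (0, 1)" by simp
  ultimately show "0 \<le> holder_norm \<alpha> u" unfolding holder_norm_def by linarith
  have "(SUP t\<in>{0..}. \<bar>u t\<bar>) \<le> A" by (rule cSUP_least) (use A in auto)
  moreover have "(SUP p\<in>?P. ?q p) \<le> B" by (rule cSUP_least) (use q ne in auto)
  ultimately show "holder_norm \<alpha> u \<le> A + B" unfolding holder_norm_def by linarith
qed

text \<open>
  The Hoelder constant of exponent \<open>1/2 - \<epsilon>\<close> that interpolation produces from a sup bound \<open>\<eta>\<close> and a
  \<open>1/2\<close>-Hoelder bound with squared constant \<open>D\<close>; it tends to 0 with \<open>\<eta>\<close>.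
\<close>

definition holder_const :: "real \<Rightarrow> real \<Rightarrow> real \<Rightarrow> real" where
  "holder_const \<epsilon> D \<eta> = (2 * \<eta>) powr (2 * \<epsilon>) * sqrt D powr (1 - 2 * \<epsilon>)"

lemma holder_const_nonneg: "0 \<le> holder_const \<epsilon> D \<eta>" by (simp add: holder_const_def)

text \<open>
  Write the increment \<open>a\<close> as \<open>a powr (2 \<epsilon>) * a powr (1 - 2 \<epsilon>)\<close>, and bound the first factor by the sup norm
  and the second by the Hoelder estimate.
\<close>

lemma holder_interpolation:
  assumes \<epsilon>: "0 < \<epsilon>" "\<epsilon> < 1 / 2" and D: "0 \<le> D"
    and b: "\<bar>u s\<bar> \<le> \<eta>" "\<bar>u t\<bar> \<le> \<eta>" and h: "(u s - u t :: real)\<^sup>2 \<le> D * \<bar>s - t\<bar>"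
  shows "\<bar>u s - u t\<bar> \<le> holder_const \<epsilon> D \<eta> * \<bar>s - t\<bar> powr (1 / 2 - \<epsilon>)"
proof (cases "u s = u t")
  case True
  then show ?thesis by (simp add: holder_const_nonneg)
next
  case False
  define a where "a = \<bar>u s - u t\<bar>"
  have a: "0 < a" "a \<le> 2 * \<eta>" using False b by (auto simp: a_def)
  have "a\<^sup>2 \<le> D * \<bar>s - t\<bar>" using h by (simp add: a_def)
  then have as: "a \<le> sqrt D * sqrt \<bar>s - t\<bar>" using real_le_rsqrt by (simp add: real_sqrt_mult[symmetric])
  have "a = a powr (2 * \<epsilon> + (1 - 2 * \<epsilon>))" using a by simp
  also have "\<dots> = a powr (2 * \<epsilon>) * a powr (1 - 2 * \<epsilon>)" by (rule powr_add)
  also have "\<dots> \<le> (2 * \<eta>) powr (2 * \<epsilon>) * (sqrt D * sqrt \<bar>s - t\<bar>) powr (1 - 2 * \<epsilon>)"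
    by (intro mult_mono powr_mono2) (use a as \<epsilon> in auto)
  also have "\<dots> = holder_const \<epsilon> D \<eta> * (sqrt \<bar>s - t\<bar>) powr (1 - 2 * \<epsilon>)"
    using D by (simp add: holder_const_def powr_mult)
  also have "(sqrt \<bar>s - t\<bar>) powr (1 - 2 * \<epsilon>) = \<bar>s - t\<bar> powr (1 / 2 - \<epsilon>)"
    by (simp add: powr_half_sqrt[symmetric] powr_powr right_diff_distrib)
  finally show ?thesis by (simp add: a_def)
qed

lemma holder_const_tendsto:
  assumes \<epsilon>: "0 < \<epsilon>" and g: "(g \<longlongrightarrow> 0) F" "\<And>y. 0 \<le> g y"
  shows "((\<lambda>y. g y + holder_const \<epsilon> D (g y)) \<longlongrightarrow> 0) F"
proof -
  have "((\<lambda>y. (2 * g y) powr (2 * \<epsilon>)) \<longlongrightarrow> 0 powr (2 * \<epsilon>)) F"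
  proof (rule tendsto_powr')
    show "((\<lambda>y. 2 * g y) \<longlongrightarrow> 0) F" using tendsto_mult[OF tendsto_const[of 2] g(1)] by simp
  qed (use \<epsilon> g(2) in auto)
  then have "((\<lambda>y. (2 * g y) powr (2 * \<epsilon>) * sqrt D powr (1 - 2 * \<epsilon>)) \<longlongrightarrow> 0 * sqrt D powr (1 - 2 * \<epsilon>)) F"
    by (intro tendsto_mult tendsto_const) simp
  from tendsto_add[OF g(1) this] show ?thesis by (simp add: holder_const_def)
qed

lemma square_diff_le:
  fixes a b :: real assumes "a\<^sup>2 \<le> d" "b\<^sup>2 \<le> d" shows "(a - b)\<^sup>2 \<le> 4 * d"
proof -
  have "(a - b)\<^sup>2 + (a + b)\<^sup>2 = 2 * a\<^sup>2 + 2 * b\<^sup>2" by (simp add: power2_eq_square algebra_simps)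
  moreover have "0 \<le> (a + b)\<^sup>2" by simp
  ultimately show ?thesis using assms by linarith
qed

lemma parabolic_bounds_time_diff:
  assumes p: "parabolic_bounds K m v" and q: "parabolic_bounds K m' v'" and t: "0 \<le> s" "0 \<le> t"
  shows "((v s y - v' s x) - (v t y - v' t x))\<^sup>2 \<le> (1152 * K\<^sup>2) * \<bar>s - t\<bar>"
proof -
  have "((v s y - v t y) - (v' s x - v' t x))\<^sup>2 \<le> 4 * (288 * K\<^sup>2 * \<bar>s - t\<bar>)"
    by (rule square_diff_le) (use p q t in \<open>simp_all add: parabolic_bounds_def\<close>)
  then show ?thesis by (simp add: algebra_simps)
qed

lemma parabolic_bounds_C_holder:
  assumes p: "parabolic_bounds K m v" and K: "0 \<le> K" and \<epsilon>: "0 < \<epsilon>" "\<epsilon> < 1 / 2"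
  shows "v \<in> C_holder (1 / 2 - \<epsilon>)"
  unfolding C_holder_def mem_Collect_eq
proof (intro conjI allI impI)
  show "periodic1 (v t)" if "0 \<le> t" for t using p that by (simp add: parabolic_bounds_def)
  let ?A = "\<bar>m\<bar> + 24 * K"
  have bnd: "\<bar>v t x\<bar> \<le> ?A" if "0 \<le> t" for t x
  proof -
    have "\<bar>v t x - m\<bar> \<le> 24 * K" using p that by (simp add: parabolic_bounds_def)
    then show ?thesis by linarith
  qed
  show "(\<lambda>t. v t x) \<in> holder_space (1 / 2 - \<epsilon>)" for x
  proof -
    let ?B = "holder_const \<epsilon> (288 * K\<^sup>2) ?A"
    have "\<bar>v s x - v t x\<bar> \<le> ?B * \<bar>s - t\<bar> powr (1 / 2 - \<epsilon>)" if "0 \<le> s" "0 \<le> t" for s t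
      by (rule holder_interpolation[where u="\<lambda>t. v t x", OF \<epsilon>])
        (use p that bnd[OF that(1)] bnd[OF that(2)] in \<open>simp_all add: parabolic_bounds_def\<close>)
    moreover have "?B * \<bar>s - t\<bar> powr (1 / 2 - \<epsilon>) \<le> (?A + ?B) * \<bar>s - t\<bar> powr (1 / 2 - \<epsilon>)" for s t
      by (intro mult_right_mono) (use K in auto)
    moreover have "?A \<le> ?A + ?B" by (simp add: holder_const_nonneg)
    ultimately show ?thesis unfolding holder_space_def mem_Collect_eq using bnd
      by (intro exI[of _ "?A + ?B"] conjI allI impI) (meson order_trans)+
  qed
  fix x
  let ?g = "\<lambda>y. 24 * K * \<bar>y - x\<bar>"
  have g: "(?g \<longlongrightarrow> 0) (at x)"
  proof -
    have "isCont ?g x" by (intro continuous_intros)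
    then show ?thesis by (simp add: isCont_def)
  qed
  have u: "0 \<le> holder_norm (1 / 2 - \<epsilon>) (\<lambda>t. v t y - v t x)"
    "holder_norm (1 / 2 - \<epsilon>) (\<lambda>t. v t y - v t x) \<le> ?g y + holder_const \<epsilon> (1152 * K\<^sup>2) (?g y)" for y
  proof -
    have d: "\<bar>v t y - v t x\<bar> \<le> ?g y" if "0 \<le> t" for t using p that by (simp add: parabolic_bounds_def)
    have i: "\<bar>(v s y - v s x) - (v t y - v t x)\<bar> \<le> holder_const \<epsilon> (1152 * K\<^sup>2) (?g y) * \<bar>s - t\<bar> powr (1 / 2 - \<epsilon>)"
      if "0 \<le> s" "0 \<le> t" for s t
      by (rule holder_interpolation[where u="\<lambda>t. v t y - v t x", OF \<epsilon> _ d d parabolic_bounds_time_diff[OF p p]])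
        (use that in simp_all)
    show "0 \<le> holder_norm (1 / 2 - \<epsilon>) (\<lambda>t. v t y - v t x)"
      "holder_norm (1 / 2 - \<epsilon>) (\<lambda>t. v t y - v t x) \<le> ?g y + holder_const \<epsilon> (1152 * K\<^sup>2) (?g y)"
      by (rule holder_norm_bounds[OF d i]; assumption)+
  qed
  show "((\<lambda>y. holder_norm (1 / 2 - \<epsilon>) (\<lambda>t. v t y - v t x)) \<longlongrightarrow> 0) (at x)"
    by (rule tendsto_sandwich[OF always_eventually always_eventually tendsto_const holder_const_tendsto[OF \<epsilon>(1) g]])
      (use u K in auto)
qed

lemma C_holder_norm_tendsto:
  assumes p: "\<And>n. parabolic_bounds K (m n) (vn n)" and q: "parabolic_bounds K m' v" and \<epsilon>: "0 < \<epsilon>" "\<epsilon> < 1 / 2"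
    and unif: "\<And>e. 0 < e \<Longrightarrow> eventually (\<lambda>n. \<forall>t\<ge>0. \<forall>x. \<bar>vn n t x - v t x\<bar> \<le> e) sequentially"
  shows "(\<lambda>n. C_holder_norm (1 / 2 - \<epsilon>) (\<lambda>t x. vn n t x - v t x)) \<longlonglongrightarrow> 0"
proof (rule LIMSEQ_I)
  fix r :: real assume r: "0 < r"
  have "((\<lambda>e. \<bar>e\<bar> + holder_const \<epsilon> (1152 * K\<^sup>2) \<bar>e\<bar>) \<longlongrightarrow> 0) (at_right 0)"
    by (rule holder_const_tendsto[OF \<epsilon>(1)]) (auto intro!: tendsto_rabs_zero tendsto_ident_at)
  then have "eventually (\<lambda>e. \<bar>e\<bar> + holder_const \<epsilon> (1152 * K\<^sup>2) \<bar>e\<bar> < r) (at_right 0)"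
    by (rule order_tendstoD(2)) (rule r)
  moreover have "eventually (\<lambda>e. 0 < e) (at_right (0 :: real))" by (rule eventually_at_right_less)
  ultimately have "eventually (\<lambda>e. \<bar>e\<bar> + holder_const \<epsilon> (1152 * K\<^sup>2) \<bar>e\<bar> < r \<and> 0 < e) (at_right 0)"
    by (rule eventually_conj)
  then obtain e where "\<bar>e\<bar> + holder_const \<epsilon> (1152 * K\<^sup>2) \<bar>e\<bar> < r" "0 < e"
    using eventually_happens trivial_limit_at_right_real by blast
  then have e: "0 < e" "e + holder_const \<epsilon> (1152 * K\<^sup>2) e < r" by simp_all
  from unif[OF e(1)] obtain N where N: "\<And>n t x. n \<ge> N \<Longrightarrow> 0 \<le> t \<Longrightarrow> \<bar>vn n t x - v t x\<bar> \<le> e"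
    unfolding eventually_sequentially by blast
  have "norm (C_holder_norm (1 / 2 - \<epsilon>) (\<lambda>t x. vn n t x - v t x) - 0) < r" if n: "n \<ge> N" for n
  proof -
    let ?h = "\<lambda>x. holder_norm (1 / 2 - \<epsilon>) (\<lambda>t. vn n t x - v t x)"
    have u: "0 \<le> ?h x" "?h x \<le> e + holder_const \<epsilon> (1152 * K\<^sup>2) e" for x
    proof -
      note d = N[OF n]
      have i: "\<bar>(vn n s x - v s x) - (vn n t x - v t x)\<bar> \<le> holder_const \<epsilon> (1152 * K\<^sup>2) e * \<bar>s - t\<bar> powr (1 / 2 - \<epsilon>)"
        if "0 \<le> s" "0 \<le> t" for s t
        by (rule holder_interpolation[where u="\<lambda>t. vn n t x - v t x", OF \<epsilon> _ d d parabolic_bounds_time_diff[OF p q]])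
          (use that in simp_all)
      show "0 \<le> ?h x" "?h x \<le> e + holder_const \<epsilon> (1152 * K\<^sup>2) e"
        by (rule holder_norm_bounds[OF d i]; assumption)+
    qed
    have "?h 0 \<le> (SUP x. ?h x)" by (rule cSUP_upper) (use u(2) in \<open>auto intro!: bdd_aboveI2\<close>)
    moreover have "(SUP x. ?h x) \<le> e + holder_const \<epsilon> (1152 * K\<^sup>2) e" by (rule cSUP_least) (use u in auto)
    ultimately show ?thesis using u(1)[of 0] e unfolding C_holder_norm_def real_norm_def by linarith
  qed
  then show "\<exists>N. \<forall>n\<ge>N. norm (C_holder_norm (1 / 2 - \<epsilon>) (\<lambda>t x. vn n t x - v t x) - 0) < r" by blast
qed

lemma parabolic_bounds_mono:
  assumes p: "parabolic_bounds K m v" and K: "0 \<le> K" "K \<le> C"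
  shows "parabolic_bounds C m v"
proof -
  have s: "K\<^sup>2 \<le> C\<^sup>2" using K by (intro power_mono)
  have 1: "24 * K * r \<le> 24 * C * r" if "0 \<le> r" for r using that K by (intro mult_right_mono) auto
  have 2: "288 * K\<^sup>2 * r \<le> 288 * C\<^sup>2 * r" if "0 \<le> r" for r using that s by (intro mult_right_mono) auto
  have 3: "288 * K\<^sup>2 / sqrt (1 + 2 * t) \<le> 288 * C\<^sup>2 / sqrt (1 + 2 * t)" if "0 \<le> t" for t
    using that s by (intro divide_right_mono) auto
  have 4: "24 * K \<le> 24 * C" using K by simp
  show ?thesis using p unfolding parabolic_bounds_def
    by (intro conjI allI impI) (meson order_trans 1 2 3 4 abs_ge_zero)+
qed

text \<open>
  After a time depending only on \<open>K\<close> and \<open>e\<close>, both functions are within \<open>e / 3\<close> of their means, and the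
  means converge; before that time the convergence on the horizon applies.
\<close>

lemma parabolic_bounds_large_time:
  assumes p: "\<And>n. parabolic_bounds K (m n) (vn n)" and q: "parabolic_bounds K m' v" and m: "m \<longlonglongrightarrow> m'"
    and horizon: "\<And>T e. 0 < T \<Longrightarrow> 0 < e \<Longrightarrow> eventually (\<lambda>n. \<forall>t\<in>{0..T}. \<forall>x. \<bar>vn n t x - v t x\<bar> \<le> e) sequentially"
    and e: "0 < e"
  shows "eventually (\<lambda>n. \<forall>t\<ge>0. \<forall>x. \<bar>vn n t x - v t x\<bar> \<le> e) sequentially"
proof -
  \<comment> \<open>from time \<open>A\<^sup>2\<close> on, the decay bound \<open>288 K\<^sup>2 / sqrt (1 + 2 t)\<close> is at most \<open>(e / 3)\<^sup>2\<close>\<close>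
  define A where "A = 288 * K\<^sup>2 / (e / 3)\<^sup>2"
  have A: "0 \<le> A" by (simp add: A_def)
  define T where "T = A\<^sup>2 + 1"
  have T: "0 < T" by (simp add: T_def add_nonneg_pos)
  have far: "\<bar>w t x - k\<bar> \<le> e / 3" if w: "parabolic_bounds K k w" and t: "T \<le> t" for w k t x
  proof -
    have t0: "0 \<le> t" using t T by simp
    have "A \<le> sqrt (1 + 2 * t)" by (rule real_le_rsqrt) (use t t0 in \<open>simp add: T_def\<close>)
    then have "A * (e / 3)\<^sup>2 \<le> sqrt (1 + 2 * t) * (e / 3)\<^sup>2" by (intro mult_right_mono) auto
    moreover have "A * (e / 3)\<^sup>2 = 288 * K\<^sup>2" using e by (simp add: A_def)
    ultimately have "288 * K\<^sup>2 / sqrt (1 + 2 * t) \<le> (e / 3)\<^sup>2" using t0 by (simp add: pos_divide_le_eq mult.commute)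
    moreover have "(w t x - k)\<^sup>2 \<le> 288 * K\<^sup>2 / sqrt (1 + 2 * t)" using w t0 by (simp add: parabolic_bounds_def)
    ultimately have "(w t x - k)\<^sup>2 \<le> (e / 3)\<^sup>2" by linarith
    then show ?thesis using e abs_le_square_iff[of "w t x - k" "e / 3"] by simp
  qed
  have "eventually (\<lambda>n. \<bar>m n - m'\<bar> < e / 3) sequentially"
    using tendstoD[OF m, of "e / 3"] e by (simp add: dist_real_def)
  then show ?thesis using horizon[OF T e]
  proof eventually_elim
    case (elim n)
    show ?case
    proof (intro allI impI)
      fix t x :: real assume t: "0 \<le> t"
      show "\<bar>vn n t x - v t x\<bar> \<le> e"
      proof (cases "t \<le> T")
        case True then show ?thesis using elim(2) t by simp
      next
        case False
        then have "T \<le> t" by simp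
        from far[OF p[of n] this, of x] far[OF q this, of x] elim(1) show ?thesis by linarith
      qed
    qed
  qed
qed

section \<open>Convergence\<close>

lemma unit_representative:
  assumes "periodic1 p" shows "p x = p (frac x)"
  using periodic1_int[OF assms, of "frac x" "\<lfloor>x\<rfloor>"] by (simp add: frac_def)

text \<open>
  Arzela-Ascoli on \<open>[0,T0] \<times> [0,1]\<close>, continued periodically in space.
\<close>

lemma parabolic_bounds_subsequence:
  assumes p: "\<And>n. parabolic_bounds C (mn n) (vn n)" and C: "0 \<le> C" and M: "\<And>n. \<bar>mn n\<bar> \<le> M" and T0: "0 < T0"
  obtains u k where "strict_mono (k :: nat \<Rightarrow> nat)" "continuous_on ({0..T0} \<times> UNIV) (\<lambda>p. u (fst p) (snd p))"
    "\<And>t. periodic1 (u t)"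
    "\<And>e. 0 < e \<Longrightarrow> eventually (\<lambda>j. \<forall>t\<in>{0..T0}. \<forall>x. \<bar>vn (k j) t x - u t x\<bar> < e) sequentially"
proof -
  let ?S = "{0..T0} \<times> {0..1} :: (real \<times> real) set"
  have S: "compact ?S" by (intro compact_Times compact_Icc)
  have bd: "norm (vn n (fst p) (snd p)) \<le> M + 24 * C" if "p \<in> ?S" for n p
  proof -
    have "\<bar>vn n (fst p) (snd p) - mn n\<bar> \<le> 24 * C" using assms(1)[of n] that by (auto simp: parabolic_bounds_def)
    then show ?thesis using M[of n] by simp
  qed
  have eq: "\<exists>d. 0 < d \<and> (\<forall>n y. y \<in> ?S \<and> norm (x - y) < d \<longrightarrow> norm (vn n (fst x) (snd x) - vn n (fst y) (snd y)) < e)"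
    if x: "x \<in> ?S" and e: "0 < e" for x e
  proof -
    define G where "G = (\<lambda>y :: real \<times> real. 24 * C * \<bar>snd x - snd y\<bar> + sqrt (288 * C\<^sup>2 * \<bar>fst x - fst y\<bar>))"
    have "isCont G x" unfolding G_def by (intro continuous_intros)
    then obtain d where d: "0 < d" "\<And>y. dist y x < d \<Longrightarrow> dist (G y) (G x) < e"
      unfolding continuous_at_eps_delta using e by blast
    have "norm (vn n (fst x) (snd x) - vn n (fst y) (snd y)) < e" if y: "y \<in> ?S" "norm (x - y) < d" for n y
    proof -
      have "norm (vn n (fst x) (snd x) - vn n (fst y) (snd y)) \<le> G y" unfolding G_def real_norm_def
        by (rule parabolic_bounds_diff[OF p]) (use x y in auto)
      moreover have "G x = 0" by (simp add: G_def)
      moreover have "dist (G y) (G x) < e" by (rule d(2)) (use y(2) in \<open>simp add: dist_norm norm_minus_commute\<close>)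
      ultimately show ?thesis by (simp add: dist_real_def)
    qed
    then show ?thesis using d(1) by blast
  qed
  obtain g k where gk: "continuous_on ?S g" "strict_mono (k :: nat \<Rightarrow> nat)"
    "\<And>e. 0 < e \<Longrightarrow> \<exists>N. \<forall>n x. n \<ge> N \<and> x \<in> ?S \<longrightarrow> norm (vn (k n) (fst x) (snd x) - g x) < e"
    using Arzela_Ascoli[where \<F>="\<lambda>n p. vn n (fst p) (snd p)", OF S bd eq] by auto
  define u where "u t x = g (t, frac x)" for t x
  have per: "periodic1 (u t)" for t by (simp add: periodic1_def u_def frac_1_eq)
  have fr: "frac x \<in> {0..1}" for x :: real using frac_lt_1[of x] by (auto intro: less_imp_le)
  have lim: "eventually (\<lambda>j. \<forall>t\<in>{0..T0}. \<forall>x. \<bar>vn (k j) t x - u t x\<bar> < e) sequentially" if e: "0 < e" for e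
  proof -
    obtain N where N: "\<And>n x. n \<ge> N \<Longrightarrow> x \<in> ?S \<Longrightarrow> norm (vn (k n) (fst x) (snd x) - g x) < e"
      using gk(3)[OF e] by blast
    have "\<bar>vn (k n) t x - u t x\<bar> < e" if n: "n \<ge> N" and t: "t \<in> {0..T0}" for n t x
    proof -
      have "periodic1 (vn (k n) t)" using p[of "k n"] t by (simp add: parabolic_bounds_def)
      from unit_representative[OF this, of x] N[OF n, of "(t, frac x)"] t fr[of x] show ?thesis by (simp add: u_def)
    qed
    then show ?thesis unfolding eventually_sequentially by blast
  qed
  have cont: "continuous_on ({0..T0} \<times> UNIV) (\<lambda>p. u (fst p) (snd p))"
  proof (rule uniform_limit_theorem)
    show "\<forall>\<^sub>F n in sequentially. continuous_on ({0..T0} \<times> UNIV) (\<lambda>p. vn (k n) (fst p) (snd p))"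
      by (intro always_eventually allI continuous_on_subset[OF parabolic_bounds_continuous[OF p]]) auto
    show "uniform_limit ({0..T0} \<times> UNIV) (\<lambda>n p. vn (k n) (fst p) (snd p)) (\<lambda>p. u (fst p) (snd p)) sequentially"
    proof (rule uniform_limitI)
      fix e :: real assume "0 < e"
      from lim[OF this] show "\<forall>\<^sub>F n in sequentially. \<forall>x\<in>{0..T0} \<times> UNIV. dist (vn (k n) (fst x) (snd x)) (u (fst x) (snd x)) < e"
        by eventually_elim (auto simp: dist_real_def)
    qed
  qed simp
  show ?thesis by (rule that[of k u, OF gk(2) cont per lim])
qed

lemma LINT_tested_tendsto:
  assumes W: "W \<in> class_W" "\<And>n. Wn n \<in> class_W" and ae: "AE x in UI. (\<lambda>n. Wn n x) \<longlonglongrightarrow> W x"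
    and b: "bmeas p" "\<And>n. bmeas (pn n)" and \<phi>: "continuous_on UNIV \<phi>" "periodic1 \<phi>" and pc: "continuous_on UNIV p"
    and B: "\<And>n x. \<bar>pn n x\<bar> \<le> B"
    and unif: "\<And>e. 0 < e \<Longrightarrow> eventually (\<lambda>n. \<forall>x. \<bar>pn n x - p x\<bar> < e) sequentially"
  shows "(\<lambda>n. LINT x|UI. pn n (Wn n x) * \<phi> (Wn n x)) \<longlonglongrightarrow> (LINT x|UI. p (W x) * \<phi> (W x))"
proof -
  have bf: "bmeas \<phi>" by (rule periodic_continuous_bmeas[OF \<phi>])
  then obtain D where D: "\<And>x. \<bar>\<phi> x\<bar> \<le> D" by (auto simp: bmeas_def)
  have B0: "0 \<le> B" using B[of 0 0] by linarith
  have m: "(\<lambda>x. r (V x)) \<in> borel_measurable UI" if "V \<in> class_W" "bmeas r" for V r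
  proof -
    interpret driver V by (rule class_W_driver[OF that(1)])
    show ?thesis by (rule borel_measurable_UI[OF measurable_compose[OF W_measurable bmeas_measurable[OF that(2)]]])
  qed
  show ?thesis
  proof (rule integral_dominated_convergence[where w="\<lambda>_. B * D"])
    show "(\<lambda>x. p (W x) * \<phi> (W x)) \<in> borel_measurable UI"
      by (intro borel_measurable_times m W b bf)
    show "(\<lambda>x. pn n (Wn n x) * \<phi> (Wn n x)) \<in> borel_measurable UI" for n
      by (intro borel_measurable_times m W b bf)
    show "AE x in UI. norm (pn n (Wn n x) * \<phi> (Wn n x)) \<le> B * D" for n
      by (intro AE_I2) (simp add: abs_mult mult_mono B D B0)
    show "AE x in UI. (\<lambda>n. pn n (Wn n x) * \<phi> (Wn n x)) \<longlonglongrightarrow> p (W x) * \<phi> (W x)"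
      using ae
    proof eventually_elim
      case (elim x)
      have "isCont p (W x)" "isCont \<phi> (W x)" using pc \<phi>(1) by (simp_all add: continuous_on_eq_continuous_at)
      note c = this[THEN isCont_tendsto_compose, OF elim]
      have "(\<lambda>n. pn n (Wn n x) - p (Wn n x)) \<longlonglongrightarrow> 0"
      proof (rule tendstoI)
        fix e :: real assume "0 < e"
        from unif[OF this] show "eventually (\<lambda>n. dist (pn n (Wn n x) - p (Wn n x)) 0 < e) sequentially"
          by eventually_elim simp
      qed
      from tendsto_add[OF this c(1)] have "(\<lambda>n. pn n (Wn n x)) \<longlonglongrightarrow> p (W x)" by simp
      then show ?case by (rule tendsto_mult[OF _ c(2)])
    qed
  qed simp
qed

text \<open>
  Otherwise some subsequence stays away from \<open>v\<close>, and a further subsequence converges uniformly to some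
  \<open>u\<close>. The tested identities pass to the limit along it, since the driving functions converge almost
  everywhere and everything else converges uniformly. So \<open>u - v\<close> satisfies the homogeneous identity on
  \<open>[0,T0]\<close> and vanishes, a contradiction.
\<close>

lemma horizon_convergence:
  assumes W: "W \<in> class_W" "\<And>n. Wn n \<in> class_W" and ae: "AE x in UI. (\<lambda>n. Wn n x) \<longlonglongrightarrow> W x"
    and p: "\<And>n. parabolic_bounds C (mn n) (vn n)" and C: "0 \<le> C" and M: "\<And>n. \<bar>mn n\<bar> \<le> M"
    and ws: "\<And>n. weak_sol_a (deriv (gen_inverse (Wn n))) (fn n) (vn n)" "weak_sol_a (deriv (gen_inverse W)) f v"
    and f: "continuous_on UNIV f" "periodic1 f" and fn: "\<And>n. bmeas (fn n)" and fB: "\<And>n x. \<bar>fn n x\<bar> \<le> B"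
    and funif: "\<And>e. 0 < e \<Longrightarrow> eventually (\<lambda>n. \<forall>x. \<bar>fn n x - f x\<bar> < e) sequentially"
    and T0: "0 < T0" and e: "0 < e"
  shows "eventually (\<lambda>n. \<forall>t\<in>{0..T0}. \<forall>x. \<bar>vn n t x - v t x\<bar> \<le> e) sequentially"
proof (rule ccontr)
  assume "\<not> ?thesis"
  from not_eventually_sequentiallyD[OF this] obtain r where r: "strict_mono (r :: nat \<Rightarrow> nat)"
    and bad: "\<And>n. \<not> (\<forall>t\<in>{0..T0}. \<forall>x. \<bar>vn (r n) t x - v t x\<bar> \<le> e)" by blast
  obtain u k where k: "strict_mono (k :: nat \<Rightarrow> nat)" and uc: "continuous_on ({0..T0} \<times> UNIV) (\<lambda>p. u (fst p) (snd p))"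
    and up: "\<And>t. periodic1 (u t)"
    and lim: "\<And>e. 0 < e \<Longrightarrow> eventually (\<lambda>j. \<forall>t\<in>{0..T0}. \<forall>x. \<bar>vn (r (k j)) t x - u t x\<bar> < e) sequentially"
    by (rule parabolic_bounds_subsequence[where vn="\<lambda>n. vn (r n)" and mn="\<lambda>n. mn (r n)", OF p C M T0])
      (rule that; assumption)
  define q where "q = r \<circ> k"
  have q: "strict_mono q" unfolding q_def by (rule strict_mono_o[OF r k])
  have qlim: "filterlim q sequentially sequentially" by (rule filterlim_subseq[OF q])
  have bf: "bmeas f" by (rule periodic_continuous_bmeas[OF f])
  have vc: "continuous_on ({0..} \<times> UNIV) (\<lambda>p. v (fst p) (snd p))" and vp: "\<And>t. 0 \<le> t \<Longrightarrow> periodic1 (v t)"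
    using ws(2) unfolding weak_sol_a_def by blast+
  have vnc: "continuous_on ({0..} \<times> UNIV) (\<lambda>p. vn n (fst p) (snd p))" and vnp: "\<And>t. 0 \<le> t \<Longrightarrow> periodic1 (vn n t)" for n
    using ws(1)[of n] unfolding weak_sol_a_def by blast+
  have sub: "{0..T0} \<times> UNIV \<subseteq> {0..} \<times> (UNIV :: real set)" by auto
  note vc0 = continuous_on_subset[OF vc sub] and vnc0 = continuous_on_subset[OF vnc sub]
  have usec: "continuous_on UNIV (u t)" if "t \<in> {0..T0}" for t
  proof -
    have "continuous_on UNIV (\<lambda>x. (\<lambda>p. u (fst p) (snd p)) (t, x))"
      by (rule continuous_on_compose2[OF uc]) (use that in \<open>auto intro!: continuous_intros\<close>)
    then show ?thesis by simp
  qed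
  have bu: "bmeas (u t)" if "t \<in> {0..T0}" for t by (rule periodic_continuous_bmeas[OF usec[OF that] up])
  have aeq: "AE x in UI. (\<lambda>j. Wn (q j) x) \<longlonglongrightarrow> W x"
    using ae by eventually_elim (rule filterlim_compose[OF _ qlim])
  have limq: "eventually (\<lambda>j. \<forall>t\<in>{0..T0}. \<forall>x. \<bar>vn (q j) t x - u t x\<bar> < e) sequentially" if "0 < e" for e
    using lim[OF that] by (simp add: q_def)
  have fq: "eventually (\<lambda>j. \<forall>x. \<bar>fn (q j) x - f x\<bar> < e) sequentially" if "0 < e" for e
    using eventually_compose_filterlim[OF funif[OF that] qlim] by simp
  have test: "(LINT x|UI. u T (W x) * \<phi> (W x)) - (LINT x|UI. f (W x) * \<phi> (W x))
      = (LINT t:{0..T}|lborel. ipT (u t) (weak_deriv (weak_deriv \<phi>)))"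
    if \<phi>: "\<phi> \<in> H2T" and T: "0 < T" "T \<le> T0" for \<phi> T
  proof -
    let ?q = "weak_deriv (weak_deriv \<phi>)"
    have qi: "integrable UI ?q" using H2T_D(2)[OF \<phi>] by (auto simp: has_weak_deriv_def intro: L2T_integrable)
    have T': "0 \<le> T" "T \<in> {0..T0}" using T by simp_all
    note \<phi>c = H2T_D(4,5)[OF \<phi>]
    have vb: "\<bar>vn n T x\<bar> \<le> M + 24 * C" for n x
    proof -
      have "\<bar>vn n T x - mn n\<bar> \<le> 24 * C" using p[of n] T' by (simp add: parabolic_bounds_def)
      then show ?thesis using M[of n] by linarith
    qed
    have 1: "(\<lambda>j. LINT x|UI. vn (q j) T (Wn (q j) x) * \<phi> (Wn (q j) x)) \<longlonglongrightarrow> (LINT x|UI. u T (W x) * \<phi> (W x))"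
    proof (rule LINT_tested_tendsto[OF W aeq bu[OF T'(2)] weak_sol_a_section[OF ws(1) T'(1)] \<phi>c usec[OF T'(2)] vb])
      fix e :: real assume "0 < e"
      from limq[OF this] show "eventually (\<lambda>j. \<forall>x. \<bar>vn (q j) T x - u T x\<bar> < e) sequentially"
        by eventually_elim (use T' in blast)
    qed
    have 2: "(\<lambda>j. LINT x|UI. fn (q j) (Wn (q j) x) * \<phi> (Wn (q j) x)) \<longlonglongrightarrow> (LINT x|UI. f (W x) * \<phi> (W x))"
      by (rule LINT_tested_tendsto[OF W aeq bf fn \<phi>c f(1) fB fq])
    have 3: "(\<lambda>j. LINT t:{0..T}|lborel. ipT (vn (q j) t) ?q) \<longlonglongrightarrow> (LINT t:{0..T}|lborel. ipT (u t) ?q)"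
    proof (rule LIMSEQ_I)
      fix s :: real assume s: "0 < s"
      define L where "L = (LINT x|UI. \<bar>?q x\<bar>)"
      have L: "0 \<le> L" by (simp add: L_def)
      \<comment> \<open>the 1 keeps the denominator positive when the second derivative vanishes\<close>
      define d where "d = s / (2 * (L * T + 1))"
      have LT: "0 < L * T + 1" using L T by (simp add: add_nonneg_pos)
      then have d: "0 < d" using s by (simp add: d_def)
      have dL: "d * L * T < s"
      proof -
        have "d * (L * T + 1) = s / 2" using LT by (simp add: d_def field_simps)
        then have "d * L * T = s / 2 - d" by (simp add: algebra_simps)
        then show ?thesis using d s by linarith
      qed
      obtain N where N: "\<And>j t x. j \<ge> N \<Longrightarrow> t \<in> {0..T0} \<Longrightarrow> \<bar>vn (q j) t x - u t x\<bar> < d"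
        using limq[OF d] unfolding eventually_sequentially by blast
      have "norm ((LINT t:{0..T}|lborel. ipT (vn (q j) t) ?q) - (LINT t:{0..T}|lborel. ipT (u t) ?q)) < s" if j: "j \<ge> N" for j
      proof -
        have diff: "\<bar>ipT (vn (q j) t) ?q - ipT (u t) ?q\<bar> \<le> d * L" if t: "0 \<le> t" "t \<le> T" for t
        proof -
          have t': "t \<in> {0..T0}" using t T by simp
          note i = bmeas_mult_integrable[OF weak_sol_a_section[OF ws(1)[of "q j"] t(1)] qi] bmeas_mult_integrable[OF bu[OF t'] qi]
          have "ipT (vn (q j) t) ?q - ipT (u t) ?q = (LINT x|UI. ?q x * vn (q j) t x - ?q x * u t x)"
            unfolding ipT_UI by (subst Bochner_Integration.integral_diff[OF i]) (simp add: mult.commute)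
          then have "\<bar>ipT (vn (q j) t) ?q - ipT (u t) ?q\<bar> = \<bar>LINT x|UI. ?q x * vn (q j) t x - ?q x * u t x\<bar>" by simp
          also have "\<dots> \<le> (LINT x|UI. \<bar>?q x * vn (q j) t x - ?q x * u t x\<bar>)" by (rule integral_abs_bound)
          also have "\<dots> \<le> (LINT x|UI. d * \<bar>?q x\<bar>)"
          proof (rule integral_mono)
            show "integrable UI (\<lambda>x. \<bar>?q x * vn (q j) t x - ?q x * u t x\<bar>)"
              by (intro integrable_abs Bochner_Integration.integrable_diff i)
            show "integrable UI (\<lambda>x. d * \<bar>?q x\<bar>)" by (intro integrable_mult_right integrable_abs qi)
            fix x
            have "\<bar>?q x * vn (q j) t x - ?q x * u t x\<bar> = \<bar>?q x\<bar> * \<bar>vn (q j) t x - u t x\<bar>"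
              by (simp add: right_diff_distrib[symmetric] abs_mult)
            also have "\<dots> \<le> \<bar>?q x\<bar> * d" by (rule mult_left_mono[OF less_imp_le[OF N[OF j t']]]) simp
            finally show "\<bar>?q x * vn (q j) t x - ?q x * u t x\<bar> \<le> d * \<bar>?q x\<bar>" by (simp add: mult.commute)
          qed
          also have "\<dots> = d * L" by (simp add: L_def)
          finally show ?thesis .
        qed
        have diff': "ipT (vn (q j) t) ?q - ipT (u t) ?q \<le> d * L" "ipT (u t) ?q - ipT (vn (q j) t) ?q \<le> d * L"
          if "0 \<le> t" "t \<le> T" for t using diff[OF that] by linarith+
        note iv = ipT_time_integral(2)[OF T'(1) T(2) vnc0[of "q j"] vnp[of _ "q j"] qi]
        note iu = ipT_time_integral(2)[OF T'(1) T(2) uc up qi]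
        have "(LINT t:{0..T}|lborel. ipT (vn (q j) t) ?q - ipT (u t) ?q) \<le> (d * L) * (T - 0)"
          by (rule set_integral_le_const[OF set_integral_diff(1)[OF iv iu] T'(1) diff'(1)])
        moreover have "(LINT t:{0..T}|lborel. ipT (u t) ?q - ipT (vn (q j) t) ?q) \<le> (d * L) * (T - 0)"
          by (rule set_integral_le_const[OF set_integral_diff(1)[OF iu iv] T'(1) diff'(2)])
        moreover have "(LINT t:{0..T}|lborel. ipT (vn (q j) t) ?q - ipT (u t) ?q)
            = (LINT t:{0..T}|lborel. ipT (vn (q j) t) ?q) - (LINT t:{0..T}|lborel. ipT (u t) ?q)"
          by (rule set_integral_diff(2)[OF iv iu])
        moreover have "(LINT t:{0..T}|lborel. ipT (u t) ?q - ipT (vn (q j) t) ?q)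
            = (LINT t:{0..T}|lborel. ipT (u t) ?q) - (LINT t:{0..T}|lborel. ipT (vn (q j) t) ?q)"
          by (rule set_integral_diff(2)[OF iu iv])
        ultimately show ?thesis using dL by (simp add: abs_less_iff)
      qed
      then show "\<exists>N. \<forall>j\<ge>N. norm ((LINT t:{0..T}|lborel. ipT (vn (q j) t) ?q) - (LINT t:{0..T}|lborel. ipT (u t) ?q)) < s" by blast
    qed
    have "(\<lambda>j. LINT t:{0..T}|lborel. ipT (vn (q j) t) ?q) \<longlonglongrightarrow> (LINT x|UI. u T (W x) * \<phi> (W x)) - (LINT x|UI. f (W x) * \<phi> (W x))"
      using tendsto_diff[OF 1 2] unfolding weak_sol_a_test[OF W(2) fn ws(1) \<phi> T(1)] .
    from LIMSEQ_unique[OF this 3] show ?thesis .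
  qed
  have eq: "u t x - v t x = 0" if t: "0 \<le> t" "t \<le> T0" for t x
  proof (rule a_equation_uniqueness[where u="\<lambda>t x. u t x - v t x", OF W(1) T0 _ _ _ t])
    show "continuous_on ({0..T0} \<times> UNIV) (\<lambda>p. u (fst p) (snd p) - v (fst p) (snd p))"
      by (intro continuous_on_diff uc vc0)
    show "periodic1 (\<lambda>x. u s x - v s x)" if "0 \<le> s" for s
      using up[of s] vp[OF that] by (simp add: periodic1_def)
    fix \<phi> T assume \<phi>: "\<phi> \<in> H2T" and T: "0 < T" "T \<le> T0"
    let ?q = "weak_deriv (weak_deriv \<phi>)"
    have qi: "integrable UI ?q" using H2T_D(2)[OF \<phi>] by (auto simp: has_weak_deriv_def intro: L2T_integrable)
    have T': "0 \<le> T" "T \<in> {0..T0}" using T by simp_all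
    interpret driver W by (rule class_W_driver[OF W(1)])
    have b: "bmeas (\<lambda>x. r (W x))" if "bmeas r" for r
      using that measurable_compose[OF W_measurable bmeas_measurable[OF that]] unfolding bmeas_def by blast
    note bW = b[OF bu[OF T'(2)]] b[OF weak_sol_a_section[OF ws(2) T'(1)]] b[OF H2T_D(3)[OF \<phi>]]
    have "(LINT x|UI. (u T (W x) - v T (W x)) * \<phi> (W x)) = (LINT x|UI. u T (W x) * \<phi> (W x)) - (LINT x|UI. v T (W x) * \<phi> (W x))"
      unfolding left_diff_distrib by (intro Bochner_Integration.integral_diff sqint_mult bmeas_sqint bW)
    also have "\<dots> = (LINT t:{0..T}|lborel. ipT (u t) ?q) - (LINT t:{0..T}|lborel. ipT (v t) ?q)"
      using test[OF \<phi> T] weak_sol_a_test[OF W(1) bf ws(2) \<phi> T(1)] by linarith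
    also have "\<dots> = (LINT t:{0..T}|lborel. ipT (u t) ?q - ipT (v t) ?q)"
      by (intro set_integral_diff(2)[symmetric] ipT_time_integral(2)[OF T'(1) T(2) uc up qi] ipT_time_integral(2)[OF T'(1) T(2) vc0 vp qi])
    also have "\<dots> = (LINT t:{0..T}|lborel. ipT (\<lambda>x. u t x - v t x) ?q)"
    proof (rule set_lebesgue_integral_cong, simp, intro allI impI)
      fix s assume "s \<in> {0..T}"
      then have s: "0 \<le> s" "s \<in> {0..T0}" using T by simp_all
      show "ipT (u s) ?q - ipT (v s) ?q = ipT (\<lambda>x. u s x - v s x) ?q"
        unfolding ipT_UI left_diff_distrib
        by (rule Bochner_Integration.integral_diff[symmetric])
          (use bmeas_mult_integrable[OF bu[OF s(2)] qi] bmeas_mult_integrable[OF weak_sol_a_section[OF ws(2) s(1)] qi]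
            in \<open>simp_all add: mult.commute\<close>)
    qed
    finally show "(LINT x|UI. (u T (W x) - v T (W x)) * \<phi> (W x)) = (LINT t:{0..T}|lborel. ipT (\<lambda>x. u t x - v t x) ?q)" .
  qed
  obtain j where j: "\<And>t x. t \<in> {0..T0} \<Longrightarrow> \<bar>vn (q j) t x - u t x\<bar> < e"
    using limq[OF e] unfolding eventually_sequentially by blast
  have "\<forall>t\<in>{0..T0}. \<forall>x. \<bar>vn (r (k j)) t x - v t x\<bar> \<le> e"
  proof (intro ballI allI)
    fix t x :: real assume t: "t \<in> {0..T0}"
    have "u t x = v t x" using eq[of t x] t by simp
    then show "\<bar>vn (r (k j)) t x - v t x\<bar> \<le> e" using j[OF t, of x] by (simp add: q_def)
  qed
  with bad show False by blast
qed

text \<open>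
  The common constant for all the estimates combines the uniform bound on the images of the initial
  data with the norm for the limit problem. The means converge because they are the integrals of
  \<open>f\<^sub>n (W\<^sub>n x)\<close>, with bounded integrands that converge almost everywhere.
\<close>

theorem theorem3p6:
  fixes Wn :: "nat \<Rightarrow> real \<Rightarrow> real" and W :: "real \<Rightarrow> real"
    and hn fn :: "nat \<Rightarrow> real \<Rightarrow> real" and h f :: "real \<Rightarrow> real"
    and \<rho>n :: "nat \<Rightarrow> real \<Rightarrow> real \<Rightarrow> real" and \<rho> :: "real \<Rightarrow> real \<Rightarrow> real"
  assumes Wn_class: "\<And>n. Wn n \<in> class_W" and W_class: "W \<in> class_W"
    and hn_dom: "\<And>n. hn n \<in> dom_W (Wn n)" and h_dom: "h \<in> dom_W W"
    and fn_H2: "\<And>n. fn n \<in> H2T" and f_H2: "f \<in> H2T"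
    and hn_fn: "\<And>n y. hn n y = fn n (Wn n y)" and h_f: "\<And>y. h y = f (W y)"
    and \<rho>n_sol: "\<And>n. weak_sol_W (Wn n) (hn n) (\<rho>n n)" and \<rho>_sol: "weak_sol_W W h \<rho>"
    and vague: "vaguely_tendsto Wn W"
    and atom_at_0: "\<And>x. \<not> isCont W 0 \<Longrightarrow> isCont W x \<Longrightarrow> (\<lambda>n. Wn n x) \<longlonglongrightarrow> W x"
    and L_bounded: "\<exists>C. \<forall>n. AE x in lborel. \<bar>L_op (Wn n) (hn n) x\<bar> \<le> C"
    and fn_lim: "(\<lambda>n. H2_norm (\<lambda>x. fn n x - f x)) \<longlonglongrightarrow> 0"
  shows "\<exists>(vn :: nat \<Rightarrow> real \<Rightarrow> real \<Rightarrow> real) (v :: real \<Rightarrow> real \<Rightarrow> real).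
    (\<forall>n. unique_weak_sol_a (deriv (gen_inverse (Wn n))) (fn n) (vn n)) \<and>
    unique_weak_sol_a (deriv (gen_inverse W)) f v \<and>
    (\<forall>n. \<forall>t\<ge>0. AE x in lborel. \<rho>n n t x = vn n t (Wn n x)) \<and>
    (\<forall>t\<ge>0. AE x in lborel. \<rho> t x = v t (W x)) \<and>
    (\<forall>\<epsilon>. 0 < \<epsilon> \<and> \<epsilon> < 1/2 \<longrightarrow>
       (\<forall>n. vn n \<in> C_holder (1/2 - \<epsilon>)) \<and> v \<in> C_holder (1/2 - \<epsilon>) \<and>
       (\<lambda>n. C_holder_norm (1/2 - \<epsilon>) (\<lambda>t x. vn n t x - v t x)) \<longlonglongrightarrow> 0)"
proof -
  obtain C0 where C0: "\<And>n. AE x in lborel. \<bar>L_op (Wn n) (hn n) x\<bar> \<le> C0" using L_bounded by blast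
  define C where "C = max (max C0 0) (L2n (L_op W h))"
  have C: "0 \<le> C" by (simp add: C_def le_max_iff_disj)
  have L2n0: "0 \<le> L2n k" for k by (simp add: L2n_def)
  have "L2n (L_op (Wn n) (hn n)) \<le> max C0 0" for n
    by (rule L_op_norm_bound[OF Wn_class hn_dom max.cobounded2]) (use C0[of n] in eventually_elim, simp add: le_max_iff_disj)
  then have Kn: "L2n (L_op (Wn n) (hn n)) \<le> C" for n unfolding C_def by (rule order_trans[OF _ max.cobounded1])
  have K: "L2n (L_op W h) \<le> C" by (simp add: C_def)
  define mn where "mn n = (LINT x|UI. fn n (Wn n x))" for n
  define m where "m = (LINT x|UI. f (W x))"
  note fc = H2T_D(4,5)[OF f_H2] and fnc = H2T_D(4,5)[OF fn_H2]
  have "\<exists>v. unique_weak_sol_a (deriv (gen_inverse (Wn n))) (fn n) v \<and> (\<forall>t\<ge>0. AE x in lborel. \<rho>n n t x = v t (Wn n x)) \<and>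
      parabolic_bounds (L2n (L_op (Wn n) (hn n))) (LINT x|UI. fn n (Wn n x)) v" for n
    by (rule extraction[OF Wn_class hn_dom fnc hn_fn \<rho>n_sol])
  then obtain vn where vn: "\<And>n. unique_weak_sol_a (deriv (gen_inverse (Wn n))) (fn n) (vn n)"
    "\<And>n t. 0 \<le> t \<Longrightarrow> AE x in lborel. \<rho>n n t x = vn n t (Wn n x)"
    "\<And>n. parabolic_bounds (L2n (L_op (Wn n) (hn n))) (mn n) (vn n)"
    unfolding mn_def by metis
  obtain v where v: "unique_weak_sol_a (deriv (gen_inverse W)) f v"
    "\<And>t. 0 \<le> t \<Longrightarrow> AE x in lborel. \<rho> t x = v t (W x)"
    "parabolic_bounds (L2n (L_op W h)) m v"
    using extraction[OF W_class h_dom fc h_f \<rho>_sol] unfolding m_def by blast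
  have pn: "parabolic_bounds C (mn n) (vn n)" for n by (rule parabolic_bounds_mono[OF vn(3) L2n0 Kn])
  have p: "parabolic_bounds C m v" by (rule parabolic_bounds_mono[OF v(3) L2n0 K])
  have ws: "weak_sol_a (deriv (gen_inverse (Wn n))) (fn n) (vn n)" "weak_sol_a (deriv (gen_inverse W)) f v" for n
    using vn(1)[of n] v(1) unfolding unique_weak_sol_a_def by blast+
  have ae: "AE x in UI. (\<lambda>n. Wn n x) \<longlonglongrightarrow> W x" by (rule vague_AE[OF Wn_class W_class vague atom_at_0])
  have funif: "eventually (\<lambda>n. \<forall>x. \<bar>fn n x - f x\<bar> < e) sequentially" if e: "0 < e" for e
  proof -
    have "eventually (\<lambda>n. H2_norm (\<lambda>x. fn n x - f x) < e / 2) sequentially"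
      by (rule order_tendstoD(2)[OF fn_lim]) (use e in simp)
    then show ?thesis
    proof eventually_elim
      case (elim n)
      show ?case
      proof
        fix x show "\<bar>fn n x - f x\<bar> < e" using H2T_sup[OF H2T_diff[OF fn_H2 f_H2], of n x] elim by linarith
      qed
    qed
  qed
  have "convergent (\<lambda>n. H2_norm (\<lambda>x. fn n x - f x))" using fn_lim by (auto simp: convergent_def)
  then have "Bseq (\<lambda>n. H2_norm (\<lambda>x. fn n x - f x))" by (rule convergent_imp_Bseq)
  then obtain B1 where B1: "\<And>n. \<bar>H2_norm (\<lambda>x. fn n x - f x)\<bar> \<le> B1" unfolding Bseq_def by auto
  have fB: "\<bar>fn n x\<bar> \<le> 2 * B1 + 2 * H2_norm f" for n x
    using H2T_sup[OF H2T_diff[OF fn_H2 f_H2], of n x] B1[of n] H2T_sup[OF f_H2, of x] by linarith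
  have bf: "bmeas f" "bmeas (fn n)" for n using H2T_D(3)[OF f_H2] H2T_D(3)[OF fn_H2] by blast+
  have mlim: "mn \<longlonglongrightarrow> m"
  proof -
    have c1: "continuous_on UNIV (\<lambda>_ :: real. 1 :: real)" "periodic1 (\<lambda>_ :: real. 1 :: real)" by (simp_all add: periodic1_def)
    have "(\<lambda>n. LINT x|UI. fn n (Wn n x) * 1) \<longlonglongrightarrow> (LINT x|UI. f (W x) * 1)"
      by (rule LINT_tested_tendsto[OF W_class Wn_class ae bf c1 fc(1) fB funif])
    then show ?thesis by (simp add: mn_def[abs_def] m_def)
  qed
  then have "Bseq mn" by (intro convergent_imp_Bseq convergentI)
  then obtain M where M: "\<And>n. \<bar>mn n\<bar> \<le> M" unfolding Bseq_def by auto
  have unif: "eventually (\<lambda>n. \<forall>t\<ge>0. \<forall>x. \<bar>vn n t x - v t x\<bar> \<le> e) sequentially" if e: "0 < e" for e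
    by (rule parabolic_bounds_large_time[OF pn p mlim
      horizon_convergence[OF W_class Wn_class ae pn C M ws fc bf(2) fB funif] e])
  show ?thesis
    using vn(1,2) v(1,2) parabolic_bounds_C_holder[OF pn C] parabolic_bounds_C_holder[OF p C] C_holder_norm_tendsto[OF pn p _ _ unif]
    by (intro exI[of _ vn] exI[of _ v] conjI allI impI) (blast | simp)+
qed

end
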